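(* Consider the stationary M/G/$s$ queue with unobserved balking described in the context, in which every customer has the same constant patience level $\theta_0>0$, and let $\hat\theta_n=\max_{i=1,\ldots,n}W_i$ be the maximum likelihood estimator of $\theta_0$ based on the waiting times of the first $n$ non-balking customers. Then, as $n\to\infty$, $$\hat\theta_n\to\theta_0\quad\text{almost surely},$$ and, for every $x\ge 0$, $$P\left(n(\theta_0-\hat\theta_n)\ge x\right)\to e^{-v(\theta_0)x/(1-P_\ell)},$$ where $P_\ell$ is the stationary loss probability and $v(\theta_0)$ is the stationary virtual waiting time density at level $\theta_0$. In addition, the asymptotic variance of the estimation error agrees with the variance of the limiting exponential distribution and is given by $$\lim_{n\to\infty}n^2\,\mathrm{Var}\left[\theta_0-\hat\theta_n\right]=\lim_{n\to\infty}\left\{E\left[\{n(\theta_0-\hat\theta_n)\}^2\right]-\left(E\left[n(\theta_0-\hat\theta_n)\right]\right)^2\right\}=\left(\frac{1-P_\ell}{v(\theta_0)}\right)^2.$$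
   Context: Model. A first-come first-served queue has $s\ge 1$ servers. Potential customers arrive according to a Poisson process with rate $\lambda>0$ and have i.i.d. service requirements, independent of the arrivals, distributed as a non-negative random variable $B$ with $E[B]<\infty$. The virtual waiting time $V(t)$ is the time it would take from time $t$ until at least one server becomes idle if no customers joined after time $t$, i.e. $V(t)=\inf\{u\ge 0: Q(t)-(N_{\mathrm D}(t+u)-N_{\mathrm D}(t))\le s-1\}$, where $Q(t)$ is the number of customers in the system and $N_{\mathrm D}(t)$ the number of service completions in $(0,t]$. A customer arriving at time $t$ joins if $V(t-)\le\theta_0$ and otherwise balks (leaves immediately) and is not observed; i.e. the patience level is $Y=\theta_0$ with probability one. The system always has a stationary regime. Observations. The system is observed in stationarity starting at time $0$, which is the stationary arrival instant of a non-balking customer (number $0$). Let $\tilde A_i$ ($i\ge1$) be the arrival time of the $i$-th subsequent non-balking customer and $W_i:=V(\tilde A_i-)$ its waiting time; the sequence $W_1,W_2,\ldots$ is then stationary. Stationary quantities. Let $V$ and $Q$ denote the stationary virtual waiting time and stationary number of customers, $q_n:=P(Q=n)$. $V$ has an atom at $0$ of mass $\sum_{n=0}^{s-1}q_n$ and is absolutely continuous on $(0,\infty)$ with density $v(\cdot)$ satisfying $$v(x)=\lambda q_{s-1}\overline J_{\mid 0}(x)+\lambda\int_0^x v(y)\,P(Y\ge y)\,\overline J_{\mid y}(x-y)\,dy,\quad x\ge 0,$$ where $P(Y\ge y)=\mathbf 1_{\{y\le\theta_0\}}$ and $\overline J_{\mid y}(x)$ is the stationary probability that an upward jump of the virtual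 waiting time exceeds $x$, given that the jump is positive and that the virtual waiting time immediately before it equals $y$ (for $s=1$, $\overline J_{\mid y}(x)=P(B>x)$). The stationary loss probability is $P_\ell=\int_0^\infty v(y)P(Y<y)\,dy=P(V>\theta_0)$.
   Formalization: The density value v(θ0) is replaced by its left limit v(θ0−), proved equal to v(θ0) if P(B=θ0)=0 (the literal formula fails e.g. for s=1 and B=θ0 a.s.); B is assumed not almost surely zero, since otherwise all waiting times vanish. *)

theory Defs
  imports "HOL-Probability.Probability"
begin

text \<open>
  A finite multiset \<open>D\<close> holds the departure times of the customers that have joined so far.
  Under first-come first-served discipline the departure time of a customer is fixed at the moment
  of joining, so \<open>present D t\<close> is the number of customers in the system at time \<open>t\<close>, and
  \<open>present D (t + u)\<close> is \<open>Q(t) - (N\<^sub>D(t + u) - N\<^sub>D(t))\<close> when nobody joins after \<open>t\<close>.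
\<close>

definition present :: "real multiset \<Rightarrow> real \<Rightarrow> nat" where
  "present D t = size {#d \<in># D. t < d#}"

definition virtual_wait :: "nat \<Rightarrow> real multiset \<Rightarrow> real \<Rightarrow> real" where
  "virtual_wait s D t = Inf {u. 0 \<le> u \<and> present D (t + u) \<le> s - 1}"

text \<open>
  \<open>R\<close>: departure times of the customers present initially;
  \<open>A i\<close>, \<open>S i\<close>: arrival time and service requirement of the \<open>i\<close>-th potential customer
  (\<open>i = 0, 1, \<dots>\<close>, in order of arrival). \<open>departures \<dots> i\<close> accounts for \<open>R\<close> and those of the first
  \<open>i\<close> potential customers that joined.
\<close>

primrec departures ::
  "nat \<Rightarrow> real \<Rightarrow> real multiset \<Rightarrow> (nat \<Rightarrow> real) \<Rightarrow> (nat \<Rightarrow> real) \<Rightarrow> nat \<Rightarrow> real multiset" where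
  "departures s \<theta> R A S 0 = R"
| "departures s \<theta> R A S (Suc i) =
     (let D = departures s \<theta> R A S i; w = virtual_wait s D (A i)
      in if w \<le> \<theta> then add_mset (A i + w + S i) D else D)"

text \<open>The virtual waiting time \<open>V(A i -)\<close> just before the \<open>i\<close>-th potential arrival:\<close>

definition wait_found ::
  "nat \<Rightarrow> real \<Rightarrow> real multiset \<Rightarrow> (nat \<Rightarrow> real) \<Rightarrow> (nat \<Rightarrow> real) \<Rightarrow> nat \<Rightarrow> real" where
  "wait_found s \<theta> R A S i = virtual_wait s (departures s \<theta> R A S i) (A i)"

definition joining ::
  "nat \<Rightarrow> real \<Rightarrow> real multiset \<Rightarrow> (nat \<Rightarrow> real) \<Rightarrow> (nat \<Rightarrow> real) \<Rightarrow> nat set" where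
  "joining s \<theta> R A S = {i. wait_found s \<theta> R A S i \<le> \<theta>}"

text \<open>
  State of the system at time \<open>t\<close>: for each \<open>u \<ge> 0\<close>, the number of present customers that
  are still present at \<open>t + u\<close> (a function that determines the multiset of the remaining times in
  the system). States are compared through their laws on the space \<open>state_space\<close>.
\<close>

definition state :: "real multiset \<Rightarrow> real \<Rightarrow> real \<Rightarrow> nat" where
  "state D t = (\<lambda>u\<in>{0..}. present D (t + u))"

definition state_space :: "(real \<Rightarrow> nat) measure" where
  "state_space = (\<Pi>\<^sub>M u\<in>{0..}. count_space UNIV)"

text \<open>
  Stochastic input: \<open>R\<close> is the random initial content, \<open>T\<close> are the exponential gaps of the
  Poisson process of potential arrivals and \<open>S\<close> the service requirements, with law \<open>G\<close>; all
  of them are independent. (The independence of \<open>R\<close> from the rest is expressed by a product law,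
  since \<open>indep_var\<close> requires values in a single type.)
\<close>

definition queue_input ::
  "real \<Rightarrow> real measure \<Rightarrow> 'a measure \<Rightarrow> ('a \<Rightarrow> real multiset) \<Rightarrow> (nat \<Rightarrow> 'a \<Rightarrow> real)
     \<Rightarrow> (nat \<Rightarrow> 'a \<Rightarrow> real) \<Rightarrow> bool" where
  "queue_input lam G M R T S \<longleftrightarrow>
     prob_space M \<and>
     (\<forall>\<omega>\<in>space M. \<forall>d\<in>#R \<omega>. 0 < d) \<and>
     (\<forall>i. distributed M lborel (T i) (exponential_density lam)) \<and>
     (\<forall>i. S i \<in> borel_measurable M \<and> distr M borel (S i) = G) \<and>
     prob_space.indep_vars M (\<lambda>_. borel) (case_sum T S) UNIV \<and>
     (\<lambda>\<omega>. state (R \<omega>) 0) \<in> M \<rightarrow>\<^sub>M state_space \<and>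
     (let I = (\<Pi>\<^sub>M k\<in>UNIV. borel); X = (\<lambda>\<omega> k. case_sum T S k \<omega>)
      in distr M (state_space \<Otimes>\<^sub>M I) (\<lambda>\<omega>. (state (R \<omega>) 0, X \<omega>))
           = distr M state_space (\<lambda>\<omega>. state (R \<omega>) 0) \<Otimes>\<^sub>M distr M I X)"

text \<open>
  Time-stationary version: time 0 is an arbitrary instant, the first potential arrival occurs at
  \<open>T 0\<close>, and the law of the state of this Markov process does not change with time.
\<close>

definition arrival :: "(nat \<Rightarrow> 'a \<Rightarrow> real) \<Rightarrow> 'a \<Rightarrow> nat \<Rightarrow> real" where
  "arrival T \<omega> i = (\<Sum>k\<le>i. T k \<omega>)"

definition time_stationary ::
  "nat \<Rightarrow> real \<Rightarrow> real \<Rightarrow> real measure \<Rightarrow> 'a measure \<Rightarrow> ('a \<Rightarrow> real multiset) \<Rightarrow> (nat \<Rightarrow> 'a \<Rightarrow> real)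
     \<Rightarrow> (nat \<Rightarrow> 'a \<Rightarrow> real) \<Rightarrow> bool" where
  "time_stationary s \<theta> lam G M R T S \<longleftrightarrow>
     queue_input lam G M R T S \<and>
     (\<forall>t\<ge>0. distr M state_space
         (\<lambda>\<omega>. state (departures s \<theta> (R \<omega>) (arrival T \<omega>) (\<lambda>i. S i \<omega>) (card {i. arrival T \<omega> i \<le> t})) t)
       = distr M state_space (\<lambda>\<omega>. state (R \<omega>) 0))"

text \<open>
  Customer-stationary version: time 0 is the arrival instant of potential customer 0, who does not
  balk, and the law of the state found on arrival is the same for all non-balking customers.
\<close>

definition arrival0 :: "(nat \<Rightarrow> 'a \<Rightarrow> real) \<Rightarrow> 'a \<Rightarrow> nat \<Rightarrow> real" where
  "arrival0 T \<omega> i = (\<Sum>k<i. T k \<omega>)"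

definition joiner ::
  "nat \<Rightarrow> real \<Rightarrow> ('a \<Rightarrow> real multiset) \<Rightarrow> (nat \<Rightarrow> 'a \<Rightarrow> real) \<Rightarrow> (nat \<Rightarrow> 'a \<Rightarrow> real) \<Rightarrow> nat \<Rightarrow> 'a \<Rightarrow> nat" where
  "joiner s \<theta> R T S i \<omega> = enumerate (joining s \<theta> (R \<omega>) (arrival0 T \<omega>) (\<lambda>i. S i \<omega>)) i"

definition customer_stationary ::
  "nat \<Rightarrow> real \<Rightarrow> real \<Rightarrow> real measure \<Rightarrow> 'a measure \<Rightarrow> ('a \<Rightarrow> real multiset) \<Rightarrow> (nat \<Rightarrow> 'a \<Rightarrow> real)
     \<Rightarrow> (nat \<Rightarrow> 'a \<Rightarrow> real) \<Rightarrow> bool" where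
  "customer_stationary s \<theta> lam G M R T S \<longleftrightarrow>
     queue_input lam G M R T S \<and>
     (AE \<omega> in M. virtual_wait s (R \<omega>) 0 \<le> \<theta>) \<and>
     (\<forall>i. distr M state_space
         (\<lambda>\<omega>. let j = joiner s \<theta> R T S i \<omega> in
            state (departures s \<theta> (R \<omega>) (arrival0 T \<omega>) (\<lambda>i. S i \<omega>) j) (arrival0 T \<omega> j))
       = distr M state_space (\<lambda>\<omega>. state (R \<omega>) 0))"

text \<open>\<open>W\<^sub>i = V(A\<^sub>i -)\<close> for the \<open>i\<close>-th non-balking customer:\<close>

definition waiting_time ::
  "nat \<Rightarrow> real \<Rightarrow> ('a \<Rightarrow> real multiset) \<Rightarrow> (nat \<Rightarrow> 'a \<Rightarrow> real) \<Rightarrow> (nat \<Rightarrow> 'a \<Rightarrow> real) \<Rightarrow> nat \<Rightarrow> 'a \<Rightarrow> real" where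
  "waiting_time s \<theta> R T S i \<omega> =
     wait_found s \<theta> (R \<omega>) (arrival0 T \<omega>) (\<lambda>i. S i \<omega>) (joiner s \<theta> R T S i \<omega>)"

definition theta_hat ::
  "nat \<Rightarrow> real \<Rightarrow> ('a \<Rightarrow> real multiset) \<Rightarrow> (nat \<Rightarrow> 'a \<Rightarrow> real) \<Rightarrow> (nat \<Rightarrow> 'a \<Rightarrow> real) \<Rightarrow> nat \<Rightarrow> 'a \<Rightarrow> real" where
  "theta_hat s \<theta> R T S n \<omega> = Max ((\<lambda>i. waiting_time s \<theta> R T S i \<omega>) ` {1..n})"

text \<open>Stationary quantities, for \<open>R\<close> the content at time 0 of the time-stationary version:\<close>

definition loss_probability :: "nat \<Rightarrow> real \<Rightarrow> 'a measure \<Rightarrow> ('a \<Rightarrow> real multiset) \<Rightarrow> real" where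
  "loss_probability s \<theta> M R = measure M {\<omega>\<in>space M. virtual_wait s (R \<omega>) 0 > \<theta>}"

definition number_prob :: "'a measure \<Rightarrow> ('a \<Rightarrow> real multiset) \<Rightarrow> nat \<Rightarrow> real" where
  "number_prob M R n = measure M {\<omega>\<in>space M. present (R \<omega>) 0 = n}"

text \<open>
  \<open>K y\<close> is the conditional law, in the customer-stationary version, of the upward jump of the virtual
  waiting time caused by a joining customer, given that the virtual waiting time just before is
  \<open>y\<close> and that at least \<open>s - 1\<close> customers are found; then \<open>measure (K y) {x<..}\<close> is the tail
  \<open>J\<^sub>|\<^sub>y(x)\<close>. Finding fewer than \<open>s - 1\<close> customers always gives jump 0. If service requirements are almost
  surely positive, finding at least \<open>s - 1\<close> of them is almost surely the same as a positive jump.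
  If they can vanish, it is the reading of ``positive jump'' that gives
  \<open>J\<^sub>|\<^sub>y(x) = P(B > x)\<close> for \<open>s = 1\<close> and makes the level crossing equation below correct.
\<close>

definition jump_law ::
  "nat \<Rightarrow> real \<Rightarrow> 'a measure \<Rightarrow> ('a \<Rightarrow> real multiset) \<Rightarrow> (nat \<Rightarrow> 'a \<Rightarrow> real) \<Rightarrow> (nat \<Rightarrow> 'a \<Rightarrow> real)
     \<Rightarrow> (real \<Rightarrow> real measure) \<Rightarrow> bool" where
  "jump_law s \<theta> M R T S K \<longleftrightarrow>
     K \<in> borel \<rightarrow>\<^sub>M prob_algebra borel \<and>
     (\<forall>C\<in>sets borel. \<forall>x\<ge>0.
        measure M {\<omega>\<in>space M. virtual_wait s (R \<omega>) 0 \<in> C \<and> s - 1 \<le> present (R \<omega>) 0 \<and>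
          virtual_wait s (departures s \<theta> (R \<omega>) (arrival0 T \<omega>) (\<lambda>i. S i \<omega>) 1) 0
            - virtual_wait s (R \<omega>) 0 > x}
        = (LINT \<omega>:{\<omega>\<in>space M. virtual_wait s (R \<omega>) 0 \<in> C \<and> s - 1 \<le> present (R \<omega>) 0}|M.
             measure (K (virtual_wait s (R \<omega>) 0)) {x<..}))"

text \<open>
  The density of the stationary virtual waiting time on \<open>(0, \<infinity>)\<close>. The level crossing equation
  holds at every \<open>x \<ge> 0\<close> and thereby selects one version of the density. This
  version is right-continuous, with left limits; at \<open>\<theta>\<close> it jumps only if the law of the service
  requirements has an atom there, and then the waiting times, which stay below \<open>\<theta>\<close>, are
  governed by the left limit. The factor
  \<open>indicator {..\<theta>} y\<close> is \<open>P(Y \<ge> y)\<close>.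
\<close>

definition virtual_wait_density ::
  "nat \<Rightarrow> real \<Rightarrow> real \<Rightarrow> 'a measure \<Rightarrow> ('a \<Rightarrow> real multiset) \<Rightarrow> (real \<Rightarrow> real measure) \<Rightarrow> (real \<Rightarrow> real) \<Rightarrow> bool" where
  "virtual_wait_density s \<theta> lam M R K v \<longleftrightarrow>
     v \<in> borel_measurable borel \<and> (\<forall>x\<ge>0. 0 \<le> v x) \<and>
     (\<forall>C\<in>sets borel. C \<subseteq> {0<..} \<longrightarrow>
        emeasure M {\<omega>\<in>space M. virtual_wait s (R \<omega>) 0 \<in> C} = (\<integral>\<^sup>+x\<in>C. ennreal (v x) \<partial>lborel)) \<and>
     (\<forall>x\<ge>0. v x = lam * number_prob M R (s - 1) * measure (K 0) {x<..}
        + lam * (LINT y:{0..x}|lborel. v y * indicator {..\<theta>} y * measure (K y) {x - y<..}))"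

end

theory Submission
  imports Defs
begin

text \<open>
  The queue is observed through a Markov chain: the residual times found by successive potential
  customers, driven by independent pairs of a gap and a service requirement. The estimation error after
  \<open>n\<close> observations is at least \<open>\<epsilon>\<close> exactly if the first \<open>n\<close> customers who join after customer 0 all
  miss the window \<open>(\<theta> - \<epsilon>, \<theta>]\<close> of waiting times. With \<open>\<epsilon> = x / n\<close> the window is hit at a potential
  customer with probability about \<open>v0 * x / n\<close>, where \<open>v0\<close> is the density of the stationary waiting time to
  the left of \<open>\<theta>\<close>; a fraction \<open>1 - P\<^sub>l\<close> of the potential customers join; so among the first \<open>n\<close> joining customers
  the number of hits is asymptotically Poisson with mean \<open>v0 * x / (1 - P\<^sub>l)\<close>, and it vanishes with probability
  \<open>exp (- v0 * x / (1 - P\<^sub>l))\<close>. The proof makes this precise as follows.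

  \<^item> \<^emph>\<open>Regeneration.\<close> Customers who join wait at most \<open>\<theta>\<close>, so a queue with infinitely many servers dominates all copies of
    the queue that start below it and have the same input. It empties, as \<open>E[B] < \<infinity>\<close>, and from then
    on the copies coincide. For a stationary copy this gives decaying correlations, hence a law of
    large numbers with a rate that is the same for all bounded observables
    (\<open>law_of_large_numbers\<close>). This uniformity matters because the window shrinks with \<open>n\<close>.

  \<^item> \<^emph>\<open>Arrivals see time averages.\<close> The time-stationary law \<open>\<pi>\<close> is invariant for the chain of potential arrivals
    (\<open>\<pi>_invariant\<close>), by sampling the stationary process at an exponential time of small rate. Conditioned on
    joining it is the law seen by the observed customers (\<open>joining_law\<close>).

  \<^item> \<^emph>\<open>Poisson approximation.\<close> Missing the window, divided by the product of the conditional probabilities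
    of missing it, is a martingale. By the law of large numbers this product is nearly constant
    (\<open>poisson_approximation\<close>).

  \<^item> \<^emph>\<open>Uniform exponential tail.\<close> From any state a run of a bounded number of joining customers leads, with a probability of
    order \<open>\<epsilon>\<close>, to one who hits the window (\<open>sv_tail\<close>). The resulting bound on the tail of the scaled error
    gives almost sure convergence (\<open>AE_est_tendsto\<close>), the positivity of \<open>v0\<close>, and dominates the tail integrals for the moments,
    which therefore converge to those of the exponential limit.

  \<^item> \<^emph>\<open>The density at \<open>\<theta>\<close>.\<close> The level crossing equation shows that \<open>v\<close> has a left limit at \<open>\<theta>\<close>. It equals \<open>v \<theta>\<close> unless jumps
    end exactly at \<open>\<theta>\<close> with positive probability; the residual times that joining customers find have no
    atom at \<open>\<theta>\<close>, because the gap before is exponential, so that this requires an atom of the service requirement at \<open>\<theta>\<close> (\<open>vleft_eq_v\<close>).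
\<close>

section \<open>Residual times as a state\<close>

lemma present_add_mset: "present (add_mset d D) t = present D t + (if t < d then 1 else 0)"
  by (simp add: present_def)

lemma present_antimono: "t \<le> t' \<Longrightarrow> present D t' \<le> present D t"
proof (induction D)
  case empty
  show ?case by (simp add: present_def)
qed (auto simp: present_add_mset)

lemma present_eventually_0: "\<exists>t. \<forall>t'\<ge>t. present D t' = 0"
proof (induction D)
  case empty
  show ?case by (simp add: present_def)
next
  case (add d D)
  then obtain t where "\<forall>t'\<ge>t. present D t' = 0" by blast
  then show ?case
    by (intro exI[of _ "max t d"]) (auto simp: present_add_mset)
qed

lemma present_right_constant: "\<exists>e>0. \<forall>t'. t \<le> t' \<and> t' < t + e \<longrightarrow> present D t' = present D t"
proof (induction D)
  case empty
  show ?case by (auto simp: present_def intro: exI[of _ 1])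
next
  case (add d D)
  then obtain e where e: "e > 0" "\<forall>t'. t \<le> t' \<and> t' < t + e \<longrightarrow> present D t' = present D t" by blast
  define e' where "e' = (if t < d then min e (d - t) else e)"
  have "e' > 0" "e' \<le> e" "t < d \<Longrightarrow> e' \<le> d - t" using e by (auto simp: e'_def)
  have "present (add_mset d D) t' = present (add_mset d D) t" if "t \<le> t'" "t' < t + e'" for t'
  proof -
    have "present D t' = present D t" by (rule e(2)[rule_format]) (use that \<open>e' \<le> e\<close> in linarith)
    moreover have "t' < d \<longleftrightarrow> t < d" using that \<open>t < d \<Longrightarrow> e' \<le> d - t\<close> by linarith
    ultimately show ?thesis by (simp add: present_add_mset)
  qed
  then show ?case using \<open>e' > 0\<close> by blast
qed

text \<open>
  The virtual waiting time in a system with \<open>k + 1\<close> servers is the time until at most \<open>k\<close> customers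
  remain, that is, the \<open>k\<close>-th largest residual time (counting from 0, and padded with zeros). The
  sequence of all of them determines the state of the queue, and unlike the multiset it lives in a
  standard Borel space.
\<close>

definition resid :: "real multiset \<Rightarrow> real \<Rightarrow> nat \<Rightarrow> real" where
  "resid D t k = virtual_wait (Suc k) D t"

lemma virtual_wait_eq_resid: "1 \<le> s \<Longrightarrow> virtual_wait s D t = resid D t (s - 1)"
  by (simp add: resid_def)

text \<open>
  Since \<open>present D\<close> is decreasing and right-continuous, the infimum that defines the virtual waiting
  time is attained. Every later fact about residual times follows from this equivalence.
\<close>

lemma resid_nonneg: "0 \<le> resid D t k"
  and resid_le_iff: "0 \<le> x \<Longrightarrow> resid D t k \<le> x \<longleftrightarrow> present D (t + x) \<le> k"
proof -
  define A where "A = {u. 0 \<le> u \<and> present D (t + u) \<le> k}"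
  have r: "resid D t k = Inf A" by (simp add: resid_def virtual_wait_def A_def)
  obtain t0 where t0: "\<forall>t'\<ge>t0. present D t' = 0" using present_eventually_0 by blast
  have "max 0 (t0 - t) \<in> A" using t0 by (auto simp: A_def max_def)
  then have ne: "A \<noteq> {}" by blast
  have bdd: "bdd_below A" unfolding A_def by (rule bdd_belowI[of _ 0]) auto
  show nonneg: "0 \<le> resid D t k" unfolding r by (rule cInf_greatest[OF ne]) (auto simp: A_def)
  show "resid D t k \<le> x \<longleftrightarrow> present D (t + x) \<le> k" if x: "0 \<le> x"
  proof
    assume le: "resid D t k \<le> x"
    obtain e where e: "e > 0" "\<forall>t'. t + x \<le> t' \<and> t' < t + x + e \<longrightarrow> present D t' = present D (t + x)"
      using present_right_constant by blast
    have "Inf A < x + e" using le e(1) r by simp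
    then obtain u where u: "u \<in> A" "u < x + e" using ne by (meson cInf_lessD)
    have "present D (t + max u x) \<le> present D (t + u)" by (rule present_antimono) simp
    moreover have "present D (t + max u x) = present D (t + x)"
      by (rule e(2)[rule_format]) (use u e(1) in auto)
    ultimately show "present D (t + x) \<le> k" using u by (simp add: A_def)
  next
    assume "present D (t + x) \<le> k"
    then have "x \<in> A" using x by (simp add: A_def)
    then show "resid D t k \<le> x" unfolding r using bdd by (rule cInf_lower)
  qed
qed

lemma resid_eqI:
  assumes "0 \<le> a" "\<And>x. 0 \<le> x \<Longrightarrow> a \<le> x \<longleftrightarrow> present D (t + x) \<le> k"
  shows "resid D t k = a"
proof (rule antisym)
  show "resid D t k \<le> a" using assms(2)[OF assms(1)] resid_le_iff[OF assms(1)] by simp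
  show "a \<le> resid D t k" using assms(2)[OF resid_nonneg[of D t k]] resid_le_iff[OF resid_nonneg[of D t k], of D t k] by simp
qed

lemma present_eq_resid: "present D t \<le> k \<longleftrightarrow> resid D t k \<le> 0"
  using resid_le_iff[of 0 D t k] by simp

lemma decseq_resid: "decseq (resid D t)"
proof (rule decseq_SucI)
  fix k
  show "resid D t (Suc k) \<le> resid D t k"
    using resid_le_iff[of "resid D t k" D t k] resid_le_iff[of "resid D t k" D t "Suc k"]
      resid_nonneg[of D t k] by simp
qed

definition shift :: "real \<Rightarrow> (nat \<Rightarrow> real) \<Rightarrow> nat \<Rightarrow> real" where
  "shift t r = (\<lambda>k. max 0 (r k - t))"

text \<open>Insertion of \<open>d\<close> into a decreasing sequence:\<close>

definition ins :: "real \<Rightarrow> (nat \<Rightarrow> real) \<Rightarrow> nat \<Rightarrow> real" where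
  "ins d r = (\<lambda>k. if k = 0 then max (r 0) d else max (r k) (min (r (k - 1)) d))"

lemma resid_shift:
  assumes "0 \<le> u" shows "resid D (t + u) = shift u (resid D t)"
proof
  fix k show "resid D (t + u) k = shift u (resid D t) k"
  proof (rule resid_eqI)
    show "0 \<le> shift u (resid D t) k" by (simp add: shift_def)
  next
    fix x :: real assume "0 \<le> x"
    then show "shift u (resid D t) k \<le> x \<longleftrightarrow> present D (t + u + x) \<le> k"
      using resid_le_iff[of "u + x" D t k] assms by (auto simp: shift_def algebra_simps)
  qed
qed

lemma resid_add_mset: "resid (add_mset (t + d) D) t = ins d (resid D t)"
proof
  fix k show "resid (add_mset (t + d) D) t k = ins d (resid D t) k"
  proof (rule resid_eqI)
    show "0 \<le> ins d (resid D t) k" using resid_nonneg[of D t] by (auto simp: ins_def le_max_iff_disj)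
  next
    fix x :: real assume x: "0 \<le> x"
    show "ins d (resid D t) k \<le> x \<longleftrightarrow> present (add_mset (t + d) D) (t + x) \<le> k"
    proof (cases k)
      case 0
      then show ?thesis using resid_le_iff[OF x, of D t 0] by (auto simp: ins_def present_add_mset)
    next
      case (Suc k')
      then show ?thesis
        using resid_le_iff[OF x, of D t k] resid_le_iff[OF x, of D t k']
        by (auto simp: ins_def present_add_mset min_le_iff_disj)
    qed
  qed
qed

text \<open>
  Effect on the residual times of a potential customer with service requirement \<open>b\<close>, and of one step
  from a potential arrival to the next, \<open>t\<close> time units later.
\<close>

definition accept :: "nat \<Rightarrow> real \<Rightarrow> (nat \<Rightarrow> real) \<Rightarrow> real \<Rightarrow> nat \<Rightarrow> real" where
  "accept s \<theta> r b = (if r (s - 1) \<le> \<theta> then ins (r (s - 1) + b) r else r)"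

definition qstep :: "nat \<Rightarrow> real \<Rightarrow> (nat \<Rightarrow> real) \<Rightarrow> real \<times> real \<Rightarrow> nat \<Rightarrow> real" where
  "qstep s \<theta> r = (\<lambda>(t, b). shift t (accept s \<theta> r b))"

primrec chain :: "('x \<Rightarrow> 'i \<Rightarrow> 'x) \<Rightarrow> 'x \<Rightarrow> (nat \<Rightarrow> 'i) \<Rightarrow> nat \<Rightarrow> 'x" where
  "chain F x \<xi> 0 = x"
| "chain F x \<xi> (Suc n) = F (chain F x \<xi> n) (\<xi> n)"

lemma chain_Suc: "chain F x \<xi> (Suc n) = chain F (F x (\<xi> 0)) (\<lambda>i. \<xi> (Suc i)) n"
  by (induction n) auto

lemma chain_case_nat: "chain F x (case_nat a \<xi>) (Suc n) = chain F (F x a) \<xi> n"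
  by (simp only: chain_Suc) simp

lemma chain_add: "chain F x \<xi> (m + n) = chain F (chain F x \<xi> m) (\<lambda>i. \<xi> (m + i)) n"
  by (induction n) auto

lemma resid_departures_Suc:
  assumes "1 \<le> s"
  shows "resid (departures s \<theta> R A S (Suc i)) (A i) = accept s \<theta> (resid (departures s \<theta> R A S i) (A i)) (S i)"
  by (auto simp: accept_def Let_def virtual_wait_eq_resid[OF assms] resid_add_mset add.assoc)

lemma resid_departures_chain:
  assumes s: "1 \<le> s" and A0: "A 0 = 0" and A: "\<And>i. A (Suc i) = A i + T i" and T: "\<And>i. 0 \<le> T i"
  shows "resid (departures s \<theta> R A S i) (A i) = chain (qstep s \<theta>) (resid R 0) (\<lambda>j. (T j, S j)) i"
proof (induction i)
  case 0
  show ?case by (simp add: A0)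
next
  case (Suc i)
  have "resid (departures s \<theta> R A S (Suc i)) (A (Suc i))
      = shift (T i) (resid (departures s \<theta> R A S (Suc i)) (A i))"
    unfolding A by (rule resid_shift[OF T])
  then show ?case by (simp add: resid_departures_Suc[OF s] Suc qstep_def del: departures.simps)
qed

text \<open>
  When time 0 is not an arrival instant it is the content just after the \<open>n\<close>-th potential arrival
  that forms a chain: a gap now precedes each arrival.
\<close>

definition pstep :: "nat \<Rightarrow> real \<Rightarrow> (nat \<Rightarrow> real) \<Rightarrow> real \<times> real \<Rightarrow> nat \<Rightarrow> real" where
  "pstep s \<theta> r = (\<lambda>(t, b). accept s \<theta> (shift t r) b)"

lemma resid_departures_pchain:
  assumes s: "1 \<le> s" and A0: "A0 0 = 0" and A0S: "\<And>i. A0 (Suc i) = A0 i + T i" and T: "\<And>i. 0 \<le> T i"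
  shows "resid (departures s \<theta> R (\<lambda>i. A0 (Suc i)) S i) (A0 i) = chain (pstep s \<theta>) (resid R 0) (\<lambda>j. (T j, S j)) i"
proof (induction i)
  case 0
  show ?case by (simp add: A0)
next
  case (Suc i)
  let ?D = "departures s \<theta> R (\<lambda>i. A0 (Suc i)) S"
  have "resid (?D (Suc i)) (A0 (Suc i)) = accept s \<theta> (resid (?D i) (A0 (Suc i))) (S i)"
    using resid_departures_Suc[OF s, of \<theta> R "\<lambda>i. A0 (Suc i)" S i] by (simp del: departures.simps)
  also have "resid (?D i) (A0 (Suc i)) = shift (T i) (resid (?D i) (A0 i))"
    unfolding A0S by (rule resid_shift[OF T])
  finally show ?case by (simp add: Suc pstep_def del: departures.simps)
qed

text \<open>
  The shape of sequences of residual times. On such a sequence \<open>ins\<close> is an insertion, and its 0-th entry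
  bounds all others.
\<close>

definition good :: "(nat \<Rightarrow> real) \<Rightarrow> bool" where
  "good r \<longleftrightarrow> decseq r \<and> (\<forall>k. 0 \<le> r k)"

lemma good_resid: "good (resid D t)"
  by (simp add: good_def decseq_resid resid_nonneg)

lemma good_le: "good r \<Longrightarrow> j \<le> k \<Longrightarrow> r k \<le> r j"
  by (simp add: good_def decseqD)

lemma good_nonneg: "good r \<Longrightarrow> 0 \<le> r k"
  by (simp add: good_def)

lemma good_zero: "good (\<lambda>_. 0)"
  by (simp add: good_def monotone_on_def)

lemma goodI: "(\<And>k. r (Suc k) \<le> r k) \<Longrightarrow> (\<And>k. 0 \<le> r k) \<Longrightarrow> good r"
  by (simp add: good_def decseq_SucI)

lemma good_shift: assumes "good r" shows "good (shift t r)"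
proof (rule goodI)
  fix k show "shift t r (Suc k) \<le> shift t r k"
    using good_le[OF assms, of k "Suc k"] by (simp add: shift_def)
  show "0 \<le> shift t r k" by (simp add: shift_def)
qed

lemma good_ins: assumes "good r" shows "good (ins d r)"
proof -
  have "ins d r (Suc k) \<le> ins d r k" for k
  proof (cases k)
    case 0
    then show ?thesis using good_le[OF assms, of 0 1] by (simp add: ins_def le_max_iff_disj min_le_iff_disj)
  next
    case (Suc j)
    have "r (Suc (Suc j)) \<le> r (Suc j)" "r (Suc j) \<le> r j" by (simp_all add: good_le[OF assms])
    then show ?thesis unfolding Suc by (simp add: ins_def max_def min_def)
  qed
  moreover have "0 \<le> ins d r k" for k
    using good_nonneg[OF assms, of k] by (auto simp: ins_def le_max_iff_disj good_nonneg[OF assms])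
  ultimately show ?thesis by (rule goodI)
qed

lemma good_accept: "good r \<Longrightarrow> good (accept s \<theta> r b)"
  by (simp add: accept_def good_ins)

lemma good_qstep: "good r \<Longrightarrow> good (qstep s \<theta> r x)"
  by (cases x) (simp add: qstep_def good_shift good_accept)

lemma good_chain_qstep: "good r \<Longrightarrow> good (chain (qstep s \<theta>) r \<xi> n)"
  by (induction n) (auto simp: good_qstep)

text \<open>
  Only the \<open>m + 1\<close> largest entries matter for a queue with \<open>m + 1\<close> servers: an insertion above the
  smallest of these replaces it.
\<close>

lemma sum_ins:
  fixes g :: "real \<Rightarrow> real"
  assumes "good r"
  shows "(\<Sum>k\<le>m. g (ins d r k)) = (\<Sum>k<m. g (r k)) + g (max (r m) d)"
proof (induction m)
  case 0
  show ?case by (simp add: ins_def)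
next
  case (Suc m)
  have "r (Suc m) \<le> r m" by (simp add: good_le[OF assms])
  then have "g (max (r m) d) + g (max (r (Suc m)) (min (r m) d)) = g (r m) + g (max (r (Suc m)) d)"
    by (cases "d \<le> r m") (auto simp: max_def min_def)
  then show ?case using Suc by (simp add: ins_def)
qed

lemma accept_le: "accept s \<theta> r b (s - 1) \<le> max (r (s - 1)) (r (s - 1) + b)"
  by (auto simp: accept_def ins_def)

section \<open>Measurability of the queue content\<close>

abbreviation SQ :: "(nat \<Rightarrow> real) measure" where
  "SQ \<equiv> (\<Pi>\<^sub>M k\<in>(UNIV::nat set). (borel :: real measure))"

text \<open>
  Random finite multisets carry no \<open>\<sigma>\<close>-algebra of their own here; it suffices that the number of
  present customers can be evaluated at random times.
\<close>

definition content_measurable :: "'a measure \<Rightarrow> ('a \<Rightarrow> real multiset) \<Rightarrow> bool" where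
  "content_measurable M D \<longleftrightarrow>
     (\<forall>g\<in>borel_measurable M. (\<lambda>\<omega>. present (D \<omega>) (g \<omega>)) \<in> M \<rightarrow>\<^sub>M count_space UNIV)"

lemma content_measurableD [measurable (raw)]:
  "content_measurable M D \<Longrightarrow> g \<in> borel_measurable M \<Longrightarrow>
    (\<lambda>\<omega>. present (D \<omega>) (g \<omega>)) \<in> M \<rightarrow>\<^sub>M count_space UNIV"
  by (simp add: content_measurable_def)

lemma measurable_nat_le:
  fixes f :: "'a \<Rightarrow> nat"
  assumes "\<And>k. {\<omega>\<in>space M. f \<omega> \<le> k} \<in> sets M"
  shows "f \<in> M \<rightarrow>\<^sub>M count_space UNIV"
  unfolding measurable_count_space_eq2_countable
proof safe
  fix k :: nat
  have "f -` {k} \<inter> space M = (if k = 0 then {\<omega>\<in>space M. f \<omega> \<le> 0}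
      else {\<omega>\<in>space M. f \<omega> \<le> k} - {\<omega>\<in>space M. f \<omega> \<le> k - 1})"
    by auto
  also have "\<dots> \<in> sets M" using assms[of 0] assms[of k] assms[of "k - 1"] by (auto simp del: le_zero_eq)
  finally show "f -` {k} \<inter> space M \<in> sets M" .
qed auto

lemma measurable_resid:
  assumes D: "content_measurable M D" and [measurable]: "g \<in> borel_measurable M"
  shows "(\<lambda>\<omega>. resid (D \<omega>) (g \<omega>) k) \<in> borel_measurable M"
proof (rule borel_measurableI_le)
  fix x :: real
  have m: "(\<lambda>\<omega>. present (D \<omega>) (g \<omega> + x)) \<in> M \<rightarrow>\<^sub>M count_space UNIV"
    by (rule content_measurableD[OF D]) simp
  have "{\<omega>\<in>space M. resid (D \<omega>) (g \<omega>) k \<le> x}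
      = (if 0 \<le> x then {\<omega>\<in>space M. present (D \<omega>) (g \<omega> + x) \<le> k} else {})"
    using resid_le_iff[of x] by (auto intro: order_trans[OF resid_nonneg])
  also have "\<dots> \<in> sets M" using measurable_sets[OF m, of "{..k}"]
    by (auto simp: vimage_def Int_def conj_commute)
  finally show "{\<omega>\<in>space M. resid (D \<omega>) (g \<omega>) k \<le> x} \<in> sets M" .
qed

lemma measurable_resid_SQ:
  assumes "content_measurable M D" "g \<in> borel_measurable M"
  shows "(\<lambda>\<omega>. resid (D \<omega>) (g \<omega>)) \<in> M \<rightarrow>\<^sub>M SQ"
  by (rule measurable_PiM_single') (auto intro: measurable_resid assms)

lemma measurable_state:
  assumes "content_measurable M D" "g \<in> borel_measurable M"
  shows "(\<lambda>\<omega>. state (D \<omega>) (g \<omega>)) \<in> M \<rightarrow>\<^sub>M state_space"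
  unfolding state_def state_space_def
  by (intro measurable_restrict content_measurableD[OF assms(1)] borel_measurable_add assms(2)) auto

lemma content_measurable_departures:
  assumes "1 \<le> s" and R: "content_measurable M R"
    and A: "\<And>i. (\<lambda>\<omega>. A \<omega> i) \<in> borel_measurable M" and S: "\<And>i. (\<lambda>\<omega>. S \<omega> i) \<in> borel_measurable M"
  shows "content_measurable M (\<lambda>\<omega>. departures s \<theta> (R \<omega>) (A \<omega>) (S \<omega>) i)"
proof (induction i)
  case 0
  show ?case by (simp add: R)
next
  case (Suc i)
  show ?case unfolding content_measurable_def
  proof
    fix g :: "'a \<Rightarrow> real" assume g: "g \<in> borel_measurable M"
    let ?D = "\<lambda>\<omega>. departures s \<theta> (R \<omega>) (A \<omega>) (S \<omega>) i"
    let ?w = "\<lambda>\<omega>. resid (?D \<omega>) (A \<omega> i) (s - 1)"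
    note [measurable] = g A S content_measurableD[OF Suc g] measurable_resid[OF Suc A]
    have "(\<lambda>\<omega>. present (departures s \<theta> (R \<omega>) (A \<omega>) (S \<omega>) (Suc i)) (g \<omega>))
       = (\<lambda>\<omega>. present (?D \<omega>) (g \<omega>) + (if ?w \<omega> \<le> \<theta> \<and> g \<omega> < A \<omega> i + ?w \<omega> + S \<omega> i then 1 else 0))"
      by (auto simp: Let_def present_add_mset virtual_wait_eq_resid[OF assms(1)] fun_eq_iff)
    also have "\<dots> \<in> M \<rightarrow>\<^sub>M count_space UNIV" by measurable
    finally show "(\<lambda>\<omega>. present (departures s \<theta> (R \<omega>) (A \<omega>) (S \<omega>) (Suc i)) (g \<omega>)) \<in> M \<rightarrow>\<^sub>M count_space UNIV" .
  qed
qed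

lemma content_measurable_initial:
  assumes pos: "\<forall>\<omega>\<in>space M. \<forall>d\<in>#R \<omega>. 0 < d" and st: "(\<lambda>\<omega>. state (R \<omega>) 0) \<in> M \<rightarrow>\<^sub>M state_space"
  shows "content_measurable M R"
proof -
  have fixed: "(\<lambda>\<omega>. present (R \<omega>) u) \<in> M \<rightarrow>\<^sub>M count_space UNIV" if "0 \<le> u" for u
  proof -
    have "(\<lambda>\<omega>. state (R \<omega>) 0 u) \<in> M \<rightarrow>\<^sub>M count_space UNIV"
      using that st unfolding state_space_def
      by (intro measurable_compose[OF st[unfolded state_space_def] measurable_component_singleton]) auto
    then show ?thesis using that by (simp add: state_def)
  qed
  have r[measurable]: "(\<lambda>\<omega>. resid (R \<omega>) 0 k) \<in> borel_measurable M" for k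
  proof (rule borel_measurableI_le)
    fix x :: real
    have "{\<omega>\<in>space M. resid (R \<omega>) 0 k \<le> x} = (if 0 \<le> x then {\<omega>\<in>space M. present (R \<omega>) x \<le> k} else {})"
      using resid_le_iff[of x] by (auto intro: order_trans[OF resid_nonneg])
    also have "\<dots> \<in> sets M" using fixed[of x] by (cases "0 \<le> x") auto
    finally show "{\<omega>\<in>space M. resid (R \<omega>) 0 k \<le> x} \<in> sets M" .
  qed
  have neg: "present (R \<omega>) u = present (R \<omega>) 0" if "\<omega> \<in> space M" "u < 0" for u \<omega>
  proof -
    have "filter_mset (\<lambda>d. u < d) (R \<omega>) = filter_mset (\<lambda>d. 0 < d) (R \<omega>)"
      using pos that by (intro filter_mset_cong) force+
    then show ?thesis by (simp add: present_def)
  qed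
  show ?thesis unfolding content_measurable_def
  proof (intro ballI measurable_nat_le)
    fix g :: "'a \<Rightarrow> real" and k assume [measurable]: "g \<in> borel_measurable M"
    have "present (R \<omega>) (g \<omega>) \<le> k \<longleftrightarrow> resid (R \<omega>) 0 k \<le> max 0 (g \<omega>)" if "\<omega> \<in> space M" for \<omega>
      using resid_le_iff[of "max 0 (g \<omega>)" "R \<omega>" 0 k] neg[OF that, of "g \<omega>"] by (cases "g \<omega> < 0") auto
    then have "{\<omega>\<in>space M. present (R \<omega>) (g \<omega>) \<le> k} = {\<omega>\<in>space M. resid (R \<omega>) 0 k \<le> max 0 (g \<omega>)}"
      by auto
    also have "\<dots> \<in> sets M" by measurable
    finally show "{\<omega>\<in>space M. present (R \<omega>) (g \<omega>) \<le> k} \<in> sets M" .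
  qed
qed

text \<open>
  The residual times are a measurable function of the state. Only countably many coordinates of the
  state may enter, hence the infimum over rational times.
\<close>

definition resid_of_state :: "(real \<Rightarrow> nat) \<Rightarrow> nat \<Rightarrow> real" where
  "resid_of_state x k = real_of_ereal (INF q\<in>{q\<in>\<rat>. 0 \<le> q}. if x q \<le> k then ereal q else \<infinity>)"

lemma resid_of_state: "resid_of_state (state D t) = resid D t"
proof
  fix k
  let ?f = "\<lambda>q. if state D t q \<le> k then ereal q else \<infinity>"
  let ?I = "INF q\<in>{q\<in>\<rat>. 0 \<le> q}. ?f q"
  have f: "?f q = (if resid D t k \<le> q then ereal q else \<infinity>)" if "0 \<le> q" for q
    using that resid_le_iff[OF that, of D t k] by (simp add: state_def)
  have "?I = ereal (resid D t k)"
  proof (rule antisym)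
    show "ereal (resid D t k) \<le> ?I" by (rule INF_greatest) (auto simp: f)
    show "?I \<le> ereal (resid D t k)"
    proof (rule ccontr)
      assume "\<not> ?I \<le> ereal (resid D t k)"
      then have "ereal (resid D t k) < ?I" by (simp only: not_le)
      from ereal_dense2[OF this] obtain z where z: "ereal (resid D t k) < ereal z" "ereal z < ?I"
        by blast
      then obtain q where q: "q \<in> \<rat>" "resid D t k < q" "q < z"
        using Rats_dense_in_real[of "resid D t k" z] by auto
      then have "0 \<le> q" using resid_nonneg[of D t k] by linarith
      have "?I \<le> ?f q" using \<open>0 \<le> q\<close> q(1) by (intro INF_lower) auto
      also have "\<dots> = ereal q" using f[OF \<open>0 \<le> q\<close>] q by simp
      finally have "?I \<le> ereal q" .
      also have "ereal q < ereal z" using q by simp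
      finally show False using z by simp
    qed
  qed
  then show "resid_of_state (state D t) k = resid D t k" unfolding resid_of_state_def by simp
qed

lemma measurable_resid_of_state: "resid_of_state \<in> state_space \<rightarrow>\<^sub>M SQ"
proof (rule measurable_PiM_single')
  fix k :: nat
  have c: "countable {q::real. q \<in> \<rat> \<and> 0 \<le> q}"
    by (rule countable_subset[OF _ countable_rat]) auto
  have [measurable]: "(\<lambda>x. x q) \<in> state_space \<rightarrow>\<^sub>M count_space UNIV" if "0 \<le> q" for q
    unfolding state_space_def using that by (intro measurable_component_singleton) auto
  have "(\<lambda>x. INF q\<in>{q\<in>\<rat>. 0 \<le> q}. if x q \<le> k then ereal q else \<infinity>) \<in> borel_measurable state_space"
    by (intro borel_measurable_INF c) (auto intro!: measurable_If)
  then show "(\<lambda>x. resid_of_state x k) \<in> borel_measurable state_space"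
    unfolding resid_of_state_def by simp
qed auto

text \<open>Hence equality in law of states, as it enters both notions of stationarity, passes to residual times.\<close>

lemma law_resid_of_law_state:
  assumes "(\<lambda>\<omega>. state (D \<omega>) (g \<omega>)) \<in> M \<rightarrow>\<^sub>M state_space" "(\<lambda>\<omega>. state (D' \<omega>) (g' \<omega>)) \<in> M' \<rightarrow>\<^sub>M state_space"
    and "distr M state_space (\<lambda>\<omega>. state (D \<omega>) (g \<omega>)) = distr M' state_space (\<lambda>\<omega>. state (D' \<omega>) (g' \<omega>))"
  shows "distr M SQ (\<lambda>\<omega>. resid (D \<omega>) (g \<omega>)) = distr M' SQ (\<lambda>\<omega>. resid (D' \<omega>) (g' \<omega>))"
proof -
  have "distr M SQ (\<lambda>\<omega>. resid (D \<omega>) (g \<omega>))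
      = distr (distr M state_space (\<lambda>\<omega>. state (D \<omega>) (g \<omega>))) SQ resid_of_state"
    by (subst distr_distr[OF measurable_resid_of_state assms(1)]) (simp add: comp_def resid_of_state)
  also have "\<dots> = distr (distr M' state_space (\<lambda>\<omega>. state (D' \<omega>) (g' \<omega>))) SQ resid_of_state"
    using assms(3) by simp
  also have "\<dots> = distr M' SQ (\<lambda>\<omega>. resid (D' \<omega>) (g' \<omega>))"
    by (subst distr_distr[OF measurable_resid_of_state assms(2)]) (simp add: comp_def resid_of_state)
  finally show ?thesis .
qed

lemma measurable_SQ_component: "(\<lambda>r. r k) \<in> borel_measurable SQ"
  by (rule measurable_component_singleton) auto

lemma measurable_ins:
  assumes [measurable]: "f \<in> borel_measurable M" "r \<in> M \<rightarrow>\<^sub>M SQ"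
  shows "(\<lambda>x. ins (f x) (r x)) \<in> M \<rightarrow>\<^sub>M SQ"
proof (rule measurable_PiM_single')
  fix k :: nat
  have [measurable]: "(\<lambda>x. r x k) \<in> borel_measurable M" for k
    by (rule measurable_compose[OF assms(2) measurable_SQ_component])
  show "(\<lambda>x. ins (f x) (r x) k) \<in> borel_measurable M" unfolding ins_def by measurable
qed auto

lemma measurable_shift [measurable (raw)]:
  assumes [measurable]: "f \<in> borel_measurable M" "r \<in> M \<rightarrow>\<^sub>M SQ"
  shows "(\<lambda>x. shift (f x) (r x)) \<in> M \<rightarrow>\<^sub>M SQ"
proof (rule measurable_PiM_single')
  fix k :: nat
  have [measurable]: "(\<lambda>x. r x k) \<in> borel_measurable M" for k
    by (rule measurable_compose[OF assms(2) measurable_SQ_component])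
  show "(\<lambda>x. shift (f x) (r x) k) \<in> borel_measurable M" unfolding shift_def by measurable
qed auto

lemma measurable_accept [measurable (raw)]:
  assumes [measurable]: "r \<in> M \<rightarrow>\<^sub>M SQ" "f \<in> borel_measurable M"
  shows "(\<lambda>x. accept s \<theta> (r x) (f x)) \<in> M \<rightarrow>\<^sub>M SQ"
proof -
  have [measurable]: "(\<lambda>x. r x k) \<in> borel_measurable M" for k
    by (rule measurable_compose[OF assms(1) measurable_SQ_component])
  have [measurable]: "(\<lambda>x. ins (r x (s - 1) + f x) (r x)) \<in> M \<rightarrow>\<^sub>M SQ"
    by (rule measurable_ins) auto
  show ?thesis unfolding accept_def by measurable
qed

lemma measurable_qstep: "(\<lambda>(r, x). qstep s \<theta> r x) \<in> SQ \<Otimes>\<^sub>M (borel \<Otimes>\<^sub>M borel) \<rightarrow>\<^sub>M SQ"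
  unfolding qstep_def by (simp add: case_prod_beta') measurable

lemma measurable_pstep: "(\<lambda>(r, x). pstep s \<theta> r x) \<in> SQ \<Otimes>\<^sub>M (borel \<Otimes>\<^sub>M borel) \<rightarrow>\<^sub>M SQ"
  unfolding pstep_def by (simp add: case_prod_beta') measurable

section \<open>Markov chains driven by independent inputs\<close>

context sequence_space
begin

lemma measurable_chain:
  assumes F: "(\<lambda>(x, i). F x i) \<in> X \<Otimes>\<^sub>M M \<rightarrow>\<^sub>M X"
    and [measurable]: "g \<in> N \<rightarrow>\<^sub>M X" "h \<in> N \<rightarrow>\<^sub>M S"
  shows "(\<lambda>a. chain F (g a) (h a) n) \<in> N \<rightarrow>\<^sub>M X"
proof (induction n)
  case 0
  show ?case by simp
next
  case (Suc n)
  have [measurable]: "(\<lambda>a. h a n) \<in> N \<rightarrow>\<^sub>M M"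
    by (rule measurable_compose[OF assms(3)]) simp
  have "(\<lambda>a. (chain F (g a) (h a) n, h a n)) \<in> N \<rightarrow>\<^sub>M X \<Otimes>\<^sub>M M"
    using Suc by measurable
  from measurable_compose[OF this F] show ?case by simp
qed

lemma measurable_tl [measurable]: "(\<lambda>\<xi> i. \<xi> (Suc i)) \<in> S \<rightarrow>\<^sub>M S"
  by (rule measurable_PiM_single') (auto simp: space_PiM PiE_iff)

text \<open>Prepending one independent input preserves the law of the input sequence:\<close>

lemma nn_integral_first_step:
  assumes [measurable]: "f \<in> borel_measurable S"
  shows "(\<integral>\<^sup>+\<xi>. f \<xi> \<partial>S) = (\<integral>\<^sup>+a. (\<integral>\<^sup>+\<xi>. f (case_nat a \<xi>) \<partial>S) \<partial>M)"
proof -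
  interpret P: prob_space S by (rule prob_space_PiM) (rule M.prob_space_axioms)
  have "(\<integral>\<^sup>+\<xi>. f \<xi> \<partial>S) = (\<integral>\<^sup>+\<xi>. f \<xi> \<partial>distr (M \<Otimes>\<^sub>M S) S (\<lambda>(a, \<omega>). case_nat a \<omega>))"
    by (simp only: PiM_iter)
  also have "\<dots> = (\<integral>\<^sup>+(a, \<xi>). f (case_nat a \<xi>) \<partial>(M \<Otimes>\<^sub>M S))"
    by (subst nn_integral_distr) (auto simp: case_prod_beta')
  also have "\<dots> = (\<integral>\<^sup>+a. (\<integral>\<^sup>+\<xi>. f (case_nat a \<xi>) \<partial>S) \<partial>M)"
    by (subst P.nn_integral_fst[symmetric]) (auto simp: case_prod_beta')
  finally show ?thesis .
qed

text \<open>The \<open>n\<close>-th input is independent of the \<open>n\<close>-th state, which only depends on the earlier inputs.\<close>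

lemma nn_integral_next_input:
  assumes F: "(\<lambda>(x, i). F x i) \<in> X \<Otimes>\<^sub>M M \<rightarrow>\<^sub>M X" and f: "(\<lambda>(x, i). f x i) \<in> borel_measurable (X \<Otimes>\<^sub>M M)"
    and x: "x \<in> space X"
  shows "(\<integral>\<^sup>+\<xi>. f (chain F x \<xi> n) (\<xi> n) \<partial>S) = (\<integral>\<^sup>+\<xi>. (\<integral>\<^sup>+a. f (chain F x \<xi> n) a \<partial>M) \<partial>S)"
  using x
proof (induction n arbitrary: x)
  case 0
  interpret P: prob_space S by (rule prob_space_PiM) (rule M.prob_space_axioms)
  have [measurable]: "(\<lambda>a. f x a) \<in> borel_measurable M"
    using measurable_compose[OF measurable_Pair1'[OF 0, of M] f] by simp
  have "(\<integral>\<^sup>+\<xi>. f x (\<xi> 0) \<partial>S) = (\<integral>\<^sup>+a. (\<integral>\<^sup>+\<xi>. f x a \<partial>S) \<partial>M)"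
    by (subst nn_integral_first_step) auto
  then show ?case by (simp add: P.emeasure_space_1)
next
  case (Suc n)
  have F': "F x a \<in> space X" if "a \<in> space M" for a
    using measurable_space[OF F, of "(x, a)"] that Suc.prems by (auto simp: space_pair_measure)
  have ch[measurable]: "(\<lambda>\<xi>. chain F x \<xi> (Suc n)) \<in> S \<rightarrow>\<^sub>M X" for n
    by (rule measurable_chain[OF F]) (auto simp: Suc.prems)
  have m1: "(\<lambda>\<xi>. (chain F x \<xi> (Suc n), \<xi> (Suc n))) \<in> S \<rightarrow>\<^sub>M X \<Otimes>\<^sub>M M"
    by (intro measurable_Pair ch) simp
  have m2: "(\<lambda>y. \<integral>\<^sup>+a. f y a \<partial>M) \<in> borel_measurable X"
    using f by (rule M.borel_measurable_nn_integral)
  have "(\<integral>\<^sup>+\<xi>. f (chain F x \<xi> (Suc n)) (\<xi> (Suc n)) \<partial>S)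
     = (\<integral>\<^sup>+a. (\<integral>\<^sup>+\<xi>. f (chain F (F x a) \<xi> n) (\<xi> n) \<partial>S) \<partial>M)"
    using measurable_compose[OF m1 f] by (subst nn_integral_first_step) (auto simp: chain_case_nat simp del: chain.simps(2))
  also have "\<dots> = (\<integral>\<^sup>+a. (\<integral>\<^sup>+\<xi>. (\<integral>\<^sup>+a'. f (chain F (F x a) \<xi> n) a' \<partial>M) \<partial>S) \<partial>M)"
    by (intro nn_integral_cong Suc.IH F')
  also have "\<dots> = (\<integral>\<^sup>+\<xi>. (\<integral>\<^sup>+a'. f (chain F x \<xi> (Suc n)) a' \<partial>M) \<partial>S)"
    using measurable_compose[OF ch m2] by (subst (2) nn_integral_first_step) (auto simp: chain_case_nat simp del: chain.simps(2))
  finally show ?case .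
qed

end

section \<open>The queue seen by potential customers\<close>

locale balking_queue =
  fixes s :: nat and \<theta> lam :: real and G :: "real measure"
  assumes s: "1 \<le> s" and lam: "0 < lam" and \<theta>: "0 < \<theta>"
    and prob_G: "prob_space G" and sets_G [measurable_cong]: "sets G = sets borel"
    and G_nonneg: "AE b in G. 0 \<le> b" and G_integrable: "integrable G (\<lambda>b. b)"
    and G_pos: "measure G {0<..} > 0"
begin

definition Ex :: "real measure" where
  "Ex = density lborel (exponential_density lam)"

text \<open>
  One input of the chain: the gap that follows a potential customer, and the service requirement.
\<close>

definition \<nu> :: "(real \<times> real) measure" where
  "\<nu> = Ex \<Otimes>\<^sub>M G"

lemma sets_Ex [measurable_cong]: "sets Ex = sets borel"
  by (simp add: Ex_def)

lemma space_Ex [simp]: "space Ex = UNIV"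
  by (simp add: Ex_def)

lemma space_G [simp]: "space G = UNIV"
  using sets_eq_imp_space_eq[OF sets_G] by simp

lemma sets_\<nu> [measurable_cong]: "sets \<nu> = sets (borel \<Otimes>\<^sub>M borel)"
  unfolding \<nu>_def by (intro sets_pair_measure_cong sets_Ex sets_G)

lemma measurable_\<nu>: "N \<rightarrow>\<^sub>M \<nu> = N \<rightarrow>\<^sub>M borel \<Otimes>\<^sub>M borel" "\<nu> \<rightarrow>\<^sub>M N = borel \<Otimes>\<^sub>M borel \<rightarrow>\<^sub>M N"
  by (rule measurable_cong_sets; simp add: sets_\<nu>)+

lemma space_\<nu> [simp]: "space \<nu> = UNIV"
  using sets_eq_imp_space_eq[OF sets_\<nu>] by (simp add: space_pair_measure)

sublocale Ex: prob_space Ex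
  unfolding Ex_def by (rule prob_space_exponential_density[OF lam])

sublocale G: prob_space G
  by (rule prob_G)

sublocale EG: pair_prob_space Ex G ..

sublocale \<nu>: prob_space \<nu>
  unfolding \<nu>_def by (rule EG.prob_space_axioms)

abbreviation P :: "(nat \<Rightarrow> real \<times> real) measure" where
  "P \<equiv> (\<Pi>\<^sub>M i\<in>(UNIV::nat set). \<nu>)"

sublocale P: prob_space P
  by (rule prob_space_PiM) (rule \<nu>.prob_space_axioms)

sublocale inp: sequence_space \<nu> ..

lemma space_P [simp]: "space P = UNIV"
  by (simp add: space_PiM PiE_def extensional_def)

lemma space_SQ [simp]: "space SQ = UNIV"
  by (simp add: space_PiM PiE_def extensional_def)

lemma Ex_distributed: "distributed Ex lborel (\<lambda>t. t) (exponential_density lam)"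
  unfolding distributed_def Ex_def
  by (auto simp: distr_id2 exponential_density_nonneg[OF lam])

lemma Ex_gt: "0 \<le> a \<Longrightarrow> measure Ex {a<..} = exp (- (lam * a))"
  using Ex.exponential_distributedD_gt[OF Ex_distributed _ lam, of a]
  by (simp add: greaterThan_def mult.commute)

lemma AE_Ex_pos: "AE t in Ex. 0 < t"
proof -
  have "measure Ex {0<..} = 1" using Ex_gt[of 0] by simp
  then have "AE t in Ex. t \<in> {0<..}" by (subst Ex.AE_in_set_eq_1) (auto simp: sets_Ex)
  then show ?thesis by simp
qed

lemma Ex_integrable: "integrable Ex (\<lambda>t. t)" and Ex_mean: "(LINT t|Ex. t) = 1 / lam"
proof -
  show m: "(LINT t|Ex. t) = 1 / lam"
    using Ex.exponential_distributed_expectation[OF lam Ex_distributed] by simp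
  show "integrable Ex (\<lambda>t. t)"
  proof (rule ccontr)
    assume "\<not> integrable Ex (\<lambda>t. t)"
    then have "(LINT t|Ex. t) = 0" by (rule not_integrable_integral_eq)
    with m lam show False by simp
  qed
qed

lemma Ex_atom: "AE t in Ex. t \<noteq> a"
  unfolding Ex_def by (subst AE_density) (auto intro: AE_mp[OF AE_lborel_singleton[of a]])

lemma Ex_ge: assumes "0 \<le> a" shows "measure Ex {a..} = exp (- (lam * a))"
proof -
  have "measure Ex {a..} = measure Ex {a<..}"
    using Ex_atom[of a] by (intro Ex.finite_measure_eq_AE) (auto elim!: eventually_mono simp: sets_Ex)
  then show ?thesis using Ex_gt[OF assms] by simp
qed

lemma Ex_ge_max: "measure Ex {a..} = exp (- (lam * max 0 a))"
proof (cases "0 \<le> a")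
  case True
  then show ?thesis using Ex_ge by (simp add: max_def)
next
  case False
  have "AE t in Ex. t \<in> {a..}" using AE_Ex_pos by eventually_elim (use False in auto)
  then have "measure Ex {a..} = 1" by (subst (asm) Ex.AE_in_set_eq_1) (auto simp: sets_Ex)
  then show ?thesis using False by (simp add: max_def)
qed

lemma Ex_interval:
  assumes "a \<le> b"
  shows "measure Ex {a..<b} = exp (- (lam * max 0 a)) - exp (- (lam * max 0 b))"
proof -
  have "{a..<b} = {a..} - {b..}" using assms by auto
  then have "measure Ex {a..<b} = measure Ex {a..} - measure Ex {b..}"
    using assms by (subst Ex.finite_measure_Diff[symmetric]) (auto simp: sets_Ex)
  then show ?thesis by (simp add: Ex_ge_max)
qed

lemma nn_integral_\<nu>:
  assumes "f \<in> borel_measurable (borel \<Otimes>\<^sub>M borel)"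
  shows "(\<integral>\<^sup>+x. f x \<partial>\<nu>) = (\<integral>\<^sup>+t. (\<integral>\<^sup>+b. f (t, b) \<partial>G) \<partial>Ex)"
    and "(\<integral>\<^sup>+x. f x \<partial>\<nu>) = (\<integral>\<^sup>+b. (\<integral>\<^sup>+t. f (t, b) \<partial>Ex) \<partial>G)"
proof -
  have sets: "sets (Ex \<Otimes>\<^sub>M G) = sets (borel \<Otimes>\<^sub>M borel)" using sets_\<nu> by (simp add: \<nu>_def)
  have f: "f \<in> borel_measurable (Ex \<Otimes>\<^sub>M G)" using assms by (simp cong: measurable_cong_sets add: sets)
  show "(\<integral>\<^sup>+x. f x \<partial>\<nu>) = (\<integral>\<^sup>+t. (\<integral>\<^sup>+b. f (t, b) \<partial>G) \<partial>Ex)"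
    unfolding \<nu>_def by (rule G.nn_integral_fst[OF f, symmetric])
  show "(\<integral>\<^sup>+x. f x \<partial>\<nu>) = (\<integral>\<^sup>+b. (\<integral>\<^sup>+t. f (t, b) \<partial>Ex) \<partial>G)"
    unfolding \<nu>_def by (rule EG.nn_integral_snd[OF f, symmetric, unfolded split_beta' fst_conv snd_conv])
qed

lemma AE_\<nu>: "AE x in \<nu>. 0 < fst x \<and> 0 \<le> snd x"
proof -
  have "AE x in Ex \<Otimes>\<^sub>M G. 0 < fst x"
  proof (rule EG.AE_pair_measure)
    have "Measurable.pred (borel \<Otimes>\<^sub>M borel) (\<lambda>x::real\<times>real. 0 < fst x)" by measurable
    then show "{x \<in> space (Ex \<Otimes>\<^sub>M G). 0 < fst x} \<in> sets (Ex \<Otimes>\<^sub>M G)"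
      using sets_\<nu>[unfolded \<nu>_def] by (simp add: pred_def space_pair_measure)
  qed (use AE_Ex_pos in auto)
  moreover have "AE x in Ex \<Otimes>\<^sub>M G. 0 \<le> snd x"
  proof (rule EG.AE_pair_measure)
    have "Measurable.pred (borel \<Otimes>\<^sub>M borel) (\<lambda>x::real\<times>real. 0 \<le> snd x)" by measurable
    then show "{x \<in> space (Ex \<Otimes>\<^sub>M G). 0 \<le> snd x} \<in> sets (Ex \<Otimes>\<^sub>M G)"
      using sets_\<nu>[unfolded \<nu>_def] by (simp add: pred_def space_pair_measure)
  qed (use G_nonneg in auto)
  ultimately show ?thesis unfolding \<nu>_def by eventually_elim auto
qed

lemma AE_P: "AE \<xi> in P. \<forall>i. 0 < fst (\<xi> i) \<and> 0 \<le> snd (\<xi> i)"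
  unfolding AE_all_countable
  by (intro allI AE_PiM_component \<nu>.prob_space_axioms AE_\<nu>) auto

abbreviation step :: "(nat \<Rightarrow> real) \<Rightarrow> real \<times> real \<Rightarrow> nat \<Rightarrow> real" where
  "step \<equiv> qstep s \<theta>"

text \<open>The residual times found by the \<open>n\<close>-th potential customer:\<close>

abbreviation Y :: "(nat \<Rightarrow> real) \<Rightarrow> (nat \<Rightarrow> real \<times> real) \<Rightarrow> nat \<Rightarrow> nat \<Rightarrow> real" where
  "Y \<equiv> chain step"

lemma measurable_step_\<nu>: "(\<lambda>(r, x). step r x) \<in> SQ \<Otimes>\<^sub>M \<nu> \<rightarrow>\<^sub>M SQ"
  using measurable_qstep[of s \<theta>] by (simp cong: measurable_cong_sets)

lemma measurable_step [measurable (raw)]: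
  assumes "f \<in> N \<rightarrow>\<^sub>M SQ" "g \<in> N \<rightarrow>\<^sub>M borel \<Otimes>\<^sub>M borel"
  shows "(\<lambda>x. step (f x) (g x)) \<in> N \<rightarrow>\<^sub>M SQ"
  using measurable_compose[OF measurable_Pair[OF assms] measurable_qstep[of s \<theta>]] by simp

lemma measurable_Y [measurable (raw)]:
  assumes "f \<in> N \<rightarrow>\<^sub>M SQ" "g \<in> N \<rightarrow>\<^sub>M P"
  shows "(\<lambda>x. Y (f x) (g x) n) \<in> N \<rightarrow>\<^sub>M SQ"
  by (rule inp.measurable_chain[OF measurable_step_\<nu> assms])

lemma measurable_Y_component [measurable (raw)]:
  assumes "f \<in> N \<rightarrow>\<^sub>M SQ" "g \<in> N \<rightarrow>\<^sub>M P"
  shows "(\<lambda>x. Y (f x) (g x) n k) \<in> borel_measurable N"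
  by (rule measurable_compose[OF measurable_Y[OF assms] measurable_SQ_component])

section \<open>Emptying and coupling\<close>

text \<open>
  A customer who joins waits at most \<open>\<theta>\<close>, so the queue is dominated by one with infinitely many servers
  and service requirements \<open>\<theta> + b\<close> that nobody leaves. The time until that system is empty, kept
  negative when it has been empty for a while, forms a real-valued chain that does not look at the
  state of the queue. Whenever it is at most 0, the queue is empty whatever its initial state,
  and copies with different initial states but the same input coincide from then on.
\<close>

definition lstep :: "real \<Rightarrow> real \<times> real \<Rightarrow> real" where
  "lstep l = (\<lambda>(t, b). max l (\<theta> + b) - t)"

lemma measurable_lstep: "(\<lambda>(l, x). lstep l x) \<in> borel \<Otimes>\<^sub>M (borel \<Otimes>\<^sub>M borel) \<rightarrow>\<^sub>M borel"
  unfolding lstep_def by (simp add: case_prod_beta') measurable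

lemma measurable_L [measurable (raw)]:
  assumes "f \<in> borel_measurable N" "g \<in> N \<rightarrow>\<^sub>M P"
  shows "(\<lambda>x. chain lstep (f x) (g x) n) \<in> borel_measurable N"
  by (rule inp.measurable_chain[OF _ assms]) (use measurable_lstep in \<open>simp cong: measurable_cong_sets\<close>)

lemma step_dominated:
  assumes "\<And>k. r k \<le> max 0 l" "0 \<le> fst x" "0 \<le> snd x"
  shows "step r x k \<le> max 0 (lstep l x)"
proof -
  obtain t b where x: "x = (t, b)" by fastforce
  have tb: "0 \<le> t" "0 \<le> b" using assms x by auto
  have "accept s \<theta> r b k \<le> max 0 (max l (\<theta> + b))"
  proof (cases "r (s - 1) \<le> \<theta>")
    case True
    have "ins (r (s - 1) + b) r k \<le> max (r k) (r (s - 1) + b)" by (auto simp: ins_def)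
    also have "\<dots> \<le> max 0 (max l (\<theta> + b))" using assms(1)[of k] True tb by auto
    finally show ?thesis using True by (simp add: accept_def)
  next
    case False
    then show ?thesis using assms(1)[of k] by (auto simp: accept_def)
  qed
  then show ?thesis using tb by (auto simp: x qstep_def shift_def lstep_def)
qed

lemma Y_dominated:
  assumes "\<And>k. r k \<le> max 0 l" "\<And>i. 0 \<le> fst (\<xi> i) \<and> 0 \<le> snd (\<xi> i)"
  shows "Y r \<xi> n k \<le> max 0 (chain lstep l \<xi> n)"
proof (induction n arbitrary: k)
  case (Suc n)
  have "step (Y r \<xi> n) (\<xi> n) k \<le> max 0 (lstep (chain lstep l \<xi> n) (\<xi> n))"
    by (rule step_dominated) (use Suc assms(2) in auto)
  then show ?case by simp
qed (use assms(1) in simp)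

text \<open>
  Copies from any initial states below \<open>l\<close> are caught between 0 and the dominating chain, so they are all 0
  when the latter is; with the same input they stay equal.
\<close>

lemma Y_coalesce:
  assumes "good r" "r 0 \<le> l" and \<xi>: "\<And>i. 0 \<le> fst (\<xi> i) \<and> 0 \<le> snd (\<xi> i)"
    and j: "chain lstep l \<xi> j \<le> 0" "j \<le> n"
  shows "Y r \<xi> n = Y (\<lambda>_. 0) \<xi> n" "Y r \<xi> j = (\<lambda>_. 0)"
proof -
  have *: "Y r' \<xi> j = (\<lambda>_. 0)" if r': "good r'" "r' 0 \<le> l" for r'
  proof
    fix k
    have "r' k \<le> max 0 l" for k using good_le[OF r'(1), of 0 k] r'(2) by simp
    then have "Y r' \<xi> j k \<le> max 0 (chain lstep l \<xi> j)" by (rule Y_dominated[OF _ \<xi>])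
    moreover have "0 \<le> Y r' \<xi> j k" by (rule good_nonneg[OF good_chain_qstep[OF r'(1)]])
    ultimately show "Y r' \<xi> j k = 0" using j by simp
  qed
  have l: "0 \<le> l" using assms good_nonneg[of r 0] by simp
  obtain i where n: "n = j + i" using j by (metis le_iff_add)
  show "Y r \<xi> n = Y (\<lambda>_. 0) \<xi> n"
    unfolding n chain_add by (simp add: *[OF assms(1,2)] *[OF good_zero l])
  show "Y r \<xi> j = (\<lambda>_. 0)" by (rule *[OF assms(1,2)])
qed

lemma nn_integral_fst_\<nu>: "g \<in> borel_measurable borel \<Longrightarrow> (\<integral>\<^sup>+x. g (fst x) \<partial>\<nu>) = (\<integral>\<^sup>+t. g t \<partial>Ex)"
  by (subst nn_integral_\<nu>(1)) (simp_all add: G.emeasure_space_1[simplified])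

lemma nn_integral_snd_\<nu>: "g \<in> borel_measurable borel \<Longrightarrow> (\<integral>\<^sup>+x. g (snd x) \<partial>\<nu>) = (\<integral>\<^sup>+b. g b \<partial>G)"
  by (subst nn_integral_\<nu>(2)) (simp_all add: Ex.emeasure_space_1[simplified])

lemma sets_gap_exceeds_job: "{x. max c (\<theta> + snd x) \<le> fst x} \<in> sets \<nu>"
proof -
  have "Measurable.pred (borel \<Otimes>\<^sub>M borel) (\<lambda>x::real\<times>real. max c (\<theta> + snd x) \<le> fst x)" by measurable
  then show ?thesis by (simp add: pred_def space_pair_measure sets_\<nu>)
qed

text \<open>
  Gaps are unbounded, so one of them may outlast every customer of a system whose level is at most \<open>c\<close>.
\<close>

lemma gap_exceeds_job: "0 < measure \<nu> {x. max c (\<theta> + snd x) \<le> fst x}"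
proof -
  have "\<exists>n::nat. emeasure G {..real n} \<noteq> 0"
  proof (rule ccontr)
    assume "\<not> ?thesis"
    then have "emeasure G (\<Union>n::nat. {..real n}) = 0"
      by (intro emeasure_UN_eq_0) (auto simp: sets_G)
    moreover have "(\<Union>n::nat. {..real n}) = UNIV" using real_arch_simple by auto
    ultimately show False using G.emeasure_space_1 by simp
  qed
  then obtain n :: nat where n: "emeasure G {..real n} \<noteq> 0" ..
  define d where "d = max 0 (max c (\<theta> + real n))"
  have "measure Ex {d..} > 0" by (subst Ex_ge) (auto simp: d_def)
  then have "0 < emeasure Ex {d..}" by (simp add: Ex.emeasure_eq_measure)
  moreover have "emeasure \<nu> ({d..} \<times> {..real n}) = emeasure Ex {d..} * emeasure G {..real n}"
    unfolding \<nu>_def by (rule G.emeasure_pair_measure_Times) (simp_all add: sets_Ex sets_G)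
  ultimately have "0 < emeasure \<nu> ({d..} \<times> {..real n})"
    using n by (simp add: ennreal_zero_less_mult_iff zero_less_iff_neq_zero)
  also have "\<dots> \<le> emeasure \<nu> {x. max c (\<theta> + snd x) \<le> fst x}"
    by (rule emeasure_mono[OF _ sets_gap_exceeds_job]) (auto simp: d_def)
  finally show ?thesis by (simp add: \<nu>.emeasure_eq_measure)
qed

text \<open>
  A Lyapunov function for the dominating chain: a linear term for the negative drift far from 0,
  which is where \<open>E[B] < \<infinity>\<close> enters, and a jump at 0 that pays for the positive drift close to 0
  through the chance \<open>p\<close> of emptying in one step.
\<close>

lemma lyapunov:
  obtains f :: "real \<Rightarrow> real" where "f \<in> borel_measurable borel" "\<And>l. 0 \<le> f l"
    "\<And>l. 0 < l \<Longrightarrow> (\<integral>\<^sup>+x. ennreal (f (lstep l x)) \<partial>\<nu>) + 1 \<le> ennreal (f l)"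
proof -
  define A where "A l = (LINT b|G. max 0 (\<theta> + b - l))" for l
  define B where "B l = (LINT t|Ex. min l t)" for l
  have intA: "integrable G (\<lambda>b. max 0 (\<theta> + b - l))" for l
  proof -
    have "integrable G (\<lambda>b. \<theta> + b - l)"
      by (rule Bochner_Integration.integrable_diff[OF Bochner_Integration.integrable_add[OF _ G_integrable]]) auto
    then show ?thesis by (intro integrable_max) auto
  qed
  have intB: "integrable Ex (\<lambda>t. min l t)" for l
    by (intro integrable_min Ex_integrable) auto
  have A_nonneg: "0 \<le> A l" for l unfolding A_def by (rule Bochner_Integration.integral_nonneg) simp
  have A_anti: "A l' \<le> A l" if "l \<le> l'" for l l'
    unfolding A_def using that by (intro integral_mono intA) auto
  have B_mono: "B l \<le> B l'" if "l \<le> l'" for l l'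
    unfolding B_def using that by (intro integral_mono intB) auto
  have B_le: "B l \<le> l" for l
    using integral_mono[OF intB[of l], of "\<lambda>_. l"] unfolding B_def by (simp add: Ex.prob_space[simplified])
  have B_nonneg: "0 \<le> B l" if "0 \<le> l" for l unfolding B_def
    by (rule integral_nonneg_AE, use AE_Ex_pos in eventually_elim, use that in auto)
  have "(\<lambda>n. A (real n)) \<longlonglongrightarrow> (LINT b|G. 0)"
    unfolding A_def
  proof (rule integral_dominated_convergence[where w="\<lambda>b. \<bar>\<theta> + b\<bar>"])
    show "AE b in G. (\<lambda>n. max 0 (\<theta> + b - real n)) \<longlonglongrightarrow> 0"
    proof (rule AE_I2)
      fix b
      have "eventually (\<lambda>n. max 0 (\<theta> + b - real n) = 0) sequentially"
        using filterlim_real_sequentially[unfolded filterlim_at_top, rule_format, of "\<theta> + b"] by eventually_elim simp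
      then show "(\<lambda>n. max 0 (\<theta> + b - real n)) \<longlonglongrightarrow> 0" by (rule tendsto_eventually)
    qed
    have "integrable G (\<lambda>b. \<theta> + b)"
      by (rule Bochner_Integration.integrable_add[OF _ G_integrable]) auto
    then show "integrable G (\<lambda>b. \<bar>\<theta> + b\<bar>)" by (rule integrable_abs)
    show "(\<lambda>b. max 0 (\<theta> + b - real n)) \<in> borel_measurable G" for n by measurable
    show "(\<lambda>b. 0 :: real) \<in> borel_measurable G" by (rule borel_measurable_const)
    show "AE b in G. norm (max 0 (\<theta> + b - real n)) \<le> \<bar>\<theta> + b\<bar>" for n by (rule AE_I2) auto
  qed
  moreover have "(\<lambda>n. B (real n)) \<longlonglongrightarrow> (LINT t|Ex. t)"
    unfolding B_def
  proof (rule integral_dominated_convergence[where w="\<lambda>t. \<bar>t\<bar>"])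
    show "AE t in Ex. (\<lambda>n. min (real n) t) \<longlonglongrightarrow> t"
    proof (rule AE_I2)
      fix t
      have "eventually (\<lambda>n. min (real n) t = t) sequentially"
        using filterlim_real_sequentially[unfolded filterlim_at_top, rule_format, of t] by eventually_elim simp
      then show "(\<lambda>n. min (real n) t) \<longlonglongrightarrow> t" by (rule tendsto_eventually)
    qed
    show "AE t in Ex. norm (min (real n) t) \<le> \<bar>t\<bar>" for n
      using AE_Ex_pos by eventually_elim auto
    show "integrable Ex (\<lambda>t. \<bar>t\<bar>)" by (rule integrable_abs[OF Ex_integrable])
    show "(\<lambda>t. min (real n) t) \<in> borel_measurable Ex" for n by measurable
    show "(\<lambda>t. t) \<in> borel_measurable Ex" by (rule measurable_ident_sets[OF sets_Ex])
  qed
  ultimately have "(\<lambda>n. A (real n) - B (real n)) \<longlonglongrightarrow> 0 - 1 / lam"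
    by (intro tendsto_diff) (simp_all add: Ex_mean)
  then have "eventually (\<lambda>n. A (real n) - B (real n) < - 1 / (2 * lam)) sequentially"
    by (rule order_tendstoD(2)) (use lam in \<open>auto simp: field_simps\<close>)
  then obtain K :: nat where K: "A K - B K < - 1 / (2 * lam)"
    by (auto simp: eventually_at_top_linorder)
  \<comment> \<open>Beyond \<open>K\<close> the drift is at most \<open>- 1 / (2 * lam)\<close>, half of that without arriving work; \<open>a\<close> turns it into \<open>- 1\<close>,
    and \<open>c\<close> does the same below \<open>K\<close>, where the linear term rises by at most \<open>a * A 0\<close>.\<close>
  define a where "a = 2 * lam"
  have a: "0 < a" "a * (A K - B K) \<le> - 1" using K lam by (auto simp: a_def field_simps)
  define p where "p = measure \<nu> {x. max K (\<theta> + snd x) \<le> fst x}"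
  have p: "0 < p" unfolding p_def by (rule gap_exceeds_job)
  define c where "c = (1 + a * A 0) / p"
  have c: "0 \<le> c" "c * p = 1 + a * A 0" using p a A_nonneg by (auto simp: c_def)
  define f where "f l = a * max 0 l + c * indicator {0<..} l" for l :: real
  have drift: "(\<integral>\<^sup>+x. ennreal (f (lstep l x)) \<partial>\<nu>) + 1 \<le> ennreal (f l)" if l: "0 < l" for l
  proof -
    let ?E = "{x. 0 < lstep l x}"
    have "lstep l \<in> borel_measurable (borel \<Otimes>\<^sub>M borel)"
      using measurable_compose[OF measurable_Pair1'[of l borel] measurable_lstep] by simp
    then have E[measurable]: "?E \<in> sets \<nu>"
      using measurable_sets[of "lstep l" "borel \<Otimes>\<^sub>M borel" borel "{0<..}"]
      by (simp add: sets_\<nu> space_pair_measure vimage_def)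
    have "(\<integral>\<^sup>+x. ennreal (f (lstep l x)) \<partial>\<nu>)
        \<le> (\<integral>\<^sup>+x. ennreal (a * max 0 (\<theta> + snd x - l)) + ennreal (a * (l - min l (fst x))) + ennreal c * indicator ?E x \<partial>\<nu>)"
    proof (rule nn_integral_mono_AE, use AE_\<nu> in eventually_elim)
      fix x :: "real \<times> real" assume x: "0 < fst x \<and> 0 \<le> snd x"
      have "max 0 (lstep l x) \<le> max 0 (\<theta> + snd x - l) + (l - min l (fst x))"
        using l x by (auto simp: lstep_def case_prod_beta')
      then have "a * max 0 (lstep l x) \<le> a * (max 0 (\<theta> + snd x - l) + (l - min l (fst x)))"
        using a by (intro mult_left_mono) auto
      then have "f (lstep l x) \<le> a * max 0 (\<theta> + snd x - l) + a * (l - min l (fst x)) + c * indicator ?E x"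
        unfolding f_def distrib_left by (simp add: indicator_def)
      then have "ennreal (f (lstep l x)) \<le> ennreal (a * max 0 (\<theta> + snd x - l) + a * (l - min l (fst x)) + c * indicator ?E x)"
        by (rule ennreal_leI)
      also have "\<dots> = ennreal (a * max 0 (\<theta> + snd x - l)) + ennreal (a * (l - min l (fst x))) + ennreal c * indicator ?E x"
        using a c by (simp add: ennreal_plus ennreal_mult'' ennreal_indicator del: ennreal_plus[symmetric])
      finally show "ennreal (f (lstep l x)) \<le> \<dots>" .
    qed
    also have "\<dots> = (\<integral>\<^sup>+b. ennreal (a * max 0 (\<theta> + b - l)) \<partial>G) + (\<integral>\<^sup>+t. ennreal (a * (l - min l t)) \<partial>Ex) + ennreal c * emeasure \<nu> ?E"
      by (simp add: nn_integral_add nn_integral_cmult_indicator nn_integral_fst_\<nu>[of "\<lambda>t. ennreal (a * (l - min l t))"]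
        nn_integral_snd_\<nu>[of "\<lambda>b. ennreal (a * max 0 (\<theta> + b - l))"])
    also have "(\<integral>\<^sup>+b. ennreal (a * max 0 (\<theta> + b - l)) \<partial>G) = ennreal (a * A l)"
      unfolding A_def using a intA by (subst nn_integral_eq_integral) auto
    also have "(\<integral>\<^sup>+t. ennreal (a * (l - min l t)) \<partial>Ex) = ennreal (a * (l - B l))"
      unfolding B_def using a intB[of l]
      by (subst nn_integral_eq_integral) (auto simp: Ex.prob_space[simplified])
    also have "ennreal c * emeasure \<nu> ?E = ennreal (c * measure \<nu> ?E)"
      using c by (simp add: \<nu>.emeasure_eq_measure ennreal_mult)
    also have "ennreal (a * A l) + ennreal (a * (l - B l)) + ennreal (c * measure \<nu> ?E) + 1
        = ennreal (a * A l + a * (l - B l) + c * measure \<nu> ?E + 1)"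
      using a c A_nonneg[of l] B_le[of l] by (simp add: ennreal_plus del: ennreal_plus[symmetric])
    also have "\<dots> \<le> ennreal (f l)"
    proof (rule ennreal_leI)
      have fl: "f l = a * l + c" using l by (simp add: f_def)
      show "a * A l + a * (l - B l) + c * measure \<nu> ?E + 1 \<le> f l"
      proof (cases "real K \<le> l")
        case True
        have "a * (A l - B l) \<le> a * (A K - B K)" using A_anti[OF True] B_mono[OF True] a by (intro mult_left_mono) auto
        moreover have "c * measure \<nu> ?E \<le> c" using c(1) \<nu>.prob_le_1 mult_left_le by blast
        ultimately show ?thesis using a(2) unfolding fl by (simp add: ring_distribs)
      next
        case False
        let ?F = "{x. max K (\<theta> + snd x) \<le> fst x}"
        have "measure \<nu> ?E + p = measure \<nu> (?E \<union> ?F)"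
          unfolding p_def by (rule \<nu>.finite_measure_Union[symmetric]) (use E sets_gap_exceeds_job False in \<open>auto simp: lstep_def\<close>)
        then have "measure \<nu> ?E \<le> 1 - p" using \<nu>.prob_le_1[of "?E \<union> ?F"] by linarith
        then have "c * measure \<nu> ?E \<le> c - c * p" using mult_left_mono[of _ "1 - p" c] c by (simp add: ring_distribs)
        moreover have "a * A l \<le> a * A 0" using A_anti[of 0 l] l a by simp
        moreover have "0 \<le> a * B l" using a l B_nonneg[of l] by simp
        ultimately show ?thesis using c(2) unfolding fl by (simp add: ring_distribs)
      qed
    qed
    finally show ?thesis by (simp add: add_right_mono)
  qed
  show ?thesis
  proof (rule that[of f])
    show "f \<in> borel_measurable borel" unfolding f_def by measurable
    show "0 \<le> f l" for l using a c by (simp add: f_def)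
  qed (fact drift)
qed

lemma all_le_Suc: "(\<forall>j\<le>Suc n. Q j) \<longleftrightarrow> Q 0 \<and> (\<forall>j\<le>n. Q (Suc j))"
  by (metis Suc_le_mono le0 not0_implies_Suc)

definition busy_prob :: "real \<Rightarrow> nat \<Rightarrow> real" where
  "busy_prob l n = P.prob {\<xi>. \<forall>j\<le>n. 0 < chain lstep l \<xi> j}"

lemma sets_busy [measurable]: "{\<xi>. \<forall>j\<le>n. 0 < chain lstep l \<xi> j} \<in> sets P"
proof -
  have "Measurable.pred P (\<lambda>\<xi>. \<forall>j\<le>n. 0 < chain lstep l \<xi> j)" by measurable
  then show ?thesis by (simp add: pred_def)
qed

lemma busy_prob_nonneg: "0 \<le> busy_prob l n"
  by (simp add: busy_prob_def)

lemma busy_prob_le_1: "busy_prob l n \<le> 1"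
  by (simp add: busy_prob_def)

lemma measurable_busy_prob: "(\<lambda>l. busy_prob l n) \<in> borel_measurable borel"
proof -
  have "Measurable.pred (borel \<Otimes>\<^sub>M P) (\<lambda>x. \<forall>j\<le>n. 0 < chain lstep (fst x) (snd x) j)" by measurable
  then have A: "{x. \<forall>j\<le>n. 0 < chain lstep (fst x) (snd x) j} \<in> sets (borel \<Otimes>\<^sub>M P)" (is "?A \<in> _")
    by (simp add: pred_def space_pair_measure)
  have "(\<lambda>l. measure P (Pair l -` ?A)) \<in> borel_measurable borel"
    unfolding measure_def using P.measurable_emeasure_Pair[OF A] by simp
  then show ?thesis by (simp add: busy_prob_def vimage_def)
qed

text \<open>
  The Lyapunov function dominates the expected number of steps before the first emptying: adding the
  first step turns the bound into the drift inequality.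
\<close>

lemma busy_prob_tendsto_0: "(\<lambda>n. busy_prob l n) \<longlonglongrightarrow> 0"
proof -
  obtain f :: "real \<Rightarrow> real" where f: "f \<in> borel_measurable borel" "\<And>l. 0 \<le> f l"
    "\<And>l. 0 < l \<Longrightarrow> (\<integral>\<^sup>+x. ennreal (f (lstep l x)) \<partial>\<nu>) + 1 \<le> ennreal (f l)"
    using lyapunov by metis
  define h where "h l n = (\<integral>\<^sup>+\<xi>. indicator {\<xi>. \<forall>j\<le>n. 0 < chain lstep l \<xi> j} \<xi> \<partial>P)" for l n
  have h: "h l n = ennreal (busy_prob l n)" for l n
    by (simp add: h_def busy_prob_def P.emeasure_eq_measure)
  have h0: "h l n = 0" if "l \<le> 0" for l n
  proof -
    have "{\<xi>. \<forall>j\<le>n. 0 < chain lstep l \<xi> j} = {}" using that by force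
    then show ?thesis by (simp add: h_def)
  qed
  have ml: "(\<lambda>a. lstep l a) \<in> borel_measurable (borel \<Otimes>\<^sub>M borel)" for l
    using measurable_compose[OF measurable_Pair1'[of l borel] measurable_lstep] by simp
  have hS: "h l (Suc n) = (\<integral>\<^sup>+a. h (lstep l a) n \<partial>\<nu>)" if l: "0 < l" for l n
  proof -
    have "h l (Suc n) = (\<integral>\<^sup>+a. (\<integral>\<^sup>+\<xi>. indicator {\<xi>. \<forall>j\<le>Suc n. 0 < chain lstep l \<xi> j} (case_nat a \<xi>) \<partial>P) \<partial>\<nu>)"
      unfolding h_def by (rule inp.nn_integral_first_step) measurable
    also have "\<dots> = (\<integral>\<^sup>+a. h (lstep l a) n \<partial>\<nu>)"
    proof (intro nn_integral_cong, unfold h_def, intro nn_integral_cong)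
      fix a \<xi>
      have "(\<forall>j\<le>Suc n. 0 < chain lstep l (case_nat a \<xi>) j) \<longleftrightarrow> (\<forall>j\<le>n. 0 < chain lstep (lstep l a) \<xi> j)"
        unfolding all_le_Suc chain_case_nat using l by simp
      then show "(indicator {\<xi>. \<forall>j\<le>Suc n. 0 < chain lstep l \<xi> j} (case_nat a \<xi>) :: ennreal)
          = indicator {\<xi>. \<forall>j\<le>n. 0 < chain lstep (lstep l a) \<xi> j} \<xi>"
        by (simp add: indicator_def)
    qed
    finally show ?thesis .
  qed
  have mh: "(\<lambda>l. h l n) \<in> borel_measurable borel" for n
    unfolding h using measurable_busy_prob by measurable
  have sum: "(\<Sum>i<n. h l i) \<le> ennreal (f l)" for l n
  proof (induction n arbitrary: l)
    case 0
    show ?case by simp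
  next
    case (Suc n)
    show ?case
    proof (cases "0 < l")
      case True
      have "(\<Sum>i<Suc n. h l i) = h l 0 + (\<Sum>i<n. \<integral>\<^sup>+a. h (lstep l a) i \<partial>\<nu>)"
        by (subst sum.lessThan_Suc_shift) (simp add: hS[OF True])
      also have "(\<Sum>i<n. \<integral>\<^sup>+a. h (lstep l a) i \<partial>\<nu>) = (\<integral>\<^sup>+a. (\<Sum>i<n. h (lstep l a) i) \<partial>\<nu>)"
        by (rule nn_integral_sum[symmetric])
          (use measurable_compose[OF ml mh] in \<open>simp add: measurable_\<nu>\<close>)
      also have "\<dots> \<le> (\<integral>\<^sup>+a. ennreal (f (lstep l a)) \<partial>\<nu>)" by (intro nn_integral_mono Suc)
      finally have "(\<Sum>i<Suc n. h l i) \<le> h l 0 + (\<integral>\<^sup>+a. ennreal (f (lstep l a)) \<partial>\<nu>)"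
        by (simp add: add_left_mono)
      also have "h l 0 \<le> 1" unfolding h by (simp add: busy_prob_le_1)
      then have "h l 0 + (\<integral>\<^sup>+a. ennreal (f (lstep l a)) \<partial>\<nu>) \<le> 1 + (\<integral>\<^sup>+a. ennreal (f (lstep l a)) \<partial>\<nu>)"
        by (rule add_right_mono)
      also have "\<dots> \<le> ennreal (f l)" using f(3)[OF True] by (simp add: add.commute)
      finally show ?thesis .
    next
      case False
      then show ?thesis by (simp add: h0)
    qed
  qed
  have bound: "busy_prob l n \<le> f l / real (Suc n)" for n
  proof -
    have "ennreal (real (Suc n) * busy_prob l n) = (\<Sum>i<Suc n. h l n)"
      by (simp add: h busy_prob_nonneg ennreal_mult ennreal_of_nat_eq_real_of_nat del: sum.lessThan_Suc)
    also have "\<dots> \<le> (\<Sum>i<Suc n. h l i)"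
      unfolding h busy_prob_def by (intro sum_mono ennreal_leI P.finite_measure_mono) auto
    also have "\<dots> \<le> ennreal (f l)" by (rule sum)
    finally show ?thesis using f(2) by (simp add: field_simps)
  qed
  have "(\<lambda>n. f l / real (Suc n)) \<longlonglongrightarrow> 0" by (rule LIMSEQ_Suc[OF lim_const_over_n])
  from real_tendsto_sandwich[OF always_eventually always_eventually tendsto_const this, of "busy_prob l"]
  show ?thesis using bound by (simp add: busy_prob_nonneg del: of_nat_Suc)
qed

lemma AE_empties: "AE \<xi> in P. \<exists>j. chain lstep l \<xi> j \<le> 0"
proof -
  let ?N = "{\<xi>. \<forall>j. 0 < chain lstep l \<xi> j}"
  have "Measurable.pred P (\<lambda>\<xi>. \<forall>j. 0 < chain lstep l \<xi> j)" by measurable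
  then have N: "?N \<in> sets P" by (simp add: pred_def)
  have "P.prob ?N \<le> busy_prob l n" for n
    unfolding busy_prob_def by (rule P.finite_measure_mono) auto
  then have "P.prob ?N \<le> 0"
    by (intro LIMSEQ_le_const[OF busy_prob_tendsto_0]) auto
  then have "emeasure P ?N = 0" by (simp add: P.emeasure_eq_measure measure_le_0_iff)
  then have "AE \<xi> in P. \<xi> \<notin> ?N" using N by (intro AE_not_in) (auto simp: null_sets_def)
  then show ?thesis by eventually_elim (auto simp: not_less)
qed

text \<open>
  The level of the dominating chain decreases by at most the gap in each step, so it could not come down to 0
  from arbitrary levels if the gaps had a finite sum.
\<close>

lemma AE_arrivals_unbounded: "AE \<xi> in P. \<forall>c. \<exists>n. c < (\<Sum>k<n. fst (\<xi> k))"
proof -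
  have "AE \<xi> in P. \<forall>m::nat. \<exists>j. chain lstep (real m) \<xi> j \<le> 0"
    unfolding AE_all_countable using AE_empties by blast
  then show ?thesis
  proof eventually_elim
    fix \<xi> assume *: "\<forall>m::nat. \<exists>j. chain lstep (real m) \<xi> j \<le> 0"
    have L: "l - (\<Sum>k<n. fst (\<xi> k)) \<le> chain lstep l \<xi> n" for l n
    proof (induction n)
      case (Suc n)
      have "chain lstep l \<xi> n - fst (\<xi> n) \<le> lstep (chain lstep l \<xi> n) (\<xi> n)"
        by (simp add: lstep_def case_prod_beta')
      with Suc show ?case by simp
    qed simp
    show "\<forall>c. \<exists>n. c < (\<Sum>k<n. fst (\<xi> k))"
    proof
      fix c :: real
      obtain m :: nat where m: "c < real m" using reals_Archimedean2 by blast
      obtain j where "chain lstep (real m) \<xi> j \<le> 0" using * by blast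
      with L[of "real m" j] m show "\<exists>n. c < (\<Sum>k<n. fst (\<xi> k))" by (intro exI[of _ j]) linarith
    qed
  qed
qed

lemma AE_Y_hits_empty: assumes "good r" shows "AE \<xi> in P. \<exists>n. Y r \<xi> n = (\<lambda>_. 0)"
  using AE_empties[of "r 0"] AE_P
proof eventually_elim
  fix \<xi> assume "\<exists>j. chain lstep (r 0) \<xi> j \<le> 0" "\<forall>i. 0 < fst (\<xi> i) \<and> 0 \<le> snd (\<xi> i)"
  then show "\<exists>n. Y r \<xi> n = (\<lambda>_. 0)" using Y_coalesce(2)[OF assms order_refl, of \<xi>] by (metis less_imp_le order_refl)
qed

section \<open>Law of the stochastic input\<close>

text \<open>
  Gaps and service requirements, jointly independent, are regrouped into a sequence of independent pairs. Together
  with the initial residual times it has a product law, so the queue is the chain driven by \<open>P\<close>.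
\<close>

lemma input_law:
  assumes q: "queue_input lam G M R T S"
  shows "content_measurable M R" "T i \<in> borel_measurable M" "S i \<in> borel_measurable M"
    and "(\<lambda>\<omega> j. (T j \<omega>, S j \<omega>)) \<in> M \<rightarrow>\<^sub>M P"
    and "distr M P (\<lambda>\<omega> j. (T j \<omega>, S j \<omega>)) = P"
    and "distr M (SQ \<Otimes>\<^sub>M P) (\<lambda>\<omega>. (resid (R \<omega>) 0, \<lambda>j. (T j \<omega>, S j \<omega>)))
      = distr M SQ (\<lambda>\<omega>. resid (R \<omega>) 0) \<Otimes>\<^sub>M P"
proof -
  define I where "I = (\<Pi>\<^sub>M k\<in>(UNIV :: (nat + nat) set). (borel :: real measure))"
  define X where "X = (\<lambda>\<omega> k. case_sum T S k \<omega>)"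
  have M: "prob_space M" and pos: "\<forall>\<omega>\<in>space M. \<forall>d\<in>#R \<omega>. 0 < d"
    and Td: "\<And>i. distributed M lborel (T i) (exponential_density lam)"
    and S: "\<And>i. S i \<in> borel_measurable M" "\<And>i. distr M borel (S i) = G"
    and ind: "prob_space.indep_vars M (\<lambda>_. borel) (case_sum T S) UNIV"
    and st: "(\<lambda>\<omega>. state (R \<omega>) 0) \<in> M \<rightarrow>\<^sub>M state_space"
    and law: "distr M (state_space \<Otimes>\<^sub>M I) (\<lambda>\<omega>. (state (R \<omega>) 0, X \<omega>))
           = distr M state_space (\<lambda>\<omega>. state (R \<omega>) 0) \<Otimes>\<^sub>M distr M I X"
    using q unfolding queue_input_def Let_def I_def X_def by auto
  interpret M: prob_space M by (rule M)
  have T: "T i \<in> borel_measurable M" for i using distributed_measurable[OF Td[of i]] by simp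
  have TEx: "distr M borel (T i) = Ex" for i
    using distributed_distr_eq_density[OF Td[of i]] by (simp add: Ex_def cong: distr_cong)
  show R: "content_measurable M R" by (rule content_measurable_initial[OF pos st])
  show "T i \<in> borel_measurable M" "S i \<in> borel_measurable M" by (fact T, fact S)
  have pairs: "(\<lambda>\<omega>. (T j \<omega>, S j \<omega>)) \<in> M \<rightarrow>\<^sub>M borel \<Otimes>\<^sub>M borel" for j
    using T S by measurable
  show \<xi>: "(\<lambda>\<omega> j. (T j \<omega>, S j \<omega>)) \<in> M \<rightarrow>\<^sub>M P"
    by (rule measurable_PiM_single') (use pairs in \<open>simp_all add: measurable_\<nu>\<close>)
  have X: "X \<in> M \<rightarrow>\<^sub>M I" unfolding I_def X_def
    by (rule measurable_PiM_single') (use T S in \<open>auto split: sum.split\<close>)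
  define h :: "(nat + nat \<Rightarrow> real) \<Rightarrow> nat \<Rightarrow> real \<times> real" where "h = (\<lambda>x j. (x (Inl j), x (Inr j)))"
  have h: "h \<in> I \<rightarrow>\<^sub>M P"
    unfolding h_def I_def by (rule measurable_PiM_single') (simp_all add: measurable_\<nu>)
  have pair_law: "distr M (borel \<Otimes>\<^sub>M borel) (\<lambda>\<omega>. (T j \<omega>, S j \<omega>)) = \<nu>" for j
  proof -
    let ?r = "\<lambda>A \<omega>. restrict (\<lambda>i. case_sum T S i \<omega>) A"
    have "M.indep_var (PiM {Inl j} (\<lambda>_. borel)) (?r {Inl j}) (PiM {Inr j} (\<lambda>_. borel)) (?r {Inr j})"
      by (rule M.indep_var_restrict[OF ind]) auto
    then have "M.indep_var borel ((\<lambda>x. x (Inl j)) \<circ> ?r {Inl j}) borel ((\<lambda>x. x (Inr j)) \<circ> ?r {Inr j})"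
      by (rule M.indep_var_compose) (auto intro!: measurable_component_singleton)
    then have "M.indep_var borel (T j) borel (S j)" by (simp add: comp_def)
    then have "distr M (borel \<Otimes>\<^sub>M borel) (\<lambda>\<omega>. (T j \<omega>, S j \<omega>)) = distr M borel (T j) \<Otimes>\<^sub>M distr M borel (S j)"
      using M.indep_var_distribution_eq[of borel "T j" borel "S j"] by metis
    then show ?thesis by (simp add: TEx S \<nu>_def)
  qed
  have "M.indep_vars (\<lambda>_. borel \<Otimes>\<^sub>M borel) (\<lambda>j \<omega>. (T j \<omega>, S j \<omega>)) UNIV"
  proof -
    let ?K = "\<lambda>j::nat. {Inl j, Inr j}"
    have 1: "M.indep_vars (\<lambda>j. PiM (?K j) (\<lambda>_. borel)) (\<lambda>j \<omega>. restrict (\<lambda>i. case_sum T S i \<omega>) (?K j)) UNIV"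
      by (rule M.indep_vars_restrict[OF ind]) (auto simp: disjoint_family_on_def)
    have 2: "(\<lambda>x. (x (Inl j), x (Inr j))) \<in> PiM (?K j) (\<lambda>_. borel :: real measure) \<rightarrow>\<^sub>M borel \<Otimes>\<^sub>M borel" for j
      by (intro measurable_Pair measurable_component_singleton) auto
    show ?thesis using M.indep_vars_compose2[OF 1 2] by simp
  qed
  then have "distr M (\<Pi>\<^sub>M i\<in>(UNIV::nat set). borel \<Otimes>\<^sub>M borel) (\<lambda>\<omega>. \<lambda>j\<in>UNIV. (T j \<omega>, S j \<omega>))
      = (\<Pi>\<^sub>M i\<in>(UNIV::nat set). distr M (borel \<Otimes>\<^sub>M borel) (\<lambda>\<omega>. (T i \<omega>, S i \<omega>)))"
    by (subst (asm) M.indep_vars_iff_distr_eq_PiM) (use pairs in auto)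
  then have "distr M (\<Pi>\<^sub>M i\<in>(UNIV::nat set). borel \<Otimes>\<^sub>M borel) (\<lambda>\<omega> j. (T j \<omega>, S j \<omega>)) = P"
    by (simp add: pair_law restrict_def)
  moreover have "distr M P (\<lambda>\<omega> j. (T j \<omega>, S j \<omega>))
      = distr M (\<Pi>\<^sub>M i\<in>(UNIV::nat set). borel \<Otimes>\<^sub>M borel) (\<lambda>\<omega> j. (T j \<omega>, S j \<omega>))"
    by (intro distr_cong sets_PiM_cong sets_\<nu> refl)
  ultimately have \<xi>_law: "distr M P (\<lambda>\<omega> j. (T j \<omega>, S j \<omega>)) = P" by simp
  then show "distr M P (\<lambda>\<omega> j. (T j \<omega>, S j \<omega>)) = P" .
  have hX: "h (X \<omega>) = (\<lambda>j. (T j \<omega>, S j \<omega>))" for \<omega> by (simp add: h_def X_def)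
  have XP: "distr (distr M I X) P h = P"
    using \<xi>_law by (subst distr_distr[OF h X]) (simp add: comp_def hX)
  have "distr M (SQ \<Otimes>\<^sub>M P) (\<lambda>\<omega>. (resid (R \<omega>) 0, \<lambda>j. (T j \<omega>, S j \<omega>)))
    = distr (distr M (state_space \<Otimes>\<^sub>M I) (\<lambda>\<omega>. (state (R \<omega>) 0, X \<omega>))) (SQ \<Otimes>\<^sub>M P) (\<lambda>(x, y). (resid_of_state x, h y))"
    by (subst distr_distr) (use measurable_resid_of_state h st X in \<open>auto simp: comp_def hX resid_of_state\<close>)
  also have "\<dots> = distr (distr M state_space (\<lambda>\<omega>. state (R \<omega>) 0)) SQ resid_of_state \<Otimes>\<^sub>M distr (distr M I X) P h"
    unfolding law
    by (rule pair_measure_distr[symmetric])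
      (simp_all add: XP P.sigma_finite_measure_axioms measurable_resid_of_state h)
  also have "\<dots> = distr M SQ (\<lambda>\<omega>. resid (R \<omega>) 0) \<Otimes>\<^sub>M P"
    unfolding XP by (subst distr_distr[OF measurable_resid_of_state st]) (simp add: comp_def resid_of_state)
  finally show "distr M (SQ \<Otimes>\<^sub>M P) (\<lambda>\<omega>. (resid (R \<omega>) 0, \<lambda>j. (T j \<omega>, S j \<omega>)))
      = distr M SQ (\<lambda>\<omega>. resid (R \<omega>) 0) \<Otimes>\<^sub>M P" .
qed

lemma AE_input:
  assumes "queue_input lam G M R T S" "AE \<xi> in P. Q \<xi>"
  shows "AE \<omega> in M. Q (\<lambda>j. (T j \<omega>, S j \<omega>))"
proof (rule AE_distrD[OF input_law(4)[OF assms(1)]])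
  show "AE \<xi> in distr M P (\<lambda>\<omega> j. (T j \<omega>, S j \<omega>)). Q \<xi>"
    unfolding input_law(5)[OF assms(1)] by (fact assms(2))
qed

end

section \<open>Arrivals see time averages\<close>

text \<open>
  The inequality for the complement is the reverse inequality for the set.
\<close>

lemma prob_measure_eqI_le:
  assumes "prob_space M" "prob_space N" "sets M = sets N"
    and le: "\<And>A. A \<in> sets M \<Longrightarrow> emeasure M A \<le> emeasure N A"
  shows "M = N"
proof (rule measure_eqI[OF assms(3)])
  fix A assume A: "A \<in> sets M"
  interpret M: prob_space M by fact
  interpret N: prob_space N by fact
  have sp: "space M = space N" using assms(3) by (rule sets_eq_imp_space_eq)
  have C: "space M - A \<in> sets M" using A by auto
  have "M.prob A \<le> N.prob A" "M.prob (space M - A) \<le> N.prob (space N - A)"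
    using le[OF A] le[OF C] unfolding sp by (simp_all add: M.emeasure_eq_measure N.emeasure_eq_measure)
  moreover have "M.prob (space M - A) = 1 - M.prob A" "N.prob (space N - A) = 1 - N.prob A"
    using A assms(3) by (auto simp: M.prob_compl N.prob_compl)
  ultimately have "M.prob A = N.prob A" by simp
  then show "emeasure M A = emeasure N A" by (simp add: M.emeasure_eq_measure N.emeasure_eq_measure)
qed

text \<open>The content just after the \<open>n\<close>-th potential arrival together with its epoch:\<close>

definition zstep :: "nat \<Rightarrow> real \<Rightarrow> (nat \<Rightarrow> real) \<times> real \<Rightarrow> real \<times> real \<Rightarrow> (nat \<Rightarrow> real) \<times> real" where
  "zstep s \<theta> z x = (pstep s \<theta> (fst z) x, snd z + fst x)"

lemma chain_zstep: "chain (zstep s \<theta>) (r, 0) \<xi> n = (chain (pstep s \<theta>) r \<xi> n, \<Sum>k<n. fst (\<xi> k))"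
  by (induction n) (auto simp: zstep_def)

lemma between_partial_sums:
  fixes t :: "nat \<Rightarrow> real"
  assumes pos: "\<And>k. 0 < t k" and unb: "\<And>c. \<exists>n. c < (\<Sum>k<n. t k)" and u: "0 \<le> u"
  shows "\<exists>n. (\<Sum>k<n. t k) \<le> u \<and> u < (\<Sum>k<n. t k) + t n \<and>
    (\<forall>m. (\<Sum>k<m. t k) \<le> u \<longrightarrow> u < (\<Sum>k<m. t k) + t m \<longrightarrow> m = n) \<and>
    {i. (\<Sum>k\<le>i. t k) \<le> u} = {..<n}"
proof -
  define A where "A n = (\<Sum>k<n. t k)" for n
  have AS: "A (Suc n) = A n + t n" for n by (simp add: A_def)
  have mono: "strict_mono A" by (rule strict_monoI_Suc) (simp add: AS pos)
  define n where "n = (LEAST n. u < A (Suc n))"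
  obtain m where "u < A m" using unb[of u] by (auto simp: A_def)
  moreover have "A m \<le> A (Suc m)" using pos[of m] by (simp add: AS)
  ultimately have "u < A (Suc m)" by simp
  then have n1: "u < A (Suc n)" unfolding n_def by (rule LeastI)
  have n2: "A n \<le> u"
  proof (cases n)
    case 0 then show ?thesis using u by (simp add: A_def)
  next
    case (Suc k)
    then have "\<not> u < A (Suc k)" using not_less_Least[of k "\<lambda>n. u < A (Suc n)"] by (simp add: n_def)
    then show ?thesis using Suc by simp
  qed
  have iff: "A (Suc i) \<le> u \<longleftrightarrow> i < n" for i
  proof
    assume "A (Suc i) \<le> u"
    then have "A (Suc i) < A (Suc n)" using n1 by simp
    then show "i < n" using strict_mono_less[OF mono] by simp
  next
    assume "i < n"
    then have "A (Suc i) \<le> A n" using strict_mono_less_eq[OF mono] by simp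
    then show "A (Suc i) \<le> u" using n2 by simp
  qed
  show ?thesis
  proof (intro exI[of _ n] conjI allI impI)
    show "(\<Sum>k<n. t k) \<le> u" using n2 by (simp add: A_def)
    show "u < (\<Sum>k<n. t k) + t n" using n1 by (simp add: A_def)
    show "{i. (\<Sum>k\<le>i. t k) \<le> u} = {..<n}" using iff by (auto simp: A_def lessThan_Suc_atMost)
    fix m assume m: "(\<Sum>k<m. t k) \<le> u" "u < (\<Sum>k<m. t k) + t m"
    then have "A m < A (Suc n)" "A n < A (Suc m)" using n1 n2 by (auto simp: A_def)
    then show "m = n" using strict_mono_less[OF mono] by simp
  qed
qed

context balking_queue
begin

lemma measurable_zstep: "(\<lambda>(z, x). zstep s \<theta> z x) \<in> (SQ \<Otimes>\<^sub>M borel) \<Otimes>\<^sub>M \<nu> \<rightarrow>\<^sub>M SQ \<Otimes>\<^sub>M borel"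
proof -
  have [measurable]: "(\<lambda>y. pstep s \<theta> (fst (fst y)) (snd y)) \<in> (SQ \<Otimes>\<^sub>M borel) \<Otimes>\<^sub>M \<nu> \<rightarrow>\<^sub>M SQ"
    by (rule measurable_compose[OF _ measurable_pstep[of s \<theta>], of "\<lambda>y. (fst (fst y), snd y)", simplified]) measurable
  show ?thesis unfolding zstep_def by (simp add: case_prod_beta') measurable
qed

lemma measurable_Z [measurable (raw)]:
  assumes "f \<in> N \<rightarrow>\<^sub>M SQ \<Otimes>\<^sub>M borel" "g \<in> N \<rightarrow>\<^sub>M P"
  shows "(\<lambda>x. chain (zstep s \<theta>) (f x) (g x) n) \<in> N \<rightarrow>\<^sub>M SQ \<Otimes>\<^sub>M borel"
  by (rule inp.measurable_chain[OF measurable_zstep assms])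

abbreviation Z :: "(nat \<Rightarrow> real) \<Rightarrow> (nat \<Rightarrow> real \<times> real) \<Rightarrow> nat \<Rightarrow> (nat \<Rightarrow> real) \<times> real" where
  "Z r \<xi> n \<equiv> chain (zstep s \<theta>) (r, 0) \<xi> n"

end

locale stationary_queue = balking_queue s \<theta> lam G for s \<theta> lam G +
  fixes M :: "'a measure" and R :: "'a \<Rightarrow> real multiset" and T S :: "nat \<Rightarrow> 'a \<Rightarrow> real"
  assumes ts: "time_stationary s \<theta> lam G M R T S"
begin

text \<open>The stationary law of the residual times:\<close>

definition \<pi> :: "(nat \<Rightarrow> real) measure" where
  "\<pi> = distr M SQ (\<lambda>\<omega>. resid (R \<omega>) 0)"

lemma q: "queue_input lam G M R T S"
  using ts by (simp add: time_stationary_def)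

sublocale M: prob_space M
  using q by (simp add: queue_input_def)

lemma measurable_R: "(\<lambda>\<omega>. resid (R \<omega>) 0) \<in> M \<rightarrow>\<^sub>M SQ"
  by (rule measurable_resid_SQ[OF input_law(1)[OF q]]) simp

lemma sets_\<pi> [measurable_cong]: "sets \<pi> = sets SQ"
  by (simp add: \<pi>_def)

sublocale \<pi>: prob_space \<pi>
  unfolding \<pi>_def by (rule M.prob_space_distr[OF measurable_R])

sublocale \<pi>P: pair_prob_space \<pi> P ..
sublocale \<pi>\<nu>: pair_prob_space \<pi> \<nu> ..

lemma space_\<pi> [simp]: "space \<pi> = UNIV"
  using sets_eq_imp_space_eq[OF sets_\<pi>] by simp

lemma AE_\<pi>_good: "AE r in \<pi>. good r"
proof -
  have "Measurable.pred SQ good"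
  proof -
    have [measurable]: "Measurable.pred SQ (\<lambda>r. r (Suc k) \<le> r k)" for k
      unfolding pred_def by (rule borel_measurable_le[OF measurable_SQ_component measurable_SQ_component])
    have [measurable]: "Measurable.pred SQ (\<lambda>r. 0 \<le> r k)" for k
      unfolding pred_def by (rule borel_measurable_le[OF borel_measurable_const measurable_SQ_component])
    have "good = (\<lambda>r. (\<forall>k. r (Suc k) \<le> r k) \<and> (\<forall>k. 0 \<le> r k))"
      by (simp add: good_def decseq_Suc_iff fun_eq_iff)
    moreover have "Measurable.pred SQ (\<lambda>r. (\<forall>k. r (Suc k) \<le> r k) \<and> (\<forall>k. 0 \<le> r k))" by measurable
    ultimately show ?thesis by metis
  qed
  then show ?thesis
    unfolding \<pi>_def by (subst AE_distr_iff[OF measurable_R]) (auto simp: pred_def good_resid)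
qed

text \<open>
  The contribution to \<open>f\<close> of the state at time \<open>u\<close>, if \<open>u\<close> falls between the epoch of the content \<open>z\<close>
  and the next potential arrival:
\<close>

definition occ :: "((nat \<Rightarrow> real) \<Rightarrow> ennreal) \<Rightarrow> real \<Rightarrow> (nat \<Rightarrow> real) \<times> real \<Rightarrow> real \<times> real \<Rightarrow> ennreal" where
  "occ f u z x = (if snd z \<le> u \<and> u < snd z + fst x then f (shift (u - snd z) (fst z)) else 0)"

lemma measurable_occ [measurable (raw)]:
  assumes [measurable]: "f \<in> borel_measurable SQ" "h \<in> borel_measurable N"
    "z \<in> N \<rightarrow>\<^sub>M SQ \<Otimes>\<^sub>M borel" "x \<in> N \<rightarrow>\<^sub>M borel \<Otimes>\<^sub>M borel"
  shows "(\<lambda>y. occ f (h y) (z y) (x y)) \<in> borel_measurable N"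
  unfolding occ_def by measurable

lemma measurable_occ_Z:
  assumes f: "f \<in> borel_measurable SQ" and h: "h \<in> borel_measurable N"
    and g: "g \<in> N \<rightarrow>\<^sub>M SQ" "g' \<in> N \<rightarrow>\<^sub>M P"
  shows "(\<lambda>y. occ f (h y) (Z (g y) (g' y) n) (g' y n)) \<in> borel_measurable N"
proof (rule measurable_occ[OF f h])
  show "(\<lambda>y. Z (g y) (g' y) n) \<in> N \<rightarrow>\<^sub>M SQ \<Otimes>\<^sub>M borel" using g by measurable
  have "(\<lambda>\<xi>. \<xi> n) \<in> P \<rightarrow>\<^sub>M \<nu>" by (rule measurable_component_singleton) simp
  from measurable_compose[OF g(2) this] show "(\<lambda>y. g' y n) \<in> N \<rightarrow>\<^sub>M borel \<Otimes>\<^sub>M borel"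
    by (simp add: measurable_\<nu>)
qed

text \<open>Stationarity at a fixed time, split according to the number of potential arrivals before it:\<close>

lemma nn_integral_\<pi>_at_time:
  assumes f[measurable]: "f \<in> borel_measurable SQ" and u: "0 \<le> u"
  shows "(\<integral>\<^sup>+r. f r \<partial>\<pi>) = (\<integral>\<^sup>+r. (\<Sum>n. \<integral>\<^sup>+\<xi>. occ f u (Z r \<xi> n) (\<xi> n) \<partial>P) \<partial>\<pi>)"
proof -
  define D where "D \<omega> = departures s \<theta> (R \<omega>) (arrival T \<omega>) (\<lambda>i. S i \<omega>)" for \<omega>
  define N where "N \<omega> = card {i. arrival T \<omega> i \<le> u}" for \<omega>
  define \<Xi> where "\<Xi> \<omega> = (\<lambda>j. (T j \<omega>, S j \<omega>))" for \<omega>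
  note mTS[measurable] = input_law(2,3)[OF q]
  have cR: "content_measurable M R" by (rule input_law(1)[OF q])
  have arr[measurable]: "(\<lambda>\<omega>. arrival T \<omega> i) \<in> borel_measurable M" for i
    unfolding arrival_def by measurable
  have N[measurable]: "N \<in> M \<rightarrow>\<^sub>M count_space UNIV"
    unfolding N_def by measurable
  have Di: "content_measurable M (\<lambda>\<omega>. D \<omega> i)" for i
    unfolding D_def by (rule content_measurable_departures[OF s cR]) measurable
  have DN: "content_measurable M (\<lambda>\<omega>. D \<omega> (N \<omega>))"
    unfolding content_measurable_def
  proof
    fix g :: "'a \<Rightarrow> real" assume "g \<in> borel_measurable M"
    then have "(\<lambda>\<omega>. present (D \<omega> i) (g \<omega>)) \<in> M \<rightarrow>\<^sub>M count_space UNIV" for i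
      by (rule content_measurableD[OF Di])
    then show "(\<lambda>\<omega>. present (D \<omega> (N \<omega>)) (g \<omega>)) \<in> M \<rightarrow>\<^sub>M count_space UNIV"
      by (rule measurable_compose_countable[OF _ N])
  qed
  have "distr M state_space (\<lambda>\<omega>. state (D \<omega> (N \<omega>)) u) = distr M state_space (\<lambda>\<omega>. state (R \<omega>) 0)"
    using ts u by (simp add: time_stationary_def D_def N_def)
  then have law: "distr M SQ (\<lambda>\<omega>. resid (D \<omega> (N \<omega>)) u) = \<pi>"
    unfolding \<pi>_def by (intro law_resid_of_law_state measurable_state DN cR) auto
  define g where "g n x = occ f u (Z (fst x) (snd x) n) (snd x n)"
    for n and x :: "(nat \<Rightarrow> real) \<times> (nat \<Rightarrow> real \<times> real)"
  have g[measurable]: "g n \<in> borel_measurable (SQ \<Otimes>\<^sub>M P)" for n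
    unfolding g_def by (intro measurable_occ_Z f) simp_all
  have "(\<integral>\<^sup>+r. f r \<partial>\<pi>) = (\<integral>\<^sup>+\<omega>. f (resid (D \<omega> (N \<omega>)) u) \<partial>M)"
    unfolding law[symmetric] by (rule nn_integral_distr[OF measurable_resid_SQ[OF DN]]) auto
  also have "\<dots> = (\<integral>\<^sup>+\<omega>. (\<Sum>n. g n (resid (R \<omega>) 0, \<Xi> \<omega>)) \<partial>M)"
  proof (rule nn_integral_cong_AE, use AE_input[OF q AE_P] AE_input[OF q AE_arrivals_unbounded] in eventually_elim)
    fix \<omega>
    assume pos: "\<forall>i. 0 < fst (T i \<omega>, S i \<omega>) \<and> 0 \<le> snd (T i \<omega>, S i \<omega>)"
      and unb: "\<forall>c. \<exists>n. c < (\<Sum>k<n. fst (T k \<omega>, S k \<omega>))"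
    have p1: "0 < T k \<omega>" for k using pos by simp
    have p2: "\<exists>n. c < (\<Sum>k<n. T k \<omega>)" for c using unb by simp
    obtain n where n: "(\<Sum>k<n. T k \<omega>) \<le> u" "u < (\<Sum>k<n. T k \<omega>) + T n \<omega>"
      "\<forall>m. (\<Sum>k<m. T k \<omega>) \<le> u \<longrightarrow> u < (\<Sum>k<m. T k \<omega>) + T m \<omega> \<longrightarrow> m = n"
      "{i. (\<Sum>k\<le>i. T k \<omega>) \<le> u} = {..<n}"
      using between_partial_sums[OF p1 p2 u] by blast
    have Nn: "N \<omega> = n" using n(4) by (simp add: N_def arrival_def)
    let ?A0 = "\<lambda>n. \<Sum>k<n. T k \<omega>"
    have A: "arrival T \<omega> = (\<lambda>i. ?A0 (Suc i))" by (simp add: fun_eq_iff arrival_def lessThan_Suc_atMost)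
    have "resid (D \<omega> n) (?A0 n) = fst (Z (resid (R \<omega>) 0) (\<Xi> \<omega>) n)"
      unfolding D_def A chain_zstep fst_conv \<Xi>_def
    proof (rule resid_departures_pchain[OF s])
      show "0 \<le> T i \<omega>" for i using pos by (simp add: less_imp_le)
    qed simp_all
    moreover have Zs: "snd (Z (resid (R \<omega>) 0) (\<Xi> \<omega>) m) = ?A0 m" for m
      by (simp add: chain_zstep \<Xi>_def)
    ultimately have D: "resid (D \<omega> (N \<omega>)) u = shift (u - snd (Z (resid (R \<omega>) 0) (\<Xi> \<omega>) n)) (fst (Z (resid (R \<omega>) 0) (\<Xi> \<omega>) n))"
      using resid_shift[of "u - ?A0 n" "D \<omega> n" "?A0 n"] n(1) by (simp add: Nn)
    have gm: "g m (resid (R \<omega>) 0, \<Xi> \<omega>) = (if m = n then f (resid (D \<omega> (N \<omega>)) u) else 0)" for m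
    proof (cases "m = n")
      case True
      then show ?thesis unfolding g_def occ_def fst_conv snd_conv D Zs using n(1,2) by (simp add: \<Xi>_def)
    next
      case False
      then have "\<not> (?A0 m \<le> u \<and> u < ?A0 m + T m \<omega>)" using n(3) by metis
      then show ?thesis using False unfolding g_def occ_def fst_conv snd_conv Zs by (auto simp: \<Xi>_def)
    qed
    have "(\<Sum>m. g m (resid (R \<omega>) 0, \<Xi> \<omega>)) = (\<Sum>m\<in>{n}. g m (resid (R \<omega>) 0, \<Xi> \<omega>))"
      by (rule suminf_finite) (simp_all add: gm)
    then show "f (resid (D \<omega> (N \<omega>)) u) = (\<Sum>m. g m (resid (R \<omega>) 0, \<Xi> \<omega>))"
      by (simp add: gm)
  qed
  also have "\<dots> = (\<integral>\<^sup>+x. (\<Sum>n. g n x) \<partial>distr M (SQ \<Otimes>\<^sub>M P) (\<lambda>\<omega>. (resid (R \<omega>) 0, \<Xi> \<omega>)))"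
    by (subst nn_integral_distr) (use measurable_R input_law(4)[OF q] in \<open>auto simp: \<Xi>_def\<close>)
  also have "\<dots> = (\<integral>\<^sup>+x. (\<Sum>n. g n x) \<partial>(\<pi> \<Otimes>\<^sub>M P))"
    unfolding \<Xi>_def input_law(6)[OF q] \<pi>_def ..
  also have "\<dots> = (\<integral>\<^sup>+r. (\<integral>\<^sup>+\<xi>. (\<Sum>n. g n (r, \<xi>)) \<partial>P) \<partial>\<pi>)"
    by (subst P.nn_integral_fst[symmetric]) (auto simp: measurable_cong_sets[OF sets_pair_measure_cong[OF sets_\<pi> refl] refl])
  also have "\<dots> = (\<integral>\<^sup>+r. (\<Sum>n. \<integral>\<^sup>+\<xi>. g n (r, \<xi>) \<partial>P) \<partial>\<pi>)"
    by (intro nn_integral_cong nn_integral_suminf measurable_compose[OF measurable_Pair1' g]) simp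
  finally show ?thesis by (simp add: g_def)
qed

text \<open>Discounted contribution to \<open>f\<close> of the potential arrival that follows the content \<open>z\<close>:\<close>

definition disc :: "real \<Rightarrow> ((nat \<Rightarrow> real) \<Rightarrow> ennreal) \<Rightarrow> (nat \<Rightarrow> real) \<times> real \<Rightarrow> ennreal" where
  "disc \<alpha> f z = (\<integral>\<^sup>+t. ennreal (\<alpha> / lam * exp (- (\<alpha> * (snd z + t)))) * f (shift t (fst z)) \<partial>Ex)"

lemma measurable_disc: 
  assumes [measurable]: "f \<in> borel_measurable SQ"
  shows "disc \<alpha> f \<in> borel_measurable (SQ \<Otimes>\<^sub>M borel)"
  unfolding disc_def by measurable

text \<open>
  If \<open>u\<close> is exponential with rate \<open>\<alpha>\<close>, the age \<open>t = u - a\<close> of the state at time \<open>u\<close>, in a gap that has not ended, has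
  density \<open>\<alpha> * exp (- \<alpha> * (a + t)) * exp (- lam * t)\<close>; up to the factor \<open>\<alpha> / lam * exp (- \<alpha> * (a + t))\<close> this is the density of the
  gap itself. This is where Poisson arrivals see time averages.
\<close>

lemma disc_eq:
  assumes [measurable]: "f \<in> borel_measurable SQ" and \<alpha>: "0 < \<alpha>" and a: "0 \<le> a"
  shows "(\<integral>\<^sup>+x. (\<integral>\<^sup>+u. occ f u (y, a) x \<partial>density lborel (exponential_density \<alpha>)) \<partial>\<nu>) = disc \<alpha> f (y, a)"
proof -
  let ?E = "density lborel (exponential_density \<alpha>)"
  interpret E: prob_space ?E by (rule prob_space_exponential_density[OF \<alpha>])
  interpret E\<nu>: pair_prob_space ?E \<nu> ..
  have [simp]: "y \<in> space SQ" by simp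
  have m: "(\<lambda>(u, x). occ f u (y, a) x) \<in> borel_measurable (?E \<Otimes>\<^sub>M \<nu>)"
    by measurable
  have "(\<integral>\<^sup>+x. (\<integral>\<^sup>+u. occ f u (y, a) x \<partial>?E) \<partial>\<nu>) = (\<integral>\<^sup>+u. (\<integral>\<^sup>+x. occ f u (y, a) x \<partial>\<nu>) \<partial>?E)"
    using E\<nu>.Fubini[OF m] by simp
  also have "\<dots> = (\<integral>\<^sup>+u. (if a \<le> u then f (shift (u - a) y) * ennreal (exp (- (lam * (u - a)))) else 0) \<partial>?E)"
  proof (rule nn_integral_cong)
    fix u :: real
    have "(\<integral>\<^sup>+x. occ f u (y, a) x \<partial>\<nu>) = (\<integral>\<^sup>+t. (if a \<le> u \<and> u < a + t then f (shift (u - a) y) else 0) \<partial>Ex)"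
      unfolding occ_def fst_conv snd_conv by (subst nn_integral_fst_\<nu>[symmetric]) simp_all
    also have "\<dots> = (\<integral>\<^sup>+t. (if a \<le> u then f (shift (u - a) y) else 0) * indicator {u - a<..} t \<partial>Ex)"
      by (intro nn_integral_cong) (auto simp: indicator_def)
    also have "\<dots> = (if a \<le> u then f (shift (u - a) y) else 0) * emeasure Ex {u - a<..}"
      by (rule nn_integral_cmult_indicator) (simp add: sets_Ex)
    also have "\<dots> = (if a \<le> u then f (shift (u - a) y) * ennreal (exp (- (lam * (u - a)))) else 0)"
      by (simp add: Ex.emeasure_eq_measure Ex_gt)
    finally show "(\<integral>\<^sup>+x. occ f u (y, a) x \<partial>\<nu>) = \<dots>" .
  qed
  also have "\<dots> = (\<integral>\<^sup>+u. ennreal (exponential_density \<alpha> u)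
      * (if a \<le> u then f (shift (u - a) y) * ennreal (exp (- (lam * (u - a)))) else 0) \<partial>lborel)"
    by (rule nn_integral_density) measurable
  also have "\<dots> = (\<integral>\<^sup>+t. ennreal (exponential_density \<alpha> (a + t))
      * (if 0 \<le> t then f (shift t y) * ennreal (exp (- (lam * t))) else 0) \<partial>lborel)"
    by (subst nn_integral_real_affine[where c=1 and t=a]) (simp_all cong: if_cong)
  also have "\<dots> = (\<integral>\<^sup>+t. ennreal (exponential_density lam t)
      * (ennreal (\<alpha> / lam * exp (- (\<alpha> * (a + t)))) * f (shift t y)) \<partial>lborel)"
  proof (rule nn_integral_cong)
    fix t :: real
    show "ennreal (exponential_density \<alpha> (a + t)) * (if 0 \<le> t then f (shift t y) * ennreal (exp (- (lam * t))) else 0)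
      = ennreal (exponential_density lam t) * (ennreal (\<alpha> / lam * exp (- (\<alpha> * (a + t)))) * f (shift t y))"
    proof (cases "0 \<le> t")
      case True
      have "ennreal (exponential_density \<alpha> (a + t)) * ennreal (exp (- (lam * t)))
          = ennreal (exponential_density lam t) * ennreal (\<alpha> / lam * exp (- (\<alpha> * (a + t))))"
        using True a \<alpha> lam by (simp add: exponential_density_def ennreal_mult[symmetric] mult.commute) (simp add: algebra_simps)
      then show ?thesis using True by (simp add: mult.assoc[symmetric]) (simp add: mult_ac)
    next
      case False
      then show ?thesis by (simp add: exponential_density_def)
    qed
  qed
  also have "\<dots> = disc \<alpha> f (y, a)"
    unfolding disc_def Ex_def by (subst nn_integral_density) simp_all
  finally show ?thesis .
qed

text \<open>
  Averaging the stationarity identity over an exponential time turns the gaps between potential arrivals into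
  discounts: the stationary law is the discounted sum of the laws found at potential arrivals.
\<close>

lemma nn_integral_\<pi>_discounted:
  assumes f: "f \<in> borel_measurable SQ" and \<alpha>: "0 < \<alpha>"
  shows "(\<integral>\<^sup>+r. f r \<partial>\<pi>) = (\<integral>\<^sup>+r. (\<Sum>n. \<integral>\<^sup>+\<xi>. disc \<alpha> f (Z r \<xi> n) \<partial>P) \<partial>\<pi>)"
proof -
  let ?E = "density lborel (exponential_density \<alpha>)"
  interpret E: prob_space ?E by (rule prob_space_exponential_density[OF \<alpha>])
  interpret E\<pi>: pair_prob_space ?E \<pi> ..
  interpret EP: pair_prob_space ?E P ..
  have spE: "space ?E = UNIV" by simp
  have AE_E: "AE u in ?E. 0 \<le> u"
    by (subst AE_density) (auto simp: exponential_density_def)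
  have m3: "(\<lambda>y. occ f (fst (fst y)) (Z (snd (fst y)) (snd y) n) (snd y n)) \<in> borel_measurable ((?E \<Otimes>\<^sub>M \<pi>) \<Otimes>\<^sub>M P)" for n
    by (rule measurable_occ_Z[OF f]) measurable
  have m2: "(\<lambda>y. \<integral>\<^sup>+\<xi>. occ f (fst y) (Z (snd y) \<xi> n) (\<xi> n) \<partial>P) \<in> borel_measurable (?E \<Otimes>\<^sub>M \<pi>)" for n
    using P.borel_measurable_nn_integral[of "\<lambda>y \<xi>. occ f (fst y) (Z (snd y) \<xi> n) (\<xi> n)" "?E \<Otimes>\<^sub>M \<pi>"] m3
    by (simp add: case_prod_beta')
  have "(\<integral>\<^sup>+r. f r \<partial>\<pi>) = (\<integral>\<^sup>+u. (\<integral>\<^sup>+r. f r \<partial>\<pi>) \<partial>?E)"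
    using E.emeasure_space_1 by simp
  also have "\<dots> = (\<integral>\<^sup>+u. (\<integral>\<^sup>+r. (\<Sum>n. \<integral>\<^sup>+\<xi>. occ f u (Z r \<xi> n) (\<xi> n) \<partial>P) \<partial>\<pi>) \<partial>?E)"
    by (rule nn_integral_cong_AE, use AE_E in eventually_elim) (rule nn_integral_\<pi>_at_time[OF f])
  also have "\<dots> = (\<integral>\<^sup>+r. (\<integral>\<^sup>+u. (\<Sum>n. \<integral>\<^sup>+\<xi>. occ f u (Z r \<xi> n) (\<xi> n) \<partial>P) \<partial>?E) \<partial>\<pi>)"
    using E\<pi>.Fubini[of "\<lambda>(u, r). \<Sum>n. \<integral>\<^sup>+\<xi>. occ f u (Z r \<xi> n) (\<xi> n) \<partial>P"] m2
    by (simp add: case_prod_beta')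
  also have "\<dots> = (\<integral>\<^sup>+r. (\<Sum>n. \<integral>\<^sup>+\<xi>. disc \<alpha> f (Z r \<xi> n) \<partial>P) \<partial>\<pi>)"
  proof (rule nn_integral_cong)
    fix r :: "nat \<Rightarrow> real"
    have r: "r \<in> space SQ" by simp
    have mu: "(\<lambda>u. \<integral>\<^sup>+\<xi>. occ f u (Z r \<xi> n) (\<xi> n) \<partial>P) \<in> borel_measurable ?E" for n
      using measurable_compose[OF measurable_Pair2'[of r \<pi> ?E] m2[of n]] by simp
    have muP: "(\<lambda>(u, \<xi>). occ f u (Z r \<xi> n) (\<xi> n)) \<in> borel_measurable (?E \<Otimes>\<^sub>M P)" for n
      unfolding case_prod_beta' by (rule measurable_occ_Z[OF f]) measurable
    have mz: "(\<lambda>(z, x). \<integral>\<^sup>+u. occ f u z x \<partial>?E) \<in> borel_measurable ((SQ \<Otimes>\<^sub>M borel) \<Otimes>\<^sub>M \<nu>)"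
      using f by measurable
    have "(\<integral>\<^sup>+u. (\<Sum>n. \<integral>\<^sup>+\<xi>. occ f u (Z r \<xi> n) (\<xi> n) \<partial>P) \<partial>?E)
        = (\<Sum>n. \<integral>\<^sup>+u. (\<integral>\<^sup>+\<xi>. occ f u (Z r \<xi> n) (\<xi> n) \<partial>P) \<partial>?E)"
      by (rule nn_integral_suminf[OF mu])
    also have "\<dots> = (\<Sum>n. \<integral>\<^sup>+\<xi>. disc \<alpha> f (Z r \<xi> n) \<partial>P)"
    proof (rule suminf_cong)
      fix n
      have "(\<integral>\<^sup>+u. (\<integral>\<^sup>+\<xi>. occ f u (Z r \<xi> n) (\<xi> n) \<partial>P) \<partial>?E)
          = (\<integral>\<^sup>+\<xi>. (\<integral>\<^sup>+u. occ f u (Z r \<xi> n) (\<xi> n) \<partial>?E) \<partial>P)"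
        using EP.Fubini[OF muP] by simp
      also have "\<dots> = (\<integral>\<^sup>+\<xi>. (\<integral>\<^sup>+x. (\<integral>\<^sup>+u. occ f u (Z r \<xi> n) x \<partial>?E) \<partial>\<nu>) \<partial>P)"
        by (rule inp.nn_integral_next_input[OF measurable_zstep mz]) (simp add: space_pair_measure)
      also have "\<dots> = (\<integral>\<^sup>+\<xi>. disc \<alpha> f (Z r \<xi> n) \<partial>P)"
      proof (rule nn_integral_cong_AE, use AE_P in eventually_elim)
        fix \<xi> :: "nat \<Rightarrow> real \<times> real" assume \<xi>: "\<forall>i. 0 < fst (\<xi> i) \<and> 0 \<le> snd (\<xi> i)"
        then have "0 \<le> snd (Z r \<xi> n)" unfolding chain_zstep by (simp add: sum_nonneg less_imp_le)
        then show "(\<integral>\<^sup>+x. (\<integral>\<^sup>+u. occ f u (Z r \<xi> n) x \<partial>?E) \<partial>\<nu>) = disc \<alpha> f (Z r \<xi> n)"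
          using disc_eq[OF f \<alpha>, of "snd (Z r \<xi> n)" "fst (Z r \<xi> n)"] by simp
      qed
      finally show "(\<integral>\<^sup>+u. (\<integral>\<^sup>+\<xi>. occ f u (Z r \<xi> n) (\<xi> n) \<partial>P) \<partial>?E) = (\<integral>\<^sup>+\<xi>. disc \<alpha> f (Z r \<xi> n) \<partial>P)" .
    qed
    finally show "(\<integral>\<^sup>+u. (\<Sum>n. \<integral>\<^sup>+\<xi>. occ f u (Z r \<xi> n) (\<xi> n) \<partial>P) \<partial>?E) = \<dots>" .
  qed
  finally show ?thesis .
qed

text \<open>
  The discounted sum moves by one step when the initial term is dropped, and this term vanishes with the
  discount rate. Hence the law seen at an arbitrary time is invariant for the chain of the
  potential arrivals.
\<close>

lemma \<pi>_invariant: "distr (\<pi> \<Otimes>\<^sub>M \<nu>) SQ (\<lambda>(r, x). step r x) = \<pi>"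
proof (rule prob_measure_eqI_le[symmetric])
  have st[measurable]: "(\<lambda>(r, x). step r x) \<in> \<pi> \<Otimes>\<^sub>M \<nu> \<rightarrow>\<^sub>M SQ"
    unfolding case_prod_beta' by measurable
  show "prob_space \<pi>" by (rule \<pi>.prob_space_axioms)
  show "prob_space (distr (\<pi> \<Otimes>\<^sub>M \<nu>) SQ (\<lambda>(r, x). step r x))"
    by (rule \<pi>\<nu>.prob_space_distr[OF st])
  show "sets \<pi> = sets (distr (\<pi> \<Otimes>\<^sub>M \<nu>) SQ (\<lambda>(r, x). step r x))" by (simp add: sets_\<pi>)
  fix B assume "B \<in> sets \<pi>"
  then have B[measurable]: "B \<in> sets SQ" by (simp add: sets_\<pi>)
  define f :: "(nat \<Rightarrow> real) \<Rightarrow> ennreal" where "f = indicator B"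
  have f[measurable]: "f \<in> borel_measurable SQ" by (simp add: f_def)
  have f1: "f r \<le> 1" for r by (simp add: f_def indicator_def)
  have eD: "emeasure (distr (\<pi> \<Otimes>\<^sub>M \<nu>) SQ (\<lambda>(r, x). step r x)) B = (\<integral>\<^sup>+r. (\<integral>\<^sup>+x. f (step r x) \<partial>\<nu>) \<partial>\<pi>)"
  proof -
    have "emeasure (distr (\<pi> \<Otimes>\<^sub>M \<nu>) SQ (\<lambda>(r, x). step r x)) B = (\<integral>\<^sup>+r. f r \<partial>distr (\<pi> \<Otimes>\<^sub>M \<nu>) SQ (\<lambda>(r, x). step r x))"
      by (simp add: f_def)
    also have "\<dots> = (\<integral>\<^sup>+z. f (step (fst z) (snd z)) \<partial>(\<pi> \<Otimes>\<^sub>M \<nu>))"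
      by (subst nn_integral_distr[OF st]) (simp_all add: case_prod_beta')
    also have "\<dots> = (\<integral>\<^sup>+r. (\<integral>\<^sup>+x. f (step r x) \<partial>\<nu>) \<partial>\<pi>)"
    proof -
      have "(\<lambda>z. f (step (fst z) (snd z))) \<in> borel_measurable (\<pi> \<Otimes>\<^sub>M \<nu>)" by measurable
      from \<nu>.nn_integral_fst[OF this] show ?thesis by simp
    qed
    finally show ?thesis .
  qed
  show "emeasure \<pi> B \<le> emeasure (distr (\<pi> \<Otimes>\<^sub>M \<nu>) SQ (\<lambda>(r, x). step r x)) B"
    unfolding eD
  proof (rule ennreal_le_epsilon)
    fix e :: real assume e: "0 < e"
    \<comment> \<open>With this rate the term of the first potential arrival is at most \<open>e\<close>.\<close>
    define \<alpha> where "\<alpha> = e * lam"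
    have \<alpha>: "0 < \<alpha>" "\<alpha> / lam = e" using e lam by (auto simp: \<alpha>_def)
    \<comment> \<open>\<open>g\<close> is \<open>f\<close> seen one step ahead, with the discount for the gap in between.\<close>
    define g where "g y = (\<integral>\<^sup>+x. ennreal (exp (- (\<alpha> * fst x))) * f (step y x) \<partial>\<nu>)" for y
    have g: "g \<in> borel_measurable SQ" unfolding g_def by measurable
    have step_g: "(\<integral>\<^sup>+x. disc \<alpha> f (zstep s \<theta> z x) \<partial>\<nu>) = disc \<alpha> g z" for z
    proof -
      have [simp]: "fst z \<in> space SQ" by simp
      have mh: "(\<lambda>x. disc \<alpha> f (zstep s \<theta> z x)) \<in> borel_measurable (borel \<Otimes>\<^sub>M borel)"
      proof (rule measurable_compose[OF _ measurable_disc[OF f]])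
        show "zstep s \<theta> z \<in> borel \<Otimes>\<^sub>M borel \<rightarrow>\<^sub>M SQ \<Otimes>\<^sub>M borel"
          unfolding zstep_def pstep_def case_prod_beta' by measurable
      qed
      have "disc \<alpha> f (zstep s \<theta> z (t, b)) = ennreal (\<alpha> / lam * exp (- (\<alpha> * (snd z + t))))
          * (\<integral>\<^sup>+t'. ennreal (exp (- (\<alpha> * t'))) * f (step (shift t (fst z)) (t', b)) \<partial>Ex)" for t b
      proof -
        have "disc \<alpha> f (zstep s \<theta> z (t, b)) = (\<integral>\<^sup>+t'. ennreal (\<alpha> / lam * exp (- (\<alpha> * (snd z + t))))
          * (ennreal (exp (- (\<alpha> * t'))) * f (step (shift t (fst z)) (t', b))) \<partial>Ex)"
          unfolding disc_def
        proof (rule nn_integral_cong)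
          fix t' :: real
          have "exp (- (\<alpha> * (snd z + t + t'))) = exp (- (\<alpha> * (snd z + t))) * exp (- (\<alpha> * t'))"
            by (simp add: exp_add[symmetric] algebra_simps)
          then have "ennreal (\<alpha> / lam * exp (- (\<alpha> * (snd z + t + t'))))
              = ennreal (\<alpha> / lam * exp (- (\<alpha> * (snd z + t)))) * ennreal (exp (- (\<alpha> * t')))"
            using \<alpha> lam e by (simp add: ennreal_mult[symmetric])
          then show "ennreal (\<alpha> / lam * exp (- (\<alpha> * (snd (zstep s \<theta> z (t, b)) + t')))) * f (shift t' (fst (zstep s \<theta> z (t, b))))
            = ennreal (\<alpha> / lam * exp (- (\<alpha> * (snd z + t)))) * (ennreal (exp (- (\<alpha> * t'))) * f (step (shift t (fst z)) (t', b)))"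
            by (simp add: zstep_def pstep_def qstep_def mult.assoc)
        qed
        then show ?thesis by (subst (asm) nn_integral_cmult) measurable
      qed
      then have "(\<integral>\<^sup>+x. disc \<alpha> f (zstep s \<theta> z x) \<partial>\<nu>)
        = (\<integral>\<^sup>+t. (\<integral>\<^sup>+b. ennreal (\<alpha> / lam * exp (- (\<alpha> * (snd z + t))))
          * (\<integral>\<^sup>+t'. ennreal (exp (- (\<alpha> * t'))) * f (step (shift t (fst z)) (t', b)) \<partial>Ex) \<partial>G) \<partial>Ex)"
        by (subst nn_integral_\<nu>(1)[OF mh]) simp
      also have "\<dots> = (\<integral>\<^sup>+t. ennreal (\<alpha> / lam * exp (- (\<alpha> * (snd z + t)))) * g (shift t (fst z)) \<partial>Ex)"
      proof (rule nn_integral_cong)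
        fix t :: real
        have [simp]: "shift t (fst z) \<in> space SQ" by simp
        have m: "(\<lambda>x. ennreal (exp (- (\<alpha> * fst x))) * f (step (shift t (fst z)) x)) \<in> borel_measurable (borel \<Otimes>\<^sub>M borel)"
          by measurable
        have "g (shift t (fst z)) = (\<integral>\<^sup>+b. (\<integral>\<^sup>+t'. ennreal (exp (- (\<alpha> * t'))) * f (step (shift t (fst z)) (t', b)) \<partial>Ex) \<partial>G)"
          unfolding g_def by (subst nn_integral_\<nu>(2)[OF m]) simp
        then show "(\<integral>\<^sup>+b. ennreal (\<alpha> / lam * exp (- (\<alpha> * (snd z + t))))
          * (\<integral>\<^sup>+t'. ennreal (exp (- (\<alpha> * t'))) * f (step (shift t (fst z)) (t', b)) \<partial>Ex) \<partial>G)
          = ennreal (\<alpha> / lam * exp (- (\<alpha> * (snd z + t)))) * g (shift t (fst z))"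
          by (simp only:) (rule nn_integral_cmult, measurable)
      qed
      finally show ?thesis unfolding disc_def .
    qed
    have succ: "(\<integral>\<^sup>+\<xi>. disc \<alpha> f (Z r \<xi> (Suc n)) \<partial>P) = (\<integral>\<^sup>+\<xi>. disc \<alpha> g (Z r \<xi> n) \<partial>P)" for r n
    proof -
      have m: "(\<lambda>(z, x). disc \<alpha> f (zstep s \<theta> z x)) \<in> borel_measurable ((SQ \<Otimes>\<^sub>M borel) \<Otimes>\<^sub>M \<nu>)"
        using measurable_compose[OF measurable_zstep measurable_disc[OF f]] by (simp add: case_prod_beta')
      have "(\<integral>\<^sup>+\<xi>. disc \<alpha> f (zstep s \<theta> (Z r \<xi> n) (\<xi> n)) \<partial>P) = (\<integral>\<^sup>+\<xi>. (\<integral>\<^sup>+x. disc \<alpha> f (zstep s \<theta> (Z r \<xi> n) x) \<partial>\<nu>) \<partial>P)"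
        by (rule inp.nn_integral_next_input[OF measurable_zstep m]) (simp add: space_pair_measure)
      then show ?thesis by (simp add: step_g)
    qed
    have zero: "(\<integral>\<^sup>+\<xi>. disc \<alpha> f (Z r \<xi> 0) \<partial>P) \<le> ennreal e" for r
    proof -
      have "disc \<alpha> f (r, 0) \<le> (\<integral>\<^sup>+t. ennreal e \<partial>Ex)"
        unfolding disc_def
      proof (rule nn_integral_mono_AE, use AE_Ex_pos in eventually_elim)
        fix t :: real assume t: "0 < t"
        have "ennreal (\<alpha> / lam * exp (- (\<alpha> * (snd (r, 0) + t)))) \<le> ennreal e"
          using t \<alpha> e by (intro ennreal_leI) (simp add: mult_left_le)
        from mult_mono[OF this f1]
        show "ennreal (\<alpha> / lam * exp (- (\<alpha> * (snd (r, 0) + t)))) * f (shift t (fst (r, 0))) \<le> ennreal e" by simp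
      qed
      then show ?thesis using Ex.emeasure_space_1 P.emeasure_space_1 by simp
    qed
    have mt: "(\<lambda>r. \<integral>\<^sup>+\<xi>. disc \<alpha> h (Z r \<xi> n) \<partial>P) \<in> borel_measurable \<pi>" if h: "h \<in> borel_measurable SQ" for h n
    proof -
      note [measurable] = measurable_disc[OF h]
      show ?thesis by measurable
    qed
    have "emeasure \<pi> B = (\<integral>\<^sup>+r. f r \<partial>\<pi>)" by (simp add: f_def sets_\<pi>)
    also have "\<dots> = (\<integral>\<^sup>+r. (\<Sum>n. \<integral>\<^sup>+\<xi>. disc \<alpha> f (Z r \<xi> n) \<partial>P) \<partial>\<pi>)"
      by (rule nn_integral_\<pi>_discounted[OF f \<alpha>(1)])
    also have "\<dots> = (\<integral>\<^sup>+r. (\<integral>\<^sup>+\<xi>. disc \<alpha> f (Z r \<xi> 0) \<partial>P) + (\<Sum>n. \<integral>\<^sup>+\<xi>. disc \<alpha> g (Z r \<xi> n) \<partial>P) \<partial>\<pi>)"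
    proof (rule nn_integral_cong)
      fix r
      show "(\<Sum>n. \<integral>\<^sup>+\<xi>. disc \<alpha> f (Z r \<xi> n) \<partial>P)
          = (\<integral>\<^sup>+\<xi>. disc \<alpha> f (Z r \<xi> 0) \<partial>P) + (\<Sum>n. \<integral>\<^sup>+\<xi>. disc \<alpha> g (Z r \<xi> n) \<partial>P)"
        using suminf_offset[of "\<lambda>n. \<integral>\<^sup>+\<xi>. disc \<alpha> f (Z r \<xi> n) \<partial>P" 1] by (simp add: succ del: chain.simps add.commute)
    qed
    also have "\<dots> \<le> (\<integral>\<^sup>+r. ennreal e + (\<Sum>n. \<integral>\<^sup>+\<xi>. disc \<alpha> g (Z r \<xi> n) \<partial>P) \<partial>\<pi>)"
      by (intro nn_integral_mono add_right_mono zero)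
    also have "\<dots> = ennreal e + (\<integral>\<^sup>+r. (\<Sum>n. \<integral>\<^sup>+\<xi>. disc \<alpha> g (Z r \<xi> n) \<partial>P) \<partial>\<pi>)"
      using mt[OF g] \<pi>.emeasure_space_1 by (subst nn_integral_add) auto
    also have "\<dots> = ennreal e + (\<integral>\<^sup>+r. g r \<partial>\<pi>)"
      by (simp add: nn_integral_\<pi>_discounted[OF g \<alpha>(1)])
    also have "\<dots> \<le> ennreal e + (\<integral>\<^sup>+r. (\<integral>\<^sup>+x. f (step r x) \<partial>\<nu>) \<partial>\<pi>)"
    proof (intro add_left_mono nn_integral_mono)
      fix r
      show "g r \<le> (\<integral>\<^sup>+x. f (step r x) \<partial>\<nu>)"
        unfolding g_def
      proof (rule nn_integral_mono_AE, use AE_\<nu> in eventually_elim)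
        fix x :: "real \<times> real" assume "0 < fst x \<and> 0 \<le> snd x"
        then have "ennreal (exp (- (\<alpha> * fst x))) \<le> 1" using \<alpha> by (simp add: ennreal_le_1)
        then show "ennreal (exp (- (\<alpha> * fst x))) * f (step r x) \<le> f (step r x)"
          using mult_right_mono[of _ 1 "f (step r x)"] by simp
      qed
    qed
    finally show "emeasure \<pi> B \<le> (\<integral>\<^sup>+r. (\<integral>\<^sup>+x. f (step r x) \<partial>\<nu>) \<partial>\<pi>) + ennreal e"
      by (simp add: add.commute)
  qed
qed

end

section \<open>Law of large numbers\<close>

lemma cesaro_tendsto_0:
  fixes d :: "nat \<Rightarrow> real"
  assumes "d \<longlonglongrightarrow> 0" "\<And>k. 0 \<le> d k" "\<And>k. d k \<le> 1"
  shows "(\<lambda>n. (\<Sum>k<n. d k) / real n) \<longlonglongrightarrow> 0"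
proof (rule LIMSEQ_I)
  fix e :: real assume e: "0 < e"
  obtain K where K: "\<And>k. K \<le> k \<Longrightarrow> d k < e / 2"
    using order_tendstoD(2)[OF assms(1), of "e / 2"] e by (auto simp: eventually_at_top_linorder)
  obtain N :: nat where N: "2 * real K / e < real N" using reals_Archimedean2 by blast
  show "\<exists>no. \<forall>n\<ge>no. norm ((\<Sum>k<n. d k) / real n - 0) < e"
  proof (intro exI allI impI)
    fix n assume n: "max (Suc N) K \<le> n"
    have "(\<Sum>k<n. d k) = (\<Sum>k<K. d k) + (\<Sum>k\<in>{K..<n}. d k)"
      using n by (subst sum.union_disjoint[symmetric]) (auto intro!: sum.cong)
    also have "(\<Sum>k<K. d k) \<le> real K" using sum_mono[of "{..<K}" d "\<lambda>_. 1"] assms(3) by simp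
    also have "(\<Sum>k\<in>{K..<n}. d k) \<le> (\<Sum>k\<in>{K..<n}. e / 2)" using K by (intro sum_mono less_imp_le) auto
    also have "\<dots> \<le> real n * (e / 2)" using e by (simp add: mult_right_mono)
    finally have "(\<Sum>k<n. d k) \<le> real K + real n * (e / 2)" by simp
    moreover have "real K < real n * (e / 2)"
    proof -
      have "2 * real K / e < real n" using N n by linarith
      then show ?thesis using e by (simp add: field_simps)
    qed
    ultimately have "(\<Sum>k<n. d k) < real n * e" by linarith
    moreover have "0 \<le> (\<Sum>k<n. d k)" using assms(2) by (intro sum_nonneg) auto
    ultimately show "norm ((\<Sum>k<n. d k) / real n - 0) < e" using n by (simp add: field_simps)
  qed
qed

lemma sum_gap_le:
  fixes d :: "nat \<Rightarrow> real"
  assumes d: "\<And>k. 0 \<le> d k" and i: "i < n"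
  shows "(\<Sum>j<n. d (if j \<le> i then i - j else j - i)) \<le> 2 * (\<Sum>k<n. d k)"
proof -
  have "(\<Sum>j<n. d (if j \<le> i then i - j else j - i)) = (\<Sum>j\<le>i. d (i - j)) + (\<Sum>j\<in>{i<..<n}. d (j - i))"
  proof -
    have n: "{..<n} = {..i} \<union> {i<..<n}" using i by auto
    have "(\<Sum>j<n. d (if j \<le> i then i - j else j - i))
        = (\<Sum>j\<le>i. d (if j \<le> i then i - j else j - i)) + (\<Sum>j\<in>{i<..<n}. d (if j \<le> i then i - j else j - i))"
      unfolding n by (rule sum.union_disjoint) auto
    also have "\<dots> = (\<Sum>j\<le>i. d (i - j)) + (\<Sum>j\<in>{i<..<n}. d (j - i))"
      by (intro arg_cong2[where f="(+)"] sum.cong) auto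
    finally show ?thesis .
  qed
  also have "(\<Sum>j\<le>i. d (i - j)) = sum d ((\<lambda>j. i - j) ` {..i})"
    by (subst sum.reindex) (auto simp: inj_on_def)
  also have "\<dots> \<le> sum d {..<n}" using d i by (intro sum_mono2) auto
  also have "(\<Sum>j\<in>{i<..<n}. d (j - i)) = sum d ((\<lambda>j. j - i) ` {i<..<n})"
    by (subst sum.reindex) (auto simp: inj_on_def)
  also have "\<dots> \<le> sum d {..<n}" using d i by (intro sum_mono2) auto
  finally show ?thesis by simp
qed

context balking_queue
begin

definition avg :: "((nat \<Rightarrow> real) \<Rightarrow> real) \<Rightarrow> nat \<Rightarrow> (nat \<Rightarrow> real) \<Rightarrow> (nat \<Rightarrow> real \<times> real) \<Rightarrow> real" where
  "avg f N r \<xi> = (\<Sum>j<N. f (Y r \<xi> j)) / real N"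

lemma measurable_avg:
  assumes [measurable]: "f \<in> borel_measurable SQ" "g \<in> M' \<rightarrow>\<^sub>M SQ" "h \<in> M' \<rightarrow>\<^sub>M P"
  shows "(\<lambda>x. avg f N (g x) (h x)) \<in> borel_measurable M'"
  unfolding avg_def by measurable

lemma avg_bounds:
  assumes "\<And>r. 0 \<le> f r" "\<And>r. f r \<le> 1"
  shows "0 \<le> avg f N r \<xi>" "avg f N r \<xi> \<le> 1"
proof -
  show "0 \<le> avg f N r \<xi>" using assms(1) by (simp add: avg_def sum_nonneg)
  have "(\<Sum>j<N. f (Y r \<xi> j)) \<le> real N" using sum_mono[of "{..<N}" "\<lambda>j. f (Y r \<xi> j)" "\<lambda>_. 1"] assms(2) by simp
  then show "avg f N r \<xi> \<le> 1" by (cases "N = 0") (auto simp: avg_def)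
qed

text \<open>By coupling, the initial state affects averages by at most the fraction of time before the first emptying.\<close>

lemma avg_coupled:
  assumes f: "\<And>r. 0 \<le> f r" "\<And>r. f r \<le> 1" and r: "good r"
    and \<xi>: "\<And>i. 0 < fst (\<xi> i) \<and> 0 \<le> snd (\<xi> i)"
  shows "\<bar>avg f N r \<xi> - avg f N (\<lambda>_. 0) \<xi>\<bar>
    \<le> (\<Sum>k<N. indicator {\<xi>. \<forall>j\<le>k. 0 < chain lstep (r 0) \<xi> j} \<xi>) / real N"
proof -
  have \<xi>': "\<And>i. 0 \<le> fst (\<xi> i) \<and> 0 \<le> snd (\<xi> i)" using \<xi> by (simp add: less_imp_le)
  have "\<bar>avg f N r \<xi> - avg f N (\<lambda>_. 0) \<xi>\<bar> = \<bar>\<Sum>k<N. f (Y r \<xi> k) - f (Y (\<lambda>_. 0) \<xi> k)\<bar> / real N"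
    by (simp add: avg_def sum_subtractf diff_divide_distrib[symmetric])
  also have "\<dots> \<le> (\<Sum>k<N. \<bar>f (Y r \<xi> k) - f (Y (\<lambda>_. 0) \<xi> k)\<bar>) / real N"
    by (intro divide_right_mono sum_abs) simp
  also have "\<dots> \<le> (\<Sum>k<N. indicator {\<xi>. \<forall>j\<le>k. 0 < chain lstep (r 0) \<xi> j} \<xi>) / real N"
  proof (intro divide_right_mono sum_mono)
    fix k
    show "\<bar>f (Y r \<xi> k) - f (Y (\<lambda>_. 0) \<xi> k)\<bar> \<le> indicator {\<xi>. \<forall>j\<le>k. 0 < chain lstep (r 0) \<xi> j} \<xi>"
    proof (cases "\<forall>j\<le>k. 0 < chain lstep (r 0) \<xi> j")
      case True
      then show ?thesis using f[of "Y r \<xi> k"] f[of "Y (\<lambda>_. 0) \<xi> k"] by (simp add: abs_le_iff)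
    next
      case False
      then obtain j where "j \<le> k" "chain lstep (r 0) \<xi> j \<le> 0" by (auto simp: not_less)
      then have "Y r \<xi> k = Y (\<lambda>_. 0) \<xi> k" by (intro Y_coalesce(1)[OF r order_refl \<xi>'])
      then show ?thesis by simp
    qed
  qed simp
  finally show ?thesis .
qed

lemma integral_busy: "(LINT \<xi>|P. indicator {\<xi>. \<forall>j\<le>k. 0 < chain lstep l \<xi> j} \<xi>) = busy_prob l k"
  by (simp add: busy_prob_def)

lemma integral_sum_busy:
  "(LINT \<xi>|P. (\<Sum>k<N. indicator {\<xi>. \<forall>j\<le>k. 0 < chain lstep l \<xi> j} \<xi>) / real N) = (\<Sum>k<N. busy_prob l k) / real N"
  "integrable P (\<lambda>\<xi>. (\<Sum>k<N. indicator {\<xi>. \<forall>j\<le>k. 0 < chain lstep l \<xi> j} \<xi>) / real N :: real)"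
proof -
  have i: "integrable P (indicator {\<xi>. \<forall>j\<le>k. 0 < chain lstep l \<xi> j} :: _ \<Rightarrow> real)" for k
    by (rule integrable_real_indicator) (simp_all add: P.emeasure_eq_measure)
  show "(LINT \<xi>|P. (\<Sum>k<N. indicator {\<xi>. \<forall>j\<le>k. 0 < chain lstep l \<xi> j} \<xi>) / real N) = (\<Sum>k<N. busy_prob l k) / real N"
    by (subst integral_divide_zero, subst Bochner_Integration.integral_sum) (simp_all add: i integral_busy del: Bochner_Integration.integral_indicator)
  show "integrable P (\<lambda>\<xi>. (\<Sum>k<N. indicator {\<xi>. \<forall>j\<le>k. 0 < chain lstep l \<xi> j} \<xi>) / real N :: real)"
    by (intro integrable_divide Bochner_Integration.integrable_sum i)
qed

lemma integrable_P_bounded: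
  fixes h :: "_ \<Rightarrow> real"
  assumes "h \<in> borel_measurable P" "\<And>\<xi>. \<bar>h \<xi>\<bar> \<le> c"
  shows "integrable P h"
  by (rule P.integrable_const_bound[of _ c]) (use assms in auto)

lemma avg_dist_start:
  assumes f[measurable]: "f \<in> borel_measurable SQ" and f01: "\<And>r. 0 \<le> f r" "\<And>r. f r \<le> 1" and r: "good r"
  shows "(LINT \<xi>|P. \<bar>avg f N r \<xi> - avg f N (\<lambda>_. 0) \<xi>\<bar>) \<le> (\<Sum>k<N. busy_prob (r 0) k) / real N"
proof -
  have [measurable]: "(\<lambda>\<xi>. avg f N r \<xi>) \<in> borel_measurable P" for r
    by (rule measurable_avg[OF f]) simp_all
  have "integrable P (\<lambda>\<xi>. \<bar>avg f N r \<xi> - avg f N (\<lambda>_. 0) \<xi>\<bar>)"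
  proof (rule integrable_P_bounded[where c=1])
    show "\<bar>\<bar>avg f N r \<xi> - avg f N (\<lambda>_. 0) \<xi>\<bar>\<bar> \<le> 1" for \<xi>
      using avg_bounds[where f=f and N=N and r=r and \<xi>=\<xi>, OF f01]
        avg_bounds[where f=f and N=N and r="\<lambda>_. 0" and \<xi>=\<xi>, OF f01] by linarith
  qed measurable
  then have "(LINT \<xi>|P. \<bar>avg f N r \<xi> - avg f N (\<lambda>_. 0) \<xi>\<bar>)
     \<le> (LINT \<xi>|P. (\<Sum>k<N. indicator {\<xi>. \<forall>j\<le>k. 0 < chain lstep (r 0) \<xi> j} \<xi>) / real N)"
  proof (rule integral_mono_AE[OF _ integral_sum_busy(2)], use AE_P in eventually_elim)
    fix \<xi> :: "nat \<Rightarrow> real \<times> real" assume "\<forall>i. 0 < fst (\<xi> i) \<and> 0 \<le> snd (\<xi> i)"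
    then show "\<bar>avg f N r \<xi> - avg f N (\<lambda>_. 0) \<xi>\<bar>
      \<le> (\<Sum>k<N. indicator {\<xi>. \<forall>j\<le>k. 0 < chain lstep (r 0) \<xi> j} \<xi>) / real N"
      by (intro avg_coupled[OF f01 r]) blast
  qed
  then show ?thesis by (simp only: integral_sum_busy)
qed

end

context stationary_queue
begin

lemma nn_integral_\<pi>_step:
  assumes h[measurable]: "h \<in> borel_measurable SQ"
  shows "(\<integral>\<^sup>+r. (\<integral>\<^sup>+x. h (step r x) \<partial>\<nu>) \<partial>\<pi>) = (\<integral>\<^sup>+r. h r \<partial>\<pi>)"
proof -
  have st[measurable]: "(\<lambda>(r, x). step r x) \<in> \<pi> \<Otimes>\<^sub>M \<nu> \<rightarrow>\<^sub>M SQ"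
    unfolding case_prod_beta' by measurable
  have m: "(\<lambda>z. h (step (fst z) (snd z))) \<in> borel_measurable (\<pi> \<Otimes>\<^sub>M \<nu>)" by measurable
  have "(\<integral>\<^sup>+r. h r \<partial>\<pi>) = (\<integral>\<^sup>+r. h r \<partial>distr (\<pi> \<Otimes>\<^sub>M \<nu>) SQ (\<lambda>(r, x). step r x))"
    by (simp only: \<pi>_invariant)
  also have "\<dots> = (\<integral>\<^sup>+z. h (step (fst z) (snd z)) \<partial>(\<pi> \<Otimes>\<^sub>M \<nu>))"
    by (subst nn_integral_distr[OF st]) (simp_all add: case_prod_beta')
  also have "\<dots> = (\<integral>\<^sup>+r. (\<integral>\<^sup>+x. h (step r x) \<partial>\<nu>) \<partial>\<pi>)"
    using \<nu>.nn_integral_fst[OF m] by simp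
  finally show ?thesis by simp
qed

text \<open>Started from \<open>\<pi>\<close> the sequence of states is stationary, so two-dimensional laws only depend on the lag.\<close>

lemma nn_integral_lag:
  assumes h: "(\<lambda>(x, y). h x y) \<in> borel_measurable (SQ \<Otimes>\<^sub>M SQ)"
  shows "(\<integral>\<^sup>+r. (\<integral>\<^sup>+\<xi>. h (Y r \<xi> i) (Y r \<xi> (i + k)) \<partial>P) \<partial>\<pi>) = (\<integral>\<^sup>+r. (\<integral>\<^sup>+\<xi>. h r (Y r \<xi> k) \<partial>P) \<partial>\<pi>)"
proof (induction i)
  case 0
  show ?case by simp
next
  case (Suc i)
  have mY: "(\<lambda>y. h (Y (f y) (g y) i) (Y (f y) (g y) j)) \<in> borel_measurable N"
    if "f \<in> N \<rightarrow>\<^sub>M SQ" "g \<in> N \<rightarrow>\<^sub>M P" for f g and N :: "'z measure" and i j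
    using measurable_compose[OF measurable_Pair[OF measurable_Y[OF that] measurable_Y[OF that]] h] by simp
  have "(\<integral>\<^sup>+\<xi>. h (Y r \<xi> (Suc i)) (Y r \<xi> (Suc i + k)) \<partial>P)
      = (\<integral>\<^sup>+x. (\<integral>\<^sup>+\<xi>. h (Y (step r x) \<xi> i) (Y (step r x) \<xi> (i + k)) \<partial>P) \<partial>\<nu>)" for r
  proof -
    have "(\<lambda>\<xi>. h (Y r \<xi> (Suc i)) (Y r \<xi> (Suc i + k))) \<in> borel_measurable P"
      by (rule mY) simp_all
    then show ?thesis
      by (subst inp.nn_integral_first_step) (simp_all only: add_Suc chain_case_nat)
  qed
  moreover have "(\<lambda>r. \<integral>\<^sup>+\<xi>. h (Y r \<xi> i) (Y r \<xi> (i + k)) \<partial>P) \<in> borel_measurable SQ"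
    using P.borel_measurable_nn_integral[of "\<lambda>r \<xi>. h (Y r \<xi> i) (Y r \<xi> (i + k))" SQ]
      mY[of fst "SQ \<Otimes>\<^sub>M P" snd] by (simp add: case_prod_beta')
  ultimately show ?case
    using nn_integral_\<pi>_step[of "\<lambda>r. \<integral>\<^sup>+\<xi>. h (Y r \<xi> i) (Y r \<xi> (i + k)) \<partial>P"] Suc by simp
qed

text \<open>
  The chance that, from a stationary initial state, the queue has not been forced empty within \<open>k\<close> steps. It
  bounds all correlations at lag \<open>k\<close>.
\<close>

definition dec :: "nat \<Rightarrow> real" where
  "dec k = (LINT r|\<pi>. busy_prob (r 0) k)"

lemma measurable_busy_\<pi>: "(\<lambda>r. busy_prob (r 0) k) \<in> borel_measurable \<pi>"
  using measurable_compose[OF measurable_SQ_component measurable_busy_prob] by (simp add: measurable_cong_sets[OF sets_\<pi> refl])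

lemma dec_bounds: "0 \<le> dec k" "dec k \<le> 1"
proof -
  show "0 \<le> dec k" unfolding dec_def by (intro Bochner_Integration.integral_nonneg busy_prob_nonneg)
  have "dec k \<le> (LINT r|\<pi>. 1)" unfolding dec_def
    by (intro integral_mono \<pi>.integrable_const_bound[where B=1])
      (auto simp: busy_prob_le_1 busy_prob_nonneg measurable_busy_\<pi>)
  then show "dec k \<le> 1" by (simp add: \<pi>.prob_space[simplified])
qed

lemma dec_tendsto_0: "dec \<longlonglongrightarrow> 0"
proof -
  have "(\<lambda>k. LINT r|\<pi>. busy_prob (r 0) k) \<longlonglongrightarrow> (LINT r|\<pi>. 0)"
    by (rule integral_dominated_convergence[where w="\<lambda>_. 1"])
      (simp_all add: measurable_busy_\<pi> busy_prob_tendsto_0 busy_prob_le_1 busy_prob_nonneg)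
  then show ?thesis by (simp add: dec_def[abs_def])
qed

lemma integrable_\<pi>P_bounded:
  fixes h :: "_ \<Rightarrow> real"
  assumes "h \<in> borel_measurable (SQ \<Otimes>\<^sub>M P)" "\<And>z. \<bar>h z\<bar> \<le> c"
  shows "integrable (\<pi> \<Otimes>\<^sub>M P) h"
proof (rule \<pi>P.integrable_const_bound[of _ c])
  show "h \<in> borel_measurable (\<pi> \<Otimes>\<^sub>M P)"
    using assms(1) by (simp add: measurable_cong_sets[OF sets_pair_measure_cong[OF sets_\<pi> refl] refl])
qed (use assms in auto)

lemma AE_\<pi>P:
  assumes "AE r in \<pi>. Q r"
  shows "AE z in \<pi> \<Otimes>\<^sub>M P. Q (fst z) \<and> (\<forall>i. 0 < fst (snd z i) \<and> 0 \<le> snd (snd z i))"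
proof -
  have 1: "distr (\<pi> \<Otimes>\<^sub>M P) \<pi> fst = \<pi>" by (rule P.distr_pair_fst)
  have "AE r in distr (\<pi> \<Otimes>\<^sub>M P) \<pi> fst. Q r" unfolding 1 by (fact assms)
  then have "AE z in \<pi> \<Otimes>\<^sub>M P. Q (fst z)" by (rule AE_distrD[OF measurable_fst])
  moreover have 2: "distr (\<pi> \<Otimes>\<^sub>M P) P snd = P"
  proof (rule measure_eqI)
    fix A assume "A \<in> sets (distr (\<pi> \<Otimes>\<^sub>M P) P snd)"
    then have A: "A \<in> sets P" by simp
    have "snd -` A \<inter> space (\<pi> \<Otimes>\<^sub>M P) = space \<pi> \<times> A" by (auto simp: space_pair_measure)
    then show "emeasure (distr (\<pi> \<Otimes>\<^sub>M P) P snd) A = emeasure P A"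
      using P.emeasure_pair_measure_Times[of "space \<pi>" \<pi> A] A \<pi>.emeasure_space_1 sets.top[of \<pi>] by (simp add: emeasure_distr)
  qed simp
  have "AE \<xi> in distr (\<pi> \<Otimes>\<^sub>M P) P snd. \<forall>i. 0 < fst (\<xi> i) \<and> 0 \<le> snd (\<xi> i)" unfolding 2 by (rule AE_P)
  then have "AE z in \<pi> \<Otimes>\<^sub>M P. \<forall>i. 0 < fst (snd z i) \<and> 0 \<le> snd (snd z i)" by (rule AE_distrD[OF measurable_snd])
  ultimately show ?thesis by eventually_elim simp
qed

lemma integral_busy_\<pi>P:
  "(LINT z|(\<pi> \<Otimes>\<^sub>M P). indicator {\<xi>. \<forall>j\<le>k. 0 < chain lstep (fst z 0) \<xi> j} (snd z)) = dec k"
  "integrable (\<pi> \<Otimes>\<^sub>M P) (\<lambda>z. indicator {\<xi>. \<forall>j\<le>k. 0 < chain lstep (fst z 0) \<xi> j} (snd z) :: real)"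
proof -
  have [measurable]: "(\<lambda>z. fst z 0) \<in> borel_measurable (SQ \<Otimes>\<^sub>M P)"
    by (rule measurable_compose[OF measurable_fst measurable_SQ_component])
  have "(\<lambda>z. if \<forall>j\<le>k. 0 < chain lstep (fst z 0) (snd z) j then 1 else 0 :: real) \<in> borel_measurable (SQ \<Otimes>\<^sub>M P)"
    by measurable
  also have "(\<lambda>z. if \<forall>j\<le>k. 0 < chain lstep (fst z 0) (snd z) j then 1 else 0 :: real)
      = (\<lambda>z. indicator {\<xi>. \<forall>j\<le>k. 0 < chain lstep (fst z 0) \<xi> j} (snd z))"
    by (auto simp: fun_eq_iff)
  finally show i: "integrable (\<pi> \<Otimes>\<^sub>M P) (\<lambda>z. indicator {\<xi>. \<forall>j\<le>k. 0 < chain lstep (fst z 0) \<xi> j} (snd z) :: real)"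
    by (rule integrable_\<pi>P_bounded[where c=1]) (simp add: indicator_def)
  show "(LINT z|(\<pi> \<Otimes>\<^sub>M P). indicator {\<xi>. \<forall>j\<le>k. 0 < chain lstep (fst z 0) \<xi> j} (snd z)) = dec k"
    using \<pi>P.integral_fst'[OF i] by (simp add: dec_def busy_prob_def)
qed

text \<open>
  Unless the dominating chain has stayed positive, the state at lag \<open>k\<close> is that of the copy started empty, which is
  independent of the initial state. One \<open>dec k\<close> is for this replacement in the product, one for the mean.
\<close>

lemma covariance_bound:
  fixes f :: "(nat \<Rightarrow> real) \<Rightarrow> real"
  assumes f[measurable]: "f \<in> borel_measurable SQ" and f01: "\<And>r. 0 \<le> f r" "\<And>r. f r \<le> 1"
  defines "m \<equiv> (LINT r|\<pi>. f r)"
  shows "(LINT z|(\<pi> \<Otimes>\<^sub>M P). f (Y (fst z) (snd z) i)) = m"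
    and "\<bar>(LINT z|(\<pi> \<Otimes>\<^sub>M P). f (Y (fst z) (snd z) i) * f (Y (fst z) (snd z) (i + k))) - m\<^sup>2\<bar> \<le> 2 * dec k"
proof -
  have ab: "\<bar>f r\<bar> \<le> 1" for r using f01[of r] by simp
  have int: "integrable (\<pi> \<Otimes>\<^sub>M P) (\<lambda>z. f (Y (fst z) (snd z) i))"
    and int2: "integrable (\<pi> \<Otimes>\<^sub>M P) (\<lambda>z. f (Y (fst z) (snd z) i) * f (Y (fst z) (snd z) j))"
    and int3: "integrable (\<pi> \<Otimes>\<^sub>M P) (\<lambda>z. f (Y (\<lambda>_. 0) (snd z) j))"
    and int4: "integrable (\<pi> \<Otimes>\<^sub>M P) (\<lambda>z. f (fst z) * f (Y (\<lambda>_. 0) (snd z) j))" for i j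
    by (rule integrable_\<pi>P_bounded[where c=1], measurable, simp add: ab abs_mult mult_le_one)+
  have nn: "(LINT z|(\<pi> \<Otimes>\<^sub>M P). h (fst z) (snd z)) = enn2real (\<integral>\<^sup>+r. (\<integral>\<^sup>+\<xi>. ennreal (h r \<xi>) \<partial>P) \<partial>\<pi>)"
    if "(\<lambda>z. h (fst z) (snd z)) \<in> borel_measurable (SQ \<Otimes>\<^sub>M P)" "\<And>r \<xi>. 0 \<le> h r \<xi>" for h :: "_ \<Rightarrow> _ \<Rightarrow> real"
  proof -
    have m: "(\<lambda>z. h (fst z) (snd z)) \<in> borel_measurable (\<pi> \<Otimes>\<^sub>M P)"
      using that(1) by (simp add: measurable_cong_sets[OF sets_pair_measure_cong[OF sets_\<pi> refl] refl])
    have m': "(\<lambda>z. ennreal (h (fst z) (snd z))) \<in> borel_measurable (\<pi> \<Otimes>\<^sub>M P)" using m by measurable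
    show ?thesis using that(2) P.nn_integral_fst[OF m'] by (simp add: integral_eq_nn_integral[OF m])
  qed
  have h1: "(\<lambda>(x, y). ennreal (f x)) \<in> borel_measurable (SQ \<Otimes>\<^sub>M SQ)"
    and h2: "(\<lambda>(x, y). ennreal (f x * f y)) \<in> borel_measurable (SQ \<Otimes>\<^sub>M SQ)" by measurable
  show mean: "(LINT z|(\<pi> \<Otimes>\<^sub>M P). f (Y (fst z) (snd z) i)) = m" for i
  proof -
    have "(LINT z|(\<pi> \<Otimes>\<^sub>M P). f (Y (fst z) (snd z) i)) = enn2real (\<integral>\<^sup>+r. (\<integral>\<^sup>+\<xi>. ennreal (f (Y r \<xi> i)) \<partial>P) \<partial>\<pi>)"
      by (rule nn) (measurable, rule f01)
    also have "\<dots> = enn2real (\<integral>\<^sup>+r. ennreal (f r) \<partial>\<pi>)"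
      using nn_integral_lag[where h="\<lambda>x y. ennreal (f x)" and i=i and k=0, OF h1] P.emeasure_space_1 by simp
    also have "\<dots> = m" unfolding m_def
      by (subst integral_eq_nn_integral) (auto simp: f01 measurable_cong_sets[OF sets_\<pi> refl])
    finally show ?thesis .
  qed
  define J where "J z = (indicator {\<xi>. \<forall>j\<le>k. 0 < chain lstep (fst z 0) \<xi> j} (snd z) :: real)" for z :: "(nat \<Rightarrow> real) \<times> (nat \<Rightarrow> real \<times> real)"
  have J: "integrable (\<pi> \<Otimes>\<^sub>M P) J" "(LINT z|(\<pi> \<Otimes>\<^sub>M P). J z) = dec k"
    unfolding J_def by (rule integral_busy_\<pi>P)+
  have close: "AE z in \<pi> \<Otimes>\<^sub>M P. \<bar>f (Y (fst z) (snd z) k) - f (Y (\<lambda>_. 0) (snd z) k)\<bar> \<le> J z"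
    using AE_\<pi>P[OF AE_\<pi>_good]
  proof eventually_elim
    fix z :: "(nat \<Rightarrow> real) \<times> (nat \<Rightarrow> real \<times> real)"
    assume z: "good (fst z) \<and> (\<forall>i. 0 < fst (snd z i) \<and> 0 \<le> snd (snd z i))"
    show "\<bar>f (Y (fst z) (snd z) k) - f (Y (\<lambda>_. 0) (snd z) k)\<bar> \<le> J z"
    proof (cases "J z = 0")
      case True
      then obtain j where j: "j \<le> k" "chain lstep (fst z 0) (snd z) j \<le> 0"
        by (auto simp: J_def indicator_def not_less split: if_splits)
      have "Y (fst z) (snd z) k = Y (\<lambda>_. 0) (snd z) k"
        by (rule Y_coalesce(1)[where l="fst z 0" and j=j]) (use z j in \<open>simp_all add: less_imp_le\<close>)
      then show ?thesis using True by simp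
    next
      case False
      then have "J z = 1" by (simp add: J_def indicator_def split: if_splits)
      then show ?thesis using f01[of "Y (fst z) (snd z) k"] f01[of "Y (\<lambda>_. 0) (snd z) k"] by (simp add: abs_le_iff)
    qed
  qed
  let ?E = "\<lambda>h. LINT z|(\<pi> \<Otimes>\<^sub>M P). h z"
  have d1: "\<bar>?E (\<lambda>z. f (Y (fst z) (snd z) k)) - ?E (\<lambda>z. f (Y (\<lambda>_. 0) (snd z) k))\<bar> \<le> dec k"
  proof -
    have "\<bar>?E (\<lambda>z. f (Y (fst z) (snd z) k)) - ?E (\<lambda>z. f (Y (\<lambda>_. 0) (snd z) k))\<bar>
      = \<bar>?E (\<lambda>z. f (Y (fst z) (snd z) k) - f (Y (\<lambda>_. 0) (snd z) k))\<bar>"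
      by (subst Bochner_Integration.integral_diff[OF int int3]) simp
    also have "\<dots> \<le> ?E (\<lambda>z. \<bar>f (Y (fst z) (snd z) k) - f (Y (\<lambda>_. 0) (snd z) k)\<bar>)"
      by (rule integral_abs_bound)
    also have "\<dots> \<le> ?E J"
      by (rule integral_mono_AE[OF _ J(1) close]) (intro integrable_abs Bochner_Integration.integrable_diff int int3)
    finally show ?thesis by (simp add: J)
  qed
  have d2: "\<bar>?E (\<lambda>z. f (fst z) * f (Y (fst z) (snd z) k)) - ?E (\<lambda>z. f (fst z) * f (Y (\<lambda>_. 0) (snd z) k))\<bar> \<le> dec k"
  proof -
    have i2: "integrable (\<pi> \<Otimes>\<^sub>M P) (\<lambda>z. f (fst z) * f (Y (fst z) (snd z) k))" using int2[of 0 k] by simp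
    have "\<bar>?E (\<lambda>z. f (fst z) * f (Y (fst z) (snd z) k)) - ?E (\<lambda>z. f (fst z) * f (Y (\<lambda>_. 0) (snd z) k))\<bar>
      = \<bar>?E (\<lambda>z. f (fst z) * f (Y (fst z) (snd z) k) - f (fst z) * f (Y (\<lambda>_. 0) (snd z) k))\<bar>"
      by (subst Bochner_Integration.integral_diff[OF i2 int4]) simp
    also have "\<dots> \<le> ?E (\<lambda>z. \<bar>f (fst z) * f (Y (fst z) (snd z) k) - f (fst z) * f (Y (\<lambda>_. 0) (snd z) k)\<bar>)"
      by (rule integral_abs_bound)
    also have "\<dots> \<le> ?E J"
    proof (rule integral_mono_AE[OF _ J(1)])
      show "integrable (\<pi> \<Otimes>\<^sub>M P) (\<lambda>z. \<bar>f (fst z) * f (Y (fst z) (snd z) k) - f (fst z) * f (Y (\<lambda>_. 0) (snd z) k)\<bar>)"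
        by (intro integrable_abs Bochner_Integration.integrable_diff i2 int4)
      show "AE z in \<pi> \<Otimes>\<^sub>M P. \<bar>f (fst z) * f (Y (fst z) (snd z) k) - f (fst z) * f (Y (\<lambda>_. 0) (snd z) k)\<bar> \<le> J z"
        using close
      proof eventually_elim
        fix z assume c: "\<bar>f (Y (fst z) (snd z) k) - f (Y (\<lambda>_. 0) (snd z) k)\<bar> \<le> J z"
        have "\<bar>f (fst z) * f (Y (fst z) (snd z) k) - f (fst z) * f (Y (\<lambda>_. 0) (snd z) k)\<bar>
          = \<bar>f (fst z)\<bar> * \<bar>f (Y (fst z) (snd z) k) - f (Y (\<lambda>_. 0) (snd z) k)\<bar>"
          by (simp add: abs_mult[symmetric] right_diff_distrib)
        also have "\<dots> \<le> 1 * J z" by (intro mult_mono ab c) auto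
        finally show "\<bar>f (fst z) * f (Y (fst z) (snd z) k) - f (fst z) * f (Y (\<lambda>_. 0) (snd z) k)\<bar> \<le> J z" by simp
      qed
    qed
    finally show ?thesis by (simp add: J)
  qed
  define w where "w = (LINT \<xi>|P. f (Y (\<lambda>_. 0) \<xi> k))"
  have p1: "?E (\<lambda>z. f (Y (\<lambda>_. 0) (snd z) k)) = w"
    using \<pi>P.integral_fst'[OF int3[of k]] by (simp add: w_def \<pi>.prob_space[simplified])
  have p2: "?E (\<lambda>z. f (fst z) * f (Y (\<lambda>_. 0) (snd z) k)) = m * w"
    using \<pi>P.integral_fst'[OF int4[of k]] by (simp add: w_def m_def)
  have m01: "0 \<le> m" "m \<le> 1"
  proof -
    show "0 \<le> m" unfolding m_def by (intro Bochner_Integration.integral_nonneg f01)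
    have "m \<le> (LINT r|\<pi>. 1)" unfolding m_def
      by (intro integral_mono \<pi>.integrable_const_bound[where B=1]) (auto simp: f01 ab measurable_cong_sets[OF sets_\<pi> refl])
    then show "m \<le> 1" by (simp add: \<pi>.prob_space[simplified])
  qed
  have "\<bar>m * w - m\<^sup>2\<bar> \<le> dec k"
  proof -
    have "m * w - m\<^sup>2 = m * (w - m)" by (simp add: power2_eq_square algebra_simps)
    then have "\<bar>m * w - m\<^sup>2\<bar> = m * \<bar>m - w\<bar>" using m01 by (simp add: abs_mult abs_minus_commute)
    also have "\<dots> \<le> 1 * \<bar>m - w\<bar>" using m01 by (intro mult_right_mono) auto
    finally show ?thesis using d1 by (simp add: mean p1)
  qed
  moreover have "\<bar>?E (\<lambda>z. f (fst z) * f (Y (fst z) (snd z) k)) - m * w\<bar> \<le> dec k" using d2 by (simp add: p2)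
  moreover have "?E (\<lambda>z. f (Y (fst z) (snd z) i) * f (Y (fst z) (snd z) (i + k))) = ?E (\<lambda>z. f (fst z) * f (Y (fst z) (snd z) k))"
  proof -
    have "?E (\<lambda>z. f (Y (fst z) (snd z) i) * f (Y (fst z) (snd z) (i + k)))
       = enn2real (\<integral>\<^sup>+r. (\<integral>\<^sup>+\<xi>. ennreal (f (Y r \<xi> i) * f (Y r \<xi> (i + k))) \<partial>P) \<partial>\<pi>)"
      by (rule nn) (measurable, simp add: f01)
    also have "\<dots> = enn2real (\<integral>\<^sup>+r. (\<integral>\<^sup>+\<xi>. ennreal (f r * f (Y r \<xi> k)) \<partial>P) \<partial>\<pi>)"
      using nn_integral_lag[OF h2, of i k] by simp
    also have "\<dots> = ?E (\<lambda>z. f (fst z) * f (Y (fst z) (snd z) k))"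
      by (rule nn[symmetric]) (measurable, simp add: f01)
    finally show ?thesis .
  qed
  ultimately show "\<bar>?E (\<lambda>z. f (Y (fst z) (snd z) i) * f (Y (fst z) (snd z) (i + k))) - m\<^sup>2\<bar> \<le> 2 * dec k"
    by linarith
qed

text \<open>
  The variance of a stationary average is a double sum of covariances, bounded by a Cesaro mean of \<open>dec\<close>.
\<close>

lemma avg_dist_stationary:
  fixes f :: "(nat \<Rightarrow> real) \<Rightarrow> real"
  assumes f[measurable]: "f \<in> borel_measurable SQ" and f01: "\<And>r. 0 \<le> f r" "\<And>r. f r \<le> 1" and N: "0 < N"
  defines "m \<equiv> (LINT r|\<pi>. f r)"
  shows "(LINT z|(\<pi> \<Otimes>\<^sub>M P). \<bar>avg f N (fst z) (snd z) - m\<bar>) \<le> sqrt (4 * ((\<Sum>k<N. dec k) / real N))"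
proof -
  let ?E = "\<lambda>h. LINT z|(\<pi> \<Otimes>\<^sub>M P). h z"
  define X where "X i z = f (Y (fst z) (snd z) i)" for i and z :: "(nat \<Rightarrow> real) \<times> (nat \<Rightarrow> real \<times> real)"
  have ab: "\<bar>f r\<bar> \<le> 1" for r using f01[of r] by simp
  have mX[measurable]: "X i \<in> borel_measurable (SQ \<Otimes>\<^sub>M P)" for i unfolding X_def by measurable
  have iX: "integrable (\<pi> \<Otimes>\<^sub>M P) (X i)" for i
    by (rule integrable_\<pi>P_bounded[where c=1]) (simp_all add: X_def ab)
  have iXX: "integrable (\<pi> \<Otimes>\<^sub>M P) (\<lambda>z. X i z * X j z)" for i j
    by (rule integrable_\<pi>P_bounded[where c=1]) (simp_all add: X_def ab abs_mult mult_le_one)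
  have EX: "?E (X i) = m" for i
    unfolding X_def m_def by (rule covariance_bound(1)[OF f f01])
  have cov: "?E (\<lambda>z. X i z * X j z) - m\<^sup>2 \<le> 2 * dec (if j \<le> i then i - j else j - i)" for i j
  proof (cases "j \<le> i")
    case True
    then show ?thesis using covariance_bound(2)[OF f f01, of j "i - j"]
      by (simp add: X_def m_def mult.commute abs_le_iff)
  next
    case False
    then show ?thesis using covariance_bound(2)[OF f f01, of i "j - i"]
      by (simp add: X_def m_def abs_le_iff)
  qed
  define W where "W z = avg f N (fst z) (snd z) - m" for z
  have W: "W z = (\<Sum>i<N. X i z - m) / real N" for z
    using N by (simp add: W_def avg_def X_def sum_subtractf field_simps)
  have m01: "0 \<le> m" "m \<le> 1"
  proof -
    show "0 \<le> m" unfolding m_def by (intro Bochner_Integration.integral_nonneg f01)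
    have "m \<le> (LINT r|\<pi>. 1)" unfolding m_def
      by (intro integral_mono \<pi>.integrable_const_bound[where B=1]) (auto simp: f01 ab measurable_cong_sets[OF sets_\<pi> refl])
    then show "m \<le> 1" by (simp add: \<pi>.prob_space[simplified])
  qed
  have W1: "\<bar>W z\<bar> \<le> 1" for z
    using avg_bounds[where f=f and N=N and r="fst z" and \<xi>="snd z", OF f01] m01 by (simp add: W_def abs_le_iff)
  have mW[measurable]: "W \<in> borel_measurable (SQ \<Otimes>\<^sub>M P)" unfolding W by measurable
  have iW: "integrable (\<pi> \<Otimes>\<^sub>M P) (\<lambda>z. \<bar>W z\<bar>)" "integrable (\<pi> \<Otimes>\<^sub>M P) (\<lambda>z. \<bar>W z\<bar>\<^sup>2)"
    by (rule integrable_\<pi>P_bounded[where c=1]; simp add: W1 abs_square_le_1)+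
  have W2: "(W z)\<^sup>2 = (\<Sum>i<N. \<Sum>j<N. X i z * X j z - m * X i z - m * X j z + m\<^sup>2) / (real N)\<^sup>2" for z
  proof -
    have "(\<Sum>i<N. X i z - m)\<^sup>2 = (\<Sum>i<N. \<Sum>j<N. (X i z - m) * (X j z - m))"
      by (simp add: power2_eq_square sum_product)
    also have "\<dots> = (\<Sum>i<N. \<Sum>j<N. X i z * X j z - m * X i z - m * X j z + m\<^sup>2)"
      by (intro sum.cong refl) (simp add: algebra_simps power2_eq_square)
    finally show ?thesis by (simp add: W power_divide)
  qed
  have iT: "integrable (\<pi> \<Otimes>\<^sub>M P) (\<lambda>z. X i z * X j z - m * X i z - m * X j z + m\<^sup>2)" for i j
    by (intro Bochner_Integration.integrable_add Bochner_Integration.integrable_diff iXX integrable_mult_right iX) simp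
  have "?E (\<lambda>z. (W z)\<^sup>2) = (\<Sum>i<N. \<Sum>j<N. ?E (\<lambda>z. X i z * X j z - m * X i z - m * X j z + m\<^sup>2)) / (real N)\<^sup>2"
    unfolding W2 by (simp add: Bochner_Integration.integral_sum Bochner_Integration.integrable_sum iT)
  also have "\<dots> = (\<Sum>i<N. \<Sum>j<N. ?E (\<lambda>z. X i z * X j z) - m\<^sup>2) / (real N)\<^sup>2"
  proof -
    have "?E (\<lambda>z. X i z * X j z - m * X i z - m * X j z + m\<^sup>2) = ?E (\<lambda>z. X i z * X j z) - m\<^sup>2" for i j
    proof -
      have c: "?E (\<lambda>z. m\<^sup>2) = m\<^sup>2" using \<pi>P.prob_space by simp
      have "?E (\<lambda>z. X i z * X j z - m * X i z - m * X j z + m\<^sup>2)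
          = ?E (\<lambda>z. X i z * X j z) - m * ?E (X i) - m * ?E (X j) + ?E (\<lambda>z. m\<^sup>2)"
        by (simp add: iXX iX)
      then show ?thesis unfolding c EX by (simp add: power2_eq_square)
    qed
    then show ?thesis by simp
  qed
  also have "\<dots> \<le> (\<Sum>i<N. \<Sum>j<N. 2 * dec (if j \<le> i then i - j else j - i)) / (real N)\<^sup>2"
    by (intro divide_right_mono sum_mono cov) simp
  also have "\<dots> = 2 * (\<Sum>i<N. \<Sum>j<N. dec (if j \<le> i then i - j else j - i)) / (real N)\<^sup>2"
    by (simp add: sum_distrib_left)
  also have "\<dots> \<le> 2 * (\<Sum>i<N. 2 * (\<Sum>k<N. dec k)) / (real N)\<^sup>2"
    by (intro divide_right_mono mult_left_mono sum_mono sum_gap_le dec_bounds) auto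
  also have "\<dots> = 4 * ((\<Sum>k<N. dec k) / real N)"
    using N by (simp add: power2_eq_square)
  finally have E2: "?E (\<lambda>z. \<bar>W z\<bar>\<^sup>2) \<le> 4 * ((\<Sum>k<N. dec k) / real N)" by simp
  have "0 \<le> \<pi>P.variance (\<lambda>z. \<bar>W z\<bar>)" by (rule \<pi>P.variance_positive)
  then have "(?E (\<lambda>z. \<bar>W z\<bar>))\<^sup>2 \<le> ?E (\<lambda>z. \<bar>W z\<bar>\<^sup>2)"
    using \<pi>P.variance_eq[OF iW] by simp
  with E2 have "(?E (\<lambda>z. \<bar>W z\<bar>))\<^sup>2 \<le> 4 * ((\<Sum>k<N. dec k) / real N)" by simp
  then show ?thesis unfolding W_def by (rule real_le_rsqrt)
qed

definition lln_err :: "(nat \<Rightarrow> real) \<Rightarrow> nat \<Rightarrow> real" where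
  "lln_err r N = (\<Sum>k<N. busy_prob (r 0) k) / real N + (\<Sum>k<N. dec k) / real N + sqrt (4 * ((\<Sum>k<N. dec k) / real N))"

lemma lln_err_tendsto_0: "lln_err r \<longlonglongrightarrow> 0"
proof -
  have d: "(\<lambda>N. (\<Sum>k<N. dec k) / real N) \<longlonglongrightarrow> 0"
    by (rule cesaro_tendsto_0[OF dec_tendsto_0 dec_bounds])
  have "(\<lambda>N. (\<Sum>k<N. busy_prob (r 0) k) / real N + (\<Sum>k<N. dec k) / real N + sqrt (4 * ((\<Sum>k<N. dec k) / real N)))
      \<longlonglongrightarrow> 0 + 0 + sqrt (4 * 0)"
    by (intro tendsto_intros d cesaro_tendsto_0 busy_prob_tendsto_0 busy_prob_nonneg busy_prob_le_1)
  then show ?thesis by (simp add: lln_err_def[abs_def])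
qed

text \<open>
  Law of large numbers in mean, from any initial state. The rate does not depend on the observable \<open>f\<close>,
  so that \<open>f\<close> may vary with \<open>N\<close>: its terms bound the passage from \<open>y\<close> to the empty state, from there to a
  stationary initial state, and the stationary fluctuations.
\<close>

lemma law_of_large_numbers:
  fixes f :: "(nat \<Rightarrow> real) \<Rightarrow> real"
  assumes f[measurable]: "f \<in> borel_measurable SQ" and f01: "\<And>r. 0 \<le> f r" "\<And>r. f r \<le> 1" and N: "0 < N" and y: "good y"
  shows "(LINT \<xi>|P. \<bar>avg f N y \<xi> - (LINT r|\<pi>. f r)\<bar>) \<le> lln_err y N"
proof -
  define m where "m = (LINT r|\<pi>. f r)"
  have m01: "0 \<le> m" "m \<le> 1"
  proof -
    show "0 \<le> m" unfolding m_def by (intro Bochner_Integration.integral_nonneg f01)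
    have "m \<le> (LINT r|\<pi>. 1)" unfolding m_def
      by (intro integral_mono \<pi>.integrable_const_bound[where B=1]) (auto simp: f01 measurable_cong_sets[OF sets_\<pi> refl])
    then show "m \<le> 1" by (simp add: \<pi>.prob_space[simplified])
  qed
  define Z0 where "Z0 = (\<lambda>_::nat. 0::real)"
  let ?E = "\<lambda>h. LINT z|(\<pi> \<Otimes>\<^sub>M P). h z"
  have bd: "0 \<le> avg f N r \<xi> \<and> avg f N r \<xi> \<le> 1" for r \<xi>
    using avg_bounds[where f=f and N=N, OF f01] by simp
  have [measurable]: "(\<lambda>\<xi>. avg f N r \<xi>) \<in> borel_measurable P" for r
    by (rule measurable_avg[OF f]) simp_all
  have [measurable]: "(\<lambda>z. avg f N (fst z) (snd z)) \<in> borel_measurable (SQ \<Otimes>\<^sub>M P)"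
    "(\<lambda>z. avg f N r (snd z)) \<in> borel_measurable (SQ \<Otimes>\<^sub>M P)" for r
    by (rule measurable_avg[OF f]; simp)+
  have b1: "\<bar>avg f N r \<xi> - m\<bar> \<le> 1" "\<bar>avg f N r \<xi> - avg f N r' \<xi>\<bar> \<le> 1" for r r' \<xi>
    using bd[of r \<xi>] bd[of r' \<xi>] m01 by (auto simp: abs_le_iff)
  have i1: "integrable P (\<lambda>\<xi>. \<bar>avg f N r \<xi> - m\<bar>)" "integrable P (\<lambda>\<xi>. \<bar>avg f N r \<xi> - avg f N r' \<xi>\<bar>)" for r r'
    by (rule integrable_P_bounded[where c=1]; simp add: b1)+
  have i2: "integrable (\<pi> \<Otimes>\<^sub>M P) (\<lambda>z. \<bar>avg f N (fst z) (snd z) - m\<bar>)"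
    "integrable (\<pi> \<Otimes>\<^sub>M P) (\<lambda>z. \<bar>avg f N Z0 (snd z) - m\<bar>)"
    "integrable (\<pi> \<Otimes>\<^sub>M P) (\<lambda>z. \<bar>avg f N (fst z) (snd z) - avg f N Z0 (snd z)\<bar>)"
    by (rule integrable_\<pi>P_bounded[where c=1]; simp add: b1)+
  have "(LINT \<xi>|P. \<bar>avg f N y \<xi> - m\<bar>) \<le> (LINT \<xi>|P. \<bar>avg f N y \<xi> - avg f N Z0 \<xi>\<bar> + \<bar>avg f N Z0 \<xi> - m\<bar>)"
    by (intro integral_mono Bochner_Integration.integrable_add i1) linarith
  also have "\<dots> = (LINT \<xi>|P. \<bar>avg f N y \<xi> - avg f N Z0 \<xi>\<bar>) + (LINT \<xi>|P. \<bar>avg f N Z0 \<xi> - m\<bar>)"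
    by (rule Bochner_Integration.integral_add[OF i1(2) i1(1)])
  also have "(LINT \<xi>|P. \<bar>avg f N y \<xi> - avg f N Z0 \<xi>\<bar>) \<le> (\<Sum>k<N. busy_prob (y 0) k) / real N"
    unfolding Z0_def by (rule avg_dist_start[OF f f01 y])
  also have "(LINT \<xi>|P. \<bar>avg f N Z0 \<xi> - m\<bar>) = ?E (\<lambda>z. \<bar>avg f N Z0 (snd z) - m\<bar>)"
    using \<pi>P.integral_fst'[OF i2(2)] by (simp add: \<pi>.prob_space[simplified])
  also have "\<dots> \<le> ?E (\<lambda>z. \<bar>avg f N (fst z) (snd z) - avg f N Z0 (snd z)\<bar> + \<bar>avg f N (fst z) (snd z) - m\<bar>)"
    by (intro integral_mono Bochner_Integration.integrable_add i2) linarith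
  also have "\<dots> = ?E (\<lambda>z. \<bar>avg f N (fst z) (snd z) - avg f N Z0 (snd z)\<bar>) + ?E (\<lambda>z. \<bar>avg f N (fst z) (snd z) - m\<bar>)"
    by (rule Bochner_Integration.integral_add[OF i2(3) i2(1)])
  also have "?E (\<lambda>z. \<bar>avg f N (fst z) (snd z) - m\<bar>) \<le> sqrt (4 * ((\<Sum>k<N. dec k) / real N))"
    unfolding m_def by (rule avg_dist_stationary[OF f f01 N])
  also have "?E (\<lambda>z. \<bar>avg f N (fst z) (snd z) - avg f N Z0 (snd z)\<bar>) \<le> (\<Sum>k<N. dec k) / real N"
  proof -
    let ?S = "\<lambda>r. (\<Sum>k<N. busy_prob (r 0) k) / real N"
    have iS: "integrable \<pi> (\<lambda>r. busy_prob (r 0) k)" for k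
      by (rule \<pi>.integrable_const_bound[where B=1]) (auto simp: busy_prob_le_1 busy_prob_nonneg measurable_busy_\<pi>)
    have "?E (\<lambda>z. \<bar>avg f N (fst z) (snd z) - avg f N Z0 (snd z)\<bar>) = (LINT r|\<pi>. (LINT \<xi>|P. \<bar>avg f N r \<xi> - avg f N Z0 \<xi>\<bar>))"
      using \<pi>P.integral_fst'[OF i2(3)] by simp
    also have "\<dots> \<le> (LINT r|\<pi>. ?S r)"
    proof (rule integral_mono_AE)
      show "integrable \<pi> (\<lambda>r. LINT \<xi>|P. \<bar>avg f N r \<xi> - avg f N Z0 \<xi>\<bar>)"
        using \<pi>P.integrable_fst'[OF i2(3)] by simp
      show "integrable \<pi> ?S" by (intro integrable_divide Bochner_Integration.integrable_sum iS)
      show "AE r in \<pi>. (LINT \<xi>|P. \<bar>avg f N r \<xi> - avg f N Z0 \<xi>\<bar>) \<le> ?S r"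
        using AE_\<pi>_good by eventually_elim (unfold Z0_def, rule avg_dist_start[OF f f01])
    qed
    also have "\<dots> = (\<Sum>k<N. dec k) / real N"
      by (simp add: dec_def Bochner_Integration.integral_sum iS)
    finally show ?thesis .
  qed
  finally show ?thesis by (simp add: lln_err_def m_def)
qed

lemma lln_prob:
  fixes f :: "(nat \<Rightarrow> real) \<Rightarrow> real"
  assumes f[measurable]: "f \<in> borel_measurable SQ" and f01: "\<And>r. 0 \<le> f r" "\<And>r. f r \<le> 1" and N: "0 < N" and y: "good y"
    and e: "0 < e"
  shows "P.prob {\<xi>. e \<le> \<bar>avg f N y \<xi> - (LINT r|\<pi>. f r)\<bar>} \<le> lln_err y N / e"
proof -
  let ?m = "LINT r|\<pi>. f r"
  have [measurable]: "(\<lambda>\<xi>. avg f N y \<xi>) \<in> borel_measurable P"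
    by (rule measurable_avg[OF f]) simp_all
  have i: "integrable P (\<lambda>\<xi>. \<bar>avg f N y \<xi> - ?m\<bar>)"
  proof (rule integrable_P_bounded[where c="1 + \<bar>?m\<bar>"])
    fix \<xi> show "\<bar>\<bar>avg f N y \<xi> - ?m\<bar>\<bar> \<le> 1 + \<bar>?m\<bar>"
      using avg_bounds[where f=f and N=N and r=y and \<xi>=\<xi>, OF f01] by linarith
  qed measurable
  have "P.prob {\<xi>\<in>space P. e \<le> \<bar>avg f N y \<xi> - ?m\<bar>} \<le> (LINT \<xi>|P. \<bar>avg f N y \<xi> - ?m\<bar>) / e"
    by (rule integral_Markov_inequality_measure[OF i]) (use e in auto)
  also have "\<dots> \<le> lln_err y N / e"
    using law_of_large_numbers[OF f f01 N y] e by (simp add: divide_right_mono)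
  finally show ?thesis by simp
qed

end

section \<open>Hitting a small window below the patience level\<close>

lemma abs_exp_minus_diff_le:
  fixes x y :: real
  assumes "0 \<le> x" "0 \<le> y"
  shows "\<bar>exp (- x) - exp (- y)\<bar> \<le> \<bar>x - y\<bar>"
proof -
  have *: "exp (- x) - exp (- y) \<le> y - x \<and> 0 \<le> exp (- x) - exp (- y)" if "0 \<le> x" "x \<le> y" for x y :: real
  proof -
    have "exp (- x) - exp (- y) = exp (- x) * (1 - exp (- (y - x)))"
      by (simp add: right_diff_distrib exp_add[symmetric])
    also have "\<dots> \<le> 1 * (y - x)"
    proof (rule mult_mono)
      show "1 - exp (- (y - x)) \<le> y - x" using exp_ge_add_one_self[of "- (y - x)"] by linarith
    qed (use that in auto)
    finally show ?thesis using that by simp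
  qed
  show ?thesis using *[of x y] *[of y x] assms by (cases "x \<le> y") auto
qed

context balking_queue
begin

text \<open>
  The estimation error is at least \<open>\<epsilon>\<close> as long as no observed customer has found the queue in this set.
\<close>

definition win :: "real \<Rightarrow> (nat \<Rightarrow> real) set" where
  "win \<epsilon> = {r. \<theta> - \<epsilon> < r (s - 1) \<and> r (s - 1) \<le> \<theta>}"

lemma sets_win [measurable]: "win \<epsilon> \<in> sets SQ"
proof -
  have "(\<lambda>r. r (s - 1)) -` {\<theta> - \<epsilon><..\<theta>} \<inter> space SQ \<in> sets SQ"
    by (rule measurable_sets[OF measurable_SQ_component]) simp
  then show ?thesis by (simp add: win_def vimage_def)
qed

text \<open>
  The waiting time decreases at unit speed between potential arrivals, so it is in the window during a time
  interval of length \<open>\<epsilon>\<close>, part of which may lie in the past.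
\<close>

lemma shift_in_win:
  assumes "\<epsilon> \<le> \<theta>"
  shows "shift t r \<in> win \<epsilon> \<longleftrightarrow> t \<in> {r (s - 1) - \<theta>..<r (s - 1) - \<theta> + \<epsilon>}"
  using assms \<theta> by (auto simp: win_def shift_def)

lemma Ex_win:
  assumes "0 < \<epsilon>" "\<epsilon> \<le> \<theta>"
  shows "measure Ex {t. shift t r \<in> win \<epsilon>}
    = exp (- (lam * max 0 (r (s - 1) - \<theta>))) - exp (- (lam * max 0 (r (s - 1) - \<theta> + \<epsilon>)))"
proof -
  have "{t. shift t r \<in> win \<epsilon>} = {r (s - 1) - \<theta>..<r (s - 1) - \<theta> + \<epsilon>}"
    using shift_in_win[OF assms(2)] by blast
  then show ?thesis using Ex_interval[of "r (s - 1) - \<theta>" "r (s - 1) - \<theta> + \<epsilon>"] assms by simp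
qed

lemma Ex_win_le:
  assumes "0 < \<epsilon>" "\<epsilon> \<le> \<theta>"
  shows "measure Ex {t. shift t r \<in> win \<epsilon>} \<le> 1 - exp (- (lam * \<epsilon>))"
proof (cases "0 \<le> r (s - 1) - \<theta>")
  case True
  have "exp (- (lam * (r (s - 1) - \<theta>))) - exp (- (lam * (r (s - 1) - \<theta> + \<epsilon>)))
      = exp (- (lam * (r (s - 1) - \<theta>))) * (1 - exp (- (lam * \<epsilon>)))"
    by (simp add: right_diff_distrib exp_add[symmetric] algebra_simps)
  also have "\<dots> \<le> 1 * (1 - exp (- (lam * \<epsilon>)))"
    using True lam assms by (intro mult_right_mono) auto
  finally show ?thesis using True assms by (simp add: Ex_win[OF assms] max_def)
next
  case False
  have "exp (- (lam * \<epsilon>)) \<le> exp (- (lam * max 0 (r (s - 1) - \<theta> + \<epsilon>)))"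
    using False lam assms by simp
  then show ?thesis using False by (simp add: Ex_win[OF assms] max_def)
qed

text \<open>Probability that the next potential customer finds a waiting time in the window:\<close>

definition hitp :: "real \<Rightarrow> (nat \<Rightarrow> real) \<Rightarrow> real" where
  "hitp \<epsilon> r = \<nu>.prob {x. step r x \<in> win \<epsilon>}"

lemma sets_step_win: "{x. step r x \<in> win \<epsilon>} \<in> sets \<nu>"
proof -
  have "(\<lambda>x. step r x) \<in> borel \<Otimes>\<^sub>M borel \<rightarrow>\<^sub>M SQ" by measurable
  from measurable_sets[OF this sets_win, of \<epsilon>] show ?thesis
    by (simp add: vimage_def sets_\<nu> space_pair_measure)
qed

lemma measurable_hitp [measurable]: "hitp \<epsilon> \<in> borel_measurable SQ"
proof -
  have "(\<lambda>z. step (fst z) (snd z)) \<in> SQ \<Otimes>\<^sub>M \<nu> \<rightarrow>\<^sub>M SQ" by measurable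
  from measurable_sets[OF this sets_win, of \<epsilon>]
  have A: "{z. step (fst z) (snd z) \<in> win \<epsilon>} \<in> sets (SQ \<Otimes>\<^sub>M \<nu>)" (is "?A \<in> _")
    by (simp add: vimage_def space_pair_measure)
  have "(\<lambda>r. measure \<nu> (Pair r -` ?A)) \<in> borel_measurable SQ"
    unfolding measure_def using \<nu>.measurable_emeasure_Pair[OF A] by simp
  then show ?thesis by (simp add: hitp_def[abs_def] vimage_def)
qed

lemma hitp_nonneg: "0 \<le> hitp \<epsilon> r"
  by (simp add: hitp_def)

lemma hitp_le:
  assumes \<epsilon>: "0 < \<epsilon>" "\<epsilon> \<le> \<theta>"
  shows "hitp \<epsilon> r \<le> 1 - exp (- (lam * \<epsilon>))"
proof -
  have q: "0 \<le> 1 - exp (- (lam * \<epsilon>))" using \<epsilon> lam by simp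
  have m: "(\<lambda>x. indicator {x. step r x \<in> win \<epsilon>} x :: ennreal) \<in> borel_measurable (borel \<Otimes>\<^sub>M borel)"
    using sets_step_win by (simp add: sets_\<nu> borel_measurable_indicator)
  have "ennreal (hitp \<epsilon> r) = (\<integral>\<^sup>+x. indicator {x. step r x \<in> win \<epsilon>} x \<partial>\<nu>)"
    using sets_step_win by (simp add: hitp_def \<nu>.emeasure_eq_measure)
  also have "\<dots> = (\<integral>\<^sup>+b. (\<integral>\<^sup>+t. indicator {x. step r x \<in> win \<epsilon>} (t, b) \<partial>Ex) \<partial>G)"
    by (rule nn_integral_\<nu>(2)[OF m])
  also have "\<dots> \<le> (\<integral>\<^sup>+b. ennreal (1 - exp (- (lam * \<epsilon>))) \<partial>G)"
  proof (rule nn_integral_mono)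
    fix b :: real
    let ?a = "accept s \<theta> r b"
    have "(\<integral>\<^sup>+t. indicator {x. step r x \<in> win \<epsilon>} (t, b) \<partial>Ex) = (\<integral>\<^sup>+t. indicator {t. shift t ?a \<in> win \<epsilon>} t \<partial>Ex)"
      by (simp add: qstep_def indicator_def)
    also have "\<dots> = ennreal (measure Ex {t. shift t ?a \<in> win \<epsilon>})"
      using \<epsilon> by (simp add: shift_in_win sets_Ex Ex.emeasure_eq_measure)
    also have "\<dots> \<le> ennreal (1 - exp (- (lam * \<epsilon>)))" by (rule ennreal_leI[OF Ex_win_le[OF \<epsilon>]])
    finally show "(\<integral>\<^sup>+t. indicator {x. step r x \<in> win \<epsilon>} (t, b) \<partial>Ex) \<le> ennreal (1 - exp (- (lam * \<epsilon>)))" .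
  qed
  also have "\<dots> = ennreal (1 - exp (- (lam * \<epsilon>)))" using G.emeasure_space_1 by simp
  finally show ?thesis using q by simp
qed

lemma one_minus_hitp: "0 < \<epsilon> \<Longrightarrow> \<epsilon> \<le> \<theta> \<Longrightarrow> exp (- (lam * \<epsilon>)) \<le> 1 - hitp \<epsilon> r"
  using hitp_le[of \<epsilon> r] by simp

text \<open>
  The indicator that the window has not been hit, divided by the product of the conditional probabilities
  of missing it, is a martingale.
\<close>

definition surv_ratio :: "real \<Rightarrow> nat \<Rightarrow> (nat \<Rightarrow> real) \<Rightarrow> (nat \<Rightarrow> real \<times> real) \<Rightarrow> real" where
  "surv_ratio \<epsilon> N r \<xi> = (\<Prod>j<N. (if Y r \<xi> (Suc j) \<in> win \<epsilon> then 0 else 1 / (1 - hitp \<epsilon> (Y r \<xi> j))))"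

lemma measurable_surv_ratio [measurable (raw)]:
  assumes [measurable]: "f \<in> N' \<rightarrow>\<^sub>M SQ" "g \<in> N' \<rightarrow>\<^sub>M P"
  shows "(\<lambda>x. surv_ratio \<epsilon> N (f x) (g x)) \<in> borel_measurable N'"
proof -
  have [measurable]: "(\<lambda>x. Y (f x) (g x) j) \<in> N' \<rightarrow>\<^sub>M SQ" for j by (rule measurable_Y) fact+
  show ?thesis unfolding surv_ratio_def by (simp del: chain.simps) measurable
qed

lemma surv_ratio_bounds:
  assumes \<epsilon>: "0 < \<epsilon>" "\<epsilon> \<le> \<theta>"
  shows "0 \<le> surv_ratio \<epsilon> N r \<xi>" "surv_ratio \<epsilon> N r \<xi> \<le> exp (lam * \<epsilon> * real N)"
proof -
  let ?u = "\<lambda>j. (if Y r \<xi> (Suc j) \<in> win \<epsilon> then 0 else 1 / (1 - hitp \<epsilon> (Y r \<xi> j)))"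
  have u: "0 \<le> ?u j \<and> ?u j \<le> exp (lam * \<epsilon>)" for j
  proof -
    have "exp (- (lam * \<epsilon>)) \<le> 1 - hitp \<epsilon> (Y r \<xi> j)" by (rule one_minus_hitp[OF \<epsilon>])
    moreover have "0 < exp (- (lam * \<epsilon>))" by simp
    ultimately have "0 < 1 - hitp \<epsilon> (Y r \<xi> j)" "1 / (1 - hitp \<epsilon> (Y r \<xi> j)) \<le> 1 / exp (- (lam * \<epsilon>))"
      by (linarith, intro frac_le) simp_all
    then show ?thesis by (auto simp: exp_minus inverse_eq_divide simp del: chain.simps)
  qed
  show "0 \<le> surv_ratio \<epsilon> N r \<xi>" unfolding surv_ratio_def using u by (intro prod_nonneg) blast
  have "surv_ratio \<epsilon> N r \<xi> \<le> (\<Prod>j<N. exp (lam * \<epsilon>))" unfolding surv_ratio_def using u by (intro prod_mono) blast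
  then show "surv_ratio \<epsilon> N r \<xi> \<le> exp (lam * \<epsilon> * real N)"
    by (simp add: exp_of_nat_mult[symmetric] mult.commute)
qed

lemma nn_integral_surv_ratio:
  assumes \<epsilon>: "0 < \<epsilon>" "\<epsilon> \<le> \<theta>"
  shows "(\<integral>\<^sup>+\<xi>. ennreal (surv_ratio \<epsilon> N r \<xi>) \<partial>P) = 1"
proof (induction N arbitrary: r)
  case 0
  show ?case using P.emeasure_space_1 by (simp add: surv_ratio_def)
next
  case (Suc N)
  let ?p = "hitp \<epsilon> r"
  have p: "0 < 1 - ?p" using one_minus_hitp[OF \<epsilon>, of r] by (rule less_le_trans[rotated]) simp
  have split: "surv_ratio \<epsilon> (Suc N) r (case_nat x \<xi>)
      = (if step r x \<in> win \<epsilon> then 0 else 1 / (1 - ?p)) * surv_ratio \<epsilon> N (step r x) \<xi>" for x \<xi>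
    unfolding surv_ratio_def prod.lessThan_Suc_shift by (simp only: chain_case_nat o_def) simp
  have nn: "0 \<le> surv_ratio \<epsilon> N r \<xi>" for r \<xi> by (rule surv_ratio_bounds[OF \<epsilon>])
  have m: "(\<lambda>\<xi>. ennreal (surv_ratio \<epsilon> N (step r x) \<xi>)) \<in> borel_measurable P" for x by measurable
  have "(\<integral>\<^sup>+\<xi>. ennreal (surv_ratio \<epsilon> (Suc N) r \<xi>) \<partial>P)
      = (\<integral>\<^sup>+x. (\<integral>\<^sup>+\<xi>. ennreal (surv_ratio \<epsilon> (Suc N) r (case_nat x \<xi>)) \<partial>P) \<partial>\<nu>)"
    by (rule inp.nn_integral_first_step) measurable
  also have "\<dots> = (\<integral>\<^sup>+x. ennreal (1 / (1 - ?p)) * indicator (- {x. step r x \<in> win \<epsilon>}) x \<partial>\<nu>)"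
  proof (rule nn_integral_cong)
    fix x
    have "(\<integral>\<^sup>+\<xi>. ennreal (surv_ratio \<epsilon> (Suc N) r (case_nat x \<xi>)) \<partial>P)
       = (\<integral>\<^sup>+\<xi>. ennreal (if step r x \<in> win \<epsilon> then 0 else 1 / (1 - ?p)) * ennreal (surv_ratio \<epsilon> N (step r x) \<xi>) \<partial>P)"
      unfolding split using p nn by (intro nn_integral_cong ennreal_mult) auto
    also have "\<dots> = ennreal (if step r x \<in> win \<epsilon> then 0 else 1 / (1 - ?p))"
      by (subst nn_integral_cmult[OF m]) (simp add: Suc)
    finally show "(\<integral>\<^sup>+\<xi>. ennreal (surv_ratio \<epsilon> (Suc N) r (case_nat x \<xi>)) \<partial>P)
       = ennreal (1 / (1 - ?p)) * indicator (- {x. step r x \<in> win \<epsilon>}) x"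
      by (simp add: indicator_def)
  qed
  also have "\<dots> = ennreal (1 / (1 - ?p)) * emeasure \<nu> (- {x. step r x \<in> win \<epsilon>})"
    using sets.compl_sets[OF sets_step_win[of r \<epsilon>]] by (intro nn_integral_cmult_indicator) (simp add: Compl_eq_Diff_UNIV)
  also have "emeasure \<nu> (- {x. step r x \<in> win \<epsilon>}) = ennreal (1 - ?p)"
    using \<nu>.prob_compl[OF sets_step_win[of r \<epsilon>]]
    by (simp add: \<nu>.emeasure_eq_measure hitp_def Compl_eq_Diff_UNIV)
  also have "ennreal (1 / (1 - ?p)) * ennreal (1 - ?p) = 1"
    using p by (simp add: ennreal_mult[symmetric])
  finally show ?case .
qed

lemma sets_nohit [measurable]: "{\<xi>. \<forall>j\<in>{1..N}. Y r \<xi> j \<notin> win \<epsilon>} \<in> sets P"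
proof -
  have [measurable]: "Measurable.pred P (\<lambda>\<xi>. Y r \<xi> j \<notin> win \<epsilon>)" for j
    by measurable
  have "Measurable.pred P (\<lambda>\<xi>. \<forall>j\<in>{1..N}. Y r \<xi> j \<notin> win \<epsilon>)" by measurable
  then show ?thesis by (simp add: pred_def)
qed

end

context stationary_queue
begin

text \<open>
  By invariance, one step ahead of a stationary state the window is hit with its stationary probability.
\<close>

lemma integral_hitp: "(LINT r|\<pi>. hitp \<epsilon> r) = measure \<pi> (win \<epsilon>)"
proof -
  have "(LINT r|\<pi>. hitp \<epsilon> r) = enn2real (\<integral>\<^sup>+r. ennreal (hitp \<epsilon> r) \<partial>\<pi>)"
    by (rule integral_eq_nn_integral) (auto simp: hitp_nonneg measurable_cong_sets[OF sets_\<pi> refl])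
  also have "(\<integral>\<^sup>+r. ennreal (hitp \<epsilon> r) \<partial>\<pi>) = (\<integral>\<^sup>+r. (\<integral>\<^sup>+x. indicator (win \<epsilon>) (step r x) \<partial>\<nu>) \<partial>\<pi>)"
  proof (rule nn_integral_cong)
    fix r
    have "(\<integral>\<^sup>+x. indicator (win \<epsilon>) (step r x) \<partial>\<nu>) = (\<integral>\<^sup>+x. indicator {x. step r x \<in> win \<epsilon>} x \<partial>\<nu>)"
      by (simp add: indicator_def)
    then show "ennreal (hitp \<epsilon> r) = (\<integral>\<^sup>+x. indicator (win \<epsilon>) (step r x) \<partial>\<nu>)"
      using sets_step_win by (simp add: hitp_def \<nu>.emeasure_eq_measure)
  qed
  also have "\<dots> = emeasure \<pi> (win \<epsilon>)"
    by (subst nn_integral_\<pi>_step) (simp_all add: sets_\<pi>)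
  finally show ?thesis by (simp add: measure_def)
qed

text \<open>
  Quantitative Poisson approximation. By the martingale it is enough that the product of the
  conditional probabilities concentrates, which is the law of large numbers applied to
  \<open>hitp \<epsilon>\<close>, rescaled to the unit interval.
\<close>

lemma poisson_approximation:
  assumes \<epsilon>: "0 < \<epsilon>" "\<epsilon> \<le> \<theta>" "lam * \<epsilon> \<le> 1 / 2" and N: "0 < N" and y: "good y"
  shows "\<bar>P.prob {\<xi>. \<forall>j\<in>{1..N}. Y y \<xi> j \<notin> win \<epsilon>} - exp (- (real N * measure \<pi> (win \<epsilon>)))\<bar>
    \<le> exp (lam * \<epsilon> * real N) * (lam * \<epsilon> * real N) * (2 * (lam * \<epsilon>) + lln_err y N)"
proof -
  define q where "q = 1 - exp (- (lam * \<epsilon>))"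
  have q: "0 < q" "q \<le> lam * \<epsilon>" using \<epsilon> lam exp_ge_add_one_self[of "- (lam * \<epsilon>)"] by (auto simp: q_def)
  have p: "0 \<le> hitp \<epsilon> r" "hitp \<epsilon> r \<le> q" for r using hitp_le[OF \<epsilon>(1,2)] hitp_nonneg by (auto simp: q_def)
  define f where "f r = hitp \<epsilon> r / q" for r
  have f[measurable]: "f \<in> borel_measurable SQ" unfolding f_def by measurable
  have f01: "0 \<le> f r" "f r \<le> 1" for r using p[of r] q by (auto simp: f_def)
  define m where "m = measure \<pi> (win \<epsilon>)"
  have fm: "(LINT r|\<pi>. f r) = m / q" by (simp add: f_def integral_hitp m_def)
  define c where "c = exp (- (real N * m))"
  define Q where "Q \<xi> = (\<Prod>j<N. 1 - hitp \<epsilon> (Y y \<xi> j))" for \<xi>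
  define U where "U \<xi> = surv_ratio \<epsilon> N y \<xi>" for \<xi>
  have mU[measurable]: "U \<in> borel_measurable P" unfolding U_def by measurable
  have mQ[measurable]: "Q \<in> borel_measurable P" unfolding Q_def by measurable
  have p1: "0 < 1 - hitp \<epsilon> r" for r using p(2)[of r] q(2) \<epsilon>(3) by linarith
  have Q01: "0 \<le> Q \<xi>" "Q \<xi> \<le> 1" for \<xi>
    unfolding Q_def using p1 p(1) by (auto intro!: prod_nonneg prod_le_1 simp: less_imp_le)
  have Ub: "0 \<le> U \<xi>" "U \<xi> \<le> exp (lam * \<epsilon> * real N)" for \<xi>
    unfolding U_def by (rule surv_ratio_bounds[OF \<epsilon>(1,2)])+
  have c01: "0 \<le> c" "c \<le> 1" by (auto simp: c_def m_def)
  \<comment> \<open>Missing the window is \<open>U * Q\<close>. As \<open>U\<close> is bounded with mean 1, replacing \<open>Q\<close> by the constant \<open>c\<close> costs a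
    multiple of the mean distance of \<open>Q\<close> from \<open>c\<close>.\<close>
  let ?A = "{\<xi>. \<forall>j\<in>{1..N}. Y y \<xi> j \<notin> win \<epsilon>}"
  have ind: "indicator ?A \<xi> = U \<xi> * Q \<xi>" for \<xi>
  proof (cases "\<xi> \<in> ?A")
    case True
    then have "U \<xi> = (\<Prod>j<N. 1 / (1 - hitp \<epsilon> (Y y \<xi> j)))"
      unfolding U_def surv_ratio_def by (intro prod.cong refl) (auto simp del: chain.simps)
    then have "U \<xi> * Q \<xi> = (\<Prod>j<N. 1 / (1 - hitp \<epsilon> (Y y \<xi> j)) * (1 - hitp \<epsilon> (Y y \<xi> j)))"
      by (simp only: Q_def prod.distrib)
    also have "\<dots> = 1" using p1 by (intro prod.neutral) (auto simp: less_le)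
    finally show ?thesis using True by simp
  next
    case False
    then obtain j where j: "j \<in> {1..N}" "Y y \<xi> j \<in> win \<epsilon>" by auto
    then have "U \<xi> = 0" unfolding U_def surv_ratio_def
      by (intro prod_zero) (auto intro!: bexI[of _ "j - 1"] simp del: chain.simps)
    then show ?thesis using False by simp
  qed
  have iU: "integrable P U" by (rule integrable_P_bounded[OF mU, where c="exp (lam * \<epsilon> * real N)"]) (use Ub in auto)
  have iQ: "integrable P (\<lambda>\<xi>. \<bar>Q \<xi> - c\<bar>)"
  proof (rule integrable_P_bounded[where c=1])
    show "\<bar>\<bar>Q \<xi> - c\<bar>\<bar> \<le> 1" for \<xi> using Q01[of \<xi>] c01 by linarith
  qed measurable
  have EU: "(LINT \<xi>|P. U \<xi>) = 1"
    using nn_integral_surv_ratio[OF \<epsilon>(1,2), of N y] Ub by (simp add: integral_eq_nn_integral U_def)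
  have "P.prob ?A - c = (LINT \<xi>|P. U \<xi> * Q \<xi>) - (LINT \<xi>|P. U \<xi> * c)"
    using EU by (simp add: ind[symmetric])
  also have "\<dots> = (LINT \<xi>|P. U \<xi> * (Q \<xi> - c))"
  proof -
    have "integrable P (\<lambda>\<xi>. U \<xi> * Q \<xi>)" unfolding ind[symmetric] by (rule integrable_real_indicator[OF sets_nohit]) (simp add: P.emeasure_eq_measure)
    then show ?thesis using iU by (simp add: right_diff_distrib)
  qed
  finally have "\<bar>P.prob ?A - c\<bar> \<le> (LINT \<xi>|P. \<bar>U \<xi> * (Q \<xi> - c)\<bar>)" by (simp only:) (rule integral_abs_bound)
  also have "\<dots> \<le> (LINT \<xi>|P. exp (lam * \<epsilon> * real N) * \<bar>Q \<xi> - c\<bar>)"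
  proof (rule integral_mono)
    have UQ: "\<bar>U \<xi> * (Q \<xi> - c)\<bar> \<le> exp (lam * \<epsilon> * real N) * \<bar>Q \<xi> - c\<bar>" for \<xi>
      using Ub[of \<xi>] by (simp add: abs_mult mult_right_mono)
    then show "\<bar>U \<xi> * (Q \<xi> - c)\<bar> \<le> exp (lam * \<epsilon> * real N) * \<bar>Q \<xi> - c\<bar>" for \<xi> .
    show i: "integrable P (\<lambda>\<xi>. exp (lam * \<epsilon> * real N) * \<bar>Q \<xi> - c\<bar>)" by (intro integrable_mult_right iQ)
    show "integrable P (\<lambda>\<xi>. \<bar>U \<xi> * (Q \<xi> - c)\<bar>)"
      by (rule Bochner_Integration.integrable_bound[OF i]) (use UQ in \<open>auto intro!: AE_I2\<close>)
  qed
  also have "\<dots> = exp (lam * \<epsilon> * real N) * (LINT \<xi>|P. \<bar>Q \<xi> - c\<bar>)" by simp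
  also have "(LINT \<xi>|P. \<bar>Q \<xi> - c\<bar>) \<le> (LINT \<xi>|P. 2 * real N * q\<^sup>2 + q * real N * \<bar>avg f N y \<xi> - (LINT r|\<pi>. f r)\<bar>)"
  proof (rule integral_mono[OF iQ])
    have [measurable]: "(\<lambda>\<xi>. avg f N y \<xi>) \<in> borel_measurable P" by (rule measurable_avg[OF f]) simp_all
    have "integrable P (\<lambda>\<xi>. \<bar>avg f N y \<xi> - (LINT r|\<pi>. f r)\<bar>)"
    proof (rule integrable_P_bounded[where c="1 + \<bar>LINT r|\<pi>. f r\<bar>"])
      fix \<xi> show "\<bar>\<bar>avg f N y \<xi> - (LINT r|\<pi>. f r)\<bar>\<bar> \<le> 1 + \<bar>LINT r|\<pi>. f r\<bar>"
        using avg_bounds[where f=f and N=N and r=y and \<xi>=\<xi>, OF f01] by linarith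
    qed measurable
    then show "integrable P (\<lambda>\<xi>. 2 * real N * q\<^sup>2 + q * real N * \<bar>avg f N y \<xi> - (LINT r|\<pi>. f r)\<bar>)" by simp
    fix \<xi>
    let ?p = "\<lambda>j. hitp \<epsilon> (Y y \<xi> j)"
    have l: "0 \<le> - ln (1 - ?p j) - ?p j \<and> - ln (1 - ?p j) - ?p j \<le> 2 * q\<^sup>2" for j
    proof
      have "ln (1 - ?p j) \<le> - ?p j" using ln_le_minus_one[OF p1[of "Y y \<xi> j"]] by simp
      then show "0 \<le> - ln (1 - ?p j) - ?p j" by simp
      have "- ?p j - 2 * (?p j)\<^sup>2 \<le> ln (1 - ?p j)"
        using p[of "Y y \<xi> j"] q(2) \<epsilon>(3) by (intro ln_one_minus_pos_lower_bound) auto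
      moreover have "(?p j)\<^sup>2 \<le> q\<^sup>2" using p[of "Y y \<xi> j"] by (intro power_mono) auto
      ultimately show "- ln (1 - ?p j) - ?p j \<le> 2 * q\<^sup>2" by linarith
    qed
    have Qe: "Q \<xi> = exp (- (\<Sum>j<N. - ln (1 - ?p j)))"
    proof -
      have "exp (- (\<Sum>j<N. - ln (1 - ?p j))) = (\<Prod>j<N. exp (ln (1 - ?p j)))"
        by (simp add: exp_sum sum_negf)
      also have "\<dots> = Q \<xi>" unfolding Q_def by (intro prod.cong refl exp_ln p1)
      finally show ?thesis by simp
    qed
    have "\<bar>Q \<xi> - c\<bar> \<le> \<bar>(\<Sum>j<N. - ln (1 - ?p j)) - real N * m\<bar>"
      unfolding Qe c_def
    proof (rule abs_exp_minus_diff_le)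
      show "0 \<le> (\<Sum>j<N. - ln (1 - ?p j))" by (intro sum_nonneg) (use l p(1) in \<open>smt (verit)\<close>)
      show "0 \<le> real N * m" by (simp add: m_def)
    qed
    also have "\<dots> = \<bar>(\<Sum>j<N. - ln (1 - ?p j) - ?p j) + ((\<Sum>j<N. ?p j) - real N * m)\<bar>"
      by (simp add: sum_subtractf)
    also have "\<dots> \<le> \<bar>\<Sum>j<N. - ln (1 - ?p j) - ?p j\<bar> + \<bar>(\<Sum>j<N. ?p j) - real N * m\<bar>" by (rule abs_triangle_ineq)
    also have "\<bar>\<Sum>j<N. - ln (1 - ?p j) - ?p j\<bar> \<le> 2 * real N * q\<^sup>2"
    proof -
      have "0 \<le> (\<Sum>j<N. - ln (1 - ?p j) - ?p j)" by (intro sum_nonneg) (use l in blast)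
      moreover have "(\<Sum>j<N. - ln (1 - ?p j) - ?p j) \<le> (\<Sum>j<N. 2 * q\<^sup>2)" by (intro sum_mono) (use l in blast)
      ultimately show ?thesis by simp
    qed
    also have "\<bar>(\<Sum>j<N. ?p j) - real N * m\<bar> = q * real N * \<bar>avg f N y \<xi> - (LINT r|\<pi>. f r)\<bar>"
    proof -
      have "(\<Sum>j<N. ?p j) = q * real N * avg f N y \<xi>"
        using q(1) N by (simp add: avg_def f_def sum_divide_distrib[symmetric])
      moreover have "real N * m = q * real N * (LINT r|\<pi>. f r)" using q(1) by (simp add: fm)
      ultimately have "(\<Sum>j<N. ?p j) - real N * m = q * real N * (avg f N y \<xi> - (LINT r|\<pi>. f r))"
        by (simp only: right_diff_distrib)
      then show ?thesis using q(1) by (simp add: abs_mult)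
    qed
    finally show "\<bar>Q \<xi> - c\<bar> \<le> 2 * real N * q\<^sup>2 + q * real N * \<bar>avg f N y \<xi> - (LINT r|\<pi>. f r)\<bar>" by simp
  qed
  also have "(LINT \<xi>|P. 2 * real N * q\<^sup>2 + q * real N * \<bar>avg f N y \<xi> - (LINT r|\<pi>. f r)\<bar>)
      = 2 * real N * q\<^sup>2 + q * real N * (LINT \<xi>|P. \<bar>avg f N y \<xi> - (LINT r|\<pi>. f r)\<bar>)"
  proof -
    have [measurable]: "(\<lambda>\<xi>. avg f N y \<xi>) \<in> borel_measurable P" by (rule measurable_avg[OF f]) simp_all
    have "integrable P (\<lambda>\<xi>. \<bar>avg f N y \<xi> - (LINT r|\<pi>. f r)\<bar>)"
    proof (rule integrable_P_bounded[where c="1 + \<bar>LINT r|\<pi>. f r\<bar>"])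
      fix \<xi> show "\<bar>\<bar>avg f N y \<xi> - (LINT r|\<pi>. f r)\<bar>\<bar> \<le> 1 + \<bar>LINT r|\<pi>. f r\<bar>"
        using avg_bounds[where f=f and N=N and r=y and \<xi>=\<xi>, OF f01] by linarith
    qed measurable
    then show ?thesis by (simp add: P.prob_space[simplified])
  qed
  also have "\<dots> \<le> 2 * real N * q\<^sup>2 + q * real N * lln_err y N"
    using law_of_large_numbers[OF f f01 N y] q(1) by (intro add_left_mono mult_left_mono) auto
  also have "\<dots> \<le> (lam * \<epsilon> * real N) * (2 * (lam * \<epsilon>) + lln_err y N)"
  proof -
    have e0: "0 \<le> lln_err y N"
      unfolding lln_err_def by (intro add_nonneg_nonneg divide_nonneg_nonneg sum_nonneg busy_prob_nonneg dec_bounds real_sqrt_ge_zero mult_nonneg_nonneg) auto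
    have "2 * real N * q\<^sup>2 + q * real N * lln_err y N = q * real N * (2 * q + lln_err y N)"
      by (simp add: power2_eq_square algebra_simps)
    also have "\<dots> \<le> (lam * \<epsilon> * real N) * (2 * (lam * \<epsilon>) + lln_err y N)"
      using q e0 by (intro mult_mono add_right_mono mult_right_mono) auto
    finally show ?thesis .
  qed
  finally have "\<bar>P.prob ?A - c\<bar> \<le> exp (lam * \<epsilon> * real N) * ((lam * \<epsilon> * real N) * (2 * (lam * \<epsilon>) + lln_err y N))"
    by (simp add: mult_left_mono)
  then show ?thesis by (simp add: c_def m_def mult.assoc)
qed

end

section \<open>Exponential tail of the estimation error\<close>

text \<open>
  A uniform bound that improves by a factor on an event improves on average; the event will be a run of arrivals
  that leads into the window.
\<close>

lemma nn_integral_le_gain: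
  assumes "prob_space M" and A[measurable]: "A \<in> sets M" and \<phi>: "0 \<le> \<phi>" and d: "0 \<le> d" "d \<le> 1"
    and h: "AE x in M. h x \<le> ennreal \<phi>" and hA: "AE x in M. x \<in> A \<longrightarrow> h x \<le> ennreal (\<phi> * (1 - d))"
  shows "(\<integral>\<^sup>+x. h x \<partial>M) \<le> ennreal (\<phi> * (1 - d * measure M A))"
proof -
  interpret prob_space M by fact
  have "(\<integral>\<^sup>+x. h x \<partial>M) \<le> (\<integral>\<^sup>+x. ennreal (\<phi> * (1 - d * indicator A x)) \<partial>M)"
    by (rule nn_integral_mono_AE, use h hA in eventually_elim) (auto simp: indicator_def)
  also have "\<dots> = ennreal (LINT x|M. \<phi> * (1 - d * indicator A x))"
  proof (rule nn_integral_eq_integral)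
    show "integrable M (\<lambda>x. \<phi> * (1 - d * indicator A x))"
      by (intro integrable_mult_right Bochner_Integration.integrable_diff integrable_real_indicator A) (auto simp: emeasure_eq_measure)
    show "AE x in M. 0 \<le> \<phi> * (1 - d * indicator A x)"
      using \<phi> d by (auto simp: indicator_def)
  qed
  also have "(LINT x|M. \<phi> * (1 - d * indicator A x)) = \<phi> * (1 - d * measure M A)"
  proof -
    have "integrable M (indicator A :: _ \<Rightarrow> real)" by (rule integrable_real_indicator[OF A]) (simp add: emeasure_eq_measure)
    then show ?thesis by (simp add: prob_space)
  qed
  finally show ?thesis .
qed

context balking_queue
begin

text \<open>
  Survival: among the first \<open>N\<close> potential customers, starting from residual times \<open>r\<close>, at least \<open>n\<close>
  join, and the first \<open>n\<close> of these miss the window. Counting by joining customers rather than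
  potential ones is essential: after a large jump of the waiting time many potential customers may be lost, and a bound in terms of
  potential customers would inherit the tail of the service requirements.
\<close>

primrec surv :: "real \<Rightarrow> nat \<Rightarrow> nat \<Rightarrow> (nat \<Rightarrow> real) \<Rightarrow> (nat \<Rightarrow> real \<times> real) \<Rightarrow> bool" where
  "surv \<epsilon> 0 n r \<xi> \<longleftrightarrow> n = 0"
| "surv \<epsilon> (Suc N) n r \<xi> \<longleftrightarrow> n = 0 \<or>
     (if r (s - 1) \<le> \<theta> then r (s - 1) \<le> \<theta> - \<epsilon> \<and> surv \<epsilon> N (n - 1) (step r (\<xi> 0)) (\<lambda>i. \<xi> (Suc i))
      else surv \<epsilon> N n (step r (\<xi> 0)) (\<lambda>i. \<xi> (Suc i)))"

lemma measurable_surv: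
  assumes "f \<in> M \<rightarrow>\<^sub>M SQ" "g \<in> M \<rightarrow>\<^sub>M P"
  shows "Measurable.pred M (\<lambda>x. surv \<epsilon> N n (f x) (g x))"
  using assms
proof (induction N arbitrary: n f g)
  case 0
  show ?case by simp
next
  case (Suc N)
  have c: "(\<lambda>x. f x (s - 1)) \<in> borel_measurable M"
    by (rule measurable_compose[OF Suc.prems(1) measurable_SQ_component])
  have [measurable]: "Measurable.pred M (\<lambda>x. f x (s - 1) \<le> a)" for a
    using c by measurable
  have "(\<lambda>\<xi>. \<xi> 0) \<in> P \<rightarrow>\<^sub>M \<nu>" by (rule measurable_component_singleton) simp
  from measurable_compose[OF Suc.prems(2) this] have g0: "(\<lambda>x. g x 0) \<in> M \<rightarrow>\<^sub>M borel \<Otimes>\<^sub>M borel"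
    by (simp add: measurable_\<nu>)
  have tl: "(\<lambda>x i. g x (Suc i)) \<in> M \<rightarrow>\<^sub>M P"
    by (rule measurable_compose[OF Suc.prems(2) inp.measurable_tl])
  have [measurable]: "Measurable.pred M (\<lambda>x. surv \<epsilon> N k (step (f x) (g x 0)) (\<lambda>i. g x (Suc i)))" for k
    by (rule Suc.IH[OF measurable_step[OF Suc.prems(1) g0] tl])
  show ?case unfolding surv.simps by measurable
qed

definition sv :: "real \<Rightarrow> nat \<Rightarrow> nat \<Rightarrow> (nat \<Rightarrow> real) \<Rightarrow> ennreal" where
  "sv \<epsilon> N n r = emeasure P {\<xi>. surv \<epsilon> N n r \<xi>}"

lemma sets_surv: "{\<xi>. surv \<epsilon> N n r \<xi>} \<in> sets P"
  using measurable_surv[of "\<lambda>_. r" P "\<lambda>\<xi>. \<xi>" \<epsilon> N n] by (simp add: pred_def)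

lemma sv_le_1: "sv \<epsilon> N n r \<le> 1"
  by (simp add: sv_def P.emeasure_le_1)

lemma sv_Suc:
  assumes "0 < n"
  shows "sv \<epsilon> (Suc N) n r = (if r (s - 1) \<le> \<theta>
    then if r (s - 1) \<le> \<theta> - \<epsilon> then \<integral>\<^sup>+x. sv \<epsilon> N (n - 1) (step r x) \<partial>\<nu> else 0
    else \<integral>\<^sup>+x. sv \<epsilon> N n (step r x) \<partial>\<nu>)"
proof -
  have sv: "(\<integral>\<^sup>+\<xi>. indicator {\<xi>. surv \<epsilon> N n r \<xi>} \<xi> \<partial>P) = sv \<epsilon> N n r" for N n r
    using sets_surv by (simp add: sv_def)
  have "sv \<epsilon> (Suc N) n r = (\<integral>\<^sup>+x. (\<integral>\<^sup>+\<xi>. indicator {\<xi>. surv \<epsilon> (Suc N) n r \<xi>} (case_nat x \<xi>) \<partial>P) \<partial>\<nu>)"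
    unfolding sv[symmetric] by (rule inp.nn_integral_first_step) (use sets_surv in simp)
  also have "\<dots> = (\<integral>\<^sup>+x. (if r (s - 1) \<le> \<theta>
    then if r (s - 1) \<le> \<theta> - \<epsilon> then sv \<epsilon> N (n - 1) (step r x) else 0 else sv \<epsilon> N n (step r x)) \<partial>\<nu>)"
  proof (rule nn_integral_cong)
    fix x
    have "(indicator {\<xi>. surv \<epsilon> (Suc N) n r \<xi>} (case_nat x \<xi>) :: ennreal) = (if r (s - 1) \<le> \<theta>
      then if r (s - 1) \<le> \<theta> - \<epsilon> then indicator {\<xi>. surv \<epsilon> N (n - 1) (step r x) \<xi>} \<xi> else 0
      else indicator {\<xi>. surv \<epsilon> N n (step r x) \<xi>} \<xi>)" for \<xi>
      using assms by (auto simp: indicator_def)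
    then show "(\<integral>\<^sup>+\<xi>. indicator {\<xi>. surv \<epsilon> (Suc N) n r \<xi>} (case_nat x \<xi>) \<partial>P) = (if r (s - 1) \<le> \<theta>
      then if r (s - 1) \<le> \<theta> - \<epsilon> then sv \<epsilon> N (n - 1) (step r x) else 0 else sv \<epsilon> N n (step r x))"
      by (simp add: sv)
  qed
  finally show ?thesis by simp
qed

text \<open>
  A potential that measures how close the queue is to a waiting time above \<open>\<theta>\<close>: the work of the
  \<open>s\<close> servers, truncated at \<open>c\<close>. A customer with service requirement at least \<open>\<delta>\<close> who joins increases it by \<open>\<delta>\<close>, even
  when the waiting time itself, the smallest of the terms, does not grow.
\<close>

definition pot :: "real \<Rightarrow> (nat \<Rightarrow> real) \<Rightarrow> real" where
  "pot c r = (\<Sum>k\<le>s - 1. min (r k) c)"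

lemma pot_shift: assumes "0 \<le> t" shows "pot c r - real s * t \<le> pot c (shift t r)"
proof -
  have "(\<Sum>k\<le>s - 1. min (r k) c - t) \<le> pot c (shift t r)"
    unfolding pot_def using assms by (intro sum_mono) (auto simp: shift_def)
  moreover have "(\<Sum>k\<le>s - 1. min (r k) c - t) = pot c r - real s * t"
    using s by (simp add: pot_def sum_subtractf)
  ultimately show ?thesis by simp
qed

lemma pot_accept:
  assumes "good r" "r (s - 1) \<le> \<theta>" "\<delta> \<le> b" "0 \<le> \<delta>"
  shows "pot (\<theta> + \<delta>) r + \<delta> \<le> pot (\<theta> + \<delta>) (accept s \<theta> r b)"
proof -
  let ?g = "\<lambda>x. min x (\<theta> + \<delta>)" and ?w = "r (s - 1)"
  have "pot (\<theta> + \<delta>) (accept s \<theta> r b) = (\<Sum>k<s - 1. ?g (r k)) + ?g (max ?w (?w + b))"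
    using sum_ins[OF assms(1), of ?g "?w + b" "s - 1"] assms(2) by (simp add: pot_def accept_def)
  moreover have "pot (\<theta> + \<delta>) r = (\<Sum>k<s - 1. ?g (r k)) + ?g ?w"
    by (simp add: pot_def lessThan_Suc_atMost[symmetric])
  moreover have "?g ?w + \<delta> \<le> ?g (max ?w (?w + b))" using assms by auto
  ultimately show ?thesis by linarith
qed

lemma pot_le:
  assumes "0 \<le> \<delta>" "r (s - 1) \<le> \<theta>"
  shows "pot (\<theta> + \<delta>) r \<le> real s * (\<theta> + \<delta>) - \<delta>"
proof -
  have "pot (\<theta> + \<delta>) r = (\<Sum>k<s - 1. min (r k) (\<theta> + \<delta>)) + min (r (s - 1)) (\<theta> + \<delta>)"
    by (simp add: pot_def lessThan_Suc_atMost[symmetric])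
  also have "(\<Sum>k<s - 1. min (r k) (\<theta> + \<delta>)) \<le> (\<Sum>k<s - 1. \<theta> + \<delta>)" by (intro sum_mono) simp
  also have "min (r (s - 1)) (\<theta> + \<delta>) \<le> \<theta>" using assms by simp
  finally show ?thesis using s by (simp add: of_nat_diff algebra_simps)
qed

lemma service_window: obtains \<delta> c where "0 < \<delta>" "0 < measure G {\<delta><..c}" "0 \<le> c"
proof -
  have "\<exists>n::nat. emeasure G {1 / real (Suc n)<..real n} \<noteq> 0"
  proof (rule ccontr)
    assume "\<not> ?thesis"
    then have "emeasure G (\<Union>n::nat. {1 / real (Suc n)<..real n}) = 0"
      by (intro emeasure_UN_eq_0) (auto simp: sets_G)
    moreover have "{0<..} \<subseteq> (\<Union>n::nat. {1 / real (Suc n)<..real n})"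
    proof
      fix x :: real assume "x \<in> {0<..}"
      then have x: "0 < x" by simp
      obtain n1 where n1: "inverse (real (Suc n1)) < x" using reals_Archimedean[OF x] by blast
      obtain n2 :: nat where n2: "x \<le> real n2" using real_arch_simple by blast
      have "1 / real (Suc (max n1 n2)) \<le> inverse (real (Suc n1))"
        by (simp add: inverse_eq_divide frac_le)
      then have "1 / real (Suc (max n1 n2)) < x" using n1 by linarith
      moreover have "x \<le> real (max n1 n2)" using n2 by simp
      ultimately show "x \<in> (\<Union>n::nat. {1 / real (Suc n)<..real n})" by (intro UN_I[of "max n1 n2"]) auto
    qed
    ultimately have "emeasure G {0<..} = 0"
      using emeasure_mono[of "{0<..}" "\<Union>n::nat. {1 / real (Suc n)<..real n}" G] by (simp add: sets_G)
    then show False using G_pos by (simp add: G.emeasure_eq_measure)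
  qed
  then obtain n :: nat where "emeasure G {1 / real (Suc n)<..real n} \<noteq> 0" ..
  then have "0 < measure G {1 / real (Suc n)<..real n}"
    by (simp add: G.emeasure_eq_measure zero_less_measure_iff)
  then show ?thesis by (intro that[of "1 / real (Suc n)" "real n"]) auto
qed

text \<open>
  The next \<open>k\<close> joining customers may arrive in quick succession, with service requirements
  at least \<open>\<delta>\<close>, until the waiting time after a jump exceeds \<open>\<theta>\<close>. From there it comes down continuously, and the next
  arrival falls into the window with probability proportional to \<open>1 - exp (- lam * \<epsilon>)\<close>, because the
  jump was at most \<open>B\<close>. This gives the survival bound a constant factor,
  whatever the state was before.
\<close>

lemma sv_gain:
  assumes \<delta>: "0 < \<delta>" and B: "0 \<le> B" and \<epsilon>: "0 < \<epsilon>" "\<epsilon> \<le> \<theta>"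
    and \<phi>: "0 \<le> \<phi>" "\<And>N n' r. good r \<Longrightarrow> n \<le> n' \<Longrightarrow> sv \<epsilon> N n' r \<le> ennreal \<phi>"
  defines "c \<equiv> measure G {\<delta><..B} * (measure Ex {..<\<delta> / (2 * real s)} * exp (- (lam * B)))"
    and "q \<equiv> 1 - exp (- (lam * \<epsilon>))"
  assumes r: "good r" "r (s - 1) \<le> \<theta>" "real s * (\<theta> + \<delta>) - real k * (\<delta> / 2) \<le> pot (\<theta> + \<delta>) r"
    and n': "n + k < n'"
  shows "sv \<epsilon> N n' r \<le> ennreal (\<phi> * (1 - c ^ k * q))"
  using r n'
proof (induction k arbitrary: r N n')
  case 0
  then show ?case using pot_le[of \<delta> r] \<delta> by simp
next
  case (Suc k)
  define b0 where "b0 = measure Ex {..<\<delta> / (2 * real s)}"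
  define eB where "eB = exp (- (lam * B))"
  define g where "g = measure G {\<delta><..B}"
  have c: "c = g * (b0 * eB)" by (simp add: c_def g_def b0_def eB_def)
  have q: "0 < q" "q \<le> 1" using \<epsilon> lam by (auto simp: q_def)
  have b0: "0 \<le> b0" "b0 \<le> 1" and g: "0 \<le> g" "g \<le> 1" and eB: "0 < eB" "eB \<le> 1"
    using lam B by (auto simp: b0_def g_def eB_def)
  have c01: "0 \<le> c" "c \<le> 1" using b0 g eB by (auto simp: c intro!: mult_le_one mult_nonneg_nonneg)
  define d where "d = b0 * eB * (c ^ k * q)"
  have ck: "0 \<le> c ^ k" "c ^ k \<le> 1" using c01 by (auto simp: power_le_one)
  have ckq: "0 \<le> c ^ k * q" "c ^ k * q \<le> 1" using ck q by (auto intro!: mult_le_one)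
  have d01: "0 \<le> d" "d \<le> 1" using b0 eB ckq by (auto simp: d_def intro!: mult_le_one mult_nonneg_nonneg)
  have n'0: "0 < n'" using Suc.prems(4) by simp
  show ?case
  proof (cases N)
    case 0
    then show ?thesis using n'0 by (simp add: sv_def)
  next
    case (Suc N')
    show ?thesis
    proof (cases "r (s - 1) \<le> \<theta> - \<epsilon>")
      case False
      then show ?thesis using Suc.prems(2) n'0 by (simp add: Suc sv_Suc)
    next
      case True
      let ?h = "\<lambda>x. sv \<epsilon> N' (n' - 1) (step r x)"
      have hle: "?h x \<le> ennreal \<phi>" for x
        using Suc.prems by (intro \<phi>(2) good_qstep) auto
      have mh: "?h \<in> borel_measurable (borel \<Otimes>\<^sub>M borel)"
      proof -
        have "Measurable.pred (SQ \<Otimes>\<^sub>M P) (\<lambda>z. surv \<epsilon> N' (n' - 1) (fst z) (snd z))"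
          by (rule measurable_surv) simp_all
        then have A: "{z. surv \<epsilon> N' (n' - 1) (fst z) (snd z)} \<in> sets (SQ \<Otimes>\<^sub>M P)" (is "?A \<in> _")
          by (simp add: pred_def space_pair_measure)
        have "sv \<epsilon> N' (n' - 1) = (\<lambda>r. emeasure P (Pair r -` ?A))" by (simp add: sv_def[abs_def] vimage_def)
        then have [measurable]: "sv \<epsilon> N' (n' - 1) \<in> borel_measurable SQ" using P.measurable_emeasure_Pair[OF A] by simp
        show ?thesis by measurable
      qed
      have "sv \<epsilon> N n' r = (\<integral>\<^sup>+x. ?h x \<partial>\<nu>)"
        using True Suc.prems(2) n'0 by (simp add: Suc sv_Suc)
      also have "\<dots> = (\<integral>\<^sup>+b. (\<integral>\<^sup>+t. ?h (t, b) \<partial>Ex) \<partial>G)" by (rule nn_integral_\<nu>(2)[OF mh])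
      also have "\<dots> \<le> ennreal (\<phi> * (1 - d * g))"
        unfolding g_def
      proof (rule nn_integral_le_gain[OF prob_G _ \<phi>(1) d01])
        show "{\<delta><..B} \<in> sets G" by (simp add: sets_G)
        show "AE b in G. (\<integral>\<^sup>+t. ?h (t, b) \<partial>Ex) \<le> ennreal \<phi>"
        proof (rule AE_I2)
          fix b
          have "(\<integral>\<^sup>+t. ?h (t, b) \<partial>Ex) \<le> (\<integral>\<^sup>+t. ennreal \<phi> \<partial>Ex)" by (intro nn_integral_mono hle)
          then show "(\<integral>\<^sup>+t. ?h (t, b) \<partial>Ex) \<le> ennreal \<phi>" using Ex.emeasure_space_1 by simp
        qed
        show "AE b in G. b \<in> {\<delta><..B} \<longrightarrow> (\<integral>\<^sup>+t. ?h (t, b) \<partial>Ex) \<le> ennreal (\<phi> * (1 - d))"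
        proof (intro AE_I2 impI)
          fix b assume b: "b \<in> {\<delta><..B}"
          let ?a = "accept s \<theta> r b"
          have ga: "good ?a" by (rule good_accept[OF Suc.prems(1)])
          have za: "?a (s - 1) \<le> \<theta> + B" using accept_le[of s \<theta> r b] Suc.prems(2) b B by auto
          show "(\<integral>\<^sup>+t. ?h (t, b) \<partial>Ex) \<le> ennreal (\<phi> * (1 - d))"
          proof (cases "\<theta> \<le> ?a (s - 1)")
            case True
            \<comment> \<open>The window lies ahead, at a distance of at most \<open>B\<close>.\<close>
            let ?W = "{t. shift t ?a \<in> win \<epsilon>}"
            have W: "?W \<in> sets Ex"
              unfolding shift_in_win[OF \<epsilon>(2)] by (simp add: sets_Ex)
            have "(\<integral>\<^sup>+t. ?h (t, b) \<partial>Ex) \<le> ennreal (\<phi> * (1 - 1 * measure Ex ?W))"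
            proof (rule nn_integral_le_gain[OF Ex.prob_space_axioms W \<phi>(1)])
              show "AE t in Ex. t \<in> ?W \<longrightarrow> ?h (t, b) \<le> ennreal (\<phi> * (1 - 1))"
              proof (intro AE_I2 impI)
                fix t assume "t \<in> ?W"
                then have "step r (t, b) \<in> win \<epsilon>" by (simp add: qstep_def)
                moreover have "0 < n' - 1" using Suc.prems(4) by simp
                ultimately have "?h (t, b) = 0"
                  by (cases N') (auto simp: sv_Suc win_def, simp add: sv_def)
                then show "?h (t, b) \<le> ennreal (\<phi> * (1 - 1))" by simp
              qed
            qed (use hle in auto)
            also have "\<dots> \<le> ennreal (\<phi> * (1 - d))"
            proof (intro ennreal_leI mult_left_mono \<phi>(1))
              let ?z = "?a (s - 1)"
              have "measure Ex ?W = exp (- (lam * (?z - \<theta>))) * q"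
                using True \<epsilon> by (simp add: Ex_win[OF \<epsilon>] q_def right_diff_distrib exp_add[symmetric] algebra_simps)
              moreover have "eB \<le> exp (- (lam * (?z - \<theta>)))"
                unfolding eB_def using za lam by simp
              ultimately have "eB * q \<le> measure Ex ?W" using q by (simp add: mult_right_mono)
              moreover have "d \<le> eB * q"
              proof -
                have "d = (b0 * c ^ k) * (eB * q)" by (simp add: d_def)
                also have "\<dots> \<le> 1 * (eB * q)"
                  using b0 ck eB q by (intro mult_right_mono mult_le_one) auto
                finally show ?thesis by simp
              qed
              ultimately show "1 - 1 * measure Ex ?W \<le> 1 - d" by simp
            qed
            finally show ?thesis .
          next
            case False
            \<comment> \<open>The next customer joins too, and after a gap below \<open>\<delta> / (2 * s)\<close> half of the gain \<open>\<delta>\<close> in potential is left.\<close>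
            have "(\<integral>\<^sup>+t. ?h (t, b) \<partial>Ex) \<le> ennreal (\<phi> * (1 - (c ^ k * q) * measure Ex {..<\<delta> / (2 * real s)}))"
            proof (rule nn_integral_le_gain[OF Ex.prob_space_axioms _ \<phi>(1) ckq])
              show "AE t in Ex. t \<in> {..<\<delta> / (2 * real s)} \<longrightarrow> ?h (t, b) \<le> ennreal (\<phi> * (1 - c ^ k * q))"
                using AE_Ex_pos
              proof (eventually_elim, intro impI)
                fix t assume t: "0 < t" "t \<in> {..<\<delta> / (2 * real s)}"
                have "pot (\<theta> + \<delta>) r + \<delta> \<le> pot (\<theta> + \<delta>) ?a"
                  by (rule pot_accept) (use Suc.prems b \<delta> in auto)
                moreover have "pot (\<theta> + \<delta>) ?a - real s * t \<le> pot (\<theta> + \<delta>) (shift t ?a)"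
                  by (rule pot_shift) (use t in simp)
                moreover have "real s * t \<le> \<delta> / 2"
                  using t s by (simp add: field_simps)
                moreover have "real (Suc k) * (\<delta> / 2) = real k * (\<delta> / 2) + \<delta> / 2" by (simp add: algebra_simps)
                moreover have "step r (t, b) = shift t ?a" by (simp add: qstep_def)
                ultimately have "real s * (\<theta> + \<delta>) - real k * (\<delta> / 2) \<le> pot (\<theta> + \<delta>) (step r (t, b))"
                  using Suc.prems(3) by (simp only:)
                moreover have "step r (t, b) (s - 1) \<le> \<theta>" using False t \<theta> by (simp add: qstep_def shift_def)
                ultimately show "?h (t, b) \<le> ennreal (\<phi> * (1 - c ^ k * q))"
                  using Suc.prems(4) by (intro Suc.IH good_qstep[OF Suc.prems(1)]) auto
              qed
            qed (use hle in \<open>auto simp: sets_Ex\<close>)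
            moreover have "d \<le> c ^ k * q * b0"
            proof -
              have "d = eB * (c ^ k * q * b0)" by (simp add: d_def)
              also have "\<dots> \<le> 1 * (c ^ k * q * b0)"
                using b0 ckq eB by (intro mult_right_mono mult_nonneg_nonneg[OF ckq(1)]) auto
              finally show ?thesis by simp
            qed
            ultimately show ?thesis
              unfolding b0_def[symmetric] by (elim order_trans) (intro ennreal_leI mult_left_mono \<phi>(1), simp)
          qed
        qed
      qed
      also have "d * g = c ^ Suc k * q" by (simp add: d_def c)
      finally show ?thesis .
    qed
  qed
qed

text \<open>Iterating over blocks of \<open>m\<close> joining customers; potential customers who balk only delay the argument.\<close>

lemma sv_tail:
  obtains m c where "0 < (m::nat)" "0 < (c::real)" "c \<le> 1"
    "\<And>\<epsilon> j N n r. 0 < \<epsilon> \<Longrightarrow> \<epsilon> \<le> \<theta> \<Longrightarrow> good r \<Longrightarrow> j * m \<le> n \<Longrightarrow>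
      sv \<epsilon> N n r \<le> ennreal ((1 - c * (1 - exp (- (lam * \<epsilon>)))) ^ j)"
proof -
  obtain \<delta> B where \<delta>: "0 < \<delta>" and G0: "0 < measure G {\<delta><..B}" and B: "0 \<le> B" by (rule service_window)
  define b0 where "b0 = measure Ex {..<\<delta> / (2 * real s)}"
  have b0: "0 < b0"
  proof -
    have "b0 = measure Ex (UNIV - {\<delta> / (2 * real s)..})" by (simp add: b0_def Compl_eq_Diff_UNIV[symmetric] Compl_atLeast)
    also have "\<dots> = 1 - measure Ex {\<delta> / (2 * real s)..}"
      using Ex.prob_compl[of "{\<delta> / (2 * real s)..}"] by (simp add: sets_Ex)
    also have "\<dots> = 1 - exp (- (lam * (\<delta> / (2 * real s))))" using \<delta> s by (subst Ex_ge) auto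
    finally show ?thesis using \<delta> lam s by simp
  qed
  define c0 where "c0 = measure G {\<delta><..B} * (b0 * exp (- (lam * B)))"
  have c0: "0 < c0" "c0 \<le> 1"
    using G0 b0 lam B by (auto simp: c0_def b0_def intro!: mult_le_one mult_pos_pos)
  \<comment> \<open>From potential 0, gains of \<open>\<delta> / 2\<close> exceed the largest possible value within \<open>k\<close> joining customers.\<close>
  define k where "k = nat \<lceil>real s * (\<theta> + \<delta>) / (\<delta> / 2)\<rceil>"
  have k: "real s * (\<theta> + \<delta>) - real k * (\<delta> / 2) \<le> 0"
  proof -
    have "real s * (\<theta> + \<delta>) / (\<delta> / 2) \<le> real k" unfolding k_def by (rule real_nat_ceiling_ge)
    then show ?thesis using \<delta> by (simp add: field_simps)
  qed
  define c where "c = c0 ^ k"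
  have c: "0 < c" "c \<le> 1" using c0 by (auto simp: c_def power_le_one)
  show ?thesis
  proof (rule that[of "Suc k" c])
    fix \<epsilon> j N n r assume \<epsilon>: "0 < \<epsilon>" "\<epsilon> \<le> \<theta>" and r: "good r" and n: "j * Suc k \<le> n"
    define q where "q = 1 - exp (- (lam * \<epsilon>))"
    have q: "0 < q" "q \<le> 1" using \<epsilon> lam by (auto simp: q_def)
    have cq: "0 \<le> 1 - c * q" using c q by (simp add: mult_le_one)
    show "sv \<epsilon> N n r \<le> ennreal ((1 - c * (1 - exp (- (lam * \<epsilon>)))) ^ j)"
      using r n unfolding q_def[symmetric]
    proof (induction j arbitrary: N n r)
      case 0
      show ?case using sv_le_1 by simp
    next
      case (Suc j)
      have IH: "sv \<epsilon> N n' r \<le> ennreal ((1 - c * q) ^ j)" if "good r" "j * Suc k \<le> n'" for N n' r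
        using Suc.IH that by blast
      have joins: "sv \<epsilon> N n r \<le> ennreal ((1 - c * q) ^ j * (1 - c * q))"
        if r: "good r" "r (s - 1) \<le> \<theta>" for N r
        unfolding c_def q_def c0_def b0_def
      proof (rule sv_gain[OF \<delta> B \<epsilon>, where n="j * Suc k"])
        show "0 \<le> (1 - (measure G {\<delta><..B} * (measure Ex {..<\<delta> / (2 * real s)} * exp (- (lam * B)))) ^ k * (1 - exp (- (lam * \<epsilon>)))) ^ j"
          using cq unfolding c_def q_def c0_def b0_def by simp
        show "sv \<epsilon> N n' r \<le> ennreal ((1 - (measure G {\<delta><..B} * (measure Ex {..<\<delta> / (2 * real s)} * exp (- (lam * B)))) ^ k * (1 - exp (- (lam * \<epsilon>)))) ^ j)"
          if "good r" "j * Suc k \<le> n'" for N n' r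
          using IH[OF that] unfolding c_def q_def c0_def b0_def .
        have "0 \<le> pot (\<theta> + \<delta>) r" unfolding pot_def
          using good_nonneg[OF r(1)] \<theta> \<delta> by (intro sum_nonneg) auto
        with k show "real s * (\<theta> + \<delta>) - real k * (\<delta> / 2) \<le> pot (\<theta> + \<delta>) r" by linarith
        show "j * Suc k + k < n" using Suc.prems(2) by simp
      qed (use r in auto)
      have "sv \<epsilon> N n r \<le> ennreal ((1 - c * q) ^ j * (1 - c * q))" using Suc.prems(1)
      proof (induction N arbitrary: r)
        case 0
        then show ?case using Suc.prems(2) by (simp add: sv_def)
      next
        case (Suc N)
        show ?case
        proof (cases "r (s - 1) \<le> \<theta>")
          case True
          then show ?thesis using joins[of r "Suc N"] Suc.prems by blast
        next
          case False
          have "0 < n" using \<open>Suc j * Suc k \<le> n\<close> by simp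
          then have "sv \<epsilon> (Suc N) n r = (\<integral>\<^sup>+x. sv \<epsilon> N n (step r x) \<partial>\<nu>)" using False by (simp add: sv_Suc)
          also have "\<dots> \<le> (\<integral>\<^sup>+x. ennreal ((1 - c * q) ^ j * (1 - c * q)) \<partial>\<nu>)"
            by (intro nn_integral_mono Suc.IH good_qstep Suc.prems)
          finally show ?thesis using \<nu>.emeasure_space_1 by simp
        qed
      qed
      then show ?case by (simp add: mult.commute)
    qed
  qed (use c in auto)
qed

text \<open>Survival in terms of the sequence of waiting times found:\<close>

definition joined :: "(nat \<Rightarrow> real) \<Rightarrow> (nat \<Rightarrow> real \<times> real) \<Rightarrow> nat \<Rightarrow> nat" where
  "joined r \<xi> j = (\<Sum>i<j. if Y r \<xi> i (s - 1) \<le> \<theta> then 1 else 0)"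

lemma joined_Suc: "joined r \<xi> (Suc j) = (if r (s - 1) \<le> \<theta> then 1 else 0) + joined (step r (\<xi> 0)) (\<lambda>i. \<xi> (Suc i)) j"
  unfolding joined_def sum.lessThan_Suc_shift by (simp only: chain_Suc) simp

lemma survI:
  assumes "\<And>j. j < N \<Longrightarrow> Y r \<xi> j \<in> win \<epsilon> \<Longrightarrow> n \<le> joined r \<xi> j" "n \<le> joined r \<xi> N"
  shows "surv \<epsilon> N n r \<xi>"
  using assms
proof (induction N arbitrary: n r \<xi>)
  case 0
  then show ?case by (simp add: joined_def)
next
  case (Suc N)
  let ?r = "step r (\<xi> 0)" and ?\<xi> = "\<lambda>i. \<xi> (Suc i)"
  let ?a = "if r (s - 1) \<le> \<theta> then 1 else 0 :: nat"
  have "surv \<epsilon> N (n - ?a) ?r ?\<xi>"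
  proof (rule Suc.IH)
    show "n - ?a \<le> joined ?r ?\<xi> N" using Suc.prems(2) unfolding joined_Suc by (auto split: if_splits)
    fix j assume j: "j < N" "Y ?r ?\<xi> j \<in> win \<epsilon>"
    then have "n \<le> joined r \<xi> (Suc j)" by (intro Suc.prems(1)) (simp_all only: chain_Suc Suc_less_eq)
    then show "n - ?a \<le> joined ?r ?\<xi> j" unfolding joined_Suc by (auto split: if_splits)
  qed
  moreover have "n = 0 \<or> r \<notin> win \<epsilon>" using Suc.prems(1)[of 0] by (auto simp: joined_def)
  ultimately show ?case by (auto simp: win_def split: if_splits)
qed

end

section \<open>Limit law for a given initial state\<close>

text \<open>A number of potential customers of order \<open>b * n\<close>:\<close>

definition blk :: "real \<Rightarrow> nat \<Rightarrow> nat" where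
  "blk b n = Suc (nat \<lceil>b * real n\<rceil>)"

lemma blk_ratio: assumes "0 < b" shows "(\<lambda>n. real (blk b n) / real n) \<longlonglongrightarrow> b"
proof (rule real_tendsto_sandwich)
    show "\<forall>\<^sub>F n in sequentially. b \<le> real (blk b n) / real n"
      using eventually_gt_at_top[of 0]
    proof eventually_elim
      fix n :: nat assume n: "0 < n"
      have "b * real n \<le> real (blk b n)" using real_nat_ceiling_ge[of "b * real n"] by (simp add: blk_def)
      then show "b \<le> real (blk b n) / real n" using n by (simp add: field_simps)
    qed
    show "\<forall>\<^sub>F n in sequentially. real (blk b n) / real n \<le> b + 2 / real n"
      using eventually_gt_at_top[of 0]
    proof eventually_elim
      fix n :: nat assume n: "0 < n"
      have "real (nat \<lceil>b * real n\<rceil>) \<le> b * real n + 1" using assms by (simp add: of_nat_nat ceiling_correct)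
      then have "real (blk b n) \<le> b * real n + 2" by (simp add: blk_def)
      then have "real (blk b n) / real n \<le> (b * real n + 2) / real n" using n by (intro divide_right_mono) auto
      also have "\<dots> = b + 2 / real n" using n by (simp add: field_simps)
      finally show "real (blk b n) / real n \<le> b + 2 / real n" .
    qed
    show "(\<lambda>n. b + 2 / real n) \<longlonglongrightarrow> b"
      using tendsto_add[OF tendsto_const[of b] lim_const_over_n[of 2]] by simp
qed (rule tendsto_const)

lemma blk_top: assumes "0 < b" shows "filterlim (blk b) at_top sequentially"
    unfolding filterlim_sequentially_iff_filterlim_real
  proof (rule filterlim_at_top_mono[where f="\<lambda>n. b * real n"])
    show "filterlim (\<lambda>n. b * real n) at_top sequentially"
      using assms by (intro filterlim_tendsto_pos_mult_at_top[OF tendsto_const] filterlim_real_sequentially)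
    show "\<forall>\<^sub>F n in sequentially. b * real n \<le> real (blk b n)"
    proof (rule always_eventually, rule allI)
      fix n show "b * real n \<le> real (blk b n)" using real_nat_ceiling_ge[of "b * real n"] by (simp add: blk_def)
    qed
  qed

context balking_queue
begin

text \<open>
  The event that all of the first \<open>n\<close> customers to join after customer 0 have waiting times at most
  \<open>\<theta> - \<epsilon>\<close>, provided that customer 0 joins. It is compared with hitting the window at a
  potential customer, of index up to \<open>N\<close>, on both sides, and with survival.
\<close>

definition maxle :: "real \<Rightarrow> nat \<Rightarrow> (nat \<Rightarrow> real) \<Rightarrow> (nat \<Rightarrow> real \<times> real) \<Rightarrow> bool" where
  "maxle \<epsilon> n r \<xi> \<longleftrightarrow> (\<forall>j. Y r \<xi> j (s - 1) \<le> \<theta> \<longrightarrow> 1 \<le> joined r \<xi> j \<longrightarrow> joined r \<xi> j \<le> n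
     \<longrightarrow> Y r \<xi> j (s - 1) \<le> \<theta> - \<epsilon>)"

lemma measurable_joined [measurable (raw)]:
  assumes [measurable]: "f \<in> M \<rightarrow>\<^sub>M SQ" "g \<in> M \<rightarrow>\<^sub>M P"
  shows "(\<lambda>x. joined (f x) (g x) j) \<in> M \<rightarrow>\<^sub>M count_space UNIV"
  unfolding joined_def by measurable

lemma measurable_maxle [measurable (raw)]:
  assumes [measurable]: "f \<in> M \<rightarrow>\<^sub>M SQ" "g \<in> M \<rightarrow>\<^sub>M P"
  shows "Measurable.pred M (\<lambda>x. maxle \<epsilon> n (f x) (g x))"
  unfolding maxle_def by measurable

lemma sets_maxle: "{\<xi>. maxle \<epsilon> n r \<xi>} \<in> sets P"
  using measurable_maxle[of "\<lambda>_. r" P "\<lambda>\<xi>. \<xi>" \<epsilon> n] by (simp add: pred_def)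

lemma sets_joined_less: "{\<xi>. joined r \<xi> N < n} \<in> sets P" "{\<xi>. n < joined r \<xi> N} \<in> sets P"
proof -
  have [measurable]: "(\<lambda>\<xi>. joined r \<xi> N) \<in> P \<rightarrow>\<^sub>M count_space UNIV" by measurable
  have "Measurable.pred P (\<lambda>\<xi>. joined r \<xi> N < n)" "Measurable.pred P (\<lambda>\<xi>. n < joined r \<xi> N)" by measurable
  then show "{\<xi>. joined r \<xi> N < n} \<in> sets P" "{\<xi>. n < joined r \<xi> N} \<in> sets P" by (simp_all add: pred_def)
qed

lemma joined_mono: "i \<le> j \<Longrightarrow> joined r \<xi> i \<le> joined r \<xi> j"
  unfolding joined_def by (rule sum_mono2) auto

lemma joined_pos: "r (s - 1) \<le> \<theta> \<Longrightarrow> 1 \<le> j \<Longrightarrow> 1 \<le> joined r \<xi> j"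
  using joined_mono[of 1 j r \<xi>] by (simp add: joined_def)

lemma nohit_of_maxle:
  assumes "r (s - 1) \<le> \<theta>" "maxle \<epsilon> n r \<xi>" "joined r \<xi> (Suc N) \<le> Suc n" "j \<in> {1..N}"
  shows "Y r \<xi> j \<notin> win \<epsilon>"
proof
  assume w: "Y r \<xi> j \<in> win \<epsilon>"
  then have "joined r \<xi> (Suc j) = Suc (joined r \<xi> j)" by (simp add: joined_def win_def)
  moreover have "joined r \<xi> (Suc j) \<le> joined r \<xi> (Suc N)" using assms(4) by (intro joined_mono) simp
  ultimately have "joined r \<xi> j \<le> n" using assms(3) by simp
  moreover have "1 \<le> joined r \<xi> j" using assms by (intro joined_pos) auto
  ultimately have "Y r \<xi> j (s - 1) \<le> \<theta> - \<epsilon>" using assms(2) w by (auto simp: maxle_def win_def)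
  then show False using w by (simp add: win_def)
qed

lemma maxle_of_nohit:
  assumes "\<forall>j\<in>{1..N}. Y r \<xi> j \<notin> win \<epsilon>" "Suc n \<le> joined r \<xi> (Suc N)"
  shows "maxle \<epsilon> n r \<xi>"
  unfolding maxle_def
proof (intro allI impI)
  fix j assume j: "Y r \<xi> j (s - 1) \<le> \<theta>" "1 \<le> joined r \<xi> j" "joined r \<xi> j \<le> n"
  have "1 \<le> j" using j(2) by (cases j) (auto simp: joined_def)
  moreover have "j \<le> N" using joined_mono[of "Suc N" j r \<xi>] j(3) assms(2) by (cases "j \<le> N") auto
  ultimately have "Y r \<xi> j \<notin> win \<epsilon>" using assms(1) by simp
  then show "Y r \<xi> j (s - 1) \<le> \<theta> - \<epsilon>" using j(1) by (auto simp: win_def)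
qed

lemma surv_of_maxle:
  assumes "r (s - 1) \<le> \<theta>" "maxle \<epsilon> n r \<xi>" "Suc n \<le> joined r \<xi> (Suc N)"
  shows "surv \<epsilon> N n (step r (\<xi> 0)) (\<lambda>i. \<xi> (Suc i))"
proof (rule survI)
  show "n \<le> joined (step r (\<xi> 0)) (\<lambda>i. \<xi> (Suc i)) N" using assms by (simp add: joined_Suc)
  fix j assume j: "Y (step r (\<xi> 0)) (\<lambda>i. \<xi> (Suc i)) j \<in> win \<epsilon>"
  have w: "Y r \<xi> (Suc j) \<in> win \<epsilon>" using j unfolding chain_Suc .
  have "\<not> joined r \<xi> (Suc j) \<le> n"
  proof
    assume "joined r \<xi> (Suc j) \<le> n"
    moreover have "1 \<le> joined r \<xi> (Suc j)" by (rule joined_pos) (use assms(1) in simp_all)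
    moreover have "Y r \<xi> (Suc j) (s - 1) \<le> \<theta>" using w unfolding win_def by blast
    ultimately have "Y r \<xi> (Suc j) (s - 1) \<le> \<theta> - \<epsilon>" using assms(2) unfolding maxle_def by blast
    then show False using w unfolding win_def by (simp del: chain.simps)
  qed
  then show "n \<le> joined (step r (\<xi> 0)) (\<lambda>i. \<xi> (Suc i)) j" using assms(1) by (simp add: joined_Suc)
qed

end

context stationary_queue
begin

text \<open>The long-run fraction of potential customers who join:\<close>

definition \<kappa> :: real where
  "\<kappa> = measure \<pi> {r. r (s - 1) \<le> \<theta>}"

lemma sets_joins: "{r. r (s - 1) \<le> \<theta>} \<in> sets SQ"
proof -
  have "(\<lambda>r. r (s - 1)) -` {..\<theta>} \<inter> space SQ \<in> sets SQ"
    by (rule measurable_sets[OF measurable_SQ_component]) simp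
  then show ?thesis by (simp add: vimage_def)
qed

text \<open>
  From every state the queue empties almost surely, and whoever finds it empty joins.
\<close>

lemma \<kappa>_pos: "0 < \<kappa>"
proof (rule ccontr)
  let ?D = "{r. r (s - 1) \<le> \<theta>}"
  assume "\<not> 0 < \<kappa>"
  then have "measure \<pi> ?D = 0" using measure_nonneg[of \<pi> ?D] unfolding \<kappa>_def by linarith
  then have D0: "emeasure \<pi> ?D = 0" by (simp add: \<pi>.emeasure_eq_measure)
  have [measurable]: "?D \<in> sets SQ" by (rule sets_joins)
  have *: "(\<integral>\<^sup>+r. (\<integral>\<^sup>+\<xi>. indicator ?D (Y r \<xi> j) \<partial>P) \<partial>\<pi>) = 0" for j
  proof -
    have "(\<lambda>(x, y). indicator ?D x :: ennreal) \<in> borel_measurable (SQ \<Otimes>\<^sub>M SQ)" by measurable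
    from nn_integral_lag[where h="\<lambda>x y. indicator ?D x" and i=j and k=0, OF this]
    have "(\<integral>\<^sup>+r. (\<integral>\<^sup>+\<xi>. indicator ?D (Y r \<xi> j) \<partial>P) \<partial>\<pi>) = (\<integral>\<^sup>+r. indicator ?D r \<partial>\<pi>)"
      using P.emeasure_space_1 by simp
    also have "\<dots> = emeasure \<pi> ?D" by (rule nn_integral_indicator) (simp only: sets_\<pi> sets_joins)
    finally show ?thesis using D0 by simp
  qed
  have "AE r in \<pi>. (\<integral>\<^sup>+\<xi>. indicator ?D (Y r \<xi> j) \<partial>P) = 0" for j
  proof -
    have "(\<lambda>r. \<integral>\<^sup>+\<xi>. indicator ?D (Y r \<xi> j) \<partial>P) \<in> borel_measurable \<pi>" by measurable
    then show ?thesis using *[of j] by (simp add: nn_integral_0_iff_AE)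
  qed
  then have "AE r in \<pi>. \<forall>j. (\<integral>\<^sup>+\<xi>. indicator ?D (Y r \<xi> j) \<partial>P) = 0" by (simp add: AE_all_countable)
  then have "AE r in \<pi>. False" using AE_\<pi>_good
  proof eventually_elim
    fix r assume r: "\<forall>j. (\<integral>\<^sup>+\<xi>. indicator ?D (Y r \<xi> j) \<partial>P) = 0" "good r"
    have "AE \<xi> in P. Y r \<xi> j \<notin> ?D" for j
    proof -
      have "(\<lambda>\<xi>. indicator ?D (Y r \<xi> j) :: ennreal) \<in> borel_measurable P" by measurable
      then have "AE \<xi> in P. (indicator ?D (Y r \<xi> j) :: ennreal) = 0"
        using r(1) nn_integral_0_iff_AE[of "\<lambda>\<xi>. indicator ?D (Y r \<xi> j)" P] by simp
      then show ?thesis by eventually_elim (auto simp: indicator_def split: if_splits)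
    qed
    then have "AE \<xi> in P. \<forall>j. Y r \<xi> j \<notin> ?D" by (simp add: AE_all_countable)
    then have "AE \<xi> in P. False" using AE_Y_hits_empty[OF r(2)]
    proof eventually_elim
      fix \<xi> assume a: "\<forall>j. Y r \<xi> j \<notin> ?D" "\<exists>n. Y r \<xi> n = (\<lambda>_. 0)"
      then obtain n where "Y r \<xi> n = (\<lambda>_. 0)" by blast
      then have "Y r \<xi> n \<in> ?D" using \<theta> by simp
      then show False using a(1) by blast
    qed
    then show False by (simp add: P.AE_False)
  qed
  then show False by (simp add: \<pi>.AE_False)
qed

lemma joined_eq_avg: "0 < N \<Longrightarrow> real (joined r \<xi> N) = real N * avg (indicator {r. r (s - 1) \<le> \<theta>}) N r \<xi>"
proof -
  assume "0 < N"
  have "real (joined r \<xi> N) = (\<Sum>i<N. real (if Y r \<xi> i (s - 1) \<le> \<theta> then 1 else 0))"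
    by (simp only: joined_def of_nat_sum)
  also have "\<dots> = (\<Sum>i<N. indicator {r. r (s - 1) \<le> \<theta>} (Y r \<xi> i))"
    by (intro sum.cong) (auto simp: indicator_def)
  finally show ?thesis using \<open>0 < N\<close> by (simp add: avg_def)
qed

lemma lln_joined:
  assumes "good y" "0 < N" "0 < e"
  shows "P.prob {\<xi>. e \<le> \<bar>real (joined y \<xi> N) / real N - \<kappa>\<bar>} \<le> lln_err y N / e"
proof -
  have "P.prob {\<xi>. e \<le> \<bar>avg (indicator {r. r (s - 1) \<le> \<theta>}) N y \<xi> - (LINT r|\<pi>. indicator {r. r (s - 1) \<le> \<theta>} r)\<bar>} \<le> lln_err y N / e"
    by (rule lln_prob) (use assms sets_joins in \<open>auto simp: indicator_def intro: borel_measurable_indicator\<close>)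
  moreover have "(LINT r|\<pi>. indicator {r. r (s - 1) \<le> \<theta>} r) = \<kappa>"
    using sets_joins by (simp add: \<kappa>_def sets_\<pi>)
  moreover have "avg (indicator {r. r (s - 1) \<le> \<theta>}) N y \<xi> = real (joined y \<xi> N) / real N" for \<xi>
    using joined_eq_avg[OF assms(2), of y \<xi>] assms(2) by simp
  ultimately show ?thesis by simp
qed

lemma sets_joined_dev: "{\<xi>. e \<le> \<bar>real (joined y \<xi> N) / real N - \<kappa>\<bar>} \<in> sets P"
proof -
  have [measurable]: "(\<lambda>\<xi>. real (joined y \<xi> N)) \<in> borel_measurable P"
    by (rule measurable_compose[OF measurable_joined]) simp_all
  have "Measurable.pred P (\<lambda>\<xi>. e \<le> \<bar>real (joined y \<xi> N) / real N - \<kappa>\<bar>)" by measurable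
  then show ?thesis by (simp add: pred_def)
qed

lemma joined_less_tendsto_0:
  assumes y: "good y" and N: "filterlim N at_top sequentially" "\<And>n. 0 < N n"
    and lim: "(\<lambda>n. real (k n) / real (N n)) \<longlonglongrightarrow> a" and a: "a < \<kappa>"
  shows "(\<lambda>n. P.prob {\<xi>. joined y \<xi> (N n) < k n}) \<longlonglongrightarrow> 0"
proof (rule real_tendsto_sandwich[where f="\<lambda>_. 0"])
  define e where "e = (\<kappa> - a) / 2"
  have e: "0 < e" using a by (simp add: e_def)
  show "(\<lambda>n. lln_err y (N n) / e) \<longlonglongrightarrow> 0"
    using tendsto_divide[OF filterlim_compose[OF lln_err_tendsto_0 N(1)] tendsto_const, of e y] e by simp
  have "eventually (\<lambda>n. real (k n) / real (N n) < \<kappa> - e) sequentially"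
    using lim by (rule order_tendstoD(2)) (use e in \<open>simp add: e_def field_simps\<close>)
  then show "\<forall>\<^sub>F n in sequentially. P.prob {\<xi>. joined y \<xi> (N n) < k n} \<le> lln_err y (N n) / e"
  proof eventually_elim
    fix n assume n: "real (k n) / real (N n) < \<kappa> - e"
    have "P.prob {\<xi>. joined y \<xi> (N n) < k n} \<le> P.prob {\<xi>. e \<le> \<bar>real (joined y \<xi> (N n)) / real (N n) - \<kappa>\<bar>}"
    proof (rule P.finite_measure_mono[OF _ sets_joined_dev], safe)
      fix \<xi> assume "joined y \<xi> (N n) < k n"
      then have "real (joined y \<xi> (N n)) / real (N n) \<le> real (k n) / real (N n)" by (intro divide_right_mono) auto
      with n show "e \<le> \<bar>real (joined y \<xi> (N n)) / real (N n) - \<kappa>\<bar>" by linarith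
    qed
    also have "\<dots> \<le> lln_err y (N n) / e" by (rule lln_joined[OF y N(2) e])
    finally show "P.prob {\<xi>. joined y \<xi> (N n) < k n} \<le> lln_err y (N n) / e" .
  qed
qed (auto intro: tendsto_const)

lemma joined_greater_tendsto_0:
  assumes y: "good y" and N: "filterlim N at_top sequentially" "\<And>n. 0 < N n"
    and lim: "(\<lambda>n. real (k n) / real (N n)) \<longlonglongrightarrow> a" and a: "\<kappa> < a"
  shows "(\<lambda>n. P.prob {\<xi>. k n < joined y \<xi> (N n)}) \<longlonglongrightarrow> 0"
proof (rule real_tendsto_sandwich[where f="\<lambda>_. 0"])
  define e where "e = (a - \<kappa>) / 2"
  have e: "0 < e" using a by (simp add: e_def)
  show "(\<lambda>n. lln_err y (N n) / e) \<longlonglongrightarrow> 0"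
    using tendsto_divide[OF filterlim_compose[OF lln_err_tendsto_0 N(1)] tendsto_const, of e y] e by simp
  have "eventually (\<lambda>n. \<kappa> + e < real (k n) / real (N n)) sequentially"
    using lim by (rule order_tendstoD(1)) (use e in \<open>simp add: e_def field_simps\<close>)
  then show "\<forall>\<^sub>F n in sequentially. P.prob {\<xi>. k n < joined y \<xi> (N n)} \<le> lln_err y (N n) / e"
  proof eventually_elim
    fix n assume n: "\<kappa> + e < real (k n) / real (N n)"
    have "P.prob {\<xi>. k n < joined y \<xi> (N n)} \<le> P.prob {\<xi>. e \<le> \<bar>real (joined y \<xi> (N n)) / real (N n) - \<kappa>\<bar>}"
    proof (rule P.finite_measure_mono[OF _ sets_joined_dev], safe)
      fix \<xi> assume "k n < joined y \<xi> (N n)"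
      then have "real (k n) / real (N n) \<le> real (joined y \<xi> (N n)) / real (N n)" by (intro divide_right_mono) auto
      with n show "e \<le> \<bar>real (joined y \<xi> (N n)) / real (N n) - \<kappa>\<bar>" by linarith
    qed
    also have "\<dots> \<le> lln_err y (N n) / e" by (rule lln_joined[OF y N(2) e])
    finally show "P.prob {\<xi>. k n < joined y \<xi> (N n)} \<le> lln_err y (N n) / e" .
  qed
qed (auto intro: tendsto_const)

lemma AE_joined_unbounded: assumes "good y" shows "AE \<xi> in P. \<forall>n. \<exists>N. n \<le> joined y \<xi> N"
proof -
  have "AE \<xi> in P. \<exists>N. n \<le> joined y \<xi> N" for n
  proof -
    let ?B = "{\<xi>. \<forall>N. joined y \<xi> N < n}"
    have l: "(\<lambda>N. P.prob {\<xi>. joined y \<xi> (Suc N) < n}) \<longlonglongrightarrow> 0"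
    proof (rule joined_less_tendsto_0[OF assms])
      show "filterlim Suc at_top sequentially" by (rule filterlim_Suc)
      show "(\<lambda>N. real n / real (Suc N)) \<longlonglongrightarrow> 0" by (rule LIMSEQ_Suc[OF lim_const_over_n])
    qed (simp_all add: \<kappa>_pos)
    have "P.prob ?B \<le> 0"
      by (rule LIMSEQ_le_const[OF l]) (auto intro!: exI[of _ 0] P.finite_measure_mono sets_joined_less)
    moreover have B: "?B \<in> sets P"
    proof -
      have [measurable]: "Measurable.pred P (\<lambda>\<xi>. joined y \<xi> N < n)" for N using sets_joined_less(1) by (simp add: pred_def)
      have "Measurable.pred P (\<lambda>\<xi>. \<forall>N. joined y \<xi> N < n)" by measurable
      then show ?thesis by (simp add: pred_def)
    qed
    ultimately have "?B \<in> null_sets P" by (auto simp: null_sets_def P.emeasure_eq_measure measure_le_0_iff)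
    then have "AE \<xi> in P. \<xi> \<notin> ?B" by (rule AE_not_in)
    then show ?thesis by eventually_elim (auto simp: not_less)
  qed
  then show ?thesis by (simp add: AE_all_countable)
qed

text \<open>
  The survival bound for \<open>N\<close> potential customers does not depend on \<open>N\<close>; letting \<open>N\<close> grow removes the condition
  that \<open>n\<close> of them join.
\<close>

lemma maxle_tail:
  obtains a C where "0 < (a::real)" "1 \<le> (C::real)"
    "\<And>\<epsilon> n y. 0 < \<epsilon> \<Longrightarrow> \<epsilon> \<le> \<theta> \<Longrightarrow> good y \<Longrightarrow> y (s - 1) \<le> \<theta> \<Longrightarrow>
      P.prob {\<xi>. maxle \<epsilon> n y \<xi>} \<le> C * exp (- (a * (\<epsilon> * real n)))"
proof -
  obtain m c where m: "0 < (m::nat)" and c: "0 < (c::real)" "c \<le> 1"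
    and sv: "\<And>\<epsilon> j N n r. 0 < \<epsilon> \<Longrightarrow> \<epsilon> \<le> \<theta> \<Longrightarrow> good r \<Longrightarrow> j * m \<le> n \<Longrightarrow>
      sv \<epsilon> N n r \<le> ennreal ((1 - c * (1 - exp (- (lam * \<epsilon>)))) ^ j)"
    by (rule sv_tail) blast
  \<comment> \<open>For \<open>\<epsilon> \<le> \<theta>\<close> the survival factor satisfies \<open>1 - c * (1 - exp (- lam * \<epsilon>)) \<le> exp (- a0 * \<epsilon>)\<close>.\<close>
  define a0 where "a0 = c * (lam * exp (- (lam * \<theta>)))"
  have a0: "0 < a0" using c lam by (simp add: a0_def)
  show ?thesis
  proof (rule that[of "a0 / real m" "exp (a0 * \<theta>)"])
    show "0 < a0 / real m" using a0 m by simp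
    show "1 \<le> exp (a0 * \<theta>)" using a0 \<theta> by simp
    fix \<epsilon> n y assume \<epsilon>: "0 < \<epsilon>" "\<epsilon> \<le> \<theta>" and y: "good y" "y (s - 1) \<le> \<theta>"
    define j where "j = n div m"
    define q where "q = 1 - exp (- (lam * \<epsilon>))"
    have q: "0 < q" "q \<le> 1" using \<epsilon> lam by (auto simp: q_def)
    let ?b = "(1 - c * q) ^ j"
    have b: "0 \<le> 1 - c * q" using c q by (simp add: mult_le_one)
    have le: "P.prob {\<xi>. maxle \<epsilon> n y \<xi>} \<le> ?b + P.prob {\<xi>. joined y \<xi> (Suc N) < Suc n}" for N
    proof -
      let ?S = "{\<xi>. surv \<epsilon> N n (step y (\<xi> 0)) (\<lambda>i. \<xi> (Suc i))}"
      have "(\<lambda>\<xi>. \<xi> 0) \<in> P \<rightarrow>\<^sub>M \<nu>" by (rule measurable_component_singleton) simp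
      then have [measurable]: "(\<lambda>\<xi>. step y (\<xi> 0)) \<in> P \<rightarrow>\<^sub>M SQ" by (intro measurable_step) (simp_all add: measurable_\<nu>)
      have S: "?S \<in> sets P"
        using measurable_surv[of "\<lambda>\<xi>. step y (\<xi> 0)" P "\<lambda>\<xi> i. \<xi> (Suc i)" \<epsilon> N n] by (simp add: pred_def)
      have "emeasure P ?S = (\<integral>\<^sup>+\<xi>. indicator ?S \<xi> \<partial>P)" using S by simp
      also have "\<dots> = (\<integral>\<^sup>+x. (\<integral>\<^sup>+\<xi>. indicator ?S (case_nat x \<xi>) \<partial>P) \<partial>\<nu>)"
        by (rule inp.nn_integral_first_step) (use S in simp)
      also have "\<dots> = (\<integral>\<^sup>+x. sv \<epsilon> N n (step y x) \<partial>\<nu>)"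
      proof (rule nn_integral_cong)
        fix x
        have "(\<integral>\<^sup>+\<xi>. indicator ?S (case_nat x \<xi>) \<partial>P) = (\<integral>\<^sup>+\<xi>. indicator {\<xi>. surv \<epsilon> N n (step y x) \<xi>} \<xi> \<partial>P)"
          by (simp add: indicator_def)
        then show "(\<integral>\<^sup>+\<xi>. indicator ?S (case_nat x \<xi>) \<partial>P) = sv \<epsilon> N n (step y x)"
          using sets_surv by (simp add: sv_def)
      qed
      also have "\<dots> \<le> (\<integral>\<^sup>+x. ennreal ?b \<partial>\<nu>)"
        unfolding q_def by (intro nn_integral_mono sv \<epsilon> good_qstep y) (simp add: j_def)
      also have "\<dots> = ennreal ?b" using \<nu>.emeasure_space_1 by simp
      finally have "P.prob ?S \<le> ?b" using b by (simp add: P.emeasure_eq_measure)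
      moreover have "P.prob {\<xi>. maxle \<epsilon> n y \<xi>} \<le> P.prob (?S \<union> {\<xi>. joined y \<xi> (Suc N) < Suc n})"
      proof (rule P.finite_measure_mono)
        show "{\<xi>. maxle \<epsilon> n y \<xi>} \<subseteq> ?S \<union> {\<xi>. joined y \<xi> (Suc N) < Suc n}"
          using surv_of_maxle[where r=y, OF y(2)] by (auto simp: not_less)
        show "?S \<union> {\<xi>. joined y \<xi> (Suc N) < Suc n} \<in> sets P" using S sets_joined_less(1) by blast
      qed
      moreover have "P.prob (?S \<union> {\<xi>. joined y \<xi> (Suc N) < Suc n}) \<le> P.prob ?S + P.prob {\<xi>. joined y \<xi> (Suc N) < Suc n}"
        by (rule measure_Un_le[OF S sets_joined_less(1)])
      ultimately show ?thesis by linarith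
    qed
    have "(\<lambda>N. P.prob {\<xi>. joined y \<xi> (Suc N) < Suc n}) \<longlonglongrightarrow> 0"
    proof (rule joined_less_tendsto_0[OF y(1)])
      show "filterlim Suc at_top sequentially" by (rule filterlim_Suc)
      show "(\<lambda>N. real (Suc n) / real (Suc N)) \<longlonglongrightarrow> 0" by (rule LIMSEQ_Suc[OF lim_const_over_n])
    qed (simp_all add: \<kappa>_pos)
    from tendsto_add[OF tendsto_const[of ?b] this]
    have "(\<lambda>N. ?b + P.prob {\<xi>. joined y \<xi> (Suc N) < Suc n}) \<longlonglongrightarrow> ?b" by simp
    then have "P.prob {\<xi>. maxle \<epsilon> n y \<xi>} \<le> ?b" by (rule LIMSEQ_le_const) (use le in blast)
    also have "?b \<le> exp (- (c * q)) ^ j"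
      using b exp_ge_add_one_self[of "- (c * q)"] by (intro power_mono) auto
    also have "\<dots> = exp (- (c * q * real j))" by (simp add: exp_of_nat_mult[symmetric] mult.commute)
    also have "\<dots> \<le> exp (- (a0 * \<epsilon> * (real n / real m - 1)))"
    proof -
      have "lam * \<epsilon> * exp (- (lam * \<epsilon>)) \<le> q"
      proof -
        have "1 + lam * \<epsilon> \<le> exp (lam * \<epsilon>)" by (rule exp_ge_add_one_self)
        then have "(1 + lam * \<epsilon>) * exp (- (lam * \<epsilon>)) \<le> exp (lam * \<epsilon>) * exp (- (lam * \<epsilon>))"
          by (rule mult_right_mono) simp
        also have "exp (lam * \<epsilon>) * exp (- (lam * \<epsilon>)) = 1" by (simp add: exp_add[symmetric])
        finally show ?thesis unfolding q_def by (simp add: algebra_simps)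
      qed
      moreover have "lam * \<epsilon> * exp (- (lam * \<theta>)) \<le> lam * \<epsilon> * exp (- (lam * \<epsilon>))"
        using lam \<epsilon> by (intro mult_left_mono) auto
      ultimately have "lam * \<epsilon> * exp (- (lam * \<theta>)) \<le> q" by linarith
      then have "c * (lam * \<epsilon> * exp (- (lam * \<theta>))) \<le> c * q" using c by (intro mult_left_mono) auto
      then have "a0 * \<epsilon> \<le> c * q" by (simp add: a0_def mult_ac)
      then have 1: "a0 * \<epsilon> * real j \<le> c * q * real j" by (rule mult_right_mono) simp
      have "real n / real m - 1 \<le> real j"
      proof -
        have "n = j * m + n mod m" by (simp add: j_def)
        moreover have "n mod m < m" using m by simp
        ultimately have "n \<le> j * m + m" by linarith
        then have "real n \<le> real j * real m + real m" by (metis of_nat_add of_nat_le_iff of_nat_mult)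
        then show ?thesis using m by (simp add: field_simps)
      qed
      then have "a0 * \<epsilon> * (real n / real m - 1) \<le> a0 * \<epsilon> * real j" using a0 \<epsilon> by (intro mult_left_mono) auto
      with 1 show ?thesis by simp
    qed
    also have "\<dots> = exp (a0 * \<epsilon>) * exp (- (a0 / real m * (\<epsilon> * real n)))"
      by (simp add: exp_add[symmetric] algebra_simps)
    also have "\<dots> \<le> exp (a0 * \<theta>) * exp (- (a0 / real m * (\<epsilon> * real n)))"
      using a0 \<epsilon> by (intro mult_right_mono) auto
    finally show "P.prob {\<xi>. maxle \<epsilon> n y \<xi>} \<le> exp (a0 * \<theta>) * exp (- (a0 / real m * (\<epsilon> * real n)))" .
  qed
qed

end

text \<open>
  All that the limit law depends on is the density of the stationary waiting time immediately to the left of \<open>\<theta>\<close>.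
\<close>

locale window_density = stationary_queue s \<theta> lam G M R T S for s \<theta> lam G and M :: "'a measure" and R T S +
  fixes v0 :: real
  assumes v0: "((\<lambda>\<epsilon>. measure \<pi> (win \<epsilon>) / \<epsilon>) \<longlongrightarrow> v0) (at_right 0)"
begin

text \<open>
  A window of width \<open>x / n\<close> is hit by one of \<open>b * n\<close> potential customers at total rate \<open>b * x * v0\<close>.
\<close>

lemma nohit_tendsto:
  assumes y: "good y" and x: "0 < x" and b: "0 < b"
  defines "N \<equiv> blk b"
  shows "(\<lambda>n. P.prob {\<xi>. \<forall>j\<in>{1..N n}. Y y \<xi> j \<notin> win (x / real n)}) \<longlonglongrightarrow> exp (- (b * x * v0))"
proof -
  define \<epsilon> where "\<epsilon> n = x / real n" for n
  have \<epsilon>0: "\<epsilon> \<longlonglongrightarrow> 0" unfolding \<epsilon>_def by (rule lim_const_over_n)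
  have \<epsilon>pos: "\<forall>\<^sub>F n in sequentially. 0 < \<epsilon> n"
    using eventually_gt_at_top[of 0] by eventually_elim (use x in \<open>simp add: \<epsilon>_def\<close>)
  have ratio: "(\<lambda>n. real (N n) / real n) \<longlonglongrightarrow> b" unfolding N_def by (rule blk_ratio[OF b])
  have Ntop: "filterlim N at_top sequentially" unfolding N_def by (rule blk_top[OF b])
  have \<epsilon>N: "(\<lambda>n. \<epsilon> n * real (N n)) \<longlonglongrightarrow> x * b"
    using tendsto_mult[OF tendsto_const[of x] ratio] by (simp add: \<epsilon>_def)
  have win: "(\<lambda>n. measure \<pi> (win (\<epsilon> n)) / \<epsilon> n) \<longlonglongrightarrow> v0"
  proof (rule filterlim_compose[OF v0])
    show "filterlim \<epsilon> (at_right 0) sequentially"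
      unfolding filterlim_at using \<epsilon>0 \<epsilon>pos by (auto elim: eventually_mono)
  qed
  have "(\<lambda>n. \<epsilon> n * real (N n) * (measure \<pi> (win (\<epsilon> n)) / \<epsilon> n)) \<longlonglongrightarrow> x * b * v0"
    by (rule tendsto_mult[OF \<epsilon>N win])
  moreover have "\<forall>\<^sub>F n in sequentially. \<epsilon> n * real (N n) * (measure \<pi> (win (\<epsilon> n)) / \<epsilon> n) = real (N n) * measure \<pi> (win (\<epsilon> n))"
    using \<epsilon>pos by eventually_elim simp
  ultimately have "(\<lambda>n. real (N n) * measure \<pi> (win (\<epsilon> n))) \<longlonglongrightarrow> x * b * v0"
    by (rule Lim_transform_eventually)
  then have main: "(\<lambda>n. exp (- (real (N n) * measure \<pi> (win (\<epsilon> n))))) \<longlonglongrightarrow> exp (- (x * b * v0))"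
    by (intro tendsto_exp tendsto_minus)
  define err where "err n = exp (lam * (\<epsilon> n * real (N n))) * (lam * (\<epsilon> n * real (N n))) * (2 * (lam * \<epsilon> n) + lln_err y (N n))" for n
  have "err \<longlonglongrightarrow> exp (lam * (x * b)) * (lam * (x * b)) * (2 * (lam * 0) + 0)"
    unfolding err_def by (intro tendsto_intros \<epsilon>N \<epsilon>0 filterlim_compose[OF lln_err_tendsto_0 Ntop])
  then have err: "err \<longlonglongrightarrow> 0" by simp
  have e1: "\<forall>\<^sub>F n in sequentially. \<epsilon> n < \<theta>" using \<epsilon>0 \<theta> by (rule order_tendstoD(2))
  have e2: "\<forall>\<^sub>F n in sequentially. lam * \<epsilon> n < 1 / 2"
    by (rule order_tendstoD(2)[OF tendsto_mult[OF tendsto_const[of lam] \<epsilon>0]]) simp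
  have "(\<lambda>n. P.prob {\<xi>. \<forall>j\<in>{1..N n}. Y y \<xi> j \<notin> win (\<epsilon> n)} - exp (- (real (N n) * measure \<pi> (win (\<epsilon> n))))) \<longlonglongrightarrow> 0"
  proof (rule Lim_null_comparison[OF _ err])
    show "\<forall>\<^sub>F n in sequentially. norm (P.prob {\<xi>. \<forall>j\<in>{1..N n}. Y y \<xi> j \<notin> win (\<epsilon> n)}
      - exp (- (real (N n) * measure \<pi> (win (\<epsilon> n))))) \<le> err n"
      using \<epsilon>pos e1 e2
    proof eventually_elim
      fix n assume "0 < \<epsilon> n" "\<epsilon> n < \<theta>" "lam * \<epsilon> n < 1 / 2"
      then show "norm (P.prob {\<xi>. \<forall>j\<in>{1..N n}. Y y \<xi> j \<notin> win (\<epsilon> n)}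
        - exp (- (real (N n) * measure \<pi> (win (\<epsilon> n))))) \<le> err n"
        using poisson_approximation[of "\<epsilon> n" "N n" y] y by (simp add: err_def N_def blk_def mult.assoc)
    qed
  qed
  from tendsto_add[OF this main] show ?thesis by (simp add: \<epsilon>_def mult_ac)
qed

end

lemma blk_ratio':
  assumes "0 < b"
  shows "(\<lambda>n. real (Suc n) / real (Suc (blk b n))) \<longlonglongrightarrow> 1 / b"
    and "(\<lambda>n. real n / real (blk b n)) \<longlonglongrightarrow> 1 / b"
proof -
  have 0: "\<forall>\<^sub>F n in sequentially. 0 < (n::nat)" by (rule eventually_gt_at_top)
  have "(\<lambda>n. (1 + 1 / real n) / (real (blk b n) / real n + 1 / real n)) \<longlonglongrightarrow> (1 + 0) / (b + 0)"
    using assms by (intro tendsto_intros blk_ratio lim_const_over_n) auto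
  moreover have "\<forall>\<^sub>F n in sequentially. (1 + 1 / real n) / (real (blk b n) / real n + 1 / real n) = real (Suc n) / real (Suc (blk b n))"
    using 0
  proof eventually_elim
    fix n :: nat assume "0 < n"
    then have "1 + 1 / real n = real (Suc n) / real n"
      "real (blk b n) / real n + 1 / real n = real (Suc (blk b n)) / real n" by (auto simp: field_simps)
    then show "(1 + 1 / real n) / (real (blk b n) / real n + 1 / real n) = real (Suc n) / real (Suc (blk b n))"
      using \<open>0 < n\<close> by simp
  qed
  ultimately show "(\<lambda>n. real (Suc n) / real (Suc (blk b n))) \<longlonglongrightarrow> 1 / b"
    by (auto intro: Lim_transform_eventually)
  have "(\<lambda>n. 1 / (real (blk b n) / real n)) \<longlonglongrightarrow> 1 / b"
    using assms by (intro tendsto_intros blk_ratio) auto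
  then show "(\<lambda>n. real n / real (blk b n)) \<longlonglongrightarrow> 1 / b" by simp
qed

context window_density
begin

text \<open>
  Among the first \<open>b * n\<close> potential customers there are more or fewer than \<open>n\<close> who join, with
  probability tending to 1, according to whether \<open>b\<close> exceeds \<open>1 / \<kappa>\<close>.
\<close>

lemma maxle_tendsto:
  assumes y: "good y" "y (s - 1) \<le> \<theta>" and x: "0 < x"
  shows "(\<lambda>n. P.prob {\<xi>. maxle (x / real n) n y \<xi>}) \<longlonglongrightarrow> exp (- (v0 * x / \<kappa>))"
proof -
  let ?L = "\<lambda>b. exp (- (b * x * v0))"
  let ?p = "\<lambda>n. P.prob {\<xi>. maxle (x / real n) n y \<xi>}"
  let ?H = "\<lambda>b n. {\<xi>. \<forall>j\<in>{1..blk b n}. Y y \<xi> j \<notin> win (x / real n)}"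
  have L: "?L (1 / \<kappa>) = exp (- (v0 * x / \<kappa>))" by (simp add: mult.commute)
  have cont: "((\<lambda>b. ?L b) \<longlongrightarrow> ?L (1 / \<kappa>)) (at (1 / \<kappa>))" by (intro tendsto_intros)
  have k: "0 < 1 / \<kappa>" using \<kappa>_pos by simp
  have Sblk: "filterlim (\<lambda>n. Suc (blk b n)) at_top sequentially" if "0 < b" for b
    by (rule filterlim_compose[OF filterlim_Suc blk_top[OF that]])
  have "?p \<longlonglongrightarrow> ?L (1 / \<kappa>)"
  proof (rule order_tendstoI)
    \<comment> \<open>Lower bound: with \<open>b > 1 / \<kappa>\<close> the potential customers considered include the first \<open>n\<close> who join.\<close>
    fix a assume "a < ?L (1 / \<kappa>)"
    moreover have "((\<lambda>b. ?L b) \<longlongrightarrow> ?L (1 / \<kappa>)) (at_right (1 / \<kappa>))"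
      by (rule filterlim_mono[OF cont order_refl at_le]) simp
    ultimately have "\<forall>\<^sub>F b in at_right (1 / \<kappa>). a < ?L b" by (rule order_tendstoD(1)[rotated])
    then obtain b where b: "1 / \<kappa> < b" "a < ?L b"
      unfolding eventually_at_right_field by (metis dense)
    have b0: "0 < b" using b k by linarith
    have "(\<lambda>n. P.prob (?H b n) - P.prob {\<xi>. joined y \<xi> (Suc (blk b n)) < Suc n}) \<longlonglongrightarrow> ?L b - 0"
    proof (intro tendsto_diff nohit_tendsto[OF y(1) x b0] joined_less_tendsto_0[OF y(1) Sblk[OF b0] _ blk_ratio'(1)[OF b0]])
      show "1 / b < \<kappa>" using b \<kappa>_pos b0 by (simp add: field_simps)
    qed simp
    then have "\<forall>\<^sub>F n in sequentially. a < P.prob (?H b n) - P.prob {\<xi>. joined y \<xi> (Suc (blk b n)) < Suc n}"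
      using b(2) by (intro order_tendstoD(1)) auto
    then show "\<forall>\<^sub>F n in sequentially. a < ?p n"
    proof eventually_elim
      fix n assume n: "a < P.prob (?H b n) - P.prob {\<xi>. joined y \<xi> (Suc (blk b n)) < Suc n}"
      have "P.prob (?H b n) \<le> P.prob ({\<xi>. maxle (x / real n) n y \<xi>} \<union> {\<xi>. joined y \<xi> (Suc (blk b n)) < Suc n})"
      proof (rule P.finite_measure_mono)
        show "?H b n \<subseteq> {\<xi>. maxle (x / real n) n y \<xi>} \<union> {\<xi>. joined y \<xi> (Suc (blk b n)) < Suc n}"
          using maxle_of_nohit[where r=y and N="blk b n" and n=n] by (auto simp: not_less)
        show "{\<xi>. maxle (x / real n) n y \<xi>} \<union> {\<xi>. joined y \<xi> (Suc (blk b n)) < Suc n} \<in> sets P"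
          using sets_maxle sets_joined_less(1) by blast
      qed
      also have "\<dots> \<le> ?p n + P.prob {\<xi>. joined y \<xi> (Suc (blk b n)) < Suc n}"
        by (rule measure_Un_le[OF sets_maxle sets_joined_less(1)])
      finally show "a < ?p n" using n by linarith
    qed
  next
    \<comment> \<open>Upper bound: with \<open>b < 1 / \<kappa>\<close> those of them who join are among the first \<open>n\<close>.\<close>
    fix a assume "?L (1 / \<kappa>) < a"
    moreover have "((\<lambda>b. ?L b) \<longlongrightarrow> ?L (1 / \<kappa>)) (at_left (1 / \<kappa>))"
      by (rule filterlim_mono[OF cont order_refl at_le]) simp
    ultimately have "\<forall>\<^sub>F b in at_left (1 / \<kappa>). ?L b < a" by (rule order_tendstoD(2)[rotated])
    then obtain b' where b': "b' < 1 / \<kappa>" "\<And>b. b' < b \<Longrightarrow> b < 1 / \<kappa> \<Longrightarrow> ?L b < a"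
      unfolding eventually_at_left_field by blast
    obtain b where b: "max 0 b' < b" "b < 1 / \<kappa>" using dense[of "max 0 b'" "1 / \<kappa>"] b'(1) k by auto
    have b0: "0 < b" and La: "?L b < a" using b b'(2)[of b] by auto
    have "(\<lambda>n. P.prob (?H b n) + P.prob {\<xi>. Suc n < joined y \<xi> (Suc (blk b n))}) \<longlonglongrightarrow> ?L b + 0"
    proof (intro tendsto_add nohit_tendsto[OF y(1) x b0] joined_greater_tendsto_0[OF y(1) Sblk[OF b0] _ blk_ratio'(1)[OF b0]])
      show "\<kappa> < 1 / b" using b \<kappa>_pos b0 by (simp add: field_simps)
    qed simp
    then have "\<forall>\<^sub>F n in sequentially. P.prob (?H b n) + P.prob {\<xi>. Suc n < joined y \<xi> (Suc (blk b n))} < a"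
      using La by (intro order_tendstoD(2)) auto
    then show "\<forall>\<^sub>F n in sequentially. ?p n < a"
    proof eventually_elim
      fix n assume n: "P.prob (?H b n) + P.prob {\<xi>. Suc n < joined y \<xi> (Suc (blk b n))} < a"
      have "?p n \<le> P.prob (?H b n \<union> {\<xi>. Suc n < joined y \<xi> (Suc (blk b n))})"
      proof (rule P.finite_measure_mono)
        show "{\<xi>. maxle (x / real n) n y \<xi>} \<subseteq> ?H b n \<union> {\<xi>. Suc n < joined y \<xi> (Suc (blk b n))}"
        proof
          fix \<xi> assume m: "\<xi> \<in> {\<xi>. maxle (x / real n) n y \<xi>}"
          show "\<xi> \<in> ?H b n \<union> {\<xi>. Suc n < joined y \<xi> (Suc (blk b n))}"
          proof (cases "joined y \<xi> (Suc (blk b n)) \<le> Suc n")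
            case True
            then have "\<xi> \<in> ?H b n" using nohit_of_maxle[where r=y and \<xi>=\<xi> and n=n, OF y(2)] m by blast
            then show ?thesis by blast
          next
            case False
            then show ?thesis by simp
          qed
        qed
        show "?H b n \<union> {\<xi>. Suc n < joined y \<xi> (Suc (blk b n))} \<in> sets P"
          using sets_nohit sets_joined_less(2) by blast
      qed
      also have "\<dots> \<le> P.prob (?H b n) + P.prob {\<xi>. Suc n < joined y \<xi> (Suc (blk b n))}"
        by (rule measure_Un_le[OF sets_nohit sets_joined_less(2)])
      finally show "?p n < a" using n by linarith
    qed
  qed
  then show ?thesis by (simp only: L)
qed

text \<open>Without mass below \<open>\<theta>\<close> the limit would be degenerate, against the exponential tail.\<close>

lemma v0_pos: "0 < v0"
proof (rule ccontr)
  assume "\<not> 0 < v0"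
  obtain a C where a: "0 < (a::real)" and C: "1 \<le> (C::real)"
    and tail: "\<And>\<epsilon> n y. 0 < \<epsilon> \<Longrightarrow> \<epsilon> \<le> \<theta> \<Longrightarrow> good y \<Longrightarrow> y (s - 1) \<le> \<theta> \<Longrightarrow>
      P.prob {\<xi>. maxle \<epsilon> n y \<xi>} \<le> C * exp (- (a * (\<epsilon> * real n)))"
    by (rule maxle_tail) blast
  \<comment> \<open>At this \<open>x\<close> the tail bound is \<open>exp (- 1)\<close>.\<close>
  define x where "x = (ln C + 1) / a"
  have x: "0 < x" using a C by (simp add: x_def add_nonneg_pos)
  have g: "good (\<lambda>_. 0)" "(\<lambda>_::nat. 0::real) (s - 1) \<le> \<theta>" using good_zero \<theta> by auto
  have "(\<lambda>n. P.prob {\<xi>. maxle (x / real n) n (\<lambda>_. 0) \<xi>}) \<longlonglongrightarrow> exp (- (v0 * x / \<kappa>))"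
    by (rule maxle_tendsto[OF g x])
  moreover have "\<forall>\<^sub>F n in sequentially. P.prob {\<xi>. maxle (x / real n) n (\<lambda>_. 0) \<xi>} \<le> C * exp (- (a * x))"
  proof -
    have "\<forall>\<^sub>F n in sequentially. x / real n < \<theta>"
      using lim_const_over_n[of x] \<theta> by (rule order_tendstoD(2))
    then show ?thesis using eventually_gt_at_top[of 0]
    proof eventually_elim
      fix n :: nat assume n: "x / real n < \<theta>" "0 < n"
      then show "P.prob {\<xi>. maxle (x / real n) n (\<lambda>_. 0) \<xi>} \<le> C * exp (- (a * x))"
        using tail[of "x / real n" "\<lambda>_. 0" n] g x by simp
    qed
  qed
  ultimately have "exp (- (v0 * x / \<kappa>)) \<le> C * exp (- (a * x))"
    by (rule tendsto_upperbound) simp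
  moreover have "C * exp (- (a * x)) = exp (- 1)"
  proof -
    have "a * x = ln C + 1" using a by (simp add: x_def)
    then have "C * exp (- (a * x)) = C * (exp (- ln C) * exp (- 1))" by (simp add: exp_add[symmetric] algebra_simps)
    then show ?thesis using C by (simp add: exp_minus)
  qed
  moreover have "1 \<le> exp (- (v0 * x / \<kappa>))"
    using \<open>\<not> 0 < v0\<close> x \<kappa>_pos by (simp add: divide_nonpos_pos mult_nonpos_nonneg)
  ultimately show False by simp
qed

end

section \<open>From the observed customers to the chain\<close>

lemma card_enumerate:
  fixes J :: "nat set"
  assumes "infinite J"
  shows "card {i \<in> J. i < enumerate J k} = k"
proof -
  have "{i \<in> J. i < enumerate J k} = enumerate J ` {..<k}"
  proof
    show "{i \<in> J. i < enumerate J k} \<subseteq> enumerate J ` {..<k}"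
    proof
      fix i assume i: "i \<in> {i \<in> J. i < enumerate J k}"
      then obtain l where l: "enumerate J l = i" using enumerate_Ex[OF assms, of i] by auto
      then have "l < k" using i assms enumerate_mono_iff by auto
      then show "i \<in> enumerate J ` {..<k}" using l by auto
    qed
    show "enumerate J ` {..<k} \<subseteq> {i \<in> J. i < enumerate J k}"
      using assms by (auto simp: enumerate_in_set enumerate_mono)
  qed
  moreover have "inj_on (enumerate J) {..<k}"
    by (rule strict_mono_imp_inj_on[OF strict_mono_enumerate[OF assms]])
  ultimately show ?thesis by (simp add: card_image)
qed

lemma measurable_enumerate:
  fixes J :: "'a \<Rightarrow> nat set"
  assumes "\<And>k. Measurable.pred M (\<lambda>\<omega>. k \<in> J \<omega>)"
  shows "(\<lambda>\<omega>. enumerate (J \<omega>) n) \<in> M \<rightarrow>\<^sub>M count_space UNIV"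
  using assms
proof (induction n arbitrary: J)
  case 0
  note [measurable] = 0
  show ?case unfolding enumerate_0 by measurable
next
  case (Suc n)
  note [measurable] = Suc.prems
  have "Measurable.pred M (\<lambda>\<omega>. k \<in> J \<omega> - {LEAST l. l \<in> J \<omega>})" for k
  proof -
    have [measurable]: "(\<lambda>\<omega>. LEAST l. l \<in> J \<omega>) \<in> M \<rightarrow>\<^sub>M count_space UNIV" by measurable
    have "Measurable.pred M (\<lambda>\<omega>. k \<in> J \<omega> \<and> k \<noteq> (LEAST l. l \<in> J \<omega>))" by measurable
    then show ?thesis by simp
  qed
  from Suc.IH[OF this] show ?case by (simp add: enumerate_Suc)
qed

locale observed_queue = stationary_queue s \<theta> lam G M R T S for s \<theta> lam G and M :: "'a measure" and R T S +
  fixes M0 :: "'b measure" and R0 :: "'b \<Rightarrow> real multiset" and T0 S0 :: "nat \<Rightarrow> 'b \<Rightarrow> real"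
  assumes cs: "customer_stationary s \<theta> lam G M0 R0 T0 S0"
begin

lemma q0: "queue_input lam G M0 R0 T0 S0"
  using cs by (simp add: customer_stationary_def)

sublocale M0: prob_space M0
  using q0 by (simp add: queue_input_def)

abbreviation r0 :: "'b \<Rightarrow> nat \<Rightarrow> real" where
  "r0 \<omega> \<equiv> resid (R0 \<omega>) 0"

abbreviation \<Xi> :: "'b \<Rightarrow> nat \<Rightarrow> real \<times> real" where
  "\<Xi> \<omega> \<equiv> (\<lambda>j. (T0 j \<omega>, S0 j \<omega>))"

text \<open>
  The stationary law of the residual times found by customers who join:
\<close>

definition \<rho> :: "(nat \<Rightarrow> real) measure" where
  "\<rho> = distr M0 SQ r0"

lemma measurable_r0: "r0 \<in> M0 \<rightarrow>\<^sub>M SQ"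
  by (rule measurable_resid_SQ[OF input_law(1)[OF q0]]) simp

lemma sets_\<rho> [measurable_cong]: "sets \<rho> = sets SQ"
  by (simp add: \<rho>_def)

lemma space_\<rho> [simp]: "space \<rho> = UNIV"
  using sets_eq_imp_space_eq[OF sets_\<rho>] by simp

sublocale \<rho>: prob_space \<rho>
  unfolding \<rho>_def by (rule M0.prob_space_distr[OF measurable_r0])

sublocale \<rho>P: pair_prob_space \<rho> P ..

lemma measurable_joint: "(\<lambda>\<omega>. (r0 \<omega>, \<Xi> \<omega>)) \<in> M0 \<rightarrow>\<^sub>M SQ \<Otimes>\<^sub>M P"
  using measurable_r0 input_law(4)[OF q0] by measurable

lemma joint_law: "distr M0 (SQ \<Otimes>\<^sub>M P) (\<lambda>\<omega>. (r0 \<omega>, \<Xi> \<omega>)) = \<rho> \<Otimes>\<^sub>M P"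
  using input_law(6)[OF q0] by (simp add: \<rho>_def)

lemma integral_joint:
  fixes h :: "_ \<Rightarrow> _ \<Rightarrow> real"
  assumes h: "(\<lambda>z. h (fst z) (snd z)) \<in> borel_measurable (SQ \<Otimes>\<^sub>M P)" and b: "\<And>r \<xi>. \<bar>h r \<xi>\<bar> \<le> c"
  shows "(LINT \<omega>|M0. h (r0 \<omega>) (\<Xi> \<omega>)) = (LINT r|\<rho>. LINT \<xi>|P. h r \<xi>)"
    and "(\<lambda>r. LINT \<xi>|P. h r \<xi>) \<in> borel_measurable \<rho>"
proof -
  have h': "(\<lambda>z. h (fst z) (snd z)) \<in> borel_measurable (\<rho> \<Otimes>\<^sub>M P)"
    using h by (simp add: measurable_cong_sets[OF sets_pair_measure_cong[OF sets_\<rho> refl] refl])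
  have i: "integrable (\<rho> \<Otimes>\<^sub>M P) (\<lambda>z. h (fst z) (snd z))"
    by (rule \<rho>P.integrable_const_bound[of _ c]) (use b h' in auto)
  have "(LINT \<omega>|M0. h (r0 \<omega>) (\<Xi> \<omega>)) = (LINT z|distr M0 (SQ \<Otimes>\<^sub>M P) (\<lambda>\<omega>. (r0 \<omega>, \<Xi> \<omega>)). h (fst z) (snd z))"
    by (subst integral_distr[OF measurable_joint h]) simp
  also have "\<dots> = (LINT r|\<rho>. LINT \<xi>|P. h r \<xi>)"
    unfolding joint_law using \<rho>P.integral_fst'[OF i] by simp
  finally show "(LINT \<omega>|M0. h (r0 \<omega>) (\<Xi> \<omega>)) = (LINT r|\<rho>. LINT \<xi>|P. h r \<xi>)" .
  show "(\<lambda>r. LINT \<xi>|P. h r \<xi>) \<in> borel_measurable \<rho>"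
    using \<rho>P.integrable_fst'[OF i] by (simp add: borel_measurable_integrable)
qed

lemma prob_joint:
  assumes Q: "Measurable.pred (SQ \<Otimes>\<^sub>M P) (\<lambda>z. Q (fst z) (snd z))"
  shows "M0.prob {\<omega>\<in>space M0. Q (r0 \<omega>) (\<Xi> \<omega>)} = (LINT r|\<rho>. P.prob {\<xi>. Q r \<xi>})"
    and "(\<lambda>r. P.prob {\<xi>. Q r \<xi>}) \<in> borel_measurable \<rho>"
    and "{\<omega>\<in>space M0. Q (r0 \<omega>) (\<Xi> \<omega>)} \<in> sets M0"
proof -
  define h :: "(nat \<Rightarrow> real) \<Rightarrow> (nat \<Rightarrow> real \<times> real) \<Rightarrow> real" where "h r \<xi> = (if Q r \<xi> then 1 else 0)" for r \<xi>
  have h: "(\<lambda>z. h (fst z) (snd z)) \<in> borel_measurable (SQ \<Otimes>\<^sub>M P)" unfolding h_def using Q by measurable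
  have b: "\<bar>h r \<xi>\<bar> \<le> 1" for r \<xi> by (simp add: h_def)
  have 1: "(LINT \<xi>|P. h r \<xi>) = P.prob {\<xi>. Q r \<xi>}" for r
  proof -
    have "(\<lambda>\<xi>. h r \<xi>) = indicator {\<xi>. Q r \<xi>}" by (auto simp: h_def indicator_def)
    then show ?thesis by simp
  qed
  show s: "{\<omega>\<in>space M0. Q (r0 \<omega>) (\<Xi> \<omega>)} \<in> sets M0"
    using measurable_compose[OF measurable_joint Q] by (simp add: pred_def)
  have "(LINT \<omega>|M0. h (r0 \<omega>) (\<Xi> \<omega>)) = (LINT \<omega>|M0. indicator {\<omega>\<in>space M0. Q (r0 \<omega>) (\<Xi> \<omega>)} \<omega>)"
    by (intro Bochner_Integration.integral_cong refl) (auto simp: h_def indicator_def)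
  also have "\<dots> = M0.prob {\<omega>\<in>space M0. Q (r0 \<omega>) (\<Xi> \<omega>)}" using s by simp
  finally show "M0.prob {\<omega>\<in>space M0. Q (r0 \<omega>) (\<Xi> \<omega>)} = (LINT r|\<rho>. P.prob {\<xi>. Q r \<xi>})"
    using integral_joint(1)[OF h b] by (simp add: 1)
  show "(\<lambda>r. P.prob {\<xi>. Q r \<xi>}) \<in> borel_measurable \<rho>"
    using integral_joint(2)[OF h b] by (simp add: 1)
qed

lemma AE_\<rho>: "AE r in \<rho>. good r \<and> r (s - 1) \<le> \<theta>"
proof -
  have g: "Measurable.pred SQ (\<lambda>r. good r \<and> r (s - 1) \<le> \<theta>)"
  proof -
    have [measurable]: "Measurable.pred SQ (\<lambda>r. r (Suc k) \<le> r k)" for k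
      unfolding pred_def by (rule borel_measurable_le[OF measurable_SQ_component measurable_SQ_component])
    have [measurable]: "Measurable.pred SQ (\<lambda>r. 0 \<le> r k)" for k
      unfolding pred_def by (rule borel_measurable_le[OF borel_measurable_const measurable_SQ_component])
    have [measurable]: "Measurable.pred SQ (\<lambda>r. r (s - 1) \<le> \<theta>)" using sets_joins by (simp add: pred_def)
    have "(\<lambda>r. good r \<and> r (s - 1) \<le> \<theta>) = (\<lambda>r. ((\<forall>k. r (Suc k) \<le> r k) \<and> (\<forall>k. 0 \<le> r k)) \<and> r (s - 1) \<le> \<theta>)"
      by (simp add: good_def decseq_Suc_iff fun_eq_iff)
    moreover have "Measurable.pred SQ (\<lambda>r. ((\<forall>k. r (Suc k) \<le> r k) \<and> (\<forall>k. 0 \<le> r k)) \<and> r (s - 1) \<le> \<theta>)" by measurable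
    ultimately show ?thesis by metis
  qed
  have "AE \<omega> in M0. virtual_wait s (R0 \<omega>) 0 \<le> \<theta>" using cs by (simp add: customer_stationary_def)
  then have "AE \<omega> in M0. good (r0 \<omega>) \<and> r0 \<omega> (s - 1) \<le> \<theta>"
    by eventually_elim (simp add: virtual_wait_eq_resid[OF s] good_resid)
  then show ?thesis
    unfolding \<rho>_def by (subst AE_distr_iff[OF measurable_r0]) (use g in \<open>auto simp: pred_def\<close>)
qed

abbreviation D0 :: "nat \<Rightarrow> 'b \<Rightarrow> real multiset" where
  "D0 i \<omega> \<equiv> departures s \<theta> (R0 \<omega>) (arrival0 T0 \<omega>) (\<lambda>i. S0 i \<omega>) i"

lemma AE_path:
  "AE \<omega> in M0. (\<forall>i. resid (D0 i \<omega>) (arrival0 T0 \<omega> i) = Y (r0 \<omega>) (\<Xi> \<omega>) i) \<and>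
     good (r0 \<omega>) \<and> r0 \<omega> (s - 1) \<le> \<theta> \<and> (\<forall>n. \<exists>N. n \<le> joined (r0 \<omega>) (\<Xi> \<omega>) N)"
proof -
  have "AE z in \<rho> \<Otimes>\<^sub>M P. (good (fst z) \<and> fst z (s - 1) \<le> \<theta>) \<and> (\<forall>n. \<exists>N. n \<le> joined (fst z) (snd z) N)"
  proof -
    have 1: "distr (\<rho> \<Otimes>\<^sub>M P) \<rho> fst = \<rho>" by (rule P.distr_pair_fst)
    have "AE r in distr (\<rho> \<Otimes>\<^sub>M P) \<rho> fst. good r \<and> r (s - 1) \<le> \<theta>" unfolding 1 by (rule AE_\<rho>)
    then have "AE z in \<rho> \<Otimes>\<^sub>M P. good (fst z) \<and> fst z (s - 1) \<le> \<theta>" by (rule AE_distrD[OF measurable_fst])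
    moreover have "AE z in \<rho> \<Otimes>\<^sub>M P. (\<forall>n. \<exists>N. n \<le> joined (fst z) (snd z) N)"
    proof (rule \<rho>P.AE_pair_measure)
      have "Measurable.pred (SQ \<Otimes>\<^sub>M P) (\<lambda>z. \<forall>n. \<exists>N. n \<le> joined (fst z) (snd z) N)" by measurable
      then show "{z \<in> space (\<rho> \<Otimes>\<^sub>M P). \<forall>n. \<exists>N. n \<le> joined (fst z) (snd z) N} \<in> sets (\<rho> \<Otimes>\<^sub>M P)"
        using sets_pair_measure_cong[OF sets_\<rho> refl, of P] by (simp add: pred_def space_pair_measure)
      show "AE r in \<rho>. AE \<xi> in P. \<forall>n. \<exists>N. n \<le> joined (fst (r, \<xi>)) (snd (r, \<xi>)) N"
        using AE_\<rho> by eventually_elim (simp add: AE_joined_unbounded)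
    qed
    ultimately show ?thesis by eventually_elim simp
  qed
  then have "AE z in distr M0 (SQ \<Otimes>\<^sub>M P) (\<lambda>\<omega>. (r0 \<omega>, \<Xi> \<omega>)).
      (good (fst z) \<and> fst z (s - 1) \<le> \<theta>) \<and> (\<forall>n. \<exists>N. n \<le> joined (fst z) (snd z) N)"
    unfolding joint_law .
  from AE_distrD[OF measurable_joint this] AE_input[OF q0 AE_P] show ?thesis
  proof eventually_elim
    fix \<omega>
    assume a: "(good (fst (r0 \<omega>, \<Xi> \<omega>)) \<and> fst (r0 \<omega>, \<Xi> \<omega>) (s - 1) \<le> \<theta>)
        \<and> (\<forall>n. \<exists>N. n \<le> joined (fst (r0 \<omega>, \<Xi> \<omega>)) (snd (r0 \<omega>, \<Xi> \<omega>)) N)"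
      and p: "\<forall>i. 0 < fst (T0 i \<omega>, S0 i \<omega>) \<and> 0 \<le> snd (T0 i \<omega>, S0 i \<omega>)"
    have "resid (D0 i \<omega>) (arrival0 T0 \<omega> i) = Y (r0 \<omega>) (\<Xi> \<omega>) i" for i
    proof (rule resid_departures_chain[OF s])
      show "0 \<le> T0 i \<omega>" for i using p by (simp add: less_imp_le)
    qed (simp_all add: arrival0_def)
    with a show "(\<forall>i. resid (D0 i \<omega>) (arrival0 T0 \<omega> i) = Y (r0 \<omega>) (\<Xi> \<omega>) i) \<and>
     good (r0 \<omega>) \<and> r0 \<omega> (s - 1) \<le> \<theta> \<and> (\<forall>n. \<exists>N. n \<le> joined (r0 \<omega>) (\<Xi> \<omega>) N)" by simp
  qed
qed

abbreviation J :: "'b \<Rightarrow> nat set" where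
  "J \<omega> \<equiv> joining s \<theta> (R0 \<omega>) (arrival0 T0 \<omega>) (\<lambda>i. S0 i \<omega>)"

abbreviation V :: "nat \<Rightarrow> 'b \<Rightarrow> real" where
  "V i \<omega> \<equiv> resid (D0 i \<omega>) (arrival0 T0 \<omega> i) (s - 1)"

abbreviation est :: "nat \<Rightarrow> 'b \<Rightarrow> real" where
  "est \<equiv> theta_hat s \<theta> R0 T0 S0"

abbreviation jn :: "nat \<Rightarrow> 'b \<Rightarrow> nat" where
  "jn \<equiv> joiner s \<theta> R0 T0 S0"

lemma J_iff: "i \<in> J \<omega> \<longleftrightarrow> V i \<omega> \<le> \<theta>"
  by (simp add: joining_def wait_found_def virtual_wait_eq_resid[OF s])

lemma waiting_time_eq: "waiting_time s \<theta> R0 T0 S0 i \<omega> = V (jn i \<omega>) \<omega>"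
  by (simp add: waiting_time_def wait_found_def virtual_wait_eq_resid[OF s])

lemma measurable_arrival0 [measurable]: "(\<lambda>\<omega>. arrival0 T0 \<omega> i) \<in> borel_measurable M0"
  using input_law(2)[OF q0] unfolding arrival0_def by measurable

lemma content_D0: "content_measurable M0 (D0 i)"
  by (rule content_measurable_departures[OF s input_law(1)[OF q0] measurable_arrival0 input_law(3)[OF q0]])

lemma measurable_V: "V i \<in> borel_measurable M0"
  by (rule measurable_resid[OF content_D0 measurable_arrival0])

lemma measurable_jn: "jn i \<in> M0 \<rightarrow>\<^sub>M count_space UNIV"
  unfolding joiner_def
proof (rule measurable_enumerate)
  fix k
  have [measurable]: "V k \<in> borel_measurable M0" by (rule measurable_V)
  show "Measurable.pred M0 (\<lambda>\<omega>. k \<in> J \<omega>)" unfolding J_iff by measurable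
qed

lemma measurable_waiting_time: "waiting_time s \<theta> R0 T0 S0 i \<in> borel_measurable M0"
proof -
  have "(\<lambda>\<omega>. V (jn i \<omega>) \<omega>) \<in> borel_measurable M0"
    by (rule measurable_compose_countable[OF measurable_V measurable_jn])
  then show ?thesis by (simp add: waiting_time_eq[abs_def])
qed

lemma measurable_est [measurable]: "est n \<in> borel_measurable M0"
  unfolding theta_hat_def by (rule borel_measurable_Max) (auto intro: measurable_waiting_time)

lemma est_le_iff: "1 \<le> n \<Longrightarrow> est n \<omega> \<le> c \<longleftrightarrow> (\<forall>i\<in>{1..n}. V (jn i \<omega>) \<omega> \<le> c)"
  by (simp add: theta_hat_def waiting_time_eq)

lemma est_nonneg: "1 \<le> n \<Longrightarrow> 0 \<le> est n \<omega>"
  unfolding theta_hat_def by (rule order_trans[OF _ Max_ge[of _ "waiting_time s \<theta> R0 T0 S0 1 \<omega>"]])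
    (auto simp: waiting_time_eq resid_nonneg)

lemma est_mono: "1 \<le> m \<Longrightarrow> m \<le> n \<Longrightarrow> est m \<omega> \<le> est n \<omega>"
  unfolding theta_hat_def by (rule Max_mono) auto

lemma joined_eq_card:
  assumes "\<And>i. Y r \<xi> i (s - 1) \<le> \<theta> \<longleftrightarrow> i \<in> A"
  shows "joined r \<xi> j = card {i \<in> A. i < j}"
proof -
  have "joined r \<xi> j = (\<Sum>i\<in>{..<j} \<inter> A. 1)"
    unfolding joined_def assms by (simp add: sum.If_cases)
  also have "{..<j} \<inter> A = {i \<in> A. i < j}" by auto
  finally show ?thesis by simp
qed

lemma AE_joiners:
  "AE \<omega> in M0. infinite (J \<omega>) \<and> 0 \<in> J \<omega> \<and> (\<forall>i. resid (D0 i \<omega>) (arrival0 T0 \<omega> i) = Y (r0 \<omega>) (\<Xi> \<omega>) i) \<and>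
    (\<forall>j. joined (r0 \<omega>) (\<Xi> \<omega>) j = card {i \<in> J \<omega>. i < j})"
  using AE_path
proof eventually_elim
  fix \<omega>
  assume a: "(\<forall>i. resid (D0 i \<omega>) (arrival0 T0 \<omega> i) = Y (r0 \<omega>) (\<Xi> \<omega>) i) \<and>
     good (r0 \<omega>) \<and> r0 \<omega> (s - 1) \<le> \<theta> \<and> (\<forall>n. \<exists>N. n \<le> joined (r0 \<omega>) (\<Xi> \<omega>) N)"
  then have V: "resid (D0 i \<omega>) (arrival0 T0 \<omega> i) = Y (r0 \<omega>) (\<Xi> \<omega>) i" for i by blast
  have c: "joined (r0 \<omega>) (\<Xi> \<omega>) j = card {i \<in> J \<omega>. i < j}" for j
    by (rule joined_eq_card) (simp only: J_iff V)
  have "infinite (J \<omega>)"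
  proof
    assume fin: "finite (J \<omega>)"
    obtain N where "Suc (card (J \<omega>)) \<le> joined (r0 \<omega>) (\<Xi> \<omega>) N" using a by blast
    also have "\<dots> \<le> card (J \<omega>)" unfolding c by (rule card_mono[OF fin]) auto
    finally show False by simp
  qed
  moreover have "0 \<in> J \<omega>" using a V[of 0] by (simp add: J_iff)
  ultimately show "infinite (J \<omega>) \<and> 0 \<in> J \<omega> \<and> (\<forall>i. resid (D0 i \<omega>) (arrival0 T0 \<omega> i) = Y (r0 \<omega>) (\<Xi> \<omega>) i) \<and>
    (\<forall>j. joined (r0 \<omega>) (\<Xi> \<omega>) j = card {i \<in> J \<omega>. i < j})"
    using V c by blast
qed

text \<open>
  The rank of a joining customer is the number of customers who joined before. Thus the observations of rank 1 to
  \<open>n\<close> are those that \<open>maxle\<close> refers to.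
\<close>

lemma AE_est:
  "AE \<omega> in M0. \<forall>n\<ge>1. est n \<omega> \<le> \<theta> \<and> (\<forall>\<epsilon>. est n \<omega> \<le> \<theta> - \<epsilon> \<longleftrightarrow> maxle \<epsilon> n (r0 \<omega>) (\<Xi> \<omega>))"
  using AE_joiners
proof eventually_elim
  fix \<omega>
  assume a: "infinite (J \<omega>) \<and> 0 \<in> J \<omega> \<and> (\<forall>i. resid (D0 i \<omega>) (arrival0 T0 \<omega> i) = Y (r0 \<omega>) (\<Xi> \<omega>) i) \<and>
    (\<forall>j. joined (r0 \<omega>) (\<Xi> \<omega>) j = card {i \<in> J \<omega>. i < j})"
  then have inf: "infinite (J \<omega>)" and V: "\<And>i. V i \<omega> = Y (r0 \<omega>) (\<Xi> \<omega>) i (s - 1)"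
    and c: "\<And>j. joined (r0 \<omega>) (\<Xi> \<omega>) j = card {i \<in> J \<omega>. i < j}" by simp_all
  have jn: "jn i \<omega> = enumerate (J \<omega>) i" for i by (simp add: joiner_def)
  have jJ: "jn i \<omega> \<in> J \<omega>" for i unfolding jn by (rule enumerate_in_set[OF inf])
  have cj: "joined (r0 \<omega>) (\<Xi> \<omega>) (jn i \<omega>) = i" for i unfolding c jn by (rule card_enumerate[OF inf])
  show "\<forall>n\<ge>1. est n \<omega> \<le> \<theta> \<and> (\<forall>\<epsilon>. est n \<omega> \<le> \<theta> - \<epsilon> \<longleftrightarrow> maxle \<epsilon> n (r0 \<omega>) (\<Xi> \<omega>))"
  proof (intro allI impI conjI)
    fix n :: nat assume n: "1 \<le> n"
    show "est n \<omega> \<le> \<theta>" unfolding est_le_iff[OF n] using jJ J_iff by blast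
    fix \<epsilon>
    show "est n \<omega> \<le> \<theta> - \<epsilon> \<longleftrightarrow> maxle \<epsilon> n (r0 \<omega>) (\<Xi> \<omega>)"
    proof
      assume e: "est n \<omega> \<le> \<theta> - \<epsilon>"
      show "maxle \<epsilon> n (r0 \<omega>) (\<Xi> \<omega>)" unfolding maxle_def
      proof (intro allI impI)
        fix j assume j: "Y (r0 \<omega>) (\<Xi> \<omega>) j (s - 1) \<le> \<theta>" "1 \<le> joined (r0 \<omega>) (\<Xi> \<omega>) j" "joined (r0 \<omega>) (\<Xi> \<omega>) j \<le> n"
        then have "j \<in> J \<omega>" unfolding J_iff V by blast
        then obtain i where i: "jn i \<omega> = j" using enumerate_Ex[OF inf] unfolding jn by blast
        then have "i \<in> {1..n}" using cj[of i] j by auto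
        then have "V j \<omega> \<le> \<theta> - \<epsilon>" using e i unfolding est_le_iff[OF n] by blast
        then show "Y (r0 \<omega>) (\<Xi> \<omega>) j (s - 1) \<le> \<theta> - \<epsilon>" unfolding V .
      qed
    next
      assume m: "maxle \<epsilon> n (r0 \<omega>) (\<Xi> \<omega>)"
      show "est n \<omega> \<le> \<theta> - \<epsilon>" unfolding est_le_iff[OF n]
      proof
        fix i assume i: "i \<in> {1..n}"
        have "Y (r0 \<omega>) (\<Xi> \<omega>) (jn i \<omega>) (s - 1) \<le> \<theta>" using jJ[of i] unfolding J_iff V .
        then show "V (jn i \<omega>) \<omega> \<le> \<theta> - \<epsilon>" using m i cj[of i] unfolding maxle_def V by auto
      qed
    qed
  qed
qed

lemma pred_maxle: "Measurable.pred (SQ \<Otimes>\<^sub>M P) (\<lambda>z. maxle \<epsilon> n (fst z) (snd z))"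
  by measurable

lemma est_prob:
  assumes n: "1 \<le> n"
  shows "M0.prob {\<omega>\<in>space M0. est n \<omega> \<le> \<theta> - \<epsilon>} = (LINT r|\<rho>. P.prob {\<xi>. maxle \<epsilon> n r \<xi>})"
proof -
  have "M0.prob {\<omega>\<in>space M0. est n \<omega> \<le> \<theta> - \<epsilon>} = M0.prob {\<omega>\<in>space M0. maxle \<epsilon> n (r0 \<omega>) (\<Xi> \<omega>)}"
  proof (rule M0.finite_measure_eq_AE)
    show "AE \<omega> in M0. \<omega> \<in> {\<omega>\<in>space M0. est n \<omega> \<le> \<theta> - \<epsilon>} \<longleftrightarrow> \<omega> \<in> {\<omega>\<in>space M0. maxle \<epsilon> n (r0 \<omega>) (\<Xi> \<omega>)}"
      using AE_est by eventually_elim (use n in auto)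
    show "{\<omega>\<in>space M0. est n \<omega> \<le> \<theta> - \<epsilon>} \<in> sets M0" by measurable
    show "{\<omega>\<in>space M0. maxle \<epsilon> n (r0 \<omega>) (\<Xi> \<omega>)} \<in> sets M0" by (rule prob_joint(3)[OF pred_maxle])
  qed
  then show ?thesis using prob_joint(1)[OF pred_maxle] by simp
qed

lemma scaled_error_prob:
  assumes n: "1 \<le> n"
  shows "M0.prob {\<omega>\<in>space M0. x \<le> real n * (\<theta> - est n \<omega>)} = (LINT r|\<rho>. P.prob {\<xi>. maxle (x / real n) n r \<xi>})"
proof -
  have "x \<le> real n * (\<theta> - est n \<omega>) \<longleftrightarrow> est n \<omega> \<le> \<theta> - x / real n" for \<omega>
    using n by (simp add: field_simps)
  then show ?thesis using est_prob[OF n, of "x / real n"] by simp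
qed

lemma scaled_error_tendsto:
  assumes "\<And>y. good y \<Longrightarrow> y (s - 1) \<le> \<theta> \<Longrightarrow> (\<lambda>n. P.prob {\<xi>. maxle (x / real n) n y \<xi>}) \<longlonglongrightarrow> l"
  shows "(\<lambda>n. M0.prob {\<omega>\<in>space M0. x \<le> real n * (\<theta> - est n \<omega>)}) \<longlonglongrightarrow> l"
proof -
  have "(\<lambda>n. LINT r|\<rho>. P.prob {\<xi>. maxle (x / real n) n r \<xi>}) \<longlonglongrightarrow> (LINT r|\<rho>. l)"
  proof (rule integral_dominated_convergence[where w="\<lambda>_. 1"])
    show "AE r in \<rho>. (\<lambda>n. P.prob {\<xi>. maxle (x / real n) n r \<xi>}) \<longlonglongrightarrow> l"
      using AE_\<rho> by eventually_elim (use assms in blast)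
  qed (auto intro: prob_joint(2)[OF pred_maxle])
  then have "(\<lambda>n. LINT r|\<rho>. P.prob {\<xi>. maxle (x / real n) n r \<xi>}) \<longlonglongrightarrow> l"
    by (simp add: \<rho>.prob_space[simplified])
  moreover have "\<forall>\<^sub>F n in sequentially. (LINT r|\<rho>. P.prob {\<xi>. maxle (x / real n) n r \<xi>})
      = M0.prob {\<omega>\<in>space M0. x \<le> real n * (\<theta> - est n \<omega>)}"
    using eventually_ge_at_top[of 1] by eventually_elim (simp add: scaled_error_prob)
  ultimately show ?thesis by (rule Lim_transform_eventually)
qed

lemma scaled_error_tail:
  obtains a C where "0 < (a::real)" "1 \<le> (C::real)"
    "\<And>n x. 1 \<le> n \<Longrightarrow> 0 \<le> x \<Longrightarrow> M0.prob {\<omega>\<in>space M0. x \<le> real n * (\<theta> - est n \<omega>)} \<le> C * exp (- (a * x))"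
proof -
  obtain a C where a: "0 < (a::real)" and C: "1 \<le> (C::real)"
    and tail: "\<And>\<epsilon> n y. 0 < \<epsilon> \<Longrightarrow> \<epsilon> \<le> \<theta> \<Longrightarrow> good y \<Longrightarrow> y (s - 1) \<le> \<theta> \<Longrightarrow>
      P.prob {\<xi>. maxle \<epsilon> n y \<xi>} \<le> C * exp (- (a * (\<epsilon> * real n)))"
    by (rule maxle_tail) blast
  show ?thesis
  proof (rule that[OF a C])
    fix n :: nat and x :: real assume n: "1 \<le> n" and x: "0 \<le> x"
    \<comment> \<open>The error is at most \<open>\<theta>\<close>, so that a bound for windows of width at most \<open>\<theta>\<close> suffices.\<close>
    consider "x = 0" | "0 < x" "x / real n \<le> \<theta>" | "\<theta> < x / real n" using x by linarith
    then show "M0.prob {\<omega>\<in>space M0. x \<le> real n * (\<theta> - est n \<omega>)} \<le> C * exp (- (a * x))"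
    proof cases
      case 1
      have "M0.prob {\<omega>\<in>space M0. x \<le> real n * (\<theta> - est n \<omega>)} \<le> 1" by (rule M0.prob_le_1)
      moreover have "C * exp (- (a * x)) = C" using 1 by simp
      ultimately show ?thesis using C by linarith
    next
      case 2
      have "(LINT r|\<rho>. P.prob {\<xi>. maxle (x / real n) n r \<xi>}) \<le> (LINT r|\<rho>. C * exp (- (a * x)))"
      proof (rule integral_mono_AE)
        show "integrable \<rho> (\<lambda>r. P.prob {\<xi>. maxle (x / real n) n r \<xi>})"
          by (rule \<rho>.integrable_const_bound[where B=1]) (auto intro: prob_joint(2)[OF pred_maxle])
        show "AE r in \<rho>. P.prob {\<xi>. maxle (x / real n) n r \<xi>} \<le> C * exp (- (a * x))"
          using AE_\<rho>
        proof eventually_elim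
          fix r assume "good r \<and> r (s - 1) \<le> \<theta>"
          then show "P.prob {\<xi>. maxle (x / real n) n r \<xi>} \<le> C * exp (- (a * x))"
            using tail[of "x / real n" r n] 2 n by simp
        qed
      qed simp
      then show ?thesis using scaled_error_prob[OF n] by (simp add: \<rho>.prob_space[simplified])
    next
      case 3
      have "\<not> x \<le> real n * (\<theta> - est n \<omega>)" for \<omega>
      proof -
        have "real n * (\<theta> - est n \<omega>) \<le> real n * \<theta>" using est_nonneg[OF n] n by simp
        also have "\<dots> < x" using 3 n by (simp add: field_simps)
        finally show ?thesis by simp
      qed
      then have "{\<omega>\<in>space M0. x \<le> real n * (\<theta> - est n \<omega>)} = {}" by blast
      then have "M0.prob {\<omega>\<in>space M0. x \<le> real n * (\<theta> - est n \<omega>)} = 0" by (simp only: measure_empty)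
      then show ?thesis using C by simp
    qed
  qed
qed

text \<open>
  As the estimator is monotone in \<open>n\<close> and bounded by \<open>\<theta>\<close>, it is enough that it comes within each distance of \<open>\<theta>\<close>
  once.
\<close>

lemma AE_est_tendsto: "AE \<omega> in M0. (\<lambda>n. est n \<omega>) \<longlonglongrightarrow> \<theta>"
proof -
  obtain a C where a: "0 < (a::real)" and C: "1 \<le> (C::real)"
    and tail: "\<And>n x. 1 \<le> n \<Longrightarrow> 0 \<le> x \<Longrightarrow> M0.prob {\<omega>\<in>space M0. x \<le> real n * (\<theta> - est n \<omega>)} \<le> C * exp (- (a * x))"
    by (rule scaled_error_tail) blast
  have "AE \<omega> in M0. \<exists>n\<ge>1. \<theta> - e < est n \<omega>" if e: "0 < e" for e
  proof -
    let ?N = "{\<omega>\<in>space M0. \<forall>n\<ge>1. est n \<omega> \<le> \<theta> - e}"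
    have N: "?N \<in> sets M0" by measurable
    have "M0.prob ?N \<le> C * exp (- (a * (real (Suc n) * e)))" for n
    proof -
      have "M0.prob ?N \<le> M0.prob {\<omega>\<in>space M0. real (Suc n) * e \<le> real (Suc n) * (\<theta> - est (Suc n) \<omega>)}"
      proof (rule M0.finite_measure_mono)
        show "?N \<subseteq> {\<omega>\<in>space M0. real (Suc n) * e \<le> real (Suc n) * (\<theta> - est (Suc n) \<omega>)}"
        proof safe
          fix \<omega> assume "\<forall>n\<ge>1. est n \<omega> \<le> \<theta> - e"
          then have "est (Suc n) \<omega> \<le> \<theta> - e" by simp
          then show "real (Suc n) * e \<le> real (Suc n) * (\<theta> - est (Suc n) \<omega>)" by (intro mult_left_mono) auto
        qed
      qed measurable
      also have "\<dots> \<le> C * exp (- (a * (real (Suc n) * e)))" using e by (intro tail) auto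
      finally show ?thesis .
    qed
    moreover have "(\<lambda>n. C * exp (- (a * (real (Suc n) * e)))) \<longlonglongrightarrow> C * 0"
    proof (intro tendsto_mult tendsto_const filterlim_compose[OF exp_at_bot])
      have "filterlim (\<lambda>n. (a * e) * real (Suc n)) at_top sequentially"
        using a e by (intro filterlim_tendsto_pos_mult_at_top[OF tendsto_const] filterlim_compose[OF filterlim_real_sequentially filterlim_Suc]) auto
      then show "filterlim (\<lambda>n. - (a * (real (Suc n) * e))) at_bot sequentially"
        by (simp add: filterlim_uminus_at_bot mult_ac)
    qed
    ultimately have "M0.prob ?N \<le> C * 0" by (intro LIMSEQ_le_const) auto
    then have "?N \<in> null_sets M0" using N by (auto simp: null_sets_def M0.emeasure_eq_measure measure_le_0_iff)
    from AE_not_in[OF this] AE_space show ?thesis by eventually_elim (auto simp: not_le)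
  qed
  then have "AE \<omega> in M0. \<forall>k. \<exists>n\<ge>1. \<theta> - 1 / real (Suc k) < est n \<omega>" by (simp add: AE_all_countable)
  then show ?thesis using AE_est
  proof eventually_elim
    fix \<omega>
    assume k: "\<forall>k. \<exists>n\<ge>1. \<theta> - 1 / real (Suc k) < est n \<omega>"
      and le: "\<forall>n\<ge>1. est n \<omega> \<le> \<theta> \<and> (\<forall>\<epsilon>. est n \<omega> \<le> \<theta> - \<epsilon> \<longleftrightarrow> maxle \<epsilon> n (r0 \<omega>) (\<Xi> \<omega>))"
    show "(\<lambda>n. est n \<omega>) \<longlonglongrightarrow> \<theta>"
    proof (rule order_tendstoI)
      fix b assume "b < \<theta>"
      then obtain k0 where k0: "inverse (real (Suc k0)) < \<theta> - b" using reals_Archimedean[of "\<theta> - b"] by auto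
      obtain n where n: "1 \<le> n" "\<theta> - 1 / real (Suc k0) < est n \<omega>" using k by blast
      have bn: "b < est n \<omega>" using k0 n(2) unfolding inverse_eq_divide by linarith
      show "\<forall>\<^sub>F n in sequentially. b < est n \<omega>"
        using eventually_ge_at_top[of n]
      proof eventually_elim
        fix m assume "n \<le> m"
        from est_mono[OF n(1) this] bn show "b < est m \<omega>" by (rule less_le_trans[rotated])
      qed
    next
      fix b assume b: "\<theta> < b"
      show "\<forall>\<^sub>F n in sequentially. est n \<omega> < b"
        using eventually_ge_at_top[of 1]
      proof eventually_elim
        fix m :: nat assume "1 \<le> m"
        then have "est m \<omega> \<le> \<theta>" using le by blast
        then show "est m \<omega> < b" using b by (rule le_less_trans)
      qed
    qed
  qed
qed

section \<open>Joining customers see the conditional stationary law\<close>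

lemma law_at_joiner: "distr M0 SQ (\<lambda>\<omega>. resid (D0 (jn i \<omega>) \<omega>) (arrival0 T0 \<omega> (jn i \<omega>))) = \<rho>"
proof -
  have D: "content_measurable M0 (\<lambda>\<omega>. D0 (jn i \<omega>) \<omega>)"
    unfolding content_measurable_def
  proof
    fix g :: "'b \<Rightarrow> real" assume "g \<in> borel_measurable M0"
    then have "(\<lambda>\<omega>. present (D0 j \<omega>) (g \<omega>)) \<in> M0 \<rightarrow>\<^sub>M count_space UNIV" for j
      by (rule content_measurableD[OF content_D0])
    then show "(\<lambda>\<omega>. present (D0 (jn i \<omega>) \<omega>) (g \<omega>)) \<in> M0 \<rightarrow>\<^sub>M count_space UNIV"
      by (rule measurable_compose_countable[OF _ measurable_jn])
  qed
  have A: "(\<lambda>\<omega>. arrival0 T0 \<omega> (jn i \<omega>)) \<in> borel_measurable M0"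
    by (rule measurable_compose_countable[OF measurable_arrival0 measurable_jn])
  have "distr M0 state_space (\<lambda>\<omega>. state (D0 (jn i \<omega>) \<omega>) (arrival0 T0 \<omega> (jn i \<omega>))) = distr M0 state_space (\<lambda>\<omega>. state (R0 \<omega>) 0)"
    using cs by (simp add: customer_stationary_def Let_def)
  then show ?thesis
    unfolding \<rho>_def by (intro law_resid_of_law_state measurable_state D A input_law(1)[OF q0]) simp_all
qed

text \<open>
  Counting the joining customers among the first \<open>b * n\<close> potential ones, with \<open>b\<close> slightly above \<open>1 / \<kappa>\<close>,
  bounds the law they see by \<open>\<pi>\<close> restricted to joining and normalised.
\<close>

lemma \<rho>_le:
  assumes B[measurable]: "B \<in> sets SQ"
  shows "measure \<rho> B \<le> measure \<pi> (B \<inter> {r. r (s - 1) \<le> \<theta>}) / \<kappa>"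
proof -
  let ?B = "B \<inter> {r. r (s - 1) \<le> \<theta>}"
  have BD[measurable]: "?B \<in> sets SQ" using sets_joins by simp
  define f :: "(nat \<Rightarrow> real) \<Rightarrow> real" where "f = indicator ?B"
  have f[measurable]: "f \<in> borel_measurable SQ" unfolding f_def by simp
  have f01: "0 \<le> f r" "f r \<le> 1" for r by (auto simp: f_def indicator_def)
  have \<pi>f: "(LINT r|\<pi>. f r) = measure \<pi> ?B" using BD by (simp add: f_def sets_\<pi>)
  \<comment> \<open>By customer stationarity the left-hand side is the expected number of the first \<open>n\<close> joining customers who find \<open>B\<close>.
    They are among the first \<open>N\<close> potential customers, unless fewer than \<open>n\<close> of those join.\<close>
  have ineq: "real n * measure \<rho> B \<le> real N * (LINT r|\<rho>. LINT \<xi>|P. avg f N r \<xi>) + real n * (LINT r|\<rho>. P.prob {\<xi>. joined r \<xi> N < n})"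
    if N: "0 < N" for n N
  proof -
    define A where "A i = {\<omega>\<in>space M0. resid (D0 (jn i \<omega>) \<omega>) (arrival0 T0 \<omega> (jn i \<omega>)) \<in> B}" for i
    have mX: "(\<lambda>\<omega>. resid (D0 (jn i \<omega>) \<omega>) (arrival0 T0 \<omega> (jn i \<omega>))) \<in> M0 \<rightarrow>\<^sub>M SQ" for i
      by (rule measurable_compose_countable[OF measurable_resid_SQ[OF content_D0 measurable_arrival0] measurable_jn])
    have A[measurable]: "A i \<in> sets M0" for i
      using measurable_sets[OF mX B, of i] by (simp add: A_def vimage_def Int_def conj_commute)
    have pA: "M0.prob (A i) = measure \<rho> B" for i
      unfolding law_at_joiner[of i, symmetric] by (subst measure_distr[OF mX B]) (simp add: A_def vimage_def Int_def conj_commute)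
    let ?C = "{\<omega>\<in>space M0. joined (r0 \<omega>) (\<Xi> \<omega>) N < n}"
    have Cp: "Measurable.pred (SQ \<Otimes>\<^sub>M P) (\<lambda>z. joined (fst z) (snd z) N < n)" by measurable
    have C[measurable]: "?C \<in> sets M0" by (rule prob_joint(3)[OF Cp])
    have mavg: "(\<lambda>z. avg f N (fst z) (snd z)) \<in> borel_measurable (SQ \<Otimes>\<^sub>M P)" by (rule measurable_avg[OF f]) simp_all
    have bavg: "\<bar>avg f N r \<xi>\<bar> \<le> 1" for r \<xi>
      using avg_bounds[where f=f and N=N and r=r and \<xi>=\<xi>, OF f01] by (simp add: abs_le_iff)
    have [measurable]: "(\<lambda>\<omega>. avg f N (r0 \<omega>) (\<Xi> \<omega>)) \<in> borel_measurable M0"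
      using measurable_compose[OF measurable_joint mavg] by simp
    have iavg: "integrable M0 (\<lambda>\<omega>. avg f N (r0 \<omega>) (\<Xi> \<omega>))"
      by (rule M0.integrable_const_bound[of _ 1]) (use bavg in auto)
    have iA: "integrable M0 (indicator (A i) :: _ \<Rightarrow> real)" for i by (rule integrable_real_indicator[OF A]) (simp add: M0.emeasure_eq_measure)
    have iC: "integrable M0 (indicator ?C :: _ \<Rightarrow> real)" by (rule integrable_real_indicator[OF C]) (simp add: M0.emeasure_eq_measure)
    have "real n * measure \<rho> B = (LINT \<omega>|M0. (\<Sum>i<n. indicator (A i) \<omega>))"
      by (subst Bochner_Integration.integral_sum[OF iA]) (simp add: pA)
    also have "\<dots> \<le> (LINT \<omega>|M0. real N * avg f N (r0 \<omega>) (\<Xi> \<omega>) + real n * indicator ?C \<omega>)"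
    proof (rule integral_mono_AE)
      show "integrable M0 (\<lambda>\<omega>. \<Sum>i<n. indicator (A i) \<omega> :: real)" by (intro Bochner_Integration.integrable_sum iA)
      show "integrable M0 (\<lambda>\<omega>. real N * avg f N (r0 \<omega>) (\<Xi> \<omega>) + real n * indicator ?C \<omega>)"
        by (intro Bochner_Integration.integrable_add integrable_mult_right iavg iC)
      show "AE \<omega> in M0. (\<Sum>i<n. indicator (A i) \<omega>) \<le> real N * avg f N (r0 \<omega>) (\<Xi> \<omega>) + real n * indicator ?C \<omega>"
        using AE_joiners AE_space
      proof eventually_elim
        fix \<omega>
        assume a: "infinite (J \<omega>) \<and> 0 \<in> J \<omega> \<and> (\<forall>i. resid (D0 i \<omega>) (arrival0 T0 \<omega> i) = Y (r0 \<omega>) (\<Xi> \<omega>) i) \<and>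
          (\<forall>j. joined (r0 \<omega>) (\<Xi> \<omega>) j = card {i \<in> J \<omega>. i < j})" and sp: "\<omega> \<in> space M0"
        then have inf: "infinite (J \<omega>)" and V: "\<And>i. resid (D0 i \<omega>) (arrival0 T0 \<omega> i) = Y (r0 \<omega>) (\<Xi> \<omega>) i"
          and c: "\<And>j. joined (r0 \<omega>) (\<Xi> \<omega>) j = card {i \<in> J \<omega>. i < j}" by blast+
        have avgN: "real N * avg f N (r0 \<omega>) (\<Xi> \<omega>) = (\<Sum>j<N. f (Y (r0 \<omega>) (\<Xi> \<omega>) j))" using N by (simp add: avg_def)
        show "(\<Sum>i<n. indicator (A i) \<omega>) \<le> real N * avg f N (r0 \<omega>) (\<Xi> \<omega>) + real n * indicator ?C \<omega>"
        proof (cases "\<omega> \<in> ?C")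
          case True
          have "(\<Sum>i<n. indicator (A i) \<omega>) \<le> (\<Sum>i<n. 1 :: real)" by (intro sum_mono) (simp add: indicator_def)
          moreover have "0 \<le> (\<Sum>j<N. f (Y (r0 \<omega>) (\<Xi> \<omega>) j))" by (intro sum_nonneg f01)
          ultimately show ?thesis unfolding avgN using True by simp
        next
          case False
          then have n: "n \<le> joined (r0 \<omega>) (\<Xi> \<omega>) N" using sp by simp
          let ?e = "enumerate (J \<omega>)"
          have eN: "?e i < N" if i: "i < n" for i
          proof (rule ccontr)
            assume "\<not> ?e i < N"
            then have "joined (r0 \<omega>) (\<Xi> \<omega>) N \<le> joined (r0 \<omega>) (\<Xi> \<omega>) (?e i)" by (intro joined_mono) simp
            also have "\<dots> = i" unfolding c by (rule card_enumerate[OF inf])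
            finally show False using n i by simp
          qed
          have eJ: "Y (r0 \<omega>) (\<Xi> \<omega>) (?e i) (s - 1) \<le> \<theta>" for i
            using enumerate_in_set[OF inf, of i] unfolding J_iff V .
          have "(\<Sum>i<n. indicator (A i) \<omega>) = (\<Sum>i<n. f (Y (r0 \<omega>) (\<Xi> \<omega>) (?e i)))"
          proof (intro sum.cong refl)
            fix i
            have "\<omega> \<in> A i \<longleftrightarrow> Y (r0 \<omega>) (\<Xi> \<omega>) (?e i) \<in> B" using sp by (simp add: A_def joiner_def V)
            then show "indicator (A i) \<omega> = f (Y (r0 \<omega>) (\<Xi> \<omega>) (?e i))" using eJ[of i] by (simp add: f_def indicator_def)
          qed
          also have "\<dots> = sum (\<lambda>j. f (Y (r0 \<omega>) (\<Xi> \<omega>) j)) (?e ` {..<n})"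
            using strict_mono_imp_inj_on[OF strict_mono_enumerate[OF inf]] by (subst sum.reindex) auto
          also have "\<dots> \<le> (\<Sum>j<N. f (Y (r0 \<omega>) (\<Xi> \<omega>) j))"
            using eN f01 by (intro sum_mono2) auto
          finally show ?thesis unfolding avgN using False by simp
        qed
      qed
    qed
    also have "\<dots> = real N * (LINT \<omega>|M0. avg f N (r0 \<omega>) (\<Xi> \<omega>)) + real n * M0.prob ?C"
      using iavg iC C by (simp add: Bochner_Integration.integral_add)
    finally show ?thesis using integral_joint(1)[OF mavg bavg] prob_joint(1)[OF Cp] by simp
  qed
  have lim1: "(\<lambda>n. LINT r|\<rho>. LINT \<xi>|P. avg f (blk b n) r \<xi>) \<longlonglongrightarrow> measure \<pi> ?B" if b: "0 < b" for b
  proof -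
    have mavg: "(\<lambda>z. avg f N (fst z) (snd z)) \<in> borel_measurable (SQ \<Otimes>\<^sub>M P)" for N by (rule measurable_avg[OF f]) simp_all
    have bavg: "\<bar>avg f N r \<xi>\<bar> \<le> 1" for r \<xi> N
      using avg_bounds[where f=f and N=N and r=r and \<xi>=\<xi>, OF f01] by (simp add: abs_le_iff)
    have [measurable]: "(\<lambda>\<xi>. avg f N r \<xi>) \<in> borel_measurable P" for r N by (rule measurable_avg[OF f]) simp_all
    have i: "integrable P (\<lambda>\<xi>. avg f N r \<xi>)" for r N by (rule integrable_P_bounded[where c=1]) (simp_all add: bavg)
    have "(\<lambda>n. LINT r|\<rho>. LINT \<xi>|P. avg f (blk b n) r \<xi>) \<longlonglongrightarrow> (LINT r|\<rho>. measure \<pi> ?B)"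
    proof (rule integral_dominated_convergence[where w="\<lambda>_. 1"])
      show "AE r in \<rho>. (\<lambda>n. LINT \<xi>|P. avg f (blk b n) r \<xi>) \<longlonglongrightarrow> measure \<pi> ?B"
        using AE_\<rho>
      proof eventually_elim
        fix r assume r: "good r \<and> r (s - 1) \<le> \<theta>"
        have "(\<lambda>n. (LINT \<xi>|P. avg f (blk b n) r \<xi>) - measure \<pi> ?B) \<longlonglongrightarrow> 0"
        proof (rule Lim_null_comparison[OF always_eventually filterlim_compose[OF lln_err_tendsto_0 blk_top[OF b]]], rule allI)
          fix n
          have "norm ((LINT \<xi>|P. avg f (blk b n) r \<xi>) - measure \<pi> ?B) = \<bar>LINT \<xi>|P. avg f (blk b n) r \<xi> - measure \<pi> ?B\<bar>"
            using i by (simp add: P.prob_space[simplified])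
          also have "\<dots> \<le> (LINT \<xi>|P. \<bar>avg f (blk b n) r \<xi> - measure \<pi> ?B\<bar>)" by (rule integral_abs_bound)
          also have "\<dots> \<le> lln_err r (blk b n)"
            unfolding \<pi>f[symmetric] by (rule law_of_large_numbers[OF f f01]) (use r in \<open>auto simp: blk_def\<close>)
          finally show "norm ((LINT \<xi>|P. avg f (blk b n) r \<xi>) - measure \<pi> ?B) \<le> lln_err r (blk b n)" .
        qed
        then show "(\<lambda>n. LINT \<xi>|P. avg f (blk b n) r \<xi>) \<longlonglongrightarrow> measure \<pi> ?B" by (rule LIM_zero_cancel)
      qed
      show "(\<lambda>r. LINT \<xi>|P. avg f (blk b n) r \<xi>) \<in> borel_measurable \<rho>" for n by (rule integral_joint(2)[OF mavg bavg])
      show "AE r in \<rho>. norm (LINT \<xi>|P. avg f (blk b n) r \<xi>) \<le> 1" for n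
      proof (rule AE_I2)
        fix r
        have "norm (LINT \<xi>|P. avg f (blk b n) r \<xi>) \<le> (LINT \<xi>|P. \<bar>avg f (blk b n) r \<xi>\<bar>)"
          using integral_abs_bound by simp
        also have "\<dots> \<le> (LINT \<xi>|P. 1)" by (rule integral_mono) (use i bavg in auto)
        finally show "norm (LINT \<xi>|P. avg f (blk b n) r \<xi>) \<le> 1" by (simp add: P.prob_space[simplified])
      qed
    qed auto
    then show ?thesis by (simp add: \<rho>.prob_space[simplified])
  qed
  have bound: "measure \<rho> B \<le> b * measure \<pi> ?B" if b: "1 / \<kappa> < b" for b
  proof -
    have b0: "0 < b" using b \<kappa>_pos less_trans[of 0 "1 / \<kappa>" b] by simp
    have Cp: "Measurable.pred (SQ \<Otimes>\<^sub>M P) (\<lambda>z. joined (fst z) (snd z) N < n)" for n N by measurable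
    have "(\<lambda>n. LINT r|\<rho>. P.prob {\<xi>. joined r \<xi> (blk b n) < n}) \<longlonglongrightarrow> (LINT r|\<rho>. 0)"
    proof (rule integral_dominated_convergence[where w="\<lambda>_. 1"])
      show "AE r in \<rho>. (\<lambda>n. P.prob {\<xi>. joined r \<xi> (blk b n) < n}) \<longlonglongrightarrow> 0"
        using AE_\<rho>
      proof eventually_elim
        fix r assume r: "good r \<and> r (s - 1) \<le> \<theta>"
        show "(\<lambda>n. P.prob {\<xi>. joined r \<xi> (blk b n) < n}) \<longlonglongrightarrow> 0"
        proof (rule joined_less_tendsto_0[OF _ blk_top[OF b0] _ blk_ratio'(2)[OF b0]])
          show "1 / b < \<kappa>" using b b0 \<kappa>_pos by (simp add: field_simps)
        qed (use r in \<open>auto simp: blk_def\<close>)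
      qed
    qed (auto intro: prob_joint(2)[OF Cp])
    then have l2: "(\<lambda>n. LINT r|\<rho>. P.prob {\<xi>. joined r \<xi> (blk b n) < n}) \<longlonglongrightarrow> 0" by simp
    have "(\<lambda>n. real (blk b n) / real n * (LINT r|\<rho>. LINT \<xi>|P. avg f (blk b n) r \<xi>)
        + (LINT r|\<rho>. P.prob {\<xi>. joined r \<xi> (blk b n) < n})) \<longlonglongrightarrow> b * measure \<pi> ?B + 0"
      by (intro tendsto_add tendsto_mult blk_ratio b0 lim1 l2)
    moreover have "\<forall>\<^sub>F n in sequentially. measure \<rho> B \<le> real (blk b n) / real n * (LINT r|\<rho>. LINT \<xi>|P. avg f (blk b n) r \<xi>)
        + (LINT r|\<rho>. P.prob {\<xi>. joined r \<xi> (blk b n) < n})"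
      using eventually_gt_at_top[of 0]
    proof eventually_elim
      fix n :: nat assume n: "0 < n"
      from ineq[of "blk b n" n] have "real n * measure \<rho> B
        \<le> real (blk b n) * (LINT r|\<rho>. LINT \<xi>|P. avg f (blk b n) r \<xi>) + real n * (LINT r|\<rho>. P.prob {\<xi>. joined r \<xi> (blk b n) < n})"
        by (simp add: blk_def)
      then show "measure \<rho> B \<le> real (blk b n) / real n * (LINT r|\<rho>. LINT \<xi>|P. avg f (blk b n) r \<xi>)
        + (LINT r|\<rho>. P.prob {\<xi>. joined r \<xi> (blk b n) < n})"
        using n by (simp add: field_simps)
    qed
    ultimately show ?thesis by (intro tendsto_lowerbound[where F=sequentially]) auto
  qed
  have "((\<lambda>b. b * measure \<pi> ?B) \<longlongrightarrow> 1 / \<kappa> * measure \<pi> ?B) (at_right (1 / \<kappa>))" by (intro tendsto_intros)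
  then have "measure \<rho> B \<le> 1 / \<kappa> * measure \<pi> ?B"
  proof (rule tendsto_lowerbound)
    show "\<forall>\<^sub>F b in at_right (1 / \<kappa>). measure \<rho> B \<le> b * measure \<pi> ?B"
      using eventually_at_right_less[of "1 / \<kappa>"] by eventually_elim (rule bound)
  qed simp
  then show ?thesis by simp
qed

text \<open>
  The bound applies to \<open>B\<close> and to its complement, and the totals agree.
\<close>

lemma joining_law:
  assumes B: "B \<in> sets SQ"
  shows "measure \<pi> (B \<inter> {r. r (s - 1) \<le> \<theta>}) = \<kappa> * measure \<rho> B"
proof -
  let ?D = "{r. r (s - 1) \<le> \<theta>}"
  have B': "- B \<in> sets SQ" using sets.compl_sets[OF B] by (simp add: Compl_eq_Diff_UNIV)
  have 1: "\<kappa> * measure \<rho> B \<le> measure \<pi> (B \<inter> ?D)" "\<kappa> * measure \<rho> (- B) \<le> measure \<pi> (- B \<inter> ?D)"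
    using \<rho>_le[OF B] \<rho>_le[OF B'] \<kappa>_pos by (simp_all add: field_simps)
  have "measure \<pi> (B \<inter> ?D) + measure \<pi> (- B \<inter> ?D) = measure \<pi> ((B \<inter> ?D) \<union> (- B \<inter> ?D))"
    by (rule \<pi>.finite_measure_Union[symmetric]) (use B B' sets_joins in \<open>auto simp: sets_\<pi>\<close>)
  also have "(B \<inter> ?D) \<union> (- B \<inter> ?D) = ?D" by blast
  finally have 2: "measure \<pi> (B \<inter> ?D) + measure \<pi> (- B \<inter> ?D) = \<kappa>" by (simp add: \<kappa>_def)
  have "measure \<rho> (- B) = 1 - measure \<rho> B"
    using \<rho>.prob_compl[of B] B by (simp add: sets_\<rho> Compl_eq_Diff_UNIV)
  then have "\<kappa> * measure \<rho> (- B) = \<kappa> - \<kappa> * measure \<rho> B" by (simp add: right_diff_distrib)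
  with 1 2 show ?thesis by linarith
qed

end

section \<open>The stationary density at the patience level\<close>

lemma measure_tail_tendsto:
  fixes N :: "real measure"
  assumes "prob_space N" "sets N = sets borel" "incseq X" "X \<longlonglongrightarrow> \<theta>" "\<And>n. X n < (\<theta>::real)"
  shows "(\<lambda>n. measure N {X n - y<..}) \<longlonglongrightarrow> measure N {\<theta> - y..}"
proof -
  interpret prob_space N by fact
  have "(\<lambda>n. measure N {X n - y<..}) \<longlonglongrightarrow> measure N (\<Inter>n. {X n - y<..})"
  proof (rule finite_Lim_measure_decseq)
    show "range (\<lambda>n. {X n - y<..}) \<subseteq> sets N" unfolding assms(2) by (rule image_subsetI) simp
    show "decseq (\<lambda>n. {X n - y<..})" 
    proof (rule decseq_SucI)
      fix n
      have "X n \<le> X (Suc n)" using incseq_SucD[OF assms(3)] .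
      then show "{X (Suc n) - y<..} \<subseteq> {X n - y<..}" by auto
    qed
  qed
  also have "(\<Inter>n. {X n - y<..}) = {\<theta> - y..}"
  proof (intro equalityI subsetI)
    fix z assume z: "z \<in> (\<Inter>n. {X n - y<..})"
    have "X n \<le> z + y" for n
    proof -
      have "X n - y < z" using z by blast
      then show ?thesis by linarith
    qed
    then have "\<theta> \<le> z + y" by (intro LIMSEQ_le_const2[OF assms(4)]) blast
    then show "z \<in> {\<theta> - y..}" by simp
  next
    fix z assume z: "z \<in> {\<theta> - y..}"
    have "X n - y < z" for n using assms(5)[of n] z by simp
    then show "z \<in> (\<Inter>n. {X n - y<..})" by blast
  qed
  finally show ?thesis .
qed

context stationary_queue
begin

lemma measurable_w: "(\<lambda>\<omega>. virtual_wait s (R \<omega>) 0) \<in> borel_measurable M"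
  unfolding virtual_wait_eq_resid[OF s] by (rule measurable_compose[OF measurable_R measurable_SQ_component])

lemma measure_\<pi>_eq:
  assumes "B \<in> sets borel"
  shows "measure \<pi> {r. r (s - 1) \<in> B} = measure M {\<omega>\<in>space M. virtual_wait s (R \<omega>) 0 \<in> B}"
    and "{r. r (s - 1) \<in> B} \<in> sets SQ"
proof -
  show s': "{r. r (s - 1) \<in> B} \<in> sets SQ"
    using measurable_sets[OF measurable_SQ_component assms, of "s - 1"] by (simp add: vimage_def)
  show "measure \<pi> {r. r (s - 1) \<in> B} = measure M {\<omega>\<in>space M. virtual_wait s (R \<omega>) 0 \<in> B}"
    unfolding \<pi>_def by (subst measure_distr[OF measurable_R s'])
      (simp add: vimage_def Int_def conj_commute virtual_wait_eq_resid[OF s])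
qed

lemma \<kappa>_eq: "\<kappa> = 1 - loss_probability s \<theta> M R"
proof -
  have B: "{\<omega>\<in>space M. virtual_wait s (R \<omega>) 0 \<in> {..\<theta>}} \<in> sets M"
    using measurable_sets[OF measurable_w, of "{..\<theta>}"] by (simp add: vimage_def Int_def conj_commute)
  have "{\<omega>\<in>space M. \<theta> < virtual_wait s (R \<omega>) 0} = space M - {\<omega>\<in>space M. virtual_wait s (R \<omega>) 0 \<in> {..\<theta>}}" by auto
  then have "loss_probability s \<theta> M R = 1 - measure M {\<omega>\<in>space M. virtual_wait s (R \<omega>) 0 \<in> {..\<theta>}}"
    unfolding loss_probability_def using M.prob_compl[OF B] by simp
  then show ?thesis using measure_\<pi>_eq(1)[of "{..\<theta>}"] by (simp add: \<kappa>_def)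
qed

end

locale queue_density = stationary_queue s \<theta> lam G M R T S for s \<theta> lam G and M :: "'a measure" and R T S +
  fixes K :: "real \<Rightarrow> real measure" and v :: "real \<Rightarrow> real"
  assumes vd: "virtual_wait_density s \<theta> lam M R K v" and K: "K \<in> borel \<rightarrow>\<^sub>M prob_algebra borel"
begin

lemma v_measurable [measurable]: "v \<in> borel_measurable borel"
  using vd by (simp add: virtual_wait_density_def)

lemma v_nonneg: "0 \<le> x \<Longrightarrow> 0 \<le> v x"
  using vd unfolding virtual_wait_density_def by blast

lemma v_density:
  assumes "C \<in> sets borel" "C \<subseteq> {0<..}"
  shows "emeasure M {\<omega>\<in>space M. virtual_wait s (R \<omega>) 0 \<in> C} = (\<integral>\<^sup>+x\<in>C. ennreal (v x) \<partial>lborel)"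
  using vd assms unfolding virtual_wait_density_def by blast

lemma K_prob: "prob_space (K y)" "sets (K y) = sets borel"
  using measurable_space[OF K, of y] by (auto simp: space_prob_algebra)

lemma measurable_K_tail [measurable]:
  "(\<lambda>y. measure (K y) {x - y<..}) \<in> borel_measurable borel"
  "(\<lambda>y. measure (K y) {x - y..}) \<in> borel_measurable borel"
  "(\<lambda>y. measure (K y) {x - y}) \<in> borel_measurable borel"
  "(\<lambda>y. measure (K y) {x<..}) \<in> borel_measurable borel"
proof -
  note K' = measurable_prob_algebraD[OF K]
  have S: "(SIGMA y:space borel. A y) = {z. snd z \<in> A (fst z)}" for A :: "real \<Rightarrow> real set" by (auto simp: Sigma_def)
  have sets: "{z::real\<times>real. Q z} \<in> sets (borel \<Otimes>\<^sub>M borel)" if "Measurable.pred (borel \<Otimes>\<^sub>M borel) Q" for Q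
    using that by (simp add: pred_def space_pair_measure)
  show "(\<lambda>y. measure (K y) {x - y<..}) \<in> borel_measurable borel"
    by (rule measure_measurable_subprob_algebra2[OF _ K']) (unfold S, rule sets, simp, measurable)
  show "(\<lambda>y. measure (K y) {x - y..}) \<in> borel_measurable borel"
    by (rule measure_measurable_subprob_algebra2[OF _ K']) (unfold S, rule sets, simp, measurable)
  show "(\<lambda>y. measure (K y) {x - y}) \<in> borel_measurable borel"
    by (rule measure_measurable_subprob_algebra2[OF _ K']) (unfold S, rule sets, simp, measurable)
  show "(\<lambda>y. measure (K y) {x<..}) \<in> borel_measurable borel"
    by (rule measure_measurable_subprob_algebra2[OF _ K']) (unfold S, rule sets, simp, measurable)
qed

lemma K_le_1: "measure (K y) A \<le> 1"
  using prob_space.prob_le_1[OF K_prob(1)] .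

lemma v_integrable: "integrable lborel (\<lambda>y. indicator {0..\<theta>} y * v y)"
proof -
  have "integrable lborel (\<lambda>y. indicator {0<..} y * v y)"
  proof (rule integrableI_nonneg)
    show "AE y in lborel. 0 \<le> indicator {0<..} y * v y" by (auto simp: indicator_def v_nonneg)
    have "(\<integral>\<^sup>+y. ennreal (indicator {0<..} y * v y) \<partial>lborel) = (\<integral>\<^sup>+y\<in>{0<..}. ennreal (v y) \<partial>lborel)"
      by (intro nn_integral_cong) (auto simp: indicator_def)
    also have "\<dots> = emeasure M {\<omega>\<in>space M. virtual_wait s (R \<omega>) 0 \<in> {0<..}}" by (rule v_density[symmetric]) auto
    also have "\<dots> < \<infinity>" by (simp add: M.emeasure_eq_measure)
    finally show "(\<integral>\<^sup>+y. ennreal (indicator {0<..} y * v y) \<partial>lborel) < \<infinity>" .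
  qed measurable
  then show ?thesis
  proof (rule Bochner_Integration.integrable_bound)
    show "AE y in lborel. norm (indicator {0..\<theta>} y * v y) \<le> norm (indicator {0<..} y * v y)"
      using AE_lborel_singleton[of 0] by eventually_elim (auto simp: indicator_def)
  qed measurable
qed

text \<open>
  The right-hand side of the level crossing equation at \<open>\<theta>\<close>, with closed half-lines in place of open ones:
\<close>

definition vleft :: real where
  "vleft = lam * number_prob M R (s - 1) * measure (K 0) {\<theta>..}
     + lam * (LINT y|lborel. indicator {0..<\<theta>} y * (v y * measure (K y) {\<theta> - y..}))"

lemma v_eq:
  assumes "0 \<le> x" "x \<le> \<theta>"
  shows "v x = lam * number_prob M R (s - 1) * measure (K 0) {x<..}
     + lam * (LINT y|lborel. indicator {0..x} y * (v y * measure (K y) {x - y<..}))"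
proof -
  have "v x = lam * number_prob M R (s - 1) * measure (K 0) {x<..}
        + lam * (LINT y:{0..x}|lborel. v y * indicator {..\<theta>} y * measure (K y) {x - y<..})"
    using vd assms unfolding virtual_wait_density_def by blast
  also have "(LINT y:{0..x}|lborel. v y * indicator {..\<theta>} y * measure (K y) {x - y<..})
     = (LINT y|lborel. indicator {0..x} y * (v y * measure (K y) {x - y<..}))"
    unfolding set_lebesgue_integral_def using assms by (intro Bochner_Integration.integral_cong) (auto simp: indicator_def)
  finally show ?thesis .
qed

text \<open>
  As \<open>x\<close> increases to \<open>\<theta>\<close>, the open half-lines in the level crossing equation decrease to closed ones. This is
  where an atom of the jump law can make the left limit differ from \<open>v \<theta>\<close>.
\<close>

lemma v_tendsto_left: "(v \<longlongrightarrow> vleft) (at_left \<theta>)"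
proof (rule tendsto_at_left_sequentially[of 0])
  fix X :: "nat \<Rightarrow> real" assume X: "\<And>n. X n < \<theta>" "\<And>n. 0 < X n" "incseq X" "X \<longlonglongrightarrow> \<theta>"
  have K1: "(\<lambda>n. measure (K y) {X n - y<..}) \<longlonglongrightarrow> measure (K y) {\<theta> - y..}" for y
    by (rule measure_tail_tendsto[OF K_prob X(3,4,1)])
  have "(\<lambda>n. LINT y|lborel. indicator {0..X n} y * (v y * measure (K y) {X n - y<..}))
     \<longlonglongrightarrow> (LINT y|lborel. indicator {0..<\<theta>} y * (v y * measure (K y) {\<theta> - y..}))"
  proof (rule integral_dominated_convergence[where w="\<lambda>y. indicator {0..\<theta>} y * v y"])
    show "integrable lborel (\<lambda>y. indicator {0..\<theta>} y * v y)" by (rule v_integrable)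
    show "AE y in lborel. norm (indicator {0..X n} y * (v y * measure (K y) {X n - y<..})) \<le> indicator {0..\<theta>} y * v y" for n
    proof (rule AE_I2)
      fix y
      show "norm (indicator {0..X n} y * (v y * measure (K y) {X n - y<..})) \<le> indicator {0..\<theta>} y * v y"
        using X(1)[of n] v_nonneg[of y] K_le_1[of y "{X n - y<..}"]
        by (auto simp: indicator_def abs_mult mult_left_le)
    qed
    show "AE y in lborel. (\<lambda>n. indicator {0..X n} y * (v y * measure (K y) {X n - y<..}))
      \<longlonglongrightarrow> indicator {0..<\<theta>} y * (v y * measure (K y) {\<theta> - y..})"
    proof (rule AE_I2)
      fix y
      have "\<forall>\<^sub>F n in sequentially. (indicator {0..X n} y :: real) = indicator {0..<\<theta>} y"
      proof (cases "y < \<theta>")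
        case True
        then have "\<forall>\<^sub>F n in sequentially. y < X n" using X(4) by (intro order_tendstoD(1)) auto
        then show ?thesis by eventually_elim (use True in \<open>auto simp: indicator_def\<close>)
      next
        case False
        have "indicator {0..X n} y = (indicator {0..<\<theta>} y :: real)" for n using False X(1)[of n] by (auto simp: indicator_def)
        then show ?thesis by simp
      qed
      then have "(\<lambda>n. indicator {0..X n} y :: real) \<longlonglongrightarrow> indicator {0..<\<theta>} y" by (rule tendsto_eventually)
      then show "(\<lambda>n. indicator {0..X n} y * (v y * measure (K y) {X n - y<..}))
        \<longlonglongrightarrow> indicator {0..<\<theta>} y * (v y * measure (K y) {\<theta> - y..})"
        by (intro tendsto_mult tendsto_const K1)
    qed
  qed measurable
  moreover have "(\<lambda>n. measure (K 0) {X n<..}) \<longlonglongrightarrow> measure (K 0) {\<theta>..}" using K1[of 0] by simp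
  ultimately have "(\<lambda>n. lam * number_prob M R (s - 1) * measure (K 0) {X n<..}
     + lam * (LINT y|lborel. indicator {0..X n} y * (v y * measure (K y) {X n - y<..}))) \<longlonglongrightarrow> vleft"
    unfolding vleft_def by (intro tendsto_intros)
  moreover have "v (X n) = lam * number_prob M R (s - 1) * measure (K 0) {X n<..}
     + lam * (LINT y|lborel. indicator {0..X n} y * (v y * measure (K y) {X n - y<..}))" for n
    using X(1,2)[of n] by (intro v_eq) auto
  ultimately show "(\<lambda>n. v (X n)) \<longlonglongrightarrow> vleft" by simp
qed (rule \<theta>)

text \<open>
  The window ends at \<open>\<theta>\<close>, so up to a null set only the values of \<open>v\<close> to the left of \<open>\<theta>\<close> contribute.
\<close>

lemma window_density: "((\<lambda>\<epsilon>. measure \<pi> (win \<epsilon>) / \<epsilon>) \<longlongrightarrow> vleft) (at_right 0)"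
proof (rule tendstoI)
  fix e :: real assume e: "0 < e"
  have "\<forall>\<^sub>F x in at_left \<theta>. dist (v x) vleft < e / 2" using v_tendsto_left e by (intro tendstoD) auto
  then obtain a where a: "a < \<theta>" "\<And>x. a < x \<Longrightarrow> x < \<theta> \<Longrightarrow> dist (v x) vleft < e / 2"
    unfolding eventually_at_left_field by blast
  have "\<forall>\<^sub>F \<epsilon> in at_right 0. \<epsilon> < min \<theta> (\<theta> - a)"
    using \<theta> a(1) by (intro eventually_at_rightI[of 0 "min \<theta> (\<theta> - a)"]) auto
  then show "\<forall>\<^sub>F \<epsilon> in at_right 0. dist (measure \<pi> (win \<epsilon>) / \<epsilon>) vleft < e"
    using eventually_at_right_less[of 0]
  proof eventually_elim
    fix \<epsilon> :: real assume \<epsilon>: "\<epsilon> < min \<theta> (\<theta> - a)" "0 < \<epsilon>"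
    let ?I = "{\<theta> - \<epsilon><..\<theta>}"
    have sub: "?I \<subseteq> {0<..}" using \<epsilon> by auto
    have "win \<epsilon> = {r. r (s - 1) \<in> ?I}" by (auto simp: win_def)
    then have "ennreal (measure \<pi> (win \<epsilon>)) = emeasure M {\<omega>\<in>space M. virtual_wait s (R \<omega>) 0 \<in> ?I}"
      using measure_\<pi>_eq(1)[of ?I] by (simp add: M.emeasure_eq_measure)
    also have "\<dots> = (\<integral>\<^sup>+x\<in>?I. ennreal (v x) \<partial>lborel)" by (rule v_density[OF _ sub]) simp
    also have "\<dots> = (\<integral>\<^sup>+x. ennreal (indicator ?I x * v x) \<partial>lborel)"
      by (intro nn_integral_cong) (auto simp: indicator_def)
    finally have m: "ennreal (measure \<pi> (win \<epsilon>)) = (\<integral>\<^sup>+x. ennreal (indicator ?I x * v x) \<partial>lborel)" .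
    have int: "integrable lborel (\<lambda>x. indicator ?I x * v x)"
      by (rule Bochner_Integration.integrable_bound[OF v_integrable]) (use \<epsilon> in \<open>auto simp: indicator_def intro!: AE_I2\<close>)
    have mv: "measure \<pi> (win \<epsilon>) = (LINT x|lborel. indicator ?I x * v x)"
    proof -
      have "(\<integral>\<^sup>+x. ennreal (indicator ?I x * v x) \<partial>lborel) = ennreal (LINT x|lborel. indicator ?I x * v x)"
        by (rule nn_integral_eq_integral[OF int]) (use sub v_nonneg in \<open>auto simp: indicator_def intro!: AE_I2\<close>)
      moreover have "0 \<le> (LINT x|lborel. indicator ?I x * v x)"
        by (rule Bochner_Integration.integral_nonneg) (use \<epsilon> v_nonneg in \<open>auto simp: indicator_def\<close>)
      ultimately show ?thesis using m by simp
    qed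
    have I: "integrable lborel (\<lambda>x. indicator ?I x * c)" "(LINT x|lborel. indicator ?I x * c) = \<epsilon> * c" for c :: real
    proof -
      have i: "integrable lborel (indicator ?I :: real \<Rightarrow> real)" using \<epsilon> by (intro integrable_real_indicator) simp_all
      then show "integrable lborel (\<lambda>x. indicator ?I x * c)" by (rule integrable_mult_left)
      have "(LINT x|lborel. indicator ?I x * c) = (LINT x|lborel. indicator ?I x) * c" by simp
      also have "(LINT x|lborel. indicator ?I x) = \<epsilon>" using \<epsilon> by simp
      finally show "(LINT x|lborel. indicator ?I x * c) = \<epsilon> * c" .
    qed
    have ae: "AE x in lborel. \<bar>indicator ?I x * v x - indicator ?I x * vleft\<bar> \<le> indicator ?I x * (e / 2)"
      using AE_lborel_singleton[of \<theta>]
    proof eventually_elim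
      fix x assume "x \<noteq> \<theta>"
      then have "x \<in> ?I \<Longrightarrow> \<bar>v x - vleft\<bar> \<le> e / 2"
        using a(2)[of x] \<epsilon> by (simp add: dist_real_def)
      then show "\<bar>indicator ?I x * v x - indicator ?I x * vleft\<bar> \<le> indicator ?I x * (e / 2)"
        by (cases "x \<in> ?I") simp_all
    qed
    have "\<bar>(LINT x|lborel. indicator ?I x * v x) - \<epsilon> * vleft\<bar> = \<bar>LINT x|lborel. indicator ?I x * v x - indicator ?I x * vleft\<bar>"
      using Bochner_Integration.integral_diff[OF int I(1)[of vleft]] I(2)[of vleft] by (simp only:)
    also have "\<dots> \<le> (LINT x|lborel. \<bar>indicator ?I x * v x - indicator ?I x * vleft\<bar>)" by (rule integral_abs_bound)
    also have "\<dots> \<le> (LINT x|lborel. indicator ?I x * (e / 2))"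
      by (rule integral_mono_AE[OF _ I(1) ae]) (intro integrable_abs Bochner_Integration.integrable_diff int I(1))
    also have "\<dots> = \<epsilon> * (e / 2)" by (rule I(2))
    finally have "\<bar>measure \<pi> (win \<epsilon>) - \<epsilon> * vleft\<bar> \<le> \<epsilon> * (e / 2)" unfolding mv .
    moreover have "measure \<pi> (win \<epsilon>) / \<epsilon> - vleft = (measure \<pi> (win \<epsilon>) - \<epsilon> * vleft) / \<epsilon>" using \<epsilon> by (simp add: field_simps)
    ultimately have "\<bar>measure \<pi> (win \<epsilon>) / \<epsilon> - vleft\<bar> \<le> e / 2"
      using \<epsilon>(2) by (simp add: abs_divide pos_divide_le_eq mult.commute)
    then show "dist (measure \<pi> (win \<epsilon>) / \<epsilon>) vleft < e" using e by (simp add: dist_real_def)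
  qed
qed

lemma vleft_eq:
  assumes 1: "number_prob M R (s - 1) * measure (K 0) {\<theta>} = 0"
    and 2: "AE y in lborel. 0 < y \<and> y < \<theta> \<longrightarrow> v y * measure (K y) {\<theta> - y} = 0"
  shows "vleft = v \<theta>"
proof -
  have split: "measure (K y) {a..} = measure (K y) {a<..} + measure (K y) {a}" for y a
  proof -
    interpret K: prob_space "K y" by (rule K_prob)
    have "{a..} = {a<..} \<union> {a}" by auto
    then show ?thesis using K.finite_measure_Union[of "{a<..}" "{a}"] by (simp add: K_prob)
  qed
  have "(LINT y|lborel. indicator {0..<\<theta>} y * (v y * measure (K y) {\<theta> - y..}))
      = (LINT y|lborel. indicator {0..\<theta>} y * (v y * measure (K y) {\<theta> - y<..}))"
  proof (rule integral_cong_AE)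
    show "AE y in lborel. indicator {0..<\<theta>} y * (v y * measure (K y) {\<theta> - y..}) = indicator {0..\<theta>} y * (v y * measure (K y) {\<theta> - y<..})"
      using 2 AE_lborel_singleton[of 0] AE_lborel_singleton[of \<theta>]
      by eventually_elim (auto simp: indicator_def split distrib_left)
  qed measurable
  moreover have "lam * number_prob M R (s - 1) * measure (K 0) {\<theta>..} = lam * number_prob M R (s - 1) * measure (K 0) {\<theta><..}"
    using 1 by (auto simp: split distrib_left)
  ultimately show ?thesis using v_eq[of \<theta>] \<theta> by (simp add: vleft_def)
qed

end

locale observed_density =
  observed_queue s \<theta> lam G M R T S M0 R0 T0 S0 + queue_density s \<theta> lam G M R T S K v
  for s \<theta> lam G and M :: "'a measure" and R T S and M0 :: "'b measure" and R0 T0 S0 K v +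
  assumes jl: "jump_law s \<theta> M0 R0 T0 S0 K"
begin

lemma accept_shift_neq:
  assumes "b \<noteq> \<theta>" "t \<noteq> a (s - 1) - \<theta>" "t \<noteq> a (s - 1 - 1) - \<theta>" "t \<noteq> a (s - 1) - \<theta> + b"
  shows "accept s \<theta> (shift t a) b (s - 1) \<noteq> \<theta>"
proof
  let ?w = "max 0 (a (s - 1) - t)"
  assume "accept s \<theta> (shift t a) b (s - 1) = \<theta>"
  then have "?w = \<theta> \<or> max 0 (a (s - 1 - 1) - t) = \<theta> \<or> ?w + b = \<theta>"
    by (auto simp: accept_def ins_def shift_def max_def min_def split: if_splits)
  then show False using assms \<theta> by (auto simp: max_def split: if_splits)
qed

text \<open>
  In stationarity residual times have no atom at \<open>\<theta>\<close>, as the last gap is exponential. So the waiting time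
  just after a jump has an atom there only if the service requirement has one.
\<close>

lemma AE_accept_neq:
  assumes G0: "measure G {\<theta>} = 0"
  shows "AE r in \<rho>. P.prob {\<xi>. accept s \<theta> r (snd (\<xi> 0)) (s - 1) = \<theta>} = 0"
proof -
  have acc[measurable]: "(\<lambda>x. accept s \<theta> (f x) (g x) (s - 1)) \<in> borel_measurable N"
    if "f \<in> N \<rightarrow>\<^sub>M SQ" "g \<in> borel_measurable N" for f g and N :: "'z measure"
    by (rule measurable_compose[OF measurable_accept[OF that] measurable_SQ_component])
  define h :: "(nat \<Rightarrow> real) \<Rightarrow> ennreal" where
    "h r = (\<integral>\<^sup>+b. (if accept s \<theta> r b (s - 1) = \<theta> then 1 else 0) \<partial>G)" for r
  have h[measurable]: "h \<in> borel_measurable SQ" unfolding h_def by measurable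
  have Gb: "AE b in G. b \<noteq> \<theta>"
  proof -
    have "{\<theta>} \<in> null_sets G" using G0 by (auto simp: null_sets_def sets_G G.emeasure_eq_measure)
    from AE_not_in[OF this] show ?thesis by simp
  qed
  have zero: "(\<integral>\<^sup>+t. h (shift t a) \<partial>Ex) = 0" for a
  proof -
    have [simp]: "a \<in> space SQ" by simp
    have m: "(\<lambda>(t, b). if accept s \<theta> (shift t a) b (s - 1) = \<theta> then 1 else 0 :: ennreal) \<in> borel_measurable (Ex \<Otimes>\<^sub>M G)"
      unfolding case_prod_beta' by measurable
    have "(\<integral>\<^sup>+t. h (shift t a) \<partial>Ex) = (\<integral>\<^sup>+b. (\<integral>\<^sup>+t. (if accept s \<theta> (shift t a) b (s - 1) = \<theta> then 1 else 0) \<partial>Ex) \<partial>G)"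
      unfolding h_def using EG.Fubini[OF m] by simp
    also have "\<dots> = (\<integral>\<^sup>+b. 0 \<partial>G)"
    proof (rule nn_integral_cong_AE, use Gb in eventually_elim)
      fix b assume b: "b \<noteq> \<theta>"
      have "(\<integral>\<^sup>+t. (if accept s \<theta> (shift t a) b (s - 1) = \<theta> then 1 else 0 :: ennreal) \<partial>Ex) = (\<integral>\<^sup>+t. 0 \<partial>Ex)"
      proof (rule nn_integral_cong_AE)
        show "AE t in Ex. (if accept s \<theta> (shift t a) b (s - 1) = \<theta> then 1 else 0 :: ennreal) = 0"
          using Ex_atom[of "a (s - 1) - \<theta>"] Ex_atom[of "a (s - 1 - 1) - \<theta>"] Ex_atom[of "a (s - 1) - \<theta> + b"]
        proof eventually_elim
          fix t assume "t \<noteq> a (s - 1) - \<theta>" "t \<noteq> a (s - 1 - 1) - \<theta>" "t \<noteq> a (s - 1) - \<theta> + b"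
          from accept_shift_neq[OF b this] show "(if accept s \<theta> (shift t a) b (s - 1) = \<theta> then 1 else 0 :: ennreal) = 0" by simp
        qed
      qed
      then show "(\<integral>\<^sup>+t. (if accept s \<theta> (shift t a) b (s - 1) = \<theta> then 1 else 0 :: ennreal) \<partial>Ex) = 0" by simp
    qed
    finally show ?thesis by simp
  qed
  have "(\<integral>\<^sup>+r. h r \<partial>\<pi>) = (\<integral>\<^sup>+r. (\<integral>\<^sup>+x. h (step r x) \<partial>\<nu>) \<partial>\<pi>)" by (rule nn_integral_\<pi>_step[OF h, symmetric])
  also have "\<dots> = (\<integral>\<^sup>+r. 0 \<partial>\<pi>)"
  proof (rule nn_integral_cong)
    fix r
    have "(\<lambda>x. h (step r x)) \<in> borel_measurable (borel \<Otimes>\<^sub>M borel)" by measurable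
    then have "(\<integral>\<^sup>+x. h (step r x) \<partial>\<nu>) = (\<integral>\<^sup>+b. (\<integral>\<^sup>+t. h (shift t (accept s \<theta> r b)) \<partial>Ex) \<partial>G)"
      by (subst nn_integral_\<nu>(2)) (simp_all add: qstep_def)
    then show "(\<integral>\<^sup>+x. h (step r x) \<partial>\<nu>) = 0" by (simp add: zero)
  qed
  finally have h0: "(\<integral>\<^sup>+r. h r \<partial>\<pi>) = 0" by simp
  have hP: "ennreal (P.prob {\<xi>. accept s \<theta> r (snd (\<xi> 0)) (s - 1) = \<theta>}) = h r" for r
  proof -
    have "(\<lambda>\<xi>. \<xi> 0) \<in> P \<rightarrow>\<^sub>M \<nu>" by (rule measurable_component_singleton) simp
    then have [measurable]: "(\<lambda>\<xi>. snd (\<xi> 0)) \<in> borel_measurable P"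
      using measurable_compose[of "\<lambda>\<xi>. \<xi> 0" P \<nu> snd borel] by (simp add: measurable_\<nu>)
    let ?A = "{\<xi>. accept s \<theta> r (snd (\<xi> 0)) (s - 1) = \<theta>}"
    have "Measurable.pred P (\<lambda>\<xi>. accept s \<theta> r (snd (\<xi> 0)) (s - 1) = \<theta>)" by measurable
    then have A: "?A \<in> sets P" by (simp add: pred_def)
    have mb: "(\<lambda>b. if accept s \<theta> r b (s - 1) = \<theta> then 1 else 0 :: ennreal) \<in> borel_measurable borel" by measurable
    have "ennreal (P.prob ?A) = (\<integral>\<^sup>+\<xi>. indicator ?A \<xi> \<partial>P)" using A by (simp add: P.emeasure_eq_measure)
    also have "\<dots> = (\<integral>\<^sup>+x. (\<integral>\<^sup>+\<xi>. indicator ?A (case_nat x \<xi>) \<partial>P) \<partial>\<nu>)"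
      by (rule inp.nn_integral_first_step) (use A in simp)
    also have "\<dots> = (\<integral>\<^sup>+x. (if accept s \<theta> r (snd x) (s - 1) = \<theta> then 1 else 0) \<partial>\<nu>)"
      using P.emeasure_space_1 by (intro nn_integral_cong) (simp add: indicator_def)
    also have "\<dots> = h r" unfolding h_def by (rule nn_integral_snd_\<nu>[OF mb])
    finally show ?thesis .
  qed
  let ?N = "{r. h r \<noteq> 0}"
  have N: "?N \<in> sets SQ"
  proof -
    have "Measurable.pred SQ (\<lambda>r. h r \<noteq> 0)" by measurable
    then show ?thesis by (simp add: pred_def)
  qed
  have "AE r in \<pi>. h r = 0" using h0 by (subst (asm) nn_integral_0_iff_AE) (simp_all add: measurable_cong_sets[OF sets_\<pi> refl])
  then have "measure \<pi> (?N \<inter> {r. r (s - 1) \<le> \<theta>}) = 0"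
  proof -
    have "AE r in \<pi>. r \<notin> ?N \<inter> {r. r (s - 1) \<le> \<theta>}" using \<open>AE r in \<pi>. h r = 0\<close> by eventually_elim simp
    then show ?thesis using \<pi>.prob_eq_0[of "?N \<inter> {r. r (s - 1) \<le> \<theta>}"] N sets_joins by (simp add: sets_\<pi>)
  qed
  then have "measure \<rho> ?N = 0" using joining_law[OF N] \<kappa>_pos by simp
  then have "AE r in \<rho>. r \<notin> ?N" using \<rho>.prob_eq_0[of ?N] N by (simp add: sets_\<rho>)
  then show ?thesis
  proof eventually_elim
    fix r assume "r \<notin> ?N"
    then have "ennreal (P.prob {\<xi>. accept s \<theta> r (snd (\<xi> 0)) (s - 1) = \<theta>}) = 0" unfolding hP by simp
    then show "P.prob {\<xi>. accept s \<theta> r (snd (\<xi> 0)) (s - 1) = \<theta>} = 0" by (simp add: ennreal_eq_0_iff measure_le_0_iff)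
  qed
qed

abbreviation w :: "'b \<Rightarrow> real" where
  "w \<omega> \<equiv> virtual_wait s (R0 \<omega>) 0"

text \<open>The virtual waiting time just after customer 0 has joined:\<close>

abbreviation z :: "'b \<Rightarrow> real" where
  "z \<omega> \<equiv> virtual_wait s (departures s \<theta> (R0 \<omega>) (arrival0 T0 \<omega>) (\<lambda>i. S0 i \<omega>) 1) 0"

abbreviation E :: "'b \<Rightarrow> bool" where
  "E \<omega> \<equiv> s - 1 \<le> present (R0 \<omega>) 0"

lemma measurable_w0 [measurable]: "w \<in> borel_measurable M0"
  unfolding virtual_wait_eq_resid[OF s] by (rule measurable_compose[OF measurable_r0 measurable_SQ_component])

lemma measurable_z0 [measurable]: "z \<in> borel_measurable M0"
  unfolding virtual_wait_eq_resid[OF s] by (rule measurable_resid[OF content_D0]) simp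

lemma measurable_E [measurable]: "Measurable.pred M0 E"
proof -
  have [measurable]: "(\<lambda>\<omega>. present (R0 \<omega>) 0) \<in> M0 \<rightarrow>\<^sub>M count_space UNIV"
    by (rule content_measurableD[OF input_law(1)[OF q0]]) simp
  show ?thesis by measurable
qed

lemma prob_z:
  assumes G0: "measure G {\<theta>} = 0"
  shows "M0.prob {\<omega>\<in>space M0. z \<omega> = \<theta>} = 0"
proof -
  have zeq: "z \<omega> = accept s \<theta> (r0 \<omega>) (snd (\<Xi> \<omega> 0)) (s - 1)" for \<omega>
    using resid_departures_Suc[OF s, of \<theta> "R0 \<omega>" "arrival0 T0 \<omega>" "\<lambda>i. S0 i \<omega>" 0]
    by (simp add: virtual_wait_eq_resid[OF s] arrival0_def)
  have Q: "Measurable.pred (SQ \<Otimes>\<^sub>M P) (\<lambda>z. accept s \<theta> (fst z) (snd (snd z 0)) (s - 1) = \<theta>)"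
  proof -
    have "(\<lambda>\<xi>. \<xi> 0) \<in> P \<rightarrow>\<^sub>M \<nu>" by (rule measurable_component_singleton) simp
    then have "(\<lambda>\<xi>. snd (\<xi> 0)) \<in> borel_measurable P"
      using measurable_compose[of "\<lambda>\<xi>. \<xi> 0" P \<nu> snd borel] by (simp add: measurable_\<nu>)
    then have b: "(\<lambda>z. snd (snd z 0)) \<in> borel_measurable (SQ \<Otimes>\<^sub>M P)" by (rule measurable_compose[OF measurable_snd])
    have [measurable]: "(\<lambda>z. accept s \<theta> (fst z) (snd (snd z 0)) (s - 1)) \<in> borel_measurable (SQ \<Otimes>\<^sub>M P)"
      by (rule measurable_compose[OF measurable_accept[OF measurable_fst b] measurable_SQ_component])
    show ?thesis by measurable
  qed
  have "M0.prob {\<omega>\<in>space M0. z \<omega> = \<theta>} = (LINT r|\<rho>. P.prob {\<xi>. accept s \<theta> r (snd (\<xi> 0)) (s - 1) = \<theta>})"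
    unfolding zeq by (rule prob_joint(1)[OF Q])
  also have "\<dots> = (LINT r|\<rho>. 0)"
    by (rule integral_cong_AE) (use prob_joint(2)[OF Q] AE_accept_neq[OF G0] in auto)
  finally show ?thesis by simp
qed

lemma jump_law_eq:
  assumes "C \<in> sets borel" "0 \<le> x"
  shows "M0.prob {\<omega>\<in>space M0. w \<omega> \<in> C \<and> E \<omega> \<and> z \<omega> - w \<omega> > x}
    = (LINT \<omega>|M0. indicator {\<omega>\<in>space M0. w \<omega> \<in> C \<and> E \<omega>} \<omega> * measure (K (w \<omega>)) {x<..})"
proof -
  have "M0.prob {\<omega>\<in>space M0. w \<omega> \<in> C \<and> E \<omega> \<and> z \<omega> - w \<omega> > x}
    = (LINT \<omega>:{\<omega>\<in>space M0. w \<omega> \<in> C \<and> E \<omega>}|M0. measure (K (w \<omega>)) {x<..})"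
    using jl assms unfolding jump_law_def by blast
  then show ?thesis by (simp only: set_lebesgue_integral_def real_scaleR_def)
qed

lemma integrable_K_atom:
  assumes [measurable]: "A \<in> sets M0"
  shows "integrable M0 (\<lambda>\<omega>. indicator A \<omega> * measure (K (w \<omega>)) {\<theta> - w \<omega>})"
proof (rule M0.integrable_const_bound[of _ 1])
  have [measurable]: "(\<lambda>\<omega>. measure (K (w \<omega>)) {\<theta> - w \<omega>}) \<in> borel_measurable M0"
    by (rule measurable_compose[OF measurable_w0 measurable_K_tail(3)])
  show "(\<lambda>\<omega>. indicator A \<omega> * measure (K (w \<omega>)) {\<theta> - w \<omega>}) \<in> borel_measurable M0" by measurable
qed (use K_le_1 in \<open>auto simp: indicator_def\<close>)

text \<open>
  Partitioning the waiting times below \<open>\<theta>\<close> into \<open>m\<close> intervals, the jump law bounds the chance that the jump ends exactly at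
  \<open>\<theta>\<close> by the chance that it ends within \<open>\<theta> / m\<close> of it.
\<close>

lemma K_atom_le:
  assumes m: "0 < (m::nat)"
  defines "h \<equiv> \<theta> / real m"
  shows "(LINT \<omega>|M0. indicator {\<omega>\<in>space M0. w \<omega> < \<theta> \<and> E \<omega>} \<omega> * measure (K (w \<omega>)) {\<theta> - w \<omega>})
    \<le> M0.prob {\<omega>\<in>space M0. \<bar>z \<omega> - \<theta>\<bar> \<le> h}"
proof -
  have h: "0 < h" "real m * h = \<theta>" using m \<theta> by (auto simp: h_def)
  define C where "C k = {real k * h..<real (Suc k) * h}" for k
  have C[measurable]: "C k \<in> sets borel" for k by (simp add: C_def)
  define A where "A k = {\<omega>\<in>space M0. w \<omega> \<in> C k \<and> E \<omega>}" for k
  have A[measurable]: "A k \<in> sets M0" for k unfolding A_def by measurable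
  define B where "B k = {\<omega>\<in>space M0. w \<omega> \<in> C k \<and> E \<omega> \<and> \<theta> - real (Suc k) * h < z \<omega> - w \<omega> \<and> \<not> \<theta> - real k * h < z \<omega> - w \<omega>}" for k
  have B[measurable]: "B k \<in> sets M0" for k unfolding B_def by measurable
  have w0: "0 \<le> w \<omega>" for \<omega> using resid_nonneg by (simp add: virtual_wait_eq_resid[OF s])
  have mK[measurable]: "(\<lambda>\<omega>. measure (K (w \<omega>)) {x<..}) \<in> borel_measurable M0" for x
    by (rule measurable_compose[OF measurable_w0 measurable_K_tail(4)])
  have int: "integrable M0 (\<lambda>\<omega>. indicator (A k) \<omega> * measure (K (w \<omega>)) {x<..})" for k x
    by (rule M0.integrable_const_bound[of _ 1]) (use K_le_1 in \<open>auto simp: indicator_def\<close>)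
  have part: "indicator {\<omega>\<in>space M0. w \<omega> < \<theta> \<and> E \<omega>} \<omega> \<le> (\<Sum>k<m. indicator (A k) \<omega> :: real)" for \<omega>
  proof (cases "\<omega> \<in> {\<omega>\<in>space M0. w \<omega> < \<theta> \<and> E \<omega>}")
    case True
    define k where "k = nat \<lfloor>w \<omega> / h\<rfloor>"
    have "real k \<le> w \<omega> / h" "w \<omega> / h < real k + 1"
      using w0[of \<omega>] h by (auto simp: k_def of_nat_nat)
    then have k: "real k * h \<le> w \<omega>" "w \<omega> < real (Suc k) * h" using h by (auto simp: field_simps)
    have "real k * h < real m * h" using k True h by simp
    then have "k < m" using h(1) by simp
    have "(indicator {\<omega>\<in>space M0. w \<omega> < \<theta> \<and> E \<omega>} \<omega> :: real) = indicator (A k) \<omega>" using True k by (simp add: A_def C_def)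
    also have "\<dots> \<le> (\<Sum>k<m. indicator (A k) \<omega>)" by (rule member_le_sum) (use \<open>k < m\<close> in auto)
    finally show ?thesis .
  next
    case False
    then show ?thesis by (simp add: sum_nonneg)
  qed
  have "(LINT \<omega>|M0. indicator {\<omega>\<in>space M0. w \<omega> < \<theta> \<and> E \<omega>} \<omega> * measure (K (w \<omega>)) {\<theta> - w \<omega>})
    \<le> (LINT \<omega>|M0. (\<Sum>k<m. indicator (A k) \<omega> * measure (K (w \<omega>)) {\<theta> - real (Suc k) * h<..} - indicator (A k) \<omega> * measure (K (w \<omega>)) {\<theta> - real k * h<..}))"
  proof (rule integral_mono)
    show "integrable M0 (\<lambda>\<omega>. indicator {\<omega>\<in>space M0. w \<omega> < \<theta> \<and> E \<omega>} \<omega> * measure (K (w \<omega>)) {\<theta> - w \<omega>})"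
      by (rule integrable_K_atom) measurable
    show "integrable M0 (\<lambda>\<omega>. \<Sum>k<m. indicator (A k) \<omega> * measure (K (w \<omega>)) {\<theta> - real (Suc k) * h<..} - indicator (A k) \<omega> * measure (K (w \<omega>)) {\<theta> - real k * h<..})"
      by (intro Bochner_Integration.integrable_sum Bochner_Integration.integrable_diff int)
    fix \<omega>
    interpret K: prob_space "K (w \<omega>)" by (rule K_prob)
    have "indicator {\<omega>\<in>space M0. w \<omega> < \<theta> \<and> E \<omega>} \<omega> * measure (K (w \<omega>)) {\<theta> - w \<omega>}
       \<le> (\<Sum>k<m. indicator (A k) \<omega>) * measure (K (w \<omega>)) {\<theta> - w \<omega>}"
      by (rule mult_right_mono[OF part]) simp
    also have "\<dots> = (\<Sum>k<m. indicator (A k) \<omega> * measure (K (w \<omega>)) {\<theta> - w \<omega>})" by (rule sum_distrib_right)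
    also have "\<dots> \<le> (\<Sum>k<m. indicator (A k) \<omega> * measure (K (w \<omega>)) {\<theta> - real (Suc k) * h<..} - indicator (A k) \<omega> * measure (K (w \<omega>)) {\<theta> - real k * h<..})"
    proof (rule sum_mono)
      fix k
      show "indicator (A k) \<omega> * measure (K (w \<omega>)) {\<theta> - w \<omega>}
        \<le> indicator (A k) \<omega> * measure (K (w \<omega>)) {\<theta> - real (Suc k) * h<..} - indicator (A k) \<omega> * measure (K (w \<omega>)) {\<theta> - real k * h<..}"
      proof (cases "\<omega> \<in> A k")
        case True
        then have k: "real k * h \<le> w \<omega>" "w \<omega> < real (Suc k) * h" by (auto simp: A_def C_def)
        have "{\<theta> - w \<omega>} \<union> {\<theta> - real k * h<..} \<subseteq> {\<theta> - real (Suc k) * h<..}"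
        proof -
          have "real k * h \<le> real (Suc k) * h" using h by (intro mult_right_mono) auto
          then show ?thesis using k by auto
        qed
        then have "measure (K (w \<omega>)) ({\<theta> - w \<omega>} \<union> {\<theta> - real k * h<..}) \<le> measure (K (w \<omega>)) {\<theta> - real (Suc k) * h<..}"
          by (rule K.finite_measure_mono) (simp add: K_prob)
        moreover have "measure (K (w \<omega>)) ({\<theta> - w \<omega>} \<union> {\<theta> - real k * h<..}) = measure (K (w \<omega>)) {\<theta> - w \<omega>} + measure (K (w \<omega>)) {\<theta> - real k * h<..}"
          by (rule K.finite_measure_Union) (use k in \<open>simp_all add: K_prob\<close>)
        ultimately show ?thesis using True by simp
      next
        case False
        then show ?thesis by simp
      qed
    qed
    finally show "indicator {\<omega>\<in>space M0. w \<omega> < \<theta> \<and> E \<omega>} \<omega> * measure (K (w \<omega>)) {\<theta> - w \<omega>}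
      \<le> (\<Sum>k<m. indicator (A k) \<omega> * measure (K (w \<omega>)) {\<theta> - real (Suc k) * h<..} - indicator (A k) \<omega> * measure (K (w \<omega>)) {\<theta> - real k * h<..})" .
  qed
  also have "\<dots> = (\<Sum>k<m. (LINT \<omega>|M0. indicator (A k) \<omega> * measure (K (w \<omega>)) {\<theta> - real (Suc k) * h<..})
      - (LINT \<omega>|M0. indicator (A k) \<omega> * measure (K (w \<omega>)) {\<theta> - real k * h<..}))"
    by (subst Bochner_Integration.integral_sum) (auto intro!: Bochner_Integration.integrable_diff int sum.cong Bochner_Integration.integral_diff)
  also have "\<dots> = (\<Sum>k<m. M0.prob (B k))"
  proof (rule sum.cong[OF refl])
    fix k assume "k \<in> {..<m}"
    then have "Suc k \<le> m" by simp
    then have "real (Suc k) * h \<le> real m * h" "real k * h \<le> real m * h" using h(1) by (intro mult_right_mono; simp)+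
    then have x: "0 \<le> \<theta> - real (Suc k) * h" "0 \<le> \<theta> - real k * h" using h(2) by auto
    let ?U = "\<lambda>x. {\<omega>\<in>space M0. w \<omega> \<in> C k \<and> E \<omega> \<and> z \<omega> - w \<omega> > x}"
    have "M0.prob (?U (\<theta> - real (Suc k) * h)) - M0.prob (?U (\<theta> - real k * h)) = M0.prob (?U (\<theta> - real (Suc k) * h) - ?U (\<theta> - real k * h))"
    proof (rule M0.finite_measure_Diff[symmetric])
      show "?U (\<theta> - real (Suc k) * h) \<in> sets M0" "?U (\<theta> - real k * h) \<in> sets M0" by measurable
      have "real k * h \<le> real (Suc k) * h" using h by (intro mult_right_mono) auto
      then show "?U (\<theta> - real k * h) \<subseteq> ?U (\<theta> - real (Suc k) * h)" by auto
    qed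
    also have "?U (\<theta> - real (Suc k) * h) - ?U (\<theta> - real k * h) = B k" by (auto simp: B_def)
    finally show "(LINT \<omega>|M0. indicator (A k) \<omega> * measure (K (w \<omega>)) {\<theta> - real (Suc k) * h<..})
      - (LINT \<omega>|M0. indicator (A k) \<omega> * measure (K (w \<omega>)) {\<theta> - real k * h<..}) = M0.prob (B k)"
      unfolding A_def using jump_law_eq[OF C x(1), of k] jump_law_eq[OF C x(2), of k] by simp
  qed
  also have "\<dots> = M0.prob (\<Union>k<m. B k)"
  proof (rule M0.finite_measure_finite_Union[symmetric])
    show "disjoint_family_on B {..<m}"
      unfolding disjoint_family_on_def
    proof (intro ballI impI)
      fix i j :: nat assume ij: "i \<noteq> j"
      have False if "\<omega> \<in> B i \<inter> B j" for \<omega>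
      proof -
        have "real i * h < real (Suc j) * h" "real j * h < real (Suc i) * h"
          using that by (auto simp: B_def C_def)
        then have "i < Suc j" "j < Suc i" using h(1) by (simp_all del: of_nat_Suc)
        then show False using ij by simp
      qed
      then show "B i \<inter> B j = {}" by blast
    qed
  qed auto
  also have "\<dots> \<le> M0.prob {\<omega>\<in>space M0. \<bar>z \<omega> - \<theta>\<bar> \<le> h}"
  proof (rule M0.finite_measure_mono)
    show "(\<Union>k<m. B k) \<subseteq> {\<omega>\<in>space M0. \<bar>z \<omega> - \<theta>\<bar> \<le> h}"
      by (auto simp: B_def C_def algebra_simps abs_le_iff)
    show "{\<omega>\<in>space M0. \<bar>z \<omega> - \<theta>\<bar> \<le> h} \<in> sets M0" by measurable
  qed
  finally show ?thesis .
qed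

lemma AE_K_atom:
  assumes G0: "measure G {\<theta>} = 0"
  shows "AE \<omega> in M0. w \<omega> < \<theta> \<and> E \<omega> \<longrightarrow> measure (K (w \<omega>)) {\<theta> - w \<omega>} = 0"
proof -
  let ?g = "\<lambda>\<omega>. indicator {\<omega>\<in>space M0. w \<omega> < \<theta> \<and> E \<omega>} \<omega> * measure (K (w \<omega>)) {\<theta> - w \<omega>}"
  let ?U = "\<lambda>m. {\<omega>\<in>space M0. \<bar>z \<omega> - \<theta>\<bar> \<le> \<theta> / real (Suc m)}"
  have "(\<lambda>m. M0.prob (?U m)) \<longlonglongrightarrow> M0.prob (\<Inter>m. ?U m)"
  proof (rule M0.finite_Lim_measure_decseq)
    show "range ?U \<subseteq> sets M0" by (rule image_subsetI) measurable
    show "decseq ?U"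
    proof (rule decseq_SucI)
      fix m
      have "\<theta> / real (Suc (Suc m)) \<le> \<theta> / real (Suc m)" using \<theta> by (intro divide_left_mono) auto
      then show "?U (Suc m) \<subseteq> ?U m" by auto
    qed
  qed
  also have "(\<Inter>m. ?U m) = {\<omega>\<in>space M0. z \<omega> = \<theta>}"
  proof (intro equalityI subsetI)
    fix \<omega> assume "\<omega> \<in> (\<Inter>m. ?U m)"
    then have sp: "\<omega> \<in> space M0" and le: "\<And>m. \<bar>z \<omega> - \<theta>\<bar> \<le> \<theta> / real (Suc m)" by auto
    have "(\<lambda>m. \<theta> / real (Suc m)) \<longlonglongrightarrow> 0" by (rule LIMSEQ_Suc[OF lim_const_over_n])
    then have "\<bar>z \<omega> - \<theta>\<bar> \<le> 0" by (rule LIMSEQ_le_const) (use le in blast)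
    then show "\<omega> \<in> {\<omega>\<in>space M0. z \<omega> = \<theta>}" using sp by simp
  qed (use \<theta> in auto)
  finally have lim: "(\<lambda>m. M0.prob (?U m)) \<longlonglongrightarrow> 0" by (simp only: prob_z[OF G0])
  have "(LINT \<omega>|M0. ?g \<omega>) \<le> M0.prob (?U m)" for m by (rule K_atom_le) simp
  then have le0: "(LINT \<omega>|M0. ?g \<omega>) \<le> 0" by (intro LIMSEQ_le_const[OF lim]) blast
  have int: "integrable M0 ?g"
    by (rule integrable_K_atom) measurable
  have "(LINT \<omega>|M0. ?g \<omega>) = 0"
    using le0 Bochner_Integration.integral_nonneg[of M0 ?g] by (simp add: order_antisym)
  then have "AE \<omega> in M0. ?g \<omega> = 0"
    using integral_nonneg_eq_0_iff_AE[OF int] by simp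
  then show ?thesis using AE_space by eventually_elim auto
qed

text \<open>
  Continuity of the jump law at \<open>\<theta>\<close> is known for the law seen by joining customers; it carries over
  to \<open>v\<close> and to \<open>q\<^sub>s\<^sub>-\<^sub>1\<close> since that law is the conditional stationary law.
\<close>

lemma vleft_eq_v:
  assumes G0: "measure G {\<theta>} = 0"
  shows "vleft = v \<theta>"
proof (rule vleft_eq)
  show "number_prob M R (s - 1) * measure (K 0) {\<theta>} = 0"
  proof (rule ccontr)
    assume *: "number_prob M R (s - 1) * measure (K 0) {\<theta>} \<noteq> 0"
    define B where "B = {r :: nat \<Rightarrow> real. r (s - 1) \<le> 0 \<and> (s = 1 \<or> 0 < r (s - 1 - 1))}"
    have B: "B \<in> sets SQ"
    proof -
      have [measurable]: "Measurable.pred SQ (\<lambda>r. r (s - 1) \<le> 0)" "Measurable.pred SQ (\<lambda>r. 0 < r (s - 1 - 1))"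
        unfolding pred_def by (rule borel_measurable_le[OF measurable_SQ_component borel_measurable_const],
          rule borel_measurable_less[OF borel_measurable_const measurable_SQ_component])
      have "Measurable.pred SQ (\<lambda>r. r (s - 1) \<le> 0 \<and> (s = 1 \<or> 0 < r (s - 1 - 1)))" by measurable
      then show ?thesis by (simp add: B_def pred_def)
    qed
    have BE: "resid D 0 \<in> B \<longleftrightarrow> present D 0 = s - 1" for D
    proof -
      have "present D 0 \<le> s - 1 \<longleftrightarrow> resid D 0 (s - 1) \<le> 0" "present D 0 \<le> s - 1 - 1 \<longleftrightarrow> resid D 0 (s - 1 - 1) \<le> 0"
        by (rule present_eq_resid)+
      then show ?thesis using s by (auto simp: B_def not_le[symmetric])
    qed
    have "number_prob M R (s - 1) = measure \<pi> B"
      unfolding \<pi>_def number_prob_def by (subst measure_distr[OF measurable_R B])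
        (simp add: vimage_def Int_def conj_commute BE)
    also have "B = B \<inter> {r. r (s - 1) \<le> \<theta>}" using \<theta> by (auto simp: B_def)
    also have "measure \<pi> (B \<inter> {r. r (s - 1) \<le> \<theta>}) = \<kappa> * measure \<rho> B" by (rule joining_law[OF B])
    finally have "measure \<rho> B \<noteq> 0" using * by auto
    moreover have "measure \<rho> B = M0.prob {\<omega>\<in>space M0. r0 \<omega> \<in> B}"
      unfolding \<rho>_def by (subst measure_distr[OF measurable_r0 B]) (simp add: vimage_def Int_def conj_commute)
    moreover have "AE \<omega> in M0. \<omega> \<notin> {\<omega>\<in>space M0. r0 \<omega> \<in> B}"
      using AE_K_atom[OF G0]
    proof eventually_elim
      fix \<omega> assume a: "w \<omega> < \<theta> \<and> E \<omega> \<longrightarrow> measure (K (w \<omega>)) {\<theta> - w \<omega>} = 0"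
      show "\<omega> \<notin> {\<omega>\<in>space M0. r0 \<omega> \<in> B}"
      proof
        assume "\<omega> \<in> {\<omega>\<in>space M0. r0 \<omega> \<in> B}"
        then have rB: "r0 \<omega> \<in> B" by simp
        then have "E \<omega>" using BE[of "R0 \<omega>"] by simp
        moreover have "w \<omega> = 0" using rB resid_nonneg[of "R0 \<omega>" 0 "s - 1"] by (auto simp: B_def virtual_wait_eq_resid[OF s])
        ultimately have "measure (K 0) {\<theta>} = 0" using a \<theta> by simp
        then show False using * by simp
      qed
    qed
    moreover have "{\<omega>\<in>space M0. r0 \<omega> \<in> B} \<in> sets M0"
      using measurable_sets[OF measurable_r0 B] by (simp add: vimage_def Int_def conj_commute)
    ultimately show False using M0.prob_eq_0 by simp
  qed
  show "AE y in lborel. 0 < y \<and> y < \<theta> \<longrightarrow> v y * measure (K y) {\<theta> - y} = 0"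
  proof -
    let ?N = "{y. 0 < y \<and> y < \<theta> \<and> measure (K y) {\<theta> - y} \<noteq> 0}"
    have N: "?N \<in> sets borel"
    proof -
      have "Measurable.pred borel (\<lambda>y. 0 < y \<and> y < \<theta> \<and> measure (K y) {\<theta> - y} \<noteq> 0)" by measurable
      then show ?thesis by (simp add: pred_def)
    qed
    let ?B = "{r :: nat \<Rightarrow> real. r (s - 1) \<in> ?N}"
    have B: "?B \<in> sets SQ" by (rule measure_\<pi>_eq(2)[OF N])
    have "AE \<omega> in M0. \<omega> \<notin> {\<omega>\<in>space M0. r0 \<omega> \<in> ?B}"
      using AE_K_atom[OF G0]
    proof eventually_elim
      fix \<omega> assume a: "w \<omega> < \<theta> \<and> E \<omega> \<longrightarrow> measure (K (w \<omega>)) {\<theta> - w \<omega>} = 0"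
      show "\<omega> \<notin> {\<omega>\<in>space M0. r0 \<omega> \<in> ?B}"
      proof
        assume "\<omega> \<in> {\<omega>\<in>space M0. r0 \<omega> \<in> ?B}"
        then have wN: "0 < w \<omega>" "w \<omega> < \<theta>" "measure (K (w \<omega>)) {\<theta> - w \<omega>} \<noteq> 0"
          by (simp_all add: virtual_wait_eq_resid[OF s])
        have "\<not> present (R0 \<omega>) 0 \<le> s - 1"
          using wN(1) present_eq_resid[of "R0 \<omega>" 0 "s - 1"] by (simp add: virtual_wait_eq_resid[OF s])
        then have "E \<omega>" by simp
        then show False using a wN by blast
      qed
    qed
    moreover have "{\<omega>\<in>space M0. r0 \<omega> \<in> ?B} \<in> sets M0"
      using measurable_sets[OF measurable_r0 B] by (simp add: vimage_def Int_def conj_commute)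
    moreover have "measure \<rho> ?B = M0.prob {\<omega>\<in>space M0. r0 \<omega> \<in> ?B}"
      unfolding \<rho>_def by (subst measure_distr[OF measurable_r0 B]) (simp add: vimage_def Int_def conj_commute)
    ultimately have "measure \<rho> ?B = 0" using M0.prob_eq_0 by simp
    moreover have "?B = ?B \<inter> {r. r (s - 1) \<le> \<theta>}" by auto
    ultimately have "measure \<pi> ?B = 0" using joining_law[OF B] by simp
    then have "emeasure M {\<omega>\<in>space M. virtual_wait s (R \<omega>) 0 \<in> ?N} = 0"
      unfolding measure_\<pi>_eq(1)[OF N] by (simp add: M.emeasure_eq_measure)
    then have "(\<integral>\<^sup>+y\<in>?N. ennreal (v y) \<partial>lborel) = 0"
      by (subst (asm) v_density[OF N]) auto
    moreover have "(\<lambda>y. ennreal (v y) * indicator ?N y) \<in> borel_measurable lborel" using N by simp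
    ultimately have "AE y in lborel. ennreal (v y) * indicator ?N y = 0" by (simp add: nn_integral_0_iff_AE)
    then show ?thesis
    proof eventually_elim
      fix y assume a: "ennreal (v y) * indicator ?N y = 0"
      show "0 < y \<and> y < \<theta> \<longrightarrow> v y * measure (K y) {\<theta> - y} = 0"
      proof (cases "y \<in> ?N")
        case True
        then have "ennreal (v y) = 0" "0 \<le> v y" using a v_nonneg[of y] by (auto simp: indicator_def)
        then show ?thesis by simp
      next
        case False
        then show ?thesis by auto
      qed
    qed
  qed
qed

end

section \<open>Moments of the scaled error\<close>

lemma nn_integral_power_eq_tail:
  fixes Z :: "'c \<Rightarrow> real"
  assumes N: "prob_space N" and Z [measurable]: "Z \<in> borel_measurable N" and Z0: "AE \<omega> in N. 0 \<le> Z \<omega>"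
  shows "(\<integral>\<^sup>+\<omega>. ennreal (Z \<omega> ^ Suc k) \<partial>N)
    = (\<integral>\<^sup>+x. ennreal (real (Suc k) * x ^ k * measure N {\<omega>\<in>space N. x \<le> Z \<omega>}) * indicator {0..} x \<partial>lborel)"
proof -
  interpret N: prob_space N by (rule N)
  interpret pair_sigma_finite lborel N ..
  let ?f = "\<lambda>x \<omega>. ennreal (real (Suc k) * x ^ k) * (if 0 \<le> x \<and> x \<le> Z \<omega> then 1 else 0)"
  have f: "(\<lambda>p. ?f (fst p) (snd p)) \<in> borel_measurable (lborel \<Otimes>\<^sub>M N)" by measurable
  have "(\<integral>\<^sup>+\<omega>. ennreal (Z \<omega> ^ Suc k) \<partial>N) = (\<integral>\<^sup>+\<omega>. (\<integral>\<^sup>+x. ?f x \<omega> \<partial>lborel) \<partial>N)"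
  proof (rule nn_integral_cong_AE)
    show "AE \<omega> in N. ennreal (Z \<omega> ^ Suc k) = (\<integral>\<^sup>+x. ?f x \<omega> \<partial>lborel)"
      using Z0
    proof eventually_elim
      fix \<omega> assume z: "0 \<le> Z \<omega>"
      have "(\<integral>\<^sup>+x. ?f x \<omega> \<partial>lborel) = (\<integral>\<^sup>+x. ennreal (real (Suc k) * x ^ k) * indicator {0..Z \<omega>} x \<partial>lborel)"
        by (rule nn_integral_cong) (simp add: indicator_def)
      also have "\<dots> = ennreal (Z \<omega> ^ Suc k - 0 ^ Suc k)"
      proof (rule nn_integral_FTC_Icc[OF _ _ _ z])
        show "((\<lambda>x. x ^ Suc k) has_real_derivative real (Suc k) * x ^ k) (at x)" for x
          using DERIV_pow[of "Suc k" x UNIV] by simp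
      qed auto
      finally show "ennreal (Z \<omega> ^ Suc k) = (\<integral>\<^sup>+x. ?f x \<omega> \<partial>lborel)" by simp
    qed
  qed
  also have "\<dots> = (\<integral>\<^sup>+x. (\<integral>\<^sup>+\<omega>. ?f x \<omega> \<partial>N) \<partial>lborel)"
    using Fubini[OF f] by simp
  also have "\<dots> = (\<integral>\<^sup>+x. ennreal (real (Suc k) * x ^ k * measure N {\<omega>\<in>space N. x \<le> Z \<omega>}) * indicator {0..} x \<partial>lborel)"
  proof (rule nn_integral_cong)
    fix x :: real
    show "(\<integral>\<^sup>+\<omega>. ?f x \<omega> \<partial>N) = ennreal (real (Suc k) * x ^ k * measure N {\<omega>\<in>space N. x \<le> Z \<omega>}) * indicator {0..} x"
    proof (cases "0 \<le> x")
      case True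
      have "(\<integral>\<^sup>+\<omega>. ?f x \<omega> \<partial>N) = (\<integral>\<^sup>+\<omega>. ennreal (real (Suc k) * x ^ k) * indicator {\<omega>\<in>space N. x \<le> Z \<omega>} \<omega> \<partial>N)"
        by (rule nn_integral_cong) (use True in \<open>simp add: indicator_def\<close>)
      also have "\<dots> = ennreal (real (Suc k) * x ^ k) * emeasure N {\<omega>\<in>space N. x \<le> Z \<omega>}"
        by (rule nn_integral_cmult_indicator) measurable
      also have "\<dots> = ennreal (real (Suc k) * x ^ k * measure N {\<omega>\<in>space N. x \<le> Z \<omega>})"
        unfolding N.emeasure_eq_measure using True by (subst ennreal_mult) auto
      finally show ?thesis using True by simp
    next
      case False
      then show ?thesis by simp
    qed
  qed
  finally show ?thesis .
qed

text \<open>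
  The moments of the exponential distribution, in the form in which they arise from its tail.
\<close>

lemma nn_integral_power_exp:
  fixes \<mu> :: real
  assumes \<mu>: "0 < \<mu>"
  shows "(\<integral>\<^sup>+x. ennreal (real (Suc k) * x ^ k * exp (- (\<mu> * x))) * indicator {0..} x \<partial>lborel)
    = ennreal (fact (Suc k) / \<mu> ^ Suc k)"
proof -
  have "(\<integral>\<^sup>+x. ennreal (real (Suc k) * x ^ k * exp (- (\<mu> * x))) * indicator {0..} x \<partial>lborel)
    = (\<integral>\<^sup>+x. ennreal (real (Suc k) / \<mu>) * ennreal (erlang_density 0 \<mu> x * x ^ k) \<partial>lborel)"
  proof (rule nn_integral_cong)
    fix x :: real
    show "ennreal (real (Suc k) * x ^ k * exp (- (\<mu> * x))) * indicator {0..} x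
      = ennreal (real (Suc k) / \<mu>) * ennreal (erlang_density 0 \<mu> x * x ^ k)"
      using \<mu> by (cases "x < 0") (auto simp: erlang_density_def ennreal_mult[symmetric] mult_ac)
  qed
  also have "\<dots> = ennreal (real (Suc k) / \<mu>) * (\<integral>\<^sup>+x. ennreal (erlang_density 0 \<mu> x * x ^ k) \<partial>lborel)"
    by (rule nn_integral_cmult) measurable
  also have "(\<integral>\<^sup>+x. ennreal (erlang_density 0 \<mu> x * x ^ k) \<partial>lborel) = ennreal (fact k / \<mu> ^ k)"
    using nn_integral_erlang_ith_moment[OF \<mu>, of 0 k] by simp
  also have "ennreal (real (Suc k) / \<mu>) * ennreal (fact k / \<mu> ^ k) = ennreal (fact (Suc k) / \<mu> ^ Suc k)"
    using \<mu> by (subst ennreal_mult[symmetric]) (auto simp: fact_reduce)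
  finally show ?thesis .
qed

text \<open>
  Moments are integrals of tails, so the uniform exponential bound is what makes moments follow
  the convergence in law.
\<close>

lemma moments_tendsto_of_tails:
  fixes Z :: "nat \<Rightarrow> 'c \<Rightarrow> real"
  assumes N: "prob_space N" and Z [measurable]: "\<And>n. Z n \<in> borel_measurable N"
    and bounded: "\<And>n. 1 \<le> n \<Longrightarrow> AE \<omega> in N. 0 \<le> Z n \<omega> \<and> Z n \<omega> \<le> c n"
    and a: "0 < a" and C: "0 \<le> C" and \<mu>: "0 < \<mu>"
    and tail: "\<And>n x. 1 \<le> n \<Longrightarrow> 0 \<le> x \<Longrightarrow> measure N {\<omega>\<in>space N. x \<le> Z n \<omega>} \<le> C * exp (- (a * x))"
    and lim: "\<And>x. 0 \<le> x \<Longrightarrow> (\<lambda>n. measure N {\<omega>\<in>space N. x \<le> Z n \<omega>}) \<longlonglongrightarrow> exp (- (\<mu> * x))"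
  shows "(\<lambda>n. LINT \<omega>|N. Z n \<omega> ^ Suc k) \<longlonglongrightarrow> fact (Suc k) / \<mu> ^ Suc k"
proof -
  interpret N: prob_space N by (rule N)
  let ?p = "\<lambda>n x. measure N {\<omega>\<in>space N. x \<le> Z n \<omega>}"
  let ?h = "\<lambda>p x. ennreal (real (Suc k) * x ^ k * p) * indicator {0..} x"
  have pm [measurable]: "?p n \<in> borel_measurable borel" for n
  proof -
    have "antimono (?p n)" by (intro antimonoI N.finite_measure_mono) auto
    then have "mono (\<lambda>x. - ?p n x)" by (simp add: monotone_def)
    then have "(\<lambda>x. - ?p n x) \<in> borel_measurable borel" by (rule borel_measurable_mono)
    then show ?thesis by simp
  qed
  have "(\<lambda>n. \<integral>\<^sup>+x. ?h (?p (Suc n) x) x \<partial>lborel) \<longlonglongrightarrow> (\<integral>\<^sup>+x. ?h (exp (- (\<mu> * x))) x \<partial>lborel)"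
  proof (rule nn_integral_dominated_convergence[where w="\<lambda>x. ?h (C * exp (- (a * x))) x"])
    have "(\<integral>\<^sup>+x. ?h (C * exp (- (a * x))) x \<partial>lborel) = (\<integral>\<^sup>+x. ennreal C * ?h (exp (- (a * x))) x \<partial>lborel)"
      by (rule nn_integral_cong) (auto simp: indicator_def ennreal_mult[symmetric] C mult_ac)
    also have "\<dots> = ennreal C * ennreal (fact (Suc k) / a ^ Suc k)"
      by (subst nn_integral_cmult) (simp_all only: nn_integral_power_exp[OF a], measurable)
    also have "\<dots> < \<infinity>" by (simp add: ennreal_mult_less_top)
    finally show "(\<integral>\<^sup>+x. ?h (C * exp (- (a * x))) x \<partial>lborel) < \<infinity>" .
    show "AE x in lborel. ?h (?p (Suc n) x) x \<le> ?h (C * exp (- (a * x))) x" for n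
      using tail[of "Suc n"] by (intro always_eventually allI) (auto simp: indicator_def intro!: ennreal_leI mult_left_mono)
    show "AE x in lborel. (\<lambda>n. ?h (?p (Suc n) x) x) \<longlonglongrightarrow> ?h (exp (- (\<mu> * x))) x"
    proof (intro always_eventually allI)
      fix x :: real
      show "(\<lambda>n. ?h (?p (Suc n) x) x) \<longlonglongrightarrow> ?h (exp (- (\<mu> * x))) x"
      proof (cases "0 \<le> x")
        case True
        have "(\<lambda>n. ennreal (real (Suc k) * x ^ k * ?p (Suc n) x)) \<longlonglongrightarrow> ennreal (real (Suc k) * x ^ k * exp (- (\<mu> * x)))"
          by (intro tendsto_ennrealI tendsto_mult tendsto_const LIMSEQ_Suc[OF lim[OF True]])
        then show ?thesis using True by simp
      qed simp
    qed
  qed measurable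
  moreover have "(\<integral>\<^sup>+x. ?h (?p (Suc n) x) x \<partial>lborel) = ennreal (LINT \<omega>|N. Z (Suc n) \<omega> ^ Suc k)" for n
  proof -
    have b: "AE \<omega> in N. 0 \<le> Z (Suc n) \<omega> \<and> Z (Suc n) \<omega> \<le> c (Suc n)" by (rule bounded) simp
    have int: "integrable N (\<lambda>\<omega>. Z (Suc n) \<omega> ^ Suc k)"
    proof (rule N.integrable_const_bound[of _ "c (Suc n) ^ Suc k"])
      show "AE \<omega> in N. norm (Z (Suc n) \<omega> ^ Suc k) \<le> c (Suc n) ^ Suc k"
        using b by eventually_elim (auto simp only: real_norm_def power_abs abs_of_nonneg intro!: power_mono)
    qed measurable
    have Z0: "AE \<omega> in N. 0 \<le> Z (Suc n) \<omega>" using b by eventually_elim simp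
    then have "AE \<omega> in N. 0 \<le> Z (Suc n) \<omega> ^ Suc k" by eventually_elim (rule zero_le_power)
    then show ?thesis
      using nn_integral_power_eq_tail[OF N Z Z0, of k] nn_integral_eq_integral[OF int] by simp
  qed
  ultimately have "(\<lambda>n. ennreal (LINT \<omega>|N. Z (Suc n) \<omega> ^ Suc k)) \<longlonglongrightarrow> ennreal (fact (Suc k) / \<mu> ^ Suc k)"
    by (simp only: nn_integral_power_exp[OF \<mu>])
  then have "(\<lambda>n. LINT \<omega>|N. Z (Suc n) \<omega> ^ Suc k) \<longlonglongrightarrow> fact (Suc k) / \<mu> ^ Suc k"
  proof (rule tendsto_ennrealD)
    show "0 \<le> (fact (Suc k) / \<mu> ^ Suc k :: real)" using \<mu> by simp
    have "0 \<le> (LINT \<omega>|N. Z (Suc n) \<omega> ^ Suc k)" for n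
    proof (rule integral_nonneg_AE)
      have "AE \<omega> in N. 0 \<le> Z (Suc n) \<omega> \<and> Z (Suc n) \<omega> \<le> c (Suc n)" by (rule bounded) simp
      then show "AE \<omega> in N. 0 \<le> Z (Suc n) \<omega> ^ Suc k" by eventually_elim simp
    qed
    then show "\<forall>\<^sub>F n in sequentially. 0 \<le> (LINT \<omega>|N. Z (Suc n) \<omega> ^ Suc k)" by simp
  qed
  then show ?thesis by (rule LIMSEQ_imp_Suc)
qed

lemma variance_exponential:
  assumes \<mu>: "0 < \<mu>"
  shows "prob_space.variance (density lborel (exponential_density \<mu>)) (\<lambda>y. y) = 1 / \<mu>\<^sup>2"
proof -
  interpret E: prob_space "density lborel (exponential_density \<mu>)" by (rule prob_space_exponential_density[OF \<mu>])
  have "distributed (density lborel (exponential_density \<mu>)) lborel (\<lambda>t. t) (exponential_density \<mu>)"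
    unfolding distributed_def by (auto simp: distr_id2 exponential_density_nonneg[OF \<mu>])
  then show ?thesis by (rule E.exponential_distributed_variance[OF \<mu>])
qed

context observed_density
begin

abbreviation scaled_error :: "nat \<Rightarrow> 'b \<Rightarrow> real" where
  "scaled_error n \<omega> \<equiv> real n * (\<theta> - est n \<omega>)"

lemma error_limit:
  assumes x: "0 \<le> x"
  shows "(\<lambda>n. M0.prob {\<omega>\<in>space M0. x \<le> scaled_error n \<omega>}) \<longlonglongrightarrow> exp (- (vleft / \<kappa> * x))"
proof (rule scaled_error_tendsto)
  interpret W: window_density s \<theta> lam G M R T S vleft by unfold_locales (rule window_density)
  fix y :: "nat \<Rightarrow> real" assume y: "good y" "y (s - 1) \<le> \<theta>"
  show "(\<lambda>n. P.prob {\<xi>. maxle (x / real n) n y \<xi>}) \<longlonglongrightarrow> exp (- (vleft / \<kappa> * x))"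
  proof (cases "x = 0")
    case True
    \<comment> \<open>A window of width 0 is empty, and joining customers wait at most \<open>\<theta>\<close>.\<close>
    have "{\<xi>. maxle 0 n y \<xi>} = UNIV" for n by (auto simp: maxle_def)
    moreover have "P.prob UNIV = 1" using P.prob_space by (simp add: space_P)
    ultimately show ?thesis using True by simp
  next
    case False
    then show ?thesis using W.maxle_tendsto[OF y, of x] x by simp
  qed
qed

lemma rate_pos: "0 < vleft / \<kappa>"
proof -
  interpret W: window_density s \<theta> lam G M R T S vleft by unfold_locales (rule window_density)
  show ?thesis using W.v0_pos \<kappa>_pos by simp
qed

lemma AE_scaled_error_bounds:
  assumes n: "1 \<le> n"
  shows "AE \<omega> in M0. 0 \<le> scaled_error n \<omega> \<and> scaled_error n \<omega> \<le> real n * \<theta>"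
  using AE_est
proof eventually_elim
  fix \<omega> assume "\<forall>n\<ge>1. est n \<omega> \<le> \<theta> \<and> (\<forall>\<epsilon>. est n \<omega> \<le> \<theta> - \<epsilon> \<longleftrightarrow> maxle \<epsilon> n (r0 \<omega>) (\<Xi> \<omega>))"
  then have "est n \<omega> \<le> \<theta>" using n by blast
  then show "0 \<le> scaled_error n \<omega> \<and> scaled_error n \<omega> \<le> real n * \<theta>"
    using est_nonneg[OF n, of \<omega>] by (intro conjI mult_nonneg_nonneg mult_left_mono) auto
qed

lemma moments_tendsto:
  "(\<lambda>n. LINT \<omega>|M0. scaled_error n \<omega> ^ Suc k) \<longlonglongrightarrow> fact (Suc k) / (vleft / \<kappa>) ^ Suc k"
proof -
  obtain a C where a: "0 < (a::real)" and C: "1 \<le> (C::real)"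
    and tail: "\<And>n x. 1 \<le> n \<Longrightarrow> 0 \<le> x \<Longrightarrow> M0.prob {\<omega>\<in>space M0. x \<le> scaled_error n \<omega>} \<le> C * exp (- (a * x))"
    by (rule scaled_error_tail) blast
  show ?thesis
  proof (rule moments_tendsto_of_tails[OF M0.prob_space_axioms _ AE_scaled_error_bounds a _ rate_pos tail error_limit])
    show "(\<lambda>\<omega>. scaled_error n \<omega>) \<in> borel_measurable M0" for n by measurable
    show "0 \<le> C" using C by simp
  qed
qed

lemma second_central_moment_tendsto:
  "(\<lambda>n. (LINT \<omega>|M0. (scaled_error n \<omega>)\<^sup>2) - (LINT \<omega>|M0. scaled_error n \<omega>)\<^sup>2) \<longlonglongrightarrow> (\<kappa> / vleft)\<^sup>2"
proof -
  have 1: "(\<lambda>n. LINT \<omega>|M0. scaled_error n \<omega>) \<longlonglongrightarrow> 1 / (vleft / \<kappa>)" using moments_tendsto[of 0] by simp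
  have 2: "(\<lambda>n. LINT \<omega>|M0. (scaled_error n \<omega>)\<^sup>2) \<longlonglongrightarrow> 2 / (vleft / \<kappa>)\<^sup>2"
    using moments_tendsto[of 1] by (simp add: numeral_2_eq_2)
  have "(\<lambda>n. (LINT \<omega>|M0. (scaled_error n \<omega>)\<^sup>2) - (LINT \<omega>|M0. scaled_error n \<omega>)\<^sup>2) \<longlonglongrightarrow> 2 / (vleft / \<kappa>)\<^sup>2 - (1 / (vleft / \<kappa>))\<^sup>2"
    by (intro tendsto_diff tendsto_power 1 2)
  also have "2 / (vleft / \<kappa>)\<^sup>2 - (1 / (vleft / \<kappa>))\<^sup>2 = (\<kappa> / vleft)\<^sup>2"
    by (simp add: power_divide field_simps)
  finally show ?thesis .
qed

lemma variance_scaled_error: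
  assumes n: "1 \<le> n"
  shows "(real n)\<^sup>2 * M0.variance (\<lambda>\<omega>. \<theta> - est n \<omega>) = (LINT \<omega>|M0. (scaled_error n \<omega>)\<^sup>2) - (LINT \<omega>|M0. scaled_error n \<omega>)\<^sup>2"
proof -
  let ?X = "\<lambda>\<omega>. \<theta> - est n \<omega>"
  have b: "AE \<omega> in M0. \<bar>?X \<omega>\<bar> \<le> \<theta>" using AE_scaled_error_bounds[OF n]
    by eventually_elim (use n \<theta> in \<open>auto simp: zero_le_mult_iff abs_le_iff\<close>)
  have 1: "integrable M0 ?X"
    by (rule M0.integrable_const_bound[of _ \<theta>]) (use b in auto)
  have 2: "integrable M0 (\<lambda>\<omega>. (?X \<omega>)\<^sup>2)"
  proof (rule M0.integrable_const_bound[of _ "\<theta>\<^sup>2"])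
    show "AE \<omega> in M0. norm ((?X \<omega>)\<^sup>2) \<le> \<theta>\<^sup>2" using b
    proof eventually_elim
      fix \<omega> assume "\<bar>?X \<omega>\<bar> \<le> \<theta>"
      then have "\<bar>?X \<omega>\<bar>\<^sup>2 \<le> \<theta>\<^sup>2" by (rule power_mono) simp
      then show "norm ((?X \<omega>)\<^sup>2) \<le> \<theta>\<^sup>2" by simp
    qed
  qed measurable
  show ?thesis unfolding M0.variance_eq[OF 1 2]
    by (simp add: power_mult_distrib right_diff_distrib[of "(real n)\<^sup>2"])
qed

end

theorem theorem3:
  fixes s :: nat and \<theta> lam :: real and G :: "real measure"
    and M :: "'a measure" and R :: "'a \<Rightarrow> real multiset" and T S :: "nat \<Rightarrow> 'a \<Rightarrow> real"
    and M0 :: "'b measure" and R0 :: "'b \<Rightarrow> real multiset" and T0 S0 :: "nat \<Rightarrow> 'b \<Rightarrow> real"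
    and K :: "real \<Rightarrow> real measure" and v :: "real \<Rightarrow> real"
  defines "Pl \<equiv> loss_probability s \<theta> M R"
    and "est \<equiv> theta_hat s \<theta> R0 T0 S0"
  assumes "1 \<le> s" and "0 < lam" and "0 < \<theta>"
    and "prob_space G" and "sets G = sets borel" and "AE b in G. 0 \<le> b"
    and "integrable G (\<lambda>b. b)" and "measure G {0<..} > 0"
    and "time_stationary s \<theta> lam G M R T S"
    and "customer_stationary s \<theta> lam G M0 R0 T0 S0"
    and "jump_law s \<theta> M0 R0 T0 S0 K"
    and "virtual_wait_density s \<theta> lam M R K v"
  shows "\<exists>v0. (v \<longlongrightarrow> v0) (at_left \<theta>) \<and> (measure G {\<theta>} = 0 \<longrightarrow> v0 = v \<theta>) \<and> 0 < v0 / (1 - Pl) \<and>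
    (AE \<omega> in M0. (\<lambda>n. est n \<omega>) \<longlonglongrightarrow> \<theta>) \<and>
    (\<forall>x\<ge>0. (\<lambda>n. measure M0 {\<omega>\<in>space M0. real n * (\<theta> - est n \<omega>) \<ge> x})
              \<longlonglongrightarrow> exp (- (v0 * x / (1 - Pl)))) \<and>
    (\<lambda>n. (real n)\<^sup>2 * prob_space.variance M0 (\<lambda>\<omega>. \<theta> - est n \<omega>)) \<longlonglongrightarrow> ((1 - Pl) / v0)\<^sup>2 \<and>
    (\<lambda>n. prob_space.expectation M0 (\<lambda>\<omega>. (real n * (\<theta> - est n \<omega>))\<^sup>2)
         - (prob_space.expectation M0 (\<lambda>\<omega>. real n * (\<theta> - est n \<omega>)))\<^sup>2) \<longlonglongrightarrow> ((1 - Pl) / v0)\<^sup>2 \<and>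
    prob_space.variance (density lborel (exponential_density (v0 / (1 - Pl)))) (\<lambda>y. y)
      = ((1 - Pl) / v0)\<^sup>2"
proof -
  have K: "K \<in> borel \<rightarrow>\<^sub>M prob_algebra borel"
    using \<open>jump_law s \<theta> M0 R0 T0 S0 K\<close> by (simp add: jump_law_def)
  have bq: "balking_queue s \<theta> lam G" by (rule balking_queue.intro) fact+
  have sq: "stationary_queue s \<theta> lam G M R T S"
    by (intro stationary_queue.intro bq stationary_queue_axioms.intro) fact
  interpret observed_density s \<theta> lam G M R T S M0 R0 T0 S0 K v
    by (intro observed_density.intro observed_queue.intro queue_density.intro sq observed_queue_axioms.intro
      queue_density_axioms.intro observed_density_axioms.intro) fact+
  have Pl: "1 - Pl = \<kappa>" by (simp add: \<kappa>_eq Pl_def)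
  note second_central_moment_tendsto
  moreover have "(\<lambda>n. (real n)\<^sup>2 * M0.variance (\<lambda>\<omega>. \<theta> - theta_hat s \<theta> R0 T0 S0 n \<omega>)) \<longlonglongrightarrow> (\<kappa> / vleft)\<^sup>2"
  proof (rule Lim_transform_eventually[OF second_central_moment_tendsto])
    show "\<forall>\<^sub>F n in sequentially. (LINT \<omega>|M0. (scaled_error n \<omega>)\<^sup>2) - (LINT \<omega>|M0. scaled_error n \<omega>)\<^sup>2
      = (real n)\<^sup>2 * M0.variance (\<lambda>\<omega>. \<theta> - theta_hat s \<theta> R0 T0 S0 n \<omega>)"
      using eventually_ge_at_top[of 1] by eventually_elim (rule variance_scaled_error[symmetric])
  qed
  moreover have "prob_space.variance (density lborel (exponential_density (vleft / \<kappa>))) (\<lambda>y. y) = (\<kappa> / vleft)\<^sup>2"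
    using variance_exponential[OF rate_pos] by (simp add: power_divide)
  moreover have "(\<lambda>n. M0.prob {\<omega>\<in>space M0. real n * (\<theta> - theta_hat s \<theta> R0 T0 S0 n \<omega>) \<ge> x}) \<longlonglongrightarrow> exp (- (vleft * x / \<kappa>))"
    if "0 \<le> x" for x
    using error_limit[OF that] by simp
  ultimately show ?thesis
    unfolding Pl est_def using v_tendsto_left vleft_eq_v rate_pos AE_est_tendsto by blast
qed

end
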